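(* With probability $1$ the following holds: except for a countable set of values $x\in\mathbb{S}^1$, there exists a unique one-sided minimizer $\xi:(-\infty,0]\to\mathbb{S}^1$ such that $\xi(0)=x$.
   Context: $\mathbb{S}^1=\mathbb{R}/\mathbb{Z}$ is the circle of length $1$. $\{B_k(t),\,t\in\mathbb{R}\}$, $k\ge 1$, are independent standard two-sided Wiener processes on a probability space $(\Omega,\mathcal{F},P)$; elements of $\Omega$ are denoted $\omega=(\dot B_1(\cdot),\dot B_2(\cdot),\dots)$. The functions $F_k:\mathbb{R}\to\mathbb{R}$ are periodic with period $1$, $\int_0^1F_k(x)\,dx=0$, and for some $r\ge 3$ and some constant $C$, $f_k=F_k'\in C^r(\mathbb{S}^1)$ with $\|f_k\|_{C^r}\le C/k^2$. For a Lipschitz curve $\xi:[t_1,t_2]\to\mathbb{S}^1$ the action is $$\mathcal{A}_{t_1,t_2}(\xi)=\int_{t_1}^{t_2}\Big\{\tfrac12\dot\xi(s)^2-\sum_k f_k(\xi(s))\dot\xi(s)(B_k(s)-B_k(t_1))\Big\}ds+\sum_kF_k(\xi(t_2))(B_k(t_2)-B_k(t_1)),$$ which is the pathwise form of $\int_{t_1}^{t_2}\{\tfrac12\dot\xi^2ds+\sum_kF_k(\xi(s))dB_k(s)\}$. A piecewise $C^1$ curve $\xi:(-\infty,0]\to\mathbb{S}^1$ is a one-sided minimizer (for the given $\omega$) if for every Lipschitz continuous $\tilde\xi:(-\infty,0]\to\mathbb{S}^1$ with $\tilde\xi(0)=\xi(0)$ and $\tilde\xi=\xi$ on $(-\infty,\tau]$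 for some $\tau<0$, one has $\mathcal{A}_{s,0}(\xi)\le\mathcal{A}_{s,0}(\tilde\xi)$ for all $s\le\tau$.
   Formalization: In the definition of one-sided minimizer, "Lipschitz continuous" competitors on (-∞,0] are taken Lipschitz on each compact subinterval; with one global constant, curves of unbounded velocity such as x+t² have no competitors, are vacuously minimizers, and uniqueness fails for every x. *)

theory Defs
  imports "HOL-Probability.Probability"
begin

quotient_type circle = real / "\<lambda>x y. x - y \<in> \<int>"
proof (rule equivpI)
  show "reflp (\<lambda>x y::real. x - y \<in> \<int>)"
    by (simp add: reflp_def)
  show "symp (\<lambda>x y::real. x - y \<in> \<int>)"
    by (metis (mono_tags, lifting) Ints_minus minus_diff_eq sympI)
  show "transp (\<lambda>x y::real. x - y \<in> \<int>)"
    by (rule transpI) (metis Ints_add diff_add_cancel add_diff_eq)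
qed

lift_definition to_circle :: "real \<Rightarrow> circle" is "\<lambda>x. x" .

lemma abs_diff_round_Ints:
  fixes x y :: real
  assumes "x - y \<in> \<int>"
  shows "\<bar>x - of_int (round x)\<bar> \<le> \<bar>y - of_int (round y)\<bar>"
proof -
  obtain n where n: "x - y = of_int n"
    using assms by (auto elim: Ints_cases)
  have "\<bar>x - of_int (round x)\<bar> \<le> \<bar>x - of_int (round y + n)\<bar>"
    by (rule round_diff_minimal)
  also have "x - of_int (round y + n) = y - of_int (round y)"
    using n by simp
  finally show ?thesis .
qed

text \<open>The quotient metric of the reals modulo the integers: the distance from \<open>x - y\<close> to the
  nearest integer.\<close>

instantiation circle :: metric_space
begin

lift_definition dist_circle :: "circle \<Rightarrow> circle \<Rightarrow> real"
  is "\<lambda>x y. \<bar>(x - y) - of_int (round (x - y))\<bar>"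
proof -
  fix x x' y y' :: real
  assume "x - x' \<in> \<int>" "y - y' \<in> \<int>"
  then have "(x - x') - (y - y') \<in> \<int>" by (rule Ints_diff)
  then have *: "(x - y) - (x' - y') \<in> \<int>" by (simp add: algebra_simps)
  then have "(x' - y') - (x - y) \<in> \<int>" by (metis Ints_minus minus_diff_eq)
  with * show "\<bar>(x - y) - of_int (round (x - y))\<bar> = \<bar>(x' - y') - of_int (round (x' - y'))\<bar>"
    by (intro antisym abs_diff_round_Ints)
qed

definition uniformity_circle :: "(circle \<times> circle) filter"
  where "uniformity_circle = (INF e\<in>{0<..}. principal {(x, y). dist x y < e})"

definition open_circle :: "circle set \<Rightarrow> bool"
  where "open_circle U \<longleftrightarrow> (\<forall>x\<in>U. eventually (\<lambda>(x', y). x' = x \<longrightarrow> y \<in> U) uniformity)"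

instance
proof
  show "uniformity = (INF e\<in>{0<..}. principal {(x, y::circle). dist x y < e})"
    by (rule uniformity_circle_def)
  show "open U \<longleftrightarrow> (\<forall>x\<in>U. eventually (\<lambda>(x', y). x' = x \<longrightarrow> y \<in> U) uniformity)"
    for U :: "circle set"
    by (rule open_circle_def)
  show "dist x y = 0 \<longleftrightarrow> x = y" for x y :: circle
  proof (transfer, safe)
    fix x y :: real
    assume "\<bar>(x - y) - of_int (round (x - y))\<bar> = 0"
    then have "x - y = of_int (round (x - y))" by simp
    then show "x - y \<in> \<int>" by (metis Ints_of_int)
  next
    fix x y :: real
    assume "x - y \<in> \<int>"
    then show "\<bar>(x - y) - of_int (round (x - y))\<bar> = 0" by (auto elim!: Ints_cases)
  qed
  show "dist x y \<le> dist x z + dist y z" for x y z :: circle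
  proof transfer
    fix x y z :: real
    have "\<bar>(x - y) - of_int (round (x - y))\<bar>
        \<le> \<bar>(x - y) - of_int (round (x - z) - round (y - z))\<bar>"
      by (rule round_diff_minimal)
    also have "\<dots> \<le> \<bar>(x - z) - of_int (round (x - z))\<bar> + \<bar>(y - z) - of_int (round (y - z))\<bar>"
      by simp
    finally show "\<bar>(x - y) - of_int (round (x - y))\<bar>
        \<le> \<bar>(x - z) - of_int (round (x - z))\<bar> + \<bar>(y - z) - of_int (round (y - z))\<bar>" .
  qed
qed

end

definition lift_on :: "real set \<Rightarrow> (real \<Rightarrow> circle) \<Rightarrow> (real \<Rightarrow> real) \<Rightarrow> bool" where
  "lift_on I \<xi> c \<longleftrightarrow> continuous_on I c \<and> (\<forall>s\<in>I. to_circle (c s) = \<xi> s)"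

text \<open>Piecewise \<open>C\<^sup>1\<close> on the unbounded interval \<open>{..0}\<close>: finitely many break points in
  every compact subinterval, and \<open>C\<^sup>1\<close> up to the end points (with one-sided derivatives there)
  on every closed interval whose interior contains no break point.
  The smoothness of a curve in the circle is that of its lifts to the line.\<close>

definition piecewise_C1_curve :: "(real \<Rightarrow> circle) \<Rightarrow> bool" where
  "piecewise_C1_curve \<xi> \<longleftrightarrow>
     (\<exists>c S. lift_on {..0} \<xi> c \<and> (\<forall>a. finite (S \<inter> {a..0})) \<and>
       (\<forall>a b. a < b \<and> b \<le> 0 \<and> S \<inter> {a<..<b} = {} \<longrightarrow>
         (\<exists>c'. continuous_on {a..b} c' \<and>
           (\<forall>s\<in>{a..b}. (c has_real_derivative c' s) (at s within {a..b})))))"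

text \<open>Lipschitz continuity on \<open>{..0}\<close> is meant on compact subintervals. A global Lipschitz constant
  would be wrong in the definition of minimizers below: a piecewise \<open>C\<^sup>1\<close> curve of
  unbounded velocity would have no competitors, hence be vacuously minimizing.\<close>

definition lipschitz_curve :: "(real \<Rightarrow> circle) \<Rightarrow> bool" where
  "lipschitz_curve \<xi> \<longleftrightarrow> (\<forall>a\<le>0. \<exists>L. L-lipschitz_on {a..0} \<xi>)"

text \<open>Here \<open>b k\<close> is the realized path of the \<open>k\<close>-th Wiener process; the indices \<open>k\<close> start at 1.\<close>

definition line_action ::
    "(nat \<Rightarrow> real \<Rightarrow> real) \<Rightarrow> (nat \<Rightarrow> real \<Rightarrow> real) \<Rightarrow> (nat \<Rightarrow> real \<Rightarrow> real) \<Rightarrow>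
     real \<Rightarrow> real \<Rightarrow> (real \<Rightarrow> real) \<Rightarrow> real" where
  "line_action F f b t1 t2 c =
     (LINT s:{t1..t2}|lebesgue. 1/2 * (deriv c s)\<^sup>2
        - (\<Sum>\<^sub>\<infinity>k\<in>{1..}. f k (c s) * deriv c s * (b k s - b k t1)))
     + (\<Sum>\<^sub>\<infinity>k\<in>{1..}. F k (c t2) * (b k t2 - b k t1))"

text \<open>Two lifts of a curve on an interval differ by a constant integer, so for 1-periodic
  \<open>F k\<close> and \<open>f k\<close> the choice of the lift is immaterial.\<close>

definition action ::
    "(nat \<Rightarrow> real \<Rightarrow> real) \<Rightarrow> (nat \<Rightarrow> real \<Rightarrow> real) \<Rightarrow> (nat \<Rightarrow> real \<Rightarrow> real) \<Rightarrow>
     real \<Rightarrow> real \<Rightarrow> (real \<Rightarrow> circle) \<Rightarrow> real" where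
  "action F f b t1 t2 \<xi> = line_action F f b t1 t2 (SOME c. lift_on {t1..t2} \<xi> c)"

definition one_sided_minimizer ::
    "(nat \<Rightarrow> real \<Rightarrow> real) \<Rightarrow> (nat \<Rightarrow> real \<Rightarrow> real) \<Rightarrow> (nat \<Rightarrow> real \<Rightarrow> real) \<Rightarrow>
     (real \<Rightarrow> circle) \<Rightarrow> bool" where
  "one_sided_minimizer F f b \<xi> \<longleftrightarrow>
     piecewise_C1_curve \<xi> \<and>
     (\<forall>\<eta> \<tau>. lipschitz_curve \<eta> \<and> \<eta> 0 = \<xi> 0 \<and> \<tau> < 0 \<and> (\<forall>t\<le>\<tau>. \<eta> t = \<xi> t) \<longrightarrow>
       (\<forall>s\<le>\<tau>. action F f b s 0 \<xi> \<le> action F f b s 0 \<eta>))"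

text \<open>Standard two-sided Wiener process.\<close>

definition wiener_process :: "'a measure \<Rightarrow> (real \<Rightarrow> 'a \<Rightarrow> real) \<Rightarrow> bool" where
  "wiener_process M W \<longleftrightarrow>
     (\<forall>t. W t \<in> borel_measurable M) \<and>
     (AE \<omega> in M. W 0 \<omega> = 0 \<and> continuous_on UNIV (\<lambda>t. W t \<omega>)) \<and>
     (\<forall>s t. s < t \<longrightarrow>
       distributed M lborel (\<lambda>\<omega>. W t \<omega> - W s \<omega>) (normal_density 0 (sqrt (t - s)))) \<and>
     (\<forall>n t. strict_mono_on {..n} t \<longrightarrow>
       prob_space.indep_vars M (\<lambda>_. borel) (\<lambda>i \<omega>. W (t (Suc i)) \<omega> - W (t i) \<omega>) {..<n})"

text \<open>\<open>C\<^sup>r\<close> regularity and norm of a function on the circle, viewed as a 1-periodic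
  function on the line (so the suprema are over bounded sets).\<close>

definition C_class :: "nat \<Rightarrow> (real \<Rightarrow> real) \<Rightarrow> bool" where
  "C_class r g \<longleftrightarrow>
     (\<forall>j<r. (deriv ^^ j) g differentiable_on UNIV) \<and> continuous_on UNIV ((deriv ^^ r) g)"

definition C_norm :: "nat \<Rightarrow> (real \<Rightarrow> real) \<Rightarrow> real" where
  "C_norm r g = (\<Sum>j\<le>r. SUP x. \<bar>(deriv ^^ j) g x\<bar>)"

end

theory Submission
  imports Defs "HOL-Complex_Analysis.Great_Picard" "HOL-Real_Asymp.Real_Asymp"
begin

text \<open>
  Let \<open>c\<close> be a lift of a curve to the line. Since the series of the noise converges, the action of
  the curve over \<open>{s..0}\<close> is \<open>\<integral> c'\<^sup>2 / 2 - c' * g u (c u) du - G s (c s)\<close>, where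
  \<open>g u x = \<Sum>k. f k x * b k u\<close> and \<open>G s\<close> is a periodic primitive of \<open>g s\<close>. The last term is the same for
  all competitors of a curve, so one-sided minimizers are the curves that are \<open>minimal\<close> for a
  deterministic action with a continuous force \<open>g\<close>, for which two facts are needed.

  Two minimal curves that meet at a negative time coincide (\<open>minimal_noncrossing\<close>). This is where
  randomness enters. Almost surely the noise has arbitrarily early \<^emph>\<open>calm windows\<close>: intervals
  \<open>{T - 1 / \<epsilon>..T}\<close> on which \<open>g\<close> differs from \<open>g T\<close> by at most \<open>\<epsilon>\<close>. Up to boundary terms \<open>G T\<close> the force
  in the window is of size \<open>\<epsilon>\<close>, so a curve can be led from any point of the circle to any other one with
  speed \<open>\<epsilon>\<close> at a cost of order \<open>\<epsilon>\<^sup>2 * (1 / \<epsilon>) = \<epsilon>\<close>, and no curve saves more than that order. Let two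
  minimal curves meet at \<open>t\<close>, and follow the second one up to \<open>t\<close> and the first one afterwards. If
  this curve could be improved on \<open>{t - 1..0}\<close> by \<open>\<delta>\<close>, then exchanging the two curves in an earlier
  window that is calm for \<open>\<epsilon> = \<delta> / 8\<close> would improve one of them. So the spliced curve is minimizing,
  hence \<open>C\<^sup>1\<close> and a solution of the Euler-Lagrange equation; it has no corner at \<open>t\<close>, and uniqueness for
  this equation shows that the two curves agree (\<open>EL_unique\<close>).

  Every point is the end point of a \<open>C\<^sup>1\<close> minimal curve (\<open>minimal_exists\<close>). It is a limit of polygons with
  cells of length \<open>1 / n\<close> that minimize the action over \<open>{- n..0}\<close>. Their discrete Euler-Lagrange equation
  (\<open>minpoly_euler_lagrange\<close>) bounds the slopes and their oscillation on compact intervals uniformly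
  in \<open>n\<close>.

  If \<open>x\<close> has two minimizers, then lifts of them with the same value at \<open>0\<close> are strictly ordered at time
  \<open>- 1\<close> and enclose a rational number. Minimal curves ending at different points keep their order, so
  different \<open>x\<close> receive different rationals. Hence the exceptional \<open>x\<close> are countable
  (\<open>countable_nonunique\<close>).

  Calm windows exist almost surely (\<open>wiener_paths_calm\<close>). Cut a window of length \<open>L\<close> into \<open>N\<close> blocks. The
  increment of a Wiener process over a block is at most \<open>\<delta> / (2 * N)\<close> with probability of order
  \<open>N powr (- 1 / 2)\<close>, whereas by chaining the process moves by more than \<open>\<delta> / 2\<close> within the block with
  probability of order \<open>N powr (- 2)\<close>. For large \<open>N\<close> both conditions hold together with positive
  probability. The tolerance for the \<open>k\<close>-th process may grow like \<open>sqrt k\<close>, because its coefficients decay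
  like \<open>1 / k\<^sup>2\<close>; this makes the failure probabilities summable in \<open>k\<close>, so that by independence a window
  is calm for all \<open>k\<close> with a probability bounded away from \<open>0\<close>. Disjoint windows are independent, and the
  zero-one law yields infinitely many calm ones.
\<close>

section \<open>Almost everywhere differentiability of Lipschitz functions\<close>

lemma bounded_borel_integrable_on:
  fixes f :: "real \<Rightarrow> real"
  assumes "f \<in> borel_measurable borel" and "\<And>x. x \<in> {a..b} \<Longrightarrow> \<bar>f x\<bar> \<le> B"
  shows "f integrable_on {a..b}"
proof (rule measurable_bounded_by_integrable_imp_integrable)
  show "f \<in> borel_measurable (lebesgue_on {a..b})"
    by (intro measurable_restrict_space1 measurable_completion) (simp add: assms(1))
  show "(\<lambda>_. B) integrable_on {a..b}" by (rule integrable_const_ivl)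
qed (use assms in auto)

lemma bounded_borel_integrable_lebesgue_on:
  fixes f :: "real \<Rightarrow> real"
  assumes "f \<in> borel_measurable borel" and "\<And>x. x \<in> {a..b} \<Longrightarrow> \<bar>f x\<bar> \<le> B"
  shows "integrable (lebesgue_on {a..b}) f"
proof -
  have m: "f \<in> borel_measurable (lebesgue_on {a..b})"
    by (intro measurable_restrict_space1 measurable_completion) (simp add: assms(1))
  interpret finite_measure "lebesgue_on {a..b}"
    by (rule finite_measureI) (auto simp: emeasure_restrict_space emeasure_lborel_Icc_eq)
  show ?thesis
    by (rule integrable_const_bound[of _ B]) (use assms m in auto)
qed

lemma negligible_nonzero_if_integral_0:
  fixes f :: "real \<Rightarrow> real"
  assumes "f \<in> borel_measurable borel" and "\<And>x. x \<in> {a..b} \<Longrightarrow> \<bar>f x\<bar> \<le> B"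
    and "\<And>x. x \<in> {a..b} \<Longrightarrow> 0 \<le> f x" and "integral {a..b} f = 0"
  shows "negligible {x\<in>{a..b}. f x \<noteq> 0}"
proof -
  have i: "integrable (lebesgue_on {a..b}) f"
    by (rule bounded_borel_integrable_lebesgue_on) (use assms in auto)
  have "integral\<^sup>L (lebesgue_on {a..b}) f = 0"
    using lebesgue_integral_eq_integral[OF i] assms(4) by simp
  then have "AE x in lebesgue_on {a..b}. f x = 0"
    by (subst (asm) integral_nonneg_eq_0_iff_AE[OF i]) (use assms(3) in auto)
  then have "AE x in lebesgue. x \<in> {a..b} \<longrightarrow> f x = 0"
    by (subst (asm) AE_restrict_space_iff) auto
  then obtain N where "{x \<in> space lebesgue. \<not> (x \<in> {a..b} \<longrightarrow> f x = 0)} \<subseteq> N" "N \<in> null_sets lebesgue"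
    unfolding eventually_ae_filter by blast
  then show ?thesis
    unfolding negligible_iff_null_sets[symmetric] by (auto intro: negligible_subset)
qed

text \<open>The last point at which \<open>H\<close> has not fallen below \<open>H a\<close> exists by continuity, and a step to the right of it
  would be a later such point.\<close>

lemma increasing_if_right_steps:
  fixes H :: "real \<Rightarrow> real"
  assumes "a \<le> b" and cont: "continuous_on {a..b} H"
    and step: "\<And>x. a \<le> x \<Longrightarrow> x < b \<Longrightarrow> \<exists>y. x < y \<and> y \<le> b \<and> H x \<le> H y"
  shows "H a \<le> H b"
proof -
  define S where "S = {t\<in>{a..b}. H a \<le> H t}"
  have "closed S" unfolding S_def
    by (rule continuous_on_closed_Collect_le[OF continuous_on_const cont]) auto
  have ne: "S \<noteq> {}" "bdd_above S" using \<open>a \<le> b\<close> by (auto simp: S_def bdd_above_def)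
  then have mem: "Sup S \<in> S" using closed_contains_Sup \<open>closed S\<close> by blast
  have "\<not> Sup S < b"
  proof
    assume "Sup S < b"
    then obtain y where "Sup S < y" "y \<le> b" "H (Sup S) \<le> H y"
      using step[of "Sup S"] mem by (auto simp: S_def)
    then have "y \<in> S" using mem by (auto simp: S_def)
    then show False using cSup_upper[OF _ ne(2)] \<open>Sup S < y\<close> by fastforce
  qed
  then show ?thesis using mem by (auto simp: S_def)
qed

lemma separate_closed_point:
  fixes x :: real
  assumes "closed Z" "x \<notin> Z"
  shows "\<exists>d>0. \<forall>y. \<bar>y - x\<bar> < d \<longrightarrow> y \<notin> Z"
proof -
  have "open (- Z)" "x \<in> - Z" using assms by auto
  then obtain d where "d > 0" "\<forall>y. dist y x < d \<longrightarrow> y \<in> - Z"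
    unfolding open_dist by blast
  then show ?thesis by (auto simp: dist_real_def)
qed

text \<open>For a continuous \<open>u\<close> this is the mean value inequality. In general \<open>u\<close> is replaced, up to a small error
  in the integral, by an upper semicontinuous minorant (Vitali-Caratheodory), for which the inequality can be
  checked locally to the right of each point.\<close>

lemma integral_le_increment_if_right_dini:
  fixes c u :: "real \<Rightarrow> real"
  assumes "a \<le> b" and cont: "continuous_on UNIV c"
    and u[measurable]: "u \<in> borel_measurable borel" and bnd: "\<And>x. \<bar>u x\<bar> \<le> L"
    and step: "\<And>x \<epsilon> \<delta>. \<epsilon> > 0 \<Longrightarrow> \<delta> > 0 \<Longrightarrow> \<exists>h. 0 < h \<and> h < \<delta> \<and> (u x - \<epsilon>) * h \<le> c (x + h) - c x"
  shows "integral {a..b} u \<le> c b - c a"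
proof -
  have L: "L \<ge> 0" using bnd[of 0] by linarith
  have main: "integral {a..b} u \<le> c b - c a + e * (2 * (b - a) + 2 * L + 1)" if e: "0 < e" "e < 1" for e
  proof -
    (* Off a set of measure e, u takes values near a multiple of e on finitely many closed sets K j, which keep a positive distance from each other. *)
    define J where "J = {\<lfloor>- L / e\<rfloor>..\<lfloor>L / e\<rfloor>}"
    define N where "N = real (card J) + 1"
    have N: "N > 0" unfolding N_def by linarith
    have finJ: "finite J" unfolding J_def by simp
    define E where "E j = {x\<in>{a..b}. \<lfloor>u x / e\<rfloor> = j}" for j
    have lm: "E j \<in> sets lebesgue" for j
      unfolding E_def by (rule sets_completionI_sets) measurable
    have "\<forall>j. \<exists>T. closed T \<and> T \<subseteq> E j \<and> E j - T \<in> lmeasurable \<and> emeasure lebesgue (E j - T) < ennreal (e / N)"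
    proof
      fix j
      from sets_lebesgue_inner_closed[OF lm, of "e/N" j] obtain T where "closed T" "T \<subseteq> E j" "E j - T \<in> lmeasurable" "emeasure lebesgue (E j - T) < ennreal (e / N)"
        using e N by auto
      then show "\<exists>T. closed T \<and> T \<subseteq> E j \<and> E j - T \<in> lmeasurable \<and> emeasure lebesgue (E j - T) < ennreal (e / N)"
        by blast
    qed
    then obtain K where K: "\<And>j. closed (K j)" "\<And>j. K j \<subseteq> E j" "\<And>j. E j - K j \<in> lmeasurable"
      "\<And>j. emeasure lebesgue (E j - K j) < ennreal (e / N)" by metis
    define D where "D = (\<Union>j\<in>J. E j - K j)"
    have Dlm: "D \<in> lmeasurable" unfolding D_def using finJ K(3) by (intro fmeasurable.finite_UN) auto
    have mD: "measure lebesgue D \<le> e"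
    proof -
      have "measure lebesgue D \<le> (\<Sum>j\<in>J. measure lebesgue (E j - K j))"
        unfolding D_def using finJ K(3) by (intro measure_UNION_le) (auto intro: fmeasurableD)
      also have "\<dots> \<le> (\<Sum>j\<in>J. e / N)"
      proof (rule sum_mono)
        fix j
        have "ennreal (measure lebesgue (E j - K j)) < ennreal (e / N)"
          using K(4)[of j] emeasure_eq_measure2[OF K(3)[of j]] by simp
        then show "measure lebesgue (E j - K j) \<le> e / N"
          by (simp add: ennreal_less_iff less_imp_le)
      qed
      also have "\<dots> = real (card J) * e / N" by simp
      also have "\<dots> \<le> e" using e N unfolding N_def by (simp add: field_simps)
      finally show ?thesis .
    qed
    define Z where "Z = (\<Union>j\<in>J. K j)"
    have cZ: "closed Z" unfolding Z_def using finJ K(1) by auto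
    define m where "m x = (if x \<in> Z then e * of_int \<lfloor>u x / e\<rfloor> else - L - 1)" for x
    have mu: "m x \<le> u x" "u x - e * 1 \<le> m x \<or> x \<notin> Z" for x
    proof -
      have fl: "u x / e \<le> of_int \<lfloor>u x / e\<rfloor> + 1" "of_int \<lfloor>u x / e\<rfloor> \<le> u x / e" by linarith+
      have "u x \<le> (of_int \<lfloor>u x / e\<rfloor> + 1) * e" using fl(1) e(1) by (simp only: pos_divide_le_eq)
      moreover have "of_int \<lfloor>u x / e\<rfloor> * e \<le> u x" using fl(2) e(1) by (simp only: pos_le_divide_eq)
      ultimately have "u x - e \<le> e * of_int \<lfloor>u x / e\<rfloor>" "e * of_int \<lfloor>u x / e\<rfloor> \<le> u x" by (simp_all add: algebra_simps)
      then show "m x \<le> u x" "u x - e * 1 \<le> m x \<or> x \<notin> Z"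
        using bnd[of x] e unfolding m_def by auto
    qed
    have mmeas[measurable]: "m \<in> borel_measurable borel"
      unfolding m_def using borel_closed[OF cZ] by measurable
    have mlow: "- L - 1 \<le> m x" for x
      using mu(2)[of x] bnd[of x] e unfolding m_def by (auto simp: m_def split: if_splits)
    have mbd: "\<bar>m x\<bar> \<le> L + 1" for x using mu(1)[of x] mlow[of x] bnd[of x] by auto
    (* m is upper semicontinuous: near a point of K j it takes either the same value or the least value - L - 1. *)
    have usc: "\<exists>d>0. \<forall>y. \<bar>y - x\<bar> < d \<longrightarrow> m y \<le> m x" for x
    proof (cases "x \<in> Z")
      case False
      then obtain d where "d > 0" "\<And>y. \<bar>y - x\<bar> < d \<Longrightarrow> y \<notin> Z"
        using separate_closed_point[OF cZ False] by (auto 0 3)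
      then show ?thesis using False unfolding m_def by auto
    next
      case True
      then obtain j where j: "j \<in> J" "x \<in> K j" unfolding Z_def by auto
      define Z' where "Z' = (\<Union>i\<in>J-{j}. K i)"
      have "closed Z'" unfolding Z'_def using finJ K(1) by auto
      moreover have "x \<notin> Z'" using j K(2) unfolding Z'_def E_def by blast
      ultimately obtain d where d: "d > 0" "\<And>y. \<bar>y - x\<bar> < d \<Longrightarrow> y \<notin> Z'"
        using separate_closed_point by blast
      have "m y \<le> m x" if "\<bar>y - x\<bar> < d" for y
      proof (cases "y \<in> Z")
        case True
        then have "y \<in> K j" using d(2)[OF that] unfolding Z_def Z'_def by auto
        then have "\<lfloor>u y / e\<rfloor> = \<lfloor>u x / e\<rfloor>" using K(2) j unfolding E_def by blast
        then show ?thesis using True \<open>x \<in> Z\<close> unfolding m_def by simp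
      next
        case False
        then show ?thesis using mlow[of x] unfolding m_def by simp
      qed
      then show ?thesis using d(1) by blast
    qed
    have mint: "m integrable_on {s..t}" for s t
      by (rule bounded_borel_integrable_on[OF mmeas]) (use mbd in auto)
    have uint: "u integrable_on {s..t}" for s t
      by (rule bounded_borel_integrable_on[OF u]) (use bnd in auto)
    have upper: "integral {a..b} m \<le> c b - c a + e * (b - a)"
    proof -
      define H where "H x = c x - integral {a..x} m + e * (x - a)" for x
      have "H a \<le> H b"
      proof (rule increasing_if_right_steps[OF \<open>a \<le> b\<close>])
        show "continuous_on {a..b} H" unfolding H_def
          by (intro continuous_intros indefinite_integral_continuous_1 mint
              continuous_on_subset[OF cont]) auto
        fix x assume x: "a \<le> x" "x < b"
        obtain d where d: "d > 0" "\<And>y. \<bar>y - x\<bar> < d \<Longrightarrow> m y \<le> m x" using usc by blast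
        obtain h where h: "0 < h" "h < min d (b - x)" "(u x - e) * h \<le> c (x + h) - c x"
          using step[of e "min d (b-x)" x] e d x by auto
        have "integral {x..x+h} m \<le> integral {x..x+h} (\<lambda>_. m x)"
          using h d by (intro integral_le mint) auto
        also have "\<dots> = m x * h" using h by simp
        also have "\<dots> \<le> u x * h" using mu(1) h by (simp add: mult_right_mono)
        finally have "integral {x..x+h} m \<le> u x * h" .
        moreover have "integral {a..x} m + integral {x..x+h} m = integral {a..x+h} m"
          using x h by (intro Henstock_Kurzweil_Integration.integral_combine mint) auto
        ultimately have "H x \<le> H (x + h)"
          using h(3) unfolding H_def by (simp add: algebra_simps)
        then show "\<exists>y. x < y \<and> y \<le> b \<and> H x \<le> H y"
          using h by (intro exI[of _ "x+h"]) auto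
      qed
      then show ?thesis unfolding H_def by simp
    qed
    have Zc: "x \<in> D \<or> x \<in> Z" if "x \<in> {a..b}" for x
    proof -
      have "- L / e \<le> u x / e" "u x / e \<le> L / e" using bnd[of x] e by (auto simp: divide_simps)
      then have "\<lfloor>u x / e\<rfloor> \<in> J" unfolding J_def by (auto intro: floor_mono)
      then show ?thesis unfolding D_def Z_def E_def using that by auto
    qed
    have ind: "(indicator D :: real \<Rightarrow> real) integrable_on {a..b}"
      using fmeasurable_Int_fmeasurable[OF Dlm, of "{a..b}"] by (simp add: integrable_on_indicator Int_commute)
    have "integral {a..b} (indicator D :: real \<Rightarrow> real) \<le> e"
    proof -
      have "integral {a..b} (indicator D :: real \<Rightarrow> real) = measure lebesgue (D \<inter> {a..b})"
        using Dlm by (intro integral_indicator fmeasurable_Int_fmeasurable) simp_all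
      also have "\<dots> \<le> measure lebesgue D"
        using Dlm by (intro measure_mono_fmeasurable) (auto intro: fmeasurableD)
      finally show ?thesis using mD by simp
    qed
    moreover have "integral {a..b} u \<le> integral {a..b} (\<lambda>x. m x + e + (2*L+1) * indicator D x)"
    proof (rule integral_le)
      show "(\<lambda>x. m x + e + (2*L+1) * indicator D x) integrable_on {a..b}"
        by (intro integrable_add mint integrable_const_ivl integrable_on_mult_right ind)
      fix x assume "x \<in> {a..b}"
      then show "u x \<le> m x + e + (2*L+1) * indicator D x"
        using Zc[of x] mu(2)[of x] bnd[of x] mlow[of x] e L by (auto split: split_indicator)
    qed (rule uint)
    moreover have "integral {a..b} (\<lambda>x. m x + e + (2*L+1) * indicator D x)
      = integral {a..b} m + e * (b - a) + (2*L+1) * integral {a..b} (indicator D)"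
      using \<open>a \<le> b\<close> mint ind by (simp add: integral_add integrable_add integrable_on_mult_right integrable_const_ivl)
    ultimately have "integral {a..b} u \<le> c b - c a + e * (b - a) + e * (b - a) + (2*L+1) * integral {a..b} (indicator D)"
      using upper by linarith
    moreover have "(2*L+1) * integral {a..b} (indicator D) \<le> (2*L+1) * e"
      using \<open>integral {a..b} (indicator D :: real \<Rightarrow> real) \<le> e\<close> L by (intro mult_left_mono) auto
    ultimately show ?thesis by (simp add: algebra_simps)
  qed
  define W where "W = 2 * (b - a) + 2 * L + 1"
  have "((\<lambda>e. c b - c a + e * W) \<longlongrightarrow> c b - c a + 0 * W) (at_right 0)"
    by (intro tendsto_intros)
  moreover have "eventually (\<lambda>e. integral {a..b} u \<le> c b - c a + e * W) (at_right 0)"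
    unfolding eventually_at_right_field using main unfolding W_def by (intro exI[of _ 1]) auto
  ultimately show ?thesis
    using tendsto_lowerbound[of "\<lambda>e. c b - c a + e * W" "c b - c a + 0 * W" "at_right 0" "integral {a..b} u"] by simp
qed

definition right_quotient_sup :: "(real \<Rightarrow> real) \<Rightarrow> nat \<Rightarrow> real \<Rightarrow> real" where
  "right_quotient_sup c n x = (SUP h\<in>{0<..<1 / real (Suc n)}. (c (x + h) - c x) / h)"

text \<open>The upper right Dini derivative, as an infimum of suprema over countably many ranges of the step; this form
  makes its measurability evident.\<close>

definition right_upper_dini :: "(real \<Rightarrow> real) \<Rightarrow> real \<Rightarrow> real" where
  "right_upper_dini c x = (INF n. right_quotient_sup c n x)"

context
  fixes c :: "real \<Rightarrow> real" and L :: real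
  assumes lip: "L-lipschitz_on UNIV c"
begin

lemma quotient_bound: "h > 0 \<Longrightarrow> \<bar>(c (x + h) - c x) / h\<bar> \<le> L"
  using lipschitz_onD[OF lip, of "x+h" x] by (simp add: dist_real_def field_simps)

lemma quotient_le: "h > 0 \<Longrightarrow> (c (x + h) - c x) / h \<le> L"
  using quotient_bound[of h x] by linarith

lemma right_quotient_bdd: "bdd_above ((\<lambda>h. (c (x + h) - c x) / h) ` {0<..<1 / real (Suc n)})"
  unfolding bdd_above_def using quotient_le by (intro exI[of _ L]) auto

lemma right_quotient_sup_upper:
  "0 < h \<Longrightarrow> h < 1 / real (Suc n) \<Longrightarrow> (c (x + h) - c x) / h \<le> right_quotient_sup c n x"
  unfolding right_quotient_sup_def by (rule cSUP_upper[OF _ right_quotient_bdd]) auto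

lemma right_quotient_sup_bound: "\<bar>right_quotient_sup c n x\<bar> \<le> L"
proof -
  define h where "h = 1 / (2 * real (Suc n))"
  have h: "0 < h" "h < 1 / real (Suc n)" by (auto simp: h_def field_simps)
  have "- L \<le> (c (x + h) - c x) / h" using quotient_bound[OF h(1), of x] by linarith
  then have "- L \<le> right_quotient_sup c n x" using right_quotient_sup_upper[OF h, of x] by linarith
  moreover have "right_quotient_sup c n x \<le> L"
    unfolding right_quotient_sup_def using quotient_le by (intro cSUP_least) auto
  ultimately show ?thesis by auto
qed

lemma right_quotient_sup_ge: "- L \<le> right_quotient_sup c n x"
  using right_quotient_sup_bound[of n x] by linarith

lemma right_upper_dini_le: "right_upper_dini c x \<le> right_quotient_sup c n x"
  unfolding right_upper_dini_def
  by (rule cINF_lower) (use right_quotient_sup_ge in \<open>auto simp: bdd_below_def\<close>)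

lemma right_upper_dini_bound: "\<bar>right_upper_dini c x\<bar> \<le> L"
proof -
  have "- L \<le> right_upper_dini c x" unfolding right_upper_dini_def
    using right_quotient_sup_ge by (intro cINF_greatest) auto
  then show ?thesis using right_upper_dini_le[of x 0] right_quotient_sup_bound[of 0 x] by linarith
qed

lemma continuous_on_lip: "continuous_on UNIV c"
  using lip lipschitz_on_continuous_on by blast

text \<open>A supremum of continuous functions is lower semicontinuous.\<close>

lemma right_quotient_sup_measurable: "right_quotient_sup c n \<in> borel_measurable borel"
proof (rule borel_measurableI_greater)
  fix y
  have "{x. y < right_quotient_sup c n x} = (\<Union>h\<in>{0<..<1 / real (Suc n)}. {x. y < (c (x + h) - c x) / h})"
    unfolding right_quotient_sup_def by (subst less_cSUP_iff[OF _ right_quotient_bdd]) auto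
  also have "open \<dots>"
    by (intro open_UN ballI open_Collect_less continuous_intros continuous_on_lip
        continuous_on_compose2[OF continuous_on_lip]) auto
  finally show "{x \<in> space borel. y < right_quotient_sup c n x} \<in> sets borel" by simp
qed

lemma right_upper_dini_measurable: "right_upper_dini c \<in> borel_measurable borel"
  using right_quotient_sup_measurable unfolding right_upper_dini_def[abs_def] by measurable

lemma right_upper_dini_step:
  assumes "\<epsilon> > 0" "\<delta> > 0"
  shows "\<exists>h. 0 < h \<and> h < \<delta> \<and> (right_upper_dini c x - \<epsilon>) * h \<le> c (x + h) - c x"
proof -
  obtain n where n: "1 / real (Suc n) < \<delta>" using nat_approx_posE[OF \<open>\<delta> > 0\<close>] by blast
  have "right_upper_dini c x - \<epsilon> < right_quotient_sup c n x" using right_upper_dini_le[of x n] assms by linarith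
  then obtain h where h: "0 < h" "h < 1 / real (Suc n)" "right_upper_dini c x - \<epsilon> < (c (x + h) - c x) / h"
    unfolding right_quotient_sup_def by (subst (asm) less_cSUP_iff[OF _ right_quotient_bdd]) auto
  have "(right_upper_dini c x - \<epsilon>) * h \<le> c (x + h) - c x" using h(1,3) by (simp add: pos_less_divide_eq less_imp_le)
  then show ?thesis using n h by (intro exI[of _ h]) (auto simp del: of_nat_Suc)
qed

lemma integral_right_upper_dini_le: "a \<le> b \<Longrightarrow> integral {a..b} (right_upper_dini c) \<le> c b - c a"
  by (rule integral_le_increment_if_right_dini[OF _ continuous_on_lip right_upper_dini_measurable
        right_upper_dini_bound right_upper_dini_step])

end

text \<open>The integral of the upper Dini derivative is at most the increment. Applied to \<open>c\<close> and \<open>- c\<close> this bounds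
  the integral of the difference of the upper and the lower Dini derivative by \<open>0\<close>. The difference is
  non-negative, so the two agree almost everywhere and their integrals equal the increment.\<close>

lemma lipschitz_ae_right_derivative:
  fixes c :: "real \<Rightarrow> real"
  assumes lip: "L-lipschitz_on UNIV c"
  shows "\<exists>u N. u \<in> borel_measurable borel \<and> (\<forall>x. \<bar>u x\<bar> \<le> L) \<and>
    (\<forall>a b. a \<le> b \<longrightarrow> integral {a..b} u = c b - c a) \<and> negligible N \<and>
    (\<forall>x. x \<notin> N \<longrightarrow> ((\<lambda>h. (c (x + h) - c x) / h) \<longlongrightarrow> u x) (at_right 0))"
proof -
  let ?u = "right_upper_dini c" and ?m = "\<lambda>x. - c x"
  let ?l = "right_upper_dini ?m"
  have lip': "L-lipschitz_on UNIV ?m" using lip by simp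
  note mu[measurable] = right_upper_dini_measurable[OF lip] right_upper_dini_measurable[OF lip']
  (* - ?l x is the lower right Dini derivative. *)
  have nonneg: "0 \<le> ?u x + ?l x" for x
  proof -
    have "- ?l x \<le> right_quotient_sup c n x" for n
    proof -
      have "- ?l x \<le> right_quotient_sup c n x + e" if "e > 0" for e
      proof -
        note \<open>e > 0\<close>
        have "\<exists>k. 0 < k \<and> k < 1 / real (Suc n) \<and> - ?l x - e \<le> (c (x + k) - c x) / k"
        proof -
          define k where "k = 1 / (2 * real (Suc n))"
          have k: "0 < k" "k < 1 / real (Suc n)" by (auto simp: k_def field_simps)
          obtain j where j: "right_quotient_sup ?m j x < ?l x + e"
            using \<open>e > 0\<close> cInf_lessD[of "range (\<lambda>n. right_quotient_sup ?m n x)" "?l x + e"]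
            unfolding right_upper_dini_def by auto
          define k' where "k' = min k (1 / (2 * real (Suc j)))"
          have "1 / (2 * real (Suc j)) < 1 / real (Suc j)" by (simp add: field_simps)
          then have k': "0 < k'" "k' < 1 / real (Suc n)" "k' < 1 / real (Suc j)"
            using k unfolding k'_def by (auto simp del: of_nat_Suc simp: min_less_iff_disj)
          have "(?m (x + k') - ?m x) / k' \<le> right_quotient_sup ?m j x"
            using right_quotient_sup_upper[OF lip' k'(1,3)] .
          moreover have "(?m (x + k') - ?m x) / k' = - ((c (x + k') - c x) / k')" using k' by (simp add: field_simps)
          ultimately show ?thesis using j k'(1,2) by (intro exI[of _ k'] conjI) linarith+
        qed
        then obtain k where k: "0 < k" "k < 1 / real (Suc n)" "- ?l x - e \<le> (c (x + k) - c x) / k"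
          by blast
        then show ?thesis using right_quotient_sup_upper[OF lip k(1,2), of x] by linarith
      qed
      then show ?thesis by (rule field_le_epsilon)
    qed
    then have "- ?l x \<le> ?u x" unfolding right_upper_dini_def[of c] by (intro cINF_greatest) auto
    then show ?thesis by linarith
  qed
  have bd: "\<bar>?u x\<bar> \<le> L" "\<bar>?l x\<bar> \<le> L" for x
    using right_upper_dini_bound[OF lip] right_upper_dini_bound[OF lip'] by auto
  have bd2: "\<bar>?u x + ?l x\<bar> \<le> 2 * L" for x using bd[of x] by linarith
  have int: "?u integrable_on {a..b}" "?l integrable_on {a..b}" for a b
    using bounded_borel_integrable_on[OF mu(1) bd(1)] bounded_borel_integrable_on[OF mu(2) bd(2)] by auto
  have sum0: "integral {a..b} ?u + integral {a..b} ?l = 0" "integral {a..b} (\<lambda>x. ?u x + ?l x) = 0"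
    if "a \<le> b" for a b
  proof -
    have "0 \<le> integral {a..b} (\<lambda>x. ?u x + ?l x)" using nonneg int by (intro integral_nonneg integrable_add) auto
    moreover have "integral {a..b} (\<lambda>x. ?u x + ?l x) = integral {a..b} ?u + integral {a..b} ?l"
      using int by (rule integral_add)
    ultimately show "integral {a..b} ?u + integral {a..b} ?l = 0" "integral {a..b} (\<lambda>x. ?u x + ?l x) = 0"
      using integral_right_upper_dini_le[OF lip that] integral_right_upper_dini_le[OF lip' that] by auto
  qed
  define N where "N = {x. ?u x + ?l x \<noteq> 0}"
  have "negligible N"
  proof -
    have "negligible {x\<in>{-real n..real n}. ?u x + ?l x \<noteq> 0}" for n
      by (rule negligible_nonzero_if_integral_0[where B = "2*L"])
        (use nonneg bd2 sum0(2)[of "-real n" "real n"] in auto)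
    then have "negligible (\<Union>n. {x\<in>{-real n..real n}. ?u x + ?l x \<noteq> 0})"
      unfolding negligible_iff_null_sets by (intro null_sets_UN)
    also have "(\<Union>n. {x\<in>{-real n..real n}. ?u x + ?l x \<noteq> 0}) = N"
    proof -
      have "\<exists>n. - real n \<le> x \<and> x \<le> real n" for x using real_arch_simple[of "\<bar>x\<bar>"] by (auto simp: abs_le_iff minus_le_iff)
      then show ?thesis unfolding N_def by auto
    qed
    finally show ?thesis .
  qed
  show ?thesis
  proof (rule exI[of _ ?u], rule exI[of _ N], intro conjI allI impI)
    show "integral {a..b} ?u = c b - c a" if "a \<le> b" for a b
      using integral_right_upper_dini_le[OF lip that] integral_right_upper_dini_le[OF lip' that] sum0(1)[OF that] by linarith
    fix x assume "x \<notin> N"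
    then have eq: "?l x = - ?u x" unfolding N_def by auto
    show "((\<lambda>h. (c (x + h) - c x) / h) \<longlongrightarrow> ?u x) (at_right 0)"
    proof (rule tendstoI)
      fix e :: real assume "e > 0"
      obtain i where i: "right_quotient_sup c i x < ?u x + e"
        using \<open>e > 0\<close> cInf_lessD[of "range (\<lambda>n. right_quotient_sup c n x)" "?u x + e"]
        unfolding right_upper_dini_def by auto
      obtain j where j: "right_quotient_sup ?m j x < ?l x + e"
        using \<open>e > 0\<close> cInf_lessD[of "range (\<lambda>n. right_quotient_sup ?m n x)" "?l x + e"]
        unfolding right_upper_dini_def by auto
      have "dist ((c (x + h) - c x) / h) (?u x) < e" if h: "0 < h" "h < min (1 / real (Suc i)) (1 / real (Suc j))" for h
      proof -
        have "(c (x + h) - c x) / h \<le> right_quotient_sup c i x" "(?m (x + h) - ?m x) / h \<le> right_quotient_sup ?m j x"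
          using h right_quotient_sup_upper[OF lip, of h i x] right_quotient_sup_upper[OF lip', of h j x] by auto
        moreover have "(?m (x + h) - ?m x) / h = - ((c (x + h) - c x) / h)" using h by (simp add: field_simps)
        ultimately show ?thesis using i j eq by (auto simp: dist_real_def abs_less_iff)
      qed
      then show "eventually (\<lambda>h. dist ((c (x + h) - c x) / h) (?u x) < e) (at_right 0)"
        unfolding eventually_at_right_field by (intro exI[of _ "min (1 / real (Suc i)) (1 / real (Suc j))"]) auto
    qed
  qed (use bd(1) \<open>negligible N\<close> in simp_all)
qed

text \<open>A strict minimum on an interval with rational end points is determined by the interval and by \<open>p\<close>.\<close>

lemma countable_strict_local_minima:
  fixes c :: "real \<Rightarrow> real"
  shows "countable {x. \<exists>p\<in>\<rat>. \<exists>d>0. \<forall>y. y \<noteq> x \<and> \<bar>y - x\<bar> < d \<longrightarrow> c x - p * x < c y - p * y}"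
proof -
  define S where "S p a b = {x. a < x \<and> x < b \<and> (\<forall>y. y \<noteq> x \<and> a < y \<and> y < b \<longrightarrow> c x - p * x < c y - p * y)}" for p a b :: real
  have "countable (S p a b)" for p a b
  proof -
    have "x = y" if "x \<in> S p a b" "y \<in> S p a b" for x y
    proof (rule ccontr)
      assume "x \<noteq> y"
      then have "c x - p * x < c y - p * y" "c y - p * y < c x - p * x" using that unfolding S_def by auto
      then show False by simp
    qed
    then have "\<exists>z. S p a b \<subseteq> {z}" by blast
    then show ?thesis by (meson countable_empty countable_insert countable_subset)
  qed
  then have "countable (\<Union>p\<in>\<rat>. \<Union>a\<in>\<rat>. \<Union>b\<in>\<rat>. S p a b)" by (intro countable_UN countable_rat)
  moreover have "{x. \<exists>p\<in>\<rat>. \<exists>d>0. \<forall>y. y \<noteq> x \<and> \<bar>y - x\<bar> < d \<longrightarrow> c x - p * x < c y - p * y} \<subseteq> (\<Union>p\<in>\<rat>. \<Union>a\<in>\<rat>. \<Union>b\<in>\<rat>. S p a b)"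
  proof
    fix x assume "x \<in> {x. \<exists>p\<in>\<rat>. \<exists>d>0. \<forall>y. y \<noteq> x \<and> \<bar>y - x\<bar> < d \<longrightarrow> c x - p * x < c y - p * y}"
    then obtain p d where p: "p \<in> \<rat>" "d > 0" "\<And>y. y \<noteq> x \<Longrightarrow> \<bar>y - x\<bar> < d \<Longrightarrow> c x - p * x < c y - p * y" by blast
    obtain a where a: "a \<in> \<rat>" "x - d < a" "a < x" using Rats_dense_in_real[of "x - d" x] p by auto
    obtain b where b: "b \<in> \<rat>" "x < b" "b < x + d" using Rats_dense_in_real[of x "x + d"] p by auto
    have "x \<in> S p a b" unfolding S_def using p(3) a b by (auto simp: abs_less_iff)
    then show "x \<in> (\<Union>p\<in>\<rat>. \<Union>a\<in>\<rat>. \<Union>b\<in>\<rat>. S p a b)" using p a b by blast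
  qed
  ultimately show ?thesis by (rule countable_subset[rotated])
qed

text \<open>Subtracting a linear function whose slope is a rational between the two one-sided derivatives turns the
  point into a strict local minimum.\<close>

lemma countable_left_less_right_derivative:
  fixes c :: "real \<Rightarrow> real"
  shows "countable {x. \<exists>l r. l < r \<and> ((\<lambda>h. (c x - c (x - h)) / h) \<longlongrightarrow> l) (at_right 0) \<and>
                            ((\<lambda>h. (c (x + h) - c x) / h) \<longlongrightarrow> r) (at_right 0)}"
proof (rule countable_subset[OF _ countable_strict_local_minima[of c]], safe)
  fix x l r :: real
  assume lr: "l < r" and l: "((\<lambda>h. (c x - c (x - h)) / h) \<longlongrightarrow> l) (at_right 0)"
    and r: "((\<lambda>h. (c (x + h) - c x) / h) \<longlongrightarrow> r) (at_right 0)"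
  obtain p where p: "p \<in> \<rat>" "l < p" "p < r" using Rats_dense_in_real[OF lr] by auto
  obtain d1 where d1: "d1 > 0" "\<And>h. 0 < h \<Longrightarrow> h < d1 \<Longrightarrow> (c x - c (x - h)) / h < p"
    using order_tendstoD(2)[OF l p(2)] unfolding eventually_at_right_field by auto
  obtain d2 where d2: "d2 > 0" "\<And>h. 0 < h \<Longrightarrow> h < d2 \<Longrightarrow> p < (c (x + h) - c x) / h"
    using order_tendstoD(1)[OF r p(3)] unfolding eventually_at_right_field by auto
  have "c x - p * x < c y - p * y" if "y \<noteq> x" "\<bar>y - x\<bar> < min d1 d2" for y
  proof (cases "y < x")
    case True
    then show ?thesis using d1(2)[of "x - y"] that by (auto simp: field_simps)
  next
    case False
    then show ?thesis using d2(2)[of "y - x"] that by (auto simp: field_simps)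
  qed
  then show "\<exists>p\<in>\<rat>. \<exists>d>0. \<forall>y. y \<noteq> x \<and> \<bar>y - x\<bar> < d \<longrightarrow> c x - p * x < c y - p * y"
    using p(1) d1(1) d2(1) by (intro bexI[of _ p] exI[of _ "min d1 d2"]) auto
qed

lemma has_derivative_from_sides:
  fixes c :: "real \<Rightarrow> real"
  assumes l: "((\<lambda>h. (c x - c (x - h)) / h) \<longlongrightarrow> v) (at_right 0)"
    and r: "((\<lambda>h. (c (x + h) - c x) / h) \<longlongrightarrow> v) (at_right 0)"
  shows "(c has_real_derivative v) (at x)"
proof -
  have "((\<lambda>h. (c (x + h) - c x) / h) \<longlongrightarrow> v) (at_left 0)"
  proof -
    have "(\<lambda>h. (c (x + - h) - c x) / - h) = (\<lambda>h. (c x - c (x - h)) / h)"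
      by (auto simp: fun_eq_iff divide_simps)
    then show ?thesis using l by (simp add: filterlim_at_left_to_right)
  qed
  then show ?thesis using r unfolding DERIV_def filterlim_at_split by simp
qed

lemma negligible_if_countable:
  fixes S :: "real set"
  assumes "countable S"
  shows "negligible S"
proof -
  have "S \<in> null_sets lborel" using assms by (rule countable_imp_null_set_lborel)
  then show ?thesis using null_sets_completionI negligible_iff_null_sets by blast
qed

text \<open>Both one-sided derivatives exist almost everywhere, the left one by reflection, and they can differ
  only on a countable set.\<close>

lemma lipschitz_UNIV_ae_derivative:
  fixes c :: "real \<Rightarrow> real"
  assumes lip: "L-lipschitz_on UNIV c"
  shows "\<exists>v N. v \<in> borel_measurable borel \<and> (\<forall>x. \<bar>v x\<bar> \<le> L) \<and> negligible N \<and>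
    (\<forall>x. x \<notin> N \<longrightarrow> (c has_real_derivative v x) (at x)) \<and>
    (\<forall>a b. a \<le> b \<longrightarrow> integral {a..b} v = c b - c a)"
proof -
  obtain v N where v: "v \<in> borel_measurable borel" "\<And>x. \<bar>v x\<bar> \<le> L"
    "\<And>a b. a \<le> b \<Longrightarrow> integral {a..b} v = c b - c a" "negligible N"
    "\<And>x. x \<notin> N \<Longrightarrow> ((\<lambda>h. (c (x + h) - c x) / h) \<longlongrightarrow> v x) (at_right 0)"
    using lipschitz_ae_right_derivative[OF lip] by blast
  have lip': "L-lipschitz_on UNIV (\<lambda>x. c (- x))"
  proof (rule lipschitz_onI)
    fix x y show "dist (c (- x)) (c (- y)) \<le> L * dist x y"
      using lipschitz_onD[OF lip, of "- x" "- y"] by (simp add: dist_minus)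
  qed (rule lipschitz_on_nonneg[OF lip])
  obtain w N' where w: "negligible N'"
    "\<And>x. x \<notin> N' \<Longrightarrow> ((\<lambda>h. (c (- (x + h)) - c (- x)) / h) \<longlongrightarrow> w x) (at_right 0)"
    using lipschitz_ae_right_derivative[OF lip'] by blast
  have lq: "((\<lambda>h. (c x - c (x - h)) / h) \<longlongrightarrow> - w (- x)) (at_right 0)" if "x \<notin> uminus ` N'" for x
  proof -
    have "- x \<notin> N'" using that by force
    then have "((\<lambda>h. - ((c (- (- x + h)) - c (- (- x))) / h)) \<longlongrightarrow> - w (- x)) (at_right 0)"
      by (intro tendsto_minus w(2))
    moreover have "(\<lambda>h. - ((c (- (- x + h)) - c (- (- x))) / h)) = (\<lambda>h. (c x - c (x - h)) / h)"
      by (auto simp: fun_eq_iff divide_simps)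
    ultimately show ?thesis by simp
  qed
  define K where "K = {x. \<exists>l r. l < r \<and> ((\<lambda>h. (c x - c (x - h)) / h) \<longlongrightarrow> l) (at_right 0) \<and>
                            ((\<lambda>h. (c (x + h) - c x) / h) \<longlongrightarrow> r) (at_right 0)}"
  define K' where "K' = {x. \<exists>l r. l < r \<and> ((\<lambda>h. (- c x - - c (x - h)) / h) \<longlongrightarrow> l) (at_right 0) \<and>
                            ((\<lambda>h. (- c (x + h) - - c x) / h) \<longlongrightarrow> r) (at_right 0)}"
  define Z where "Z = N \<union> uminus ` N' \<union> K \<union> K'"
  have "negligible (uminus ` N')"
    by (rule negligible_differentiable_image_negligible[OF order_refl w(1)]) (auto intro!: derivative_intros)
  moreover have "countable K" "countable K'"
    unfolding K_def K'_def by (rule countable_left_less_right_derivative)+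
  ultimately have "negligible Z" unfolding Z_def using v(4) by (auto intro!: negligible_Un negligible_if_countable)
  moreover have "(c has_real_derivative v x) (at x)" if "x \<notin> Z" for x
  proof -
    have l: "((\<lambda>h. (c x - c (x - h)) / h) \<longlongrightarrow> - w (- x)) (at_right 0)" and r: "((\<lambda>h. (c (x + h) - c x) / h) \<longlongrightarrow> v x) (at_right 0)"
      using lq v(5) that unfolding Z_def by auto
    have "\<not> - w (- x) < v x" using that l r unfolding Z_def K_def by blast
    moreover have "\<not> v x < - w (- x)"
    proof
      assume "v x < - w (- x)"
      moreover have "((\<lambda>h. (- c x - - c (x - h)) / h) \<longlongrightarrow> w (- x)) (at_right 0)"
        using tendsto_minus[OF l] by (simp add: minus_divide_left)
      moreover have "((\<lambda>h. (- c (x + h) - - c x) / h) \<longlongrightarrow> - v x) (at_right 0)"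
        using tendsto_minus[OF r] by (simp add: minus_divide_left)
      ultimately have "x \<in> K'" unfolding K'_def by (intro CollectI exI[of _ "w (- x)"] exI[of _ "- v x"]) auto
      then show False using that unfolding Z_def by auto
    qed
    ultimately have "- w (- x) = v x" by linarith
    then show ?thesis using has_derivative_from_sides[of c x "v x"] l r by simp
  qed
  ultimately show ?thesis using v(1-3) by blast
qed

lemma lipschitz_ae_derivative:
  fixes c :: "real \<Rightarrow> real"
  assumes lip: "L-lipschitz_on {a..b} c" and "a \<le> b"
  shows "\<exists>v N. v \<in> borel_measurable borel \<and> (\<forall>x. \<bar>v x\<bar> \<le> L) \<and> negligible N \<and>
    (\<forall>x\<in>{a<..<b} - N. (c has_real_derivative v x) (at x)) \<and>
    (\<forall>s t. a \<le> s \<longrightarrow> s \<le> t \<longrightarrow> t \<le> b \<longrightarrow> integral {s..t} v = c t - c s)"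
proof -
  define e where "e x = c (max a (min b x))" for x
  have "L-lipschitz_on UNIV e"
  proof (rule lipschitz_onI)
    fix x y
    have "dist (e x) (e y) \<le> L * dist (max a (min b x)) (max a (min b y))"
      unfolding e_def using \<open>a \<le> b\<close> by (intro lipschitz_onD[OF lip]) auto
    also have "\<dots> \<le> L * dist x y"
      using lipschitz_on_nonneg[OF lip] by (intro mult_left_mono) (auto simp: dist_real_def)
    finally show "dist (e x) (e y) \<le> L * dist x y" .
  qed (rule lipschitz_on_nonneg[OF lip])
  then obtain v N where v: "v \<in> borel_measurable borel" "\<And>x. \<bar>v x\<bar> \<le> L" "negligible N"
    "\<And>x. x \<notin> N \<Longrightarrow> (e has_real_derivative v x) (at x)"
    "\<And>a b. a \<le> b \<Longrightarrow> integral {a..b} v = e b - e a"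
    using lipschitz_UNIV_ae_derivative by blast
  have ec: "e x = c x" if "x \<in> {a..b}" for x using that by (auto simp: e_def)
  have "(c has_real_derivative v x) (at x)" if "x \<in> {a<..<b}" "x \<notin> N" for x
  proof -
    have "eventually (\<lambda>y. y \<in> {a<..<b}) (nhds x)" using that by (intro eventually_nhds_in_open) auto
    then have ev: "eventually (\<lambda>y. e y = c y) (nhds x)" by eventually_elim (auto simp: ec)
    show ?thesis using v(4)[OF that(2)] ev by (subst (asm) DERIV_cong_ev[OF refl ev refl]) auto
  qed
  moreover have "integral {s..t} v = c t - c s" if "a \<le> s" "s \<le> t" "t \<le> b" for s t
    using v(5)[OF that(2)] that by (simp add: ec)
  ultimately show ?thesis using v(1-3) by blast
qed

text \<open>Half-lines generate the Borel sets. This identifies the derivative of an indefinite integral with its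
  integrand.\<close>

lemma negligible_if_integrals_0:
  fixes q :: "real \<Rightarrow> real"
  assumes q[measurable]: "q \<in> borel_measurable borel" and bnd: "\<And>x. \<bar>q x\<bar> \<le> B"
    and zero: "\<And>t. t \<in> {a..b} \<Longrightarrow> integral {a..t} q = 0"
  shows "negligible {x\<in>{a..b}. q x \<noteq> 0}"
proof (cases "a \<le> b")
  case True
  let ?p = "\<lambda>x. max 0 (q x)" and ?n = "\<lambda>x. max 0 (- q x)"
  have int: "f integrable_on {s..t}" if "f \<in> borel_measurable borel" "\<And>x. \<bar>f x\<bar> \<le> B" for f :: "real \<Rightarrow> real" and s t
    by (rule bounded_borel_integrable_on) (use that in auto)
  have bp: "\<bar>?p x\<bar> \<le> B" "\<bar>?n x\<bar> \<le> B" for x using bnd[of x] by auto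
  have eq: "integral {s..b} ?p = integral {s..b} ?n" if "a \<le> s" "s \<le> b" for s
  proof -
    have "integral {a..s} q + integral {s..b} q = integral {a..b} q"
      using that bnd by (intro Henstock_Kurzweil_Integration.integral_combine int) auto
    then have "integral {s..b} q = 0" using zero that by simp
    moreover have "integral {s..b} (\<lambda>x. ?p x - ?n x) = integral {s..b} ?p - integral {s..b} ?n"
      using bp by (intro integral_diff int) auto
    moreover have "(\<lambda>x. ?p x - ?n x) = q" by (auto simp: fun_eq_iff max_def)
    ultimately show ?thesis by simp
  qed
  (* The positive and the negative part of q are densities of the same measure, as their integrals over all half-lines agree. *)
  let ?D = "\<lambda>f. density lborel (\<lambda>x. ennreal (f x) * indicator {a..b} x)"
  have em: "emeasure (?D f) {x<..} = ennreal (integral {max a x..b} f)"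
    if f[measurable]: "f \<in> borel_measurable borel" and fb: "\<And>x. \<bar>f x\<bar> \<le> B" "\<And>x. 0 \<le> f x" for f x
  proof -
    have "emeasure (?D f) {x<..} = (\<integral>\<^sup>+y. ennreal (f y) * indicator {a..b} y * indicator {x<..} y \<partial>lborel)"
      by (subst emeasure_density) auto
    also have "\<dots> = (\<integral>\<^sup>+y. ennreal (f y) * indicator {max a x..b} y \<partial>lborel)"
    proof (rule nn_integral_cong_AE)
      have "AE y in lborel. y \<noteq> x" by (rule AE_lborel_singleton)
      then show "AE y in lborel. ennreal (f y) * indicator {a..b} y * indicator {x<..} y = ennreal (f y) * indicator {max a x..b} y"
        by eventually_elim (auto split: split_indicator)
    qed
    also have "\<dots> = ennreal (integral {max a x..b} f)"
    proof -
      have "(f has_integral integral {max a x..b} f) {max a x..b}" using int[OF f fb(1)] by (rule integrable_integral)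
      moreover have ind: "((\<lambda>y. indicator {max a x..b} y * f y) has_integral I) UNIV \<longleftrightarrow> (f has_integral I) {max a x..b}" for I
      proof -
        have "(\<lambda>y. indicator {max a x..b} y * f y) = (\<lambda>y. if y \<in> {max a x..b} then f y else 0)"
          by (auto simp: fun_eq_iff indicator_def)
        then show ?thesis by (simp only: has_integral_restrict_UNIV)
      qed
      ultimately have "(\<integral>\<^sup>+y. ennreal (indicator {max a x..b} y * f y) \<partial>lborel) = ennreal (integral {max a x..b} f)"
        by (intro nn_integral_has_integral_lborel[of "\<lambda>y. indicator {max a x..b} y * f y"])
           (use fb in \<open>auto simp: ind\<close>)
      moreover have "(\<lambda>y. ennreal (indicator {max a x..b} y * f y)) = (\<lambda>y. ennreal (f y) * indicator {max a x..b} y)"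
        by (auto simp: fun_eq_iff split: split_indicator)
      ultimately show ?thesis by simp
    qed
    finally show ?thesis .
  qed
  have "?D ?p = ?D ?n"
  proof (rule measure_eqI_lessThan)
    fix x
    have "integral {max a x..b} ?p = integral {max a x..b} ?n"
      using eq[of "max a x"] by (cases "max a x \<le> b") auto
    then show "emeasure (?D ?p) {x<..} = emeasure (?D ?n) {x<..}"
      using bp by (subst (1 2) em) auto
    show "emeasure (?D ?p) {x<..} < \<infinity>" using bp by (subst em) auto
  qed auto
  then have "AE x in lborel. ennreal (?p x) * indicator {a..b} x = ennreal (?n x) * indicator {a..b} x"
    by (intro sigma_finite_measure.density_unique[OF sigma_finite_lborel]) auto
  then have "AE x in lborel. x \<in> {a..b} \<longrightarrow> q x = 0"
    by eventually_elim (auto simp: max_def ennreal_eq_0_iff split: if_splits)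
  then have "AE x in lebesgue. x \<in> {a..b} \<longrightarrow> q x = 0" by (rule AE_completion)
  then obtain N where "{x \<in> space lebesgue. \<not> (x \<in> {a..b} \<longrightarrow> q x = 0)} \<subseteq> N" "N \<in> null_sets lebesgue"
    unfolding eventually_ae_filter by blast
  then show ?thesis
    unfolding negligible_iff_null_sets[symmetric] by (auto intro: negligible_subset)
qed auto

section \<open>Velocities of Lipschitz curves\<close>

lemma bounded_measurable_integrable_on:
  fixes f :: "real \<Rightarrow> real"
  assumes "f \<in> borel_measurable (lebesgue_on {a..b})" and "\<And>x. x \<in> {a..b} \<Longrightarrow> \<bar>f x\<bar> \<le> B"
  shows "f integrable_on {a..b}"
  by (rule measurable_bounded_by_integrable_imp_integrable[OF assms(1), where g = "\<lambda>_. B"])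
    (use assms in \<open>auto intro: integrable_const_ivl\<close>)

lemma borel_measurable_lebesgue_on_Icc:
  fixes f :: "real \<Rightarrow> real"
  shows "f \<in> borel_measurable borel \<Longrightarrow> f \<in> borel_measurable (lebesgue_on {a..b})"
  by (intro measurable_restrict_space1 measurable_completion) simp

lemma continuous_on_measurable_Icc:
  fixes f :: "real \<Rightarrow> real"
  shows "continuous_on {a..b} f \<Longrightarrow> f \<in> borel_measurable (lebesgue_on {a..b})"
  by (rule continuous_imp_measurable_on_sets_lebesgue) auto

lemma continuous_on_Icc_bounded:
  fixes f :: "real \<Rightarrow> real"
  assumes "continuous_on {a..b} f"
  shows "\<exists>C. \<forall>x\<in>{a..b}. \<bar>f x\<bar> \<le> C"
  using compact_imp_bounded[OF compact_continuous_image[OF assms compact_Icc]]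
  unfolding bounded_iff by auto

text \<open>Any almost everywhere derivative may be integrated, since two of them agree almost everywhere.\<close>

lemma lipschitz_FTC:
  fixes e w :: "real \<Rightarrow> real"
  assumes "L-lipschitz_on {a..b} e" "a \<le> b" "negligible N"
    and "\<And>x. x \<in> {a<..<b} - N \<Longrightarrow> (e has_real_derivative w x) (at x)"
  shows "integral {a..b} w = e b - e a"
proof -
  obtain v N' where v: "negligible N'" "\<forall>x\<in>{a<..<b} - N'. (e has_real_derivative v x) (at x)"
    "\<forall>s t. a \<le> s \<longrightarrow> s \<le> t \<longrightarrow> t \<le> b \<longrightarrow> integral {s..t} v = e t - e s"
    using lipschitz_ae_derivative[OF assms(1,2)] by blast
  have "integral {a..b} w = integral {a..b} v"
  proof (rule integral_spike)
    show "negligible (N \<union> N' \<union> {a, b})" using v(1) assms(3) by auto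
    fix x assume "x \<in> {a..b} - (N \<union> N' \<union> {a, b})"
    then show "v x = w x" using assms(4)[of x] v(2) by (auto intro: DERIV_unique)
  qed
  then show ?thesis using v(3) assms(2) by simp
qed

text \<open>A version \<open>v\<close> of the derivative of \<open>c\<close> that is Borel measurable and bounded on the whole line. The choice of
  \<open>v\<close> outside a null set is immaterial, and having total measurable functions keeps integrability simple.\<close>

definition velocity :: "real \<Rightarrow> real \<Rightarrow> (real \<Rightarrow> real) \<Rightarrow> (real \<Rightarrow> real) \<Rightarrow> bool" where
  "velocity a b c v \<longleftrightarrow> v \<in> borel_measurable borel \<and> (\<exists>L. \<forall>x. \<bar>v x\<bar> \<le> L) \<and>
     (\<exists>N. negligible N \<and> (\<forall>x\<in>{a<..<b} - N. (c has_real_derivative v x) (at x))) \<and>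
     (\<forall>s t. a \<le> s \<longrightarrow> s \<le> t \<longrightarrow> t \<le> b \<longrightarrow> integral {s..t} v = c t - c s)"

lemma velocityI:
  assumes "v \<in> borel_measurable borel" "\<And>x. \<bar>v x\<bar> \<le> L" "negligible N"
    "\<And>x. x \<in> {a<..<b} - N \<Longrightarrow> (c has_real_derivative v x) (at x)"
    "\<And>s t. a \<le> s \<Longrightarrow> s \<le> t \<Longrightarrow> t \<le> b \<Longrightarrow> integral {s..t} v = c t - c s"
  shows "velocity a b c v"
  unfolding velocity_def
proof (intro conjI)
  show "\<exists>L. \<forall>x. \<bar>v x\<bar> \<le> L" using assms(2) by blast
  show "\<exists>N. negligible N \<and> (\<forall>x\<in>{a<..<b} - N. (c has_real_derivative v x) (at x))"
    using assms(3,4) by (intro exI[of _ N]) simp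
qed (use assms in simp_all)

lemma velocity_measurable: "velocity a b c v \<Longrightarrow> v \<in> borel_measurable borel"
  unfolding velocity_def by simp

lemma velocity_bounded:
  assumes "velocity a b c v" obtains L where "\<And>x. \<bar>v x\<bar> \<le> L"
  using assms unfolding velocity_def by auto

lemma velocity_derivative:
  assumes "velocity a b c v"
  obtains N where "negligible N" "\<And>x. x \<in> {a<..<b} - N \<Longrightarrow> (c has_real_derivative v x) (at x)"
  using assms unfolding velocity_def by auto

lemma velocity_integral: "velocity a b c v \<Longrightarrow> a \<le> s \<Longrightarrow> s \<le> t \<Longrightarrow> t \<le> b \<Longrightarrow> integral {s..t} v = c t - c s"
  unfolding velocity_def by simp

lemma velocity_exists:
  assumes "L-lipschitz_on {a..b} c" "a \<le> b"
  shows "\<exists>v. velocity a b c v \<and> (\<forall>x. \<bar>v x\<bar> \<le> L)"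
proof -
  obtain v N where v: "v \<in> borel_measurable borel" "\<forall>x. \<bar>v x\<bar> \<le> L" "negligible N"
    "\<forall>x\<in>{a<..<b} - N. (c has_real_derivative v x) (at x)"
    "\<forall>s t. a \<le> s \<longrightarrow> s \<le> t \<longrightarrow> t \<le> b \<longrightarrow> integral {s..t} v = c t - c s"
    using lipschitz_ae_derivative[OF assms] by blast
  have "velocity a b c v" by (rule velocityI[of v L N]) (use v in auto)
  then show ?thesis using v(2) by blast
qed

lemma velocity_integrable:
  assumes "velocity a b c v" shows "v integrable_on {s..t}"
proof -
  obtain L where "\<And>x. \<bar>v x\<bar> \<le> L" using velocity_bounded[OF assms] by auto
  then show ?thesis using bounded_borel_integrable_on[OF velocity_measurable[OF assms]] by blast
qed

lemma velocity_increment_bound: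
  assumes v: "velocity a b c v" and "\<And>x. x \<in> {s..t} \<Longrightarrow> \<bar>v x\<bar> \<le> L" "a \<le> s" "s \<le> t" "t \<le> b"
  shows "\<bar>c t - c s\<bar> \<le> L * (t - s)"
proof -
  have "c t - c s = integral {s..t} v" using v assms unfolding velocity_def by simp
  moreover have "norm (integral {s..t} v) \<le> integral {s..t} (\<lambda>_. L)"
    using assms by (intro integral_norm_bound_integral velocity_integrable[OF v]) auto
  ultimately show ?thesis using assms by (simp add: mult.commute)
qed

lemma velocity_lipschitz:
  assumes v: "velocity a b c v" and L: "\<And>x. \<bar>v x\<bar> \<le> L"
  shows "L-lipschitz_on {a..b} c"
proof (rule lipschitz_on_leI)
  show "0 \<le> L" using L[of 0] by linarith
  fix x y assume "x \<in> {a..b}" "y \<in> {a..b}" "x \<le> y"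
  then show "dist (c x) (c y) \<le> L * dist x y"
    using velocity_increment_bound[OF v, of x y L] L by (simp add: dist_real_def abs_minus_commute)
qed

lemma velocity_subinterval:
  assumes "velocity a b c v" "a \<le> a'" "b' \<le> b"
  shows "velocity a' b' c v"
proof -
  obtain L where L: "\<And>x. \<bar>v x\<bar> \<le> L" using velocity_bounded[OF assms(1)] by auto
  obtain N where N: "negligible N" "\<And>x. x\<in>{a<..<b} - N \<Longrightarrow> (c has_real_derivative v x) (at x)"
    using velocity_derivative[OF assms(1)] by auto
  show ?thesis
    by (rule velocityI[OF velocity_measurable[OF assms(1)] L N(1) N(2)])
      (use velocity_integral[OF assms(1)] assms(2,3) in auto)
qed

lemma velocity_continuous:
  assumes "velocity a b c v" shows "continuous_on {a..b} c"
proof -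
  obtain L where L: "\<And>x. \<bar>v x\<bar> \<le> L" using velocity_bounded[OF assms(1)] by auto
  show ?thesis by (rule lipschitz_on_continuous_on[OF velocity_lipschitz[OF assms L]])
qed

lemma velocity_affine:
  assumes "velocity a b c v" "velocity a b d w"
  shows "velocity a b (\<lambda>s. c s + \<epsilon> * d s) (\<lambda>s. v s + \<epsilon> * w s)"
proof -
  obtain L where L: "\<And>x. \<bar>v x\<bar> \<le> L" using velocity_bounded[OF assms(1)] by auto
  obtain M where M: "\<And>x. \<bar>w x\<bar> \<le> M" using velocity_bounded[OF assms(2)] by auto
  obtain N where N: "negligible N" "\<And>x. x\<in>{a<..<b} - N \<Longrightarrow> (c has_real_derivative v x) (at x)"
    using velocity_derivative[OF assms(1)] by auto
  obtain N' where N': "negligible N'" "\<And>x. x\<in>{a<..<b} - N' \<Longrightarrow> (d has_real_derivative w x) (at x)"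
    using velocity_derivative[OF assms(2)] by auto
  note [measurable] = velocity_measurable[OF assms(1)] velocity_measurable[OF assms(2)]
  show ?thesis
  proof (rule velocityI)
    show "\<bar>v x + \<epsilon> * w x\<bar> \<le> L + \<bar>\<epsilon>\<bar> * M" for x
      using L[of x] mult_left_mono[OF M[of x], of "\<bar>\<epsilon>\<bar>"] abs_triangle_ineq[of "v x" "\<epsilon> * w x"]
      by (simp add: abs_mult)
    show "negligible (N \<union> N')" using N N' by auto
    show "((\<lambda>s. c s + \<epsilon> * d s) has_real_derivative (v x + \<epsilon> * w x)) (at x)" if "x \<in> {a<..<b} - (N \<union> N')" for x
      using that by (auto intro!: derivative_eq_intros N N')
    show "integral {s..t} (\<lambda>s. v s + \<epsilon> * w s) = (c t + \<epsilon> * d t) - (c s + \<epsilon> * d s)" if "a \<le> s" "s \<le> t" "t \<le> b" for s t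
    proof -
      have "integral {s..t} (\<lambda>s. v s + \<epsilon> * w s) = integral {s..t} v + \<epsilon> * integral {s..t} w"
        using velocity_integrable[OF assms(1)] velocity_integrable[OF assms(2)]
        by (subst integral_add) (auto intro: integrable_on_mult_right)
      then show ?thesis using velocity_integral[OF assms(1) that] velocity_integral[OF assms(2) that] by (simp add: algebra_simps)
    qed
  qed measurable
qed

lemma velocity_primitive:
  assumes q: "q \<in> borel_measurable borel" and bnd: "\<And>x. \<bar>q x\<bar> \<le> L" and "a \<le> b"
  shows "velocity a b (\<lambda>s. integral {a..s} q) q"
proof -
  let ?Q = "\<lambda>s. integral {a..s} q"
  have int: "q integrable_on {s..t}" for s t by (rule bounded_borel_integrable_on) (use assms in auto)
  have incr: "integral {s..t} q = ?Q t - ?Q s" if "a \<le> s" "s \<le> t" for s t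
    using Henstock_Kurzweil_Integration.integral_combine[of a s t q] that int by auto
  have "L-lipschitz_on {a..b} ?Q"
  proof (rule lipschitz_on_leI)
    show "0 \<le> L" using bnd[of 0] by linarith
    fix x y assume xy: "x \<in> {a..b}" "y \<in> {a..b}" "x \<le> y"
    have "norm (integral {x..y} q) \<le> integral {x..y} (\<lambda>_. L)"
      using bnd by (intro integral_norm_bound_integral int) auto
    then show "dist (?Q x) (?Q y) \<le> L * dist x y"
      using incr[of x y] xy by (simp only: dist_real_def abs_minus_commute[of "?Q x"]) (simp add: mult.commute)
  qed
  then obtain v where vv: "velocity a b ?Q v" "\<forall>x. \<bar>v x\<bar> \<le> L"
    using velocity_exists[OF _ \<open>a \<le> b\<close>] by blast
  obtain N where N: "negligible N" "\<And>x. x\<in>{a<..<b} - N \<Longrightarrow> (?Q has_real_derivative v x) (at x)"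
    using velocity_derivative[OF vv(1)] by auto
  note v = velocity_measurable[OF vv(1)] vv(2)[rule_format] N velocity_integral[OF vv(1)]
  have vint: "v integrable_on {s..t}" for s t by (rule bounded_borel_integrable_on) (use v in auto)
  have "negligible {x\<in>{a..b}. v x - q x \<noteq> 0}"
  proof (rule negligible_if_integrals_0[where B = "2 * L"])
    show "(\<lambda>x. v x - q x) \<in> borel_measurable borel" using v(1) q by measurable
    show "\<bar>v x - q x\<bar> \<le> 2 * L" for x using v(2)[of x] bnd[of x] by linarith
    show "integral {a..t} (\<lambda>x. v x - q x) = 0" if "t \<in> {a..b}" for t
      using that v(5)[of a t] by (subst integral_diff[OF vint int]) auto
  qed
  then have neg: "negligible (N \<union> {x\<in>{a..b}. v x - q x \<noteq> 0})" using v(3) by auto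
  show ?thesis
  proof (rule velocityI[OF q bnd neg])
    fix x assume "x \<in> {a<..<b} - (N \<union> {x\<in>{a..b}. v x - q x \<noteq> 0})"
    then show "(?Q has_real_derivative q x) (at x)" using v(4)[of x] by auto
  qed (rule incr)
qed

text \<open>The product of two Lipschitz functions is Lipschitz.\<close>

lemma velocity_by_parts:
  assumes c: "velocity a b c v" and d: "velocity a b d w" and "a \<le> b"
  shows "integral {a..b} (\<lambda>s. v s * d s + c s * w s) = c b * d b - c a * d a"
proof -
  obtain L where L: "\<And>x. \<bar>v x\<bar> \<le> L" using velocity_bounded[OF c] by auto
  obtain M where M: "\<And>x. \<bar>w x\<bar> \<le> M" using velocity_bounded[OF d] by auto
  obtain N where N: "negligible N" "\<And>x. x\<in>{a<..<b} - N \<Longrightarrow> (c has_real_derivative v x) (at x)"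
    using velocity_derivative[OF c] by auto
  obtain N' where N': "negligible N'" "\<And>x. x\<in>{a<..<b} - N' \<Longrightarrow> (d has_real_derivative w x) (at x)"
    using velocity_derivative[OF d] by auto
  obtain C where C: "\<And>x. x \<in> {a..b} \<Longrightarrow> \<bar>c x\<bar> \<le> C"
    using continuous_on_Icc_bounded[OF velocity_continuous[OF c]] by blast
  obtain D where D: "\<And>x. x \<in> {a..b} \<Longrightarrow> \<bar>d x\<bar> \<le> D"
    using continuous_on_Icc_bounded[OF velocity_continuous[OF d]] by blast
  have pos: "L \<ge> 0" "M \<ge> 0" "C \<ge> 0" "D \<ge> 0" using L[of a] M[of a] C[of a] D[of a] \<open>a \<le> b\<close> by auto
  have "(L * D + C * M)-lipschitz_on {a..b} (\<lambda>s. c s * d s)"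
  proof (rule lipschitz_onI)
    show "0 \<le> L * D + C * M" using pos by simp
    fix x y assume xy: "x \<in> {a..b}" "y \<in> {a..b}"
    have 1: "\<bar>c x - c y\<bar> \<le> L * \<bar>x - y\<bar>" "\<bar>d x - d y\<bar> \<le> M * \<bar>x - y\<bar>"
      using lipschitz_onD[OF velocity_lipschitz[OF c L] xy] lipschitz_onD[OF velocity_lipschitz[OF d M] xy]
      by (auto simp: dist_real_def)
    have "\<bar>c x * d x - c y * d y\<bar> = \<bar>(c x - c y) * d x + c y * (d x - d y)\<bar>" by (simp add: algebra_simps)
    also have "\<dots> \<le> \<bar>c x - c y\<bar> * \<bar>d x\<bar> + \<bar>c y\<bar> * \<bar>d x - d y\<bar>"
      using abs_triangle_ineq by (simp add: abs_mult[symmetric])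
    also have "\<dots> \<le> (L * \<bar>x - y\<bar>) * D + C * (M * \<bar>x - y\<bar>)"
      using 1 C[OF xy(2)] D[OF xy(1)] pos by (intro add_mono mult_mono) auto
    finally show "dist (c x * d x) (c y * d y) \<le> (L * D + C * M) * dist x y"
      by (simp add: dist_real_def algebra_simps)
  qed
  moreover have "negligible (N \<union> N')" using N N' by auto
  moreover have "((\<lambda>s. c s * d s) has_real_derivative (v x * d x + c x * w x)) (at x)" if "x \<in> {a<..<b} - (N \<union> N')" for x
    using that by (auto intro!: derivative_eq_intros N N')
  ultimately show ?thesis by (intro lipschitz_FTC[OF _ \<open>a \<le> b\<close>])
qed

section \<open>The action and its first variation\<close>

lemma periodic_int:
  fixes \<phi> :: "real \<Rightarrow> real"
  assumes "\<And>x. \<phi> (x + 1) = \<phi> x"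
  shows "\<phi> (x + of_int k) = \<phi> x"
proof -
  have nat: "\<phi> (x + real n) = \<phi> x" for n x
    by (induction n) (use assms[of "x + real n" for n] in \<open>auto simp: algebra_simps\<close>)
  show ?thesis
  proof (cases "k \<ge> 0")
    case True
    then show ?thesis using nat[of x "nat k"] by simp
  next
    case False
    then show ?thesis using nat[of "x + of_int k" "nat (- k)"] by simp
  qed
qed

text \<open>The force \<open>g s\<close> has the spatial derivative \<open>gx s\<close> and the potential \<open>G s\<close>; nothing but continuity is assumed in time.\<close>

locale forced_lagrangian =
  fixes g gx G :: "real \<Rightarrow> real \<Rightarrow> real"
  assumes g_cont: "continuous_on ({..0} \<times> UNIV) (\<lambda>p. g (fst p) (snd p))"
    and gx_cont: "continuous_on ({..0} \<times> UNIV) (\<lambda>p. gx (fst p) (snd p))"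
    and g_deriv: "s \<le> 0 \<Longrightarrow> (g s has_real_derivative gx s x) (at x)"
    and G_deriv: "s \<le> 0 \<Longrightarrow> (G s has_real_derivative g s x) (at x)"
    and g_periodic: "s \<le> 0 \<Longrightarrow> g s (x + 1) = g s x"
    and gx_periodic: "s \<le> 0 \<Longrightarrow> gx s (x + 1) = gx s x"
    and G_periodic: "s \<le> 0 \<Longrightarrow> G s (x + 1) = G s x"
    and g_bound_ex: "\<exists>\<Gamma>. \<forall>s\<in>{a..0}. \<forall>x. \<bar>g s x\<bar> \<le> \<Gamma> \<and> \<bar>gx s x\<bar> \<le> \<Gamma>"
    and gx_lipschitz_ex: "\<exists>K. \<forall>s\<in>{a..0}. \<forall>x y. \<bar>gx s x - gx s y\<bar> \<le> K * \<bar>x - y\<bar>"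
begin

text \<open>Points at which \<open>c\<close> is not differentiable, where \<open>deriv\<close> is an unspecified value, form a null set for the
  Lipschitz curves considered.\<close>

definition Act :: "real \<Rightarrow> real \<Rightarrow> (real \<Rightarrow> real) \<Rightarrow> real" where
  "Act a b c = integral {a..b} (\<lambda>s. (deriv c s)\<^sup>2 / 2 - deriv c s * g s (c s))"

text \<open>The velocity as a separate argument allows limits of curves and of velocities to be taken
  independently of each other.\<close>

definition Actv :: "real \<Rightarrow> real \<Rightarrow> (real \<Rightarrow> real) \<Rightarrow> (real \<Rightarrow> real) \<Rightarrow> real" where
  "Actv a b c v = integral {a..b} (\<lambda>s. (v s)\<^sup>2 / 2 - v s * g s (c s))"

text \<open>The absolute values in this and the next definition give non-negative constants also when \<open>{a..0}\<close> is empty.\<close>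

definition \<Gamma> :: "real \<Rightarrow> real" where
  "\<Gamma> a = \<bar>SOME \<Gamma>. \<forall>s\<in>{a..0}. \<forall>x. \<bar>g s x\<bar> \<le> \<Gamma> \<and> \<bar>gx s x\<bar> \<le> \<Gamma>\<bar>"

definition K :: "real \<Rightarrow> real" where
  "K a = \<bar>SOME K. \<forall>s\<in>{a..0}. \<forall>x y. \<bar>gx s x - gx s y\<bar> \<le> K * \<bar>x - y\<bar>\<bar>"

lemma \<Gamma>_nonneg: "0 \<le> \<Gamma> a" and K_nonneg: "0 \<le> K a"
  unfolding \<Gamma>_def K_def by auto

lemma g_bound: "a \<le> s \<Longrightarrow> s \<le> 0 \<Longrightarrow> \<bar>g s x\<bar> \<le> \<Gamma> a"
  and gx_bound: "a \<le> s \<Longrightarrow> s \<le> 0 \<Longrightarrow> \<bar>gx s x\<bar> \<le> \<Gamma> a"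
  using someI_ex[OF g_bound_ex[of a]] unfolding \<Gamma>_def
  by (auto intro: order_trans[OF _ abs_ge_self])

lemma gx_lipschitz:
  assumes "a \<le> s" "s \<le> 0" shows "\<bar>gx s x - gx s y\<bar> \<le> K a * \<bar>x - y\<bar>"
proof -
  let ?k = "SOME K. \<forall>s\<in>{a..0}. \<forall>x y. \<bar>gx s x - gx s y\<bar> \<le> K * \<bar>x - y\<bar>"
  have "\<bar>gx s x - gx s y\<bar> \<le> ?k * \<bar>x - y\<bar>"
    using someI_ex[OF gx_lipschitz_ex[of a]] assms by auto
  also have "\<dots> \<le> K a * \<bar>x - y\<bar>" unfolding K_def by (intro mult_right_mono) auto
  finally show ?thesis .
qed

lemma g_mvt: assumes "s \<le> 0" shows "\<exists>z. g s (x + y) - g s x = gx s z * y \<and> \<bar>z - x\<bar> \<le> \<bar>y\<bar>"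
proof (cases "y = 0")
  case False
  show ?thesis
  proof (cases "y > 0")
    case True
    obtain z where "x < z" "z < x + y" "g s (x + y) - g s x = (x + y - x) * gx s z"
      using MVT2[of x "x + y" "g s" "gx s"] True g_deriv[OF assms] by auto
    then show ?thesis by (intro exI[of _ z]) (auto simp: algebra_simps)
  next
    case False
    then have "y < 0" using \<open>y \<noteq> 0\<close> by auto
    then obtain z where "x + y < z" "z < x" "g s x - g s (x + y) = (x - (x + y)) * gx s z"
      using MVT2[of "x + y" x "g s" "gx s"] g_deriv[OF assms] by auto
    then show ?thesis by (intro exI[of _ z]) (auto simp: algebra_simps)
  qed
qed auto

lemma g_lipschitz:
  assumes "a \<le> s" "s \<le> 0" shows "\<bar>g s (x + y) - g s x\<bar> \<le> \<Gamma> a * \<bar>y\<bar>"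
proof -
  obtain z where "g s (x + y) - g s x = gx s z * y" using g_mvt[OF assms(2)] by blast
  then show ?thesis using gx_bound[OF assms, of z] by (simp add: abs_mult mult_right_mono)
qed

lemma g_taylor:
  assumes "a \<le> s" "s \<le> 0" shows "\<bar>g s (x + y) - g s x - gx s x * y\<bar> \<le> K a * y\<^sup>2"
proof -
  obtain z where z: "g s (x + y) - g s x = gx s z * y" "\<bar>z - x\<bar> \<le> \<bar>y\<bar>" using g_mvt[OF assms(2)] by blast
  then have "\<bar>g s (x + y) - g s x - gx s x * y\<bar> = \<bar>gx s z - gx s x\<bar> * \<bar>y\<bar>"
    by (simp add: abs_mult[symmetric] algebra_simps)
  also have "\<dots> \<le> (K a * \<bar>y\<bar>) * \<bar>y\<bar>"
    using order_trans[OF gx_lipschitz[OF assms] mult_left_mono[OF z(2) K_nonneg]] by (rule mult_right_mono) simp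
  finally show ?thesis by (simp add: power2_eq_square)
qed

lemma g_int: "s \<le> 0 \<Longrightarrow> g s (x + of_int k) = g s x"
  and gx_int: "s \<le> 0 \<Longrightarrow> gx s (x + of_int k) = gx s x"
  and G_int: "s \<le> 0 \<Longrightarrow> G s (x + of_int k) = G s x"
  using g_periodic gx_periodic G_periodic by (auto intro: periodic_int)

lemma continuous_on_g:
  assumes "continuous_on {a..b} c" "b \<le> 0"
  shows "continuous_on {a..b} (\<lambda>s. g s (c s))" and "continuous_on {a..b} (\<lambda>s. gx s (c s))"
  using assms
  by (auto intro!: continuous_on_compose2[OF g_cont, of _ "\<lambda>s. (s, c s)", simplified]
      continuous_on_compose2[OF gx_cont, of _ "\<lambda>s. (s, c s)", simplified] continuous_intros)

lemma Lag_integrable: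
  assumes c: "continuous_on {a..b} c" and v: "v \<in> borel_measurable borel" "\<And>x. x \<in> {a..b} \<Longrightarrow> \<bar>v x\<bar> \<le> L" and "b \<le> 0"
  shows "(\<lambda>s. (v s)\<^sup>2 / 2 - v s * g s (c s)) integrable_on {a..b}"
proof (rule bounded_measurable_integrable_on)
  show "(\<lambda>s. (v s)\<^sup>2 / 2 - v s * g s (c s)) \<in> borel_measurable (lebesgue_on {a..b})"
    using borel_measurable_lebesgue_on_Icc[OF v(1), of a b]
      continuous_on_measurable_Icc[OF continuous_on_g(1)[OF c \<open>b \<le> 0\<close>]] by measurable
  fix x assume x: "x \<in> {a..b}"
  have "L \<ge> 0" using v(2)[OF x] by linarith
  have "\<bar>(v x)\<^sup>2 / 2\<bar> \<le> L\<^sup>2 / 2" using v(2)[OF x] \<open>L \<ge> 0\<close> by (simp add: abs_le_square_iff[symmetric])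
  moreover have "\<bar>v x * g x (c x)\<bar> \<le> L * \<Gamma> a"
    unfolding abs_mult using v(2)[OF x] g_bound[of a x "c x"] x \<open>b \<le> 0\<close> \<open>L \<ge> 0\<close> by (intro mult_mono) auto
  ultimately show "\<bar>(v x)\<^sup>2 / 2 - v x * g x (c x)\<bar> \<le> L\<^sup>2 / 2 + L * \<Gamma> a" by linarith
qed

lemma Act_eq_Actv:
  assumes "velocity a b c v"
  shows "Act a b c = Actv a b c v"
proof -
  obtain N where N: "negligible N" "\<And>x. x\<in>{a<..<b} - N \<Longrightarrow> (c has_real_derivative v x) (at x)"
    using velocity_derivative[OF assms] by auto
  show ?thesis unfolding Act_def Actv_def
  proof (rule integral_spike)
    show "negligible (N \<union> {a, b})" using N by auto
    fix x assume "x \<in> {a..b} - (N \<union> {a, b})"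
    then have "deriv c x = v x" using N(2)[of x] by (auto intro: DERIV_imp_deriv)
    then show "(v x)\<^sup>2 / 2 - v x * g x (c x) = (deriv c x)\<^sup>2 / 2 - deriv c x * g x (c x)" by simp
  qed
qed

lemma Act_cong:
  assumes "\<And>s. s \<in> {a<..<b} \<Longrightarrow> c s = d s"
  shows "Act a b c = Act a b d"
  unfolding Act_def
proof (rule integral_spike[of "{a, b}"])
  fix x assume x: "x \<in> {a..b} - {a, b}"
  have "eventually (\<lambda>y. y \<in> {a<..<b}) (nhds x)" using x by (intro eventually_nhds_in_open) auto
  then have "eventually (\<lambda>y. c y = d y) (nhds x)" by eventually_elim (use assms in auto)
  then have "deriv c x = deriv d x" by (intro deriv_cong_ev) auto
  then show "(deriv d x)\<^sup>2 / 2 - deriv d x * g x (d x) = (deriv c x)\<^sup>2 / 2 - deriv c x * g x (c x)"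
    using assms[of x] x by auto
qed auto

lemma Act_shift:
  assumes "b \<le> 0" shows "Act a b (\<lambda>s. c s + of_int k) = Act a b c"
proof -
  have "((\<lambda>s. c s + of_int k) has_real_derivative D) (at x) \<longleftrightarrow> (c has_real_derivative D) (at x)" for D x
    using DERIV_diff[of "\<lambda>s. c s + of_int k" D x UNIV "\<lambda>_. of_int k" 0]
      DERIV_add[of c D x UNIV "\<lambda>_. of_int k" 0] by auto
  then have "deriv (\<lambda>s. c s + of_int k) x = deriv c x" for x unfolding deriv_def by simp
  then show ?thesis unfolding Act_def using assms by (intro integral_cong) (auto simp: g_int)
qed

lemma Act_shift_cong:
  assumes "b \<le> 0" "\<And>s. s \<in> {a<..<b} \<Longrightarrow> c s = d s + of_int k"
  shows "Act a b c = Act a b d"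
  using Act_cong[of a b c "\<lambda>s. d s + of_int k"] Act_shift[OF assms(1)] assms(2) by simp

lemma Act_combine:
  assumes c: "L-lipschitz_on {a..b} c" and "a \<le> m" "m \<le> b" "b \<le> 0"
  shows "Act a b c = Act a m c + Act m b c"
proof -
  obtain v where v: "velocity a b c v" "\<And>x. \<bar>v x\<bar> \<le> L" using velocity_exists[OF c] assms by auto
  have "Actv a b c v = Actv a m c v + Actv m b c v"
    unfolding Actv_def using assms v
    by (intro Henstock_Kurzweil_Integration.integral_combine[symmetric] Lag_integrable
        velocity_continuous[OF v(1)] velocity_measurable[OF v(1)]) auto
  then show ?thesis
    using Act_eq_Actv[OF v(1)] Act_eq_Actv[OF velocity_subinterval[OF v(1), of a m]]
      Act_eq_Actv[OF velocity_subinterval[OF v(1), of m b]] assms by simp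
qed

text \<open>Dominated convergence.\<close>

lemma Actv_tendsto:
  assumes "b \<le> 0" and c: "\<And>j. continuous_on {a..b} (c j)" "\<And>s. s \<in> {a..b} \<Longrightarrow> (\<lambda>j. c j s) \<longlonglongrightarrow> d s"
    and v: "\<And>j. v j \<in> borel_measurable borel" "\<And>j x. x \<in> {a..b} \<Longrightarrow> \<bar>v j x\<bar> \<le> L"
    and N: "negligible N" "\<And>s. s \<in> {a..b} - N \<Longrightarrow> (\<lambda>j. v j s) \<longlonglongrightarrow> w s"
  shows "(\<lambda>j. Actv a b (c j) (v j)) \<longlonglongrightarrow> Actv a b d w"
proof -
  let ?f = "\<lambda>j s. if s \<in> N then 0 else (v j s)\<^sup>2 / 2 - v j s * g s (c j s)"
  let ?h = "\<lambda>s. if s \<in> N then 0 else (w s)\<^sup>2 / 2 - w s * g s (d s)"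
  have sp: "integral {a..b} (?f j) = Actv a b (c j) (v j)" for j
    unfolding Actv_def by (rule integral_spike[OF N(1)]) auto
  have sp2: "integral {a..b} ?h = Actv a b d w"
    unfolding Actv_def by (rule integral_spike[OF N(1)]) auto
  have "(\<lambda>j. integral {a..b} (?f j)) \<longlonglongrightarrow> integral {a..b} ?h"
  proof (rule dominated_convergence)
    show "?f j integrable_on {a..b}" for j
      by (rule integrable_spike[OF Lag_integrable[OF c(1) v \<open>b \<le> 0\<close>] N(1)]) auto
    show "(\<lambda>_. L\<^sup>2 / 2 + L * \<Gamma> a) integrable_on {a..b}" by (rule integrable_const_ivl)
    fix x assume x: "x \<in> {a..b}"
    have "L \<ge> 0" using v(2)[OF x, of 0] by linarith
    have "\<bar>(v j x)\<^sup>2 / 2\<bar> \<le> L\<^sup>2 / 2" for j using v(2)[OF x, of j] \<open>L \<ge> 0\<close> by (simp add: abs_le_square_iff[symmetric])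
    moreover have "\<bar>v j x * g x (c j x)\<bar> \<le> L * \<Gamma> a" for j
      unfolding abs_mult using v(2)[OF x, of j] g_bound[of a x "c j x"] x \<open>b \<le> 0\<close> \<open>L \<ge> 0\<close> by (intro mult_mono) auto
    moreover have "0 \<le> L\<^sup>2 / 2 + L * \<Gamma> a" using \<open>L \<ge> 0\<close> \<Gamma>_nonneg by simp
    ultimately have "\<bar>(v j x)\<^sup>2 / 2 - v j x * g x (c j x)\<bar> \<le> L\<^sup>2 / 2 + L * \<Gamma> a" for j
      by (metis abs_triangle_ineq4 add_mono order_trans)
    then show "norm (?f j x) \<le> L\<^sup>2 / 2 + L * \<Gamma> a" for j
      using \<open>0 \<le> L\<^sup>2 / 2 + L * \<Gamma> a\<close> by simp
    have "isCont (g x) (d x)" using g_deriv[of x "d x"] x \<open>b \<le> 0\<close> by (intro DERIV_isCont) auto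
    then have "(\<lambda>j. g x (c j x)) \<longlonglongrightarrow> g x (d x)" using c(2)[OF x] by (rule isCont_tendsto_compose)
    then show "(\<lambda>j. ?f j x) \<longlonglongrightarrow> ?h x" using N(2)[of x] x by (auto intro!: tendsto_intros)
  qed
  then show ?thesis unfolding sp sp2 .
qed

text \<open>\<open>Act a b (c + \<epsilon> * \<phi>)\<close> exceeds \<open>Act a b c\<close> by \<open>\<epsilon>\<close> times the integral, up to an error of order
  \<open>\<epsilon>\<^sup>2\<close>; a linear term that is never negative vanishes.\<close>

lemma first_variation:
  assumes "a \<le> b" "b \<le> 0" and c: "velocity a b c v" and \<phi>: "velocity a b \<phi> w"
    and min: "\<And>\<epsilon>. \<bar>\<epsilon>\<bar> \<le> 1 \<Longrightarrow> Act a b c \<le> Act a b (\<lambda>s. c s + \<epsilon> * \<phi> s)"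
  shows "integral {a..b} (\<lambda>s. (v s - g s (c s)) * w s - v s * gx s (c s) * \<phi> s) = 0"
proof -
  obtain V where V: "\<And>x. \<bar>v x\<bar> \<le> V" using velocity_bounded[OF c] by auto
  obtain W where W: "\<And>x. \<bar>w x\<bar> \<le> W" using velocity_bounded[OF \<phi>] by auto
  obtain P where P: "\<And>x. x \<in> {a..b} \<Longrightarrow> \<bar>\<phi> x\<bar> \<le> P"
    using continuous_on_Icc_bounded[OF velocity_continuous[OF \<phi>]] by blast
  have pos: "V \<ge> 0" "W \<ge> 0" "P \<ge> 0" using V[of 0] W[of 0] P[of a] \<open>a \<le> b\<close> by auto
  let ?I = "\<lambda>s. (v s - g s (c s)) * w s - v s * gx s (c s) * \<phi> s"
  define Q where "Q = W\<^sup>2 / 2 + V * (K a * P\<^sup>2) + W * (\<Gamma> a * P)"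
  have "Q \<ge> 0" unfolding Q_def using pos K_nonneg \<Gamma>_nonneg by simp
  have cc: "continuous_on {a..b} c" and pc: "continuous_on {a..b} \<phi>"
    using c \<phi> by (auto intro: velocity_continuous)
  have Iint: "?I integrable_on {a..b}"
  proof (rule bounded_measurable_integrable_on)
    note [measurable] = borel_measurable_lebesgue_on_Icc[OF velocity_measurable[OF c], of a b]
       borel_measurable_lebesgue_on_Icc[OF velocity_measurable[OF \<phi>], of a b]
       continuous_on_measurable_Icc[OF continuous_on_g(1)[OF cc \<open>b \<le> 0\<close>]]
       continuous_on_measurable_Icc[OF continuous_on_g(2)[OF cc \<open>b \<le> 0\<close>]]
       continuous_on_measurable_Icc[OF pc]
    show "?I \<in> borel_measurable (lebesgue_on {a..b})" by measurable
    fix x assume x: "x \<in> {a..b}"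
    have "\<bar>(v x - g x (c x)) * w x\<bar> \<le> (V + \<Gamma> a) * W" unfolding abs_mult
      using V[of x] W[of x] g_bound[of a x "c x"] x \<open>b \<le> 0\<close> pos \<Gamma>_nonneg[of a] by (intro mult_mono) auto
    moreover have "\<bar>v x * gx x (c x) * \<phi> x\<bar> \<le> V * \<Gamma> a * P" unfolding abs_mult
      using V[of x] P[OF x] gx_bound[of a x "c x"] x \<open>b \<le> 0\<close> pos \<Gamma>_nonneg[of a] by (intro mult_mono) auto
    ultimately show "\<bar>?I x\<bar> \<le> (V + \<Gamma> a) * W + V * \<Gamma> a * P" by linarith
  qed
  have key: "0 \<le> \<epsilon> * integral {a..b} ?I + \<epsilon>\<^sup>2 * (Q * (b - a))" if \<epsilon>: "\<bar>\<epsilon>\<bar> \<le> 1" for \<epsilon>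
  proof -
    let ?u = "\<lambda>s. v s + \<epsilon> * w s" and ?d = "\<lambda>s. c s + \<epsilon> * \<phi> s"
    have vel: "velocity a b ?d ?u" by (rule velocity_affine[OF c \<phi>])
    obtain U where U: "\<And>x. \<bar>?u x\<bar> \<le> U" using velocity_bounded[OF vel] by auto
    have i1: "(\<lambda>s. (v s)\<^sup>2 / 2 - v s * g s (c s)) integrable_on {a..b}"
      by (rule Lag_integrable[OF cc velocity_measurable[OF c] V \<open>b \<le> 0\<close>])
    have i2: "(\<lambda>s. (?u s)\<^sup>2 / 2 - ?u s * g s (?d s)) integrable_on {a..b}"
      by (rule Lag_integrable[OF velocity_continuous[OF vel] velocity_measurable[OF vel] U \<open>b \<le> 0\<close>])
    have "Actv a b ?d ?u \<le> integral {a..b} (\<lambda>s. ((v s)\<^sup>2 / 2 - v s * g s (c s)) + \<epsilon> * ?I s + \<epsilon>\<^sup>2 * Q)"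
      unfolding Actv_def
    proof (rule integral_le[OF i2])
      show "(\<lambda>s. ((v s)\<^sup>2 / 2 - v s * g s (c s)) + \<epsilon> * ?I s + \<epsilon>\<^sup>2 * Q) integrable_on {a..b}"
        by (intro integrable_add i1 integrable_on_mult_right Iint integrable_const_ivl)
      fix x assume x: "x \<in> {a..b}"
      let ?A = "g x (c x + \<epsilon> * \<phi> x) - g x (c x) - gx x (c x) * (\<epsilon> * \<phi> x)"
      let ?B = "g x (c x + \<epsilon> * \<phi> x) - g x (c x)"
      have ax: "a \<le> x" "x \<le> 0" using x \<open>b \<le> 0\<close> by auto
      have "\<bar>v x * ?A\<bar> \<le> V * (K a * (\<epsilon> * \<phi> x)\<^sup>2)" unfolding abs_mult
        using V[of x] g_taylor[OF ax] pos by (intro mult_mono) auto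
      also have "\<dots> \<le> \<epsilon>\<^sup>2 * (V * (K a * P\<^sup>2))"
        using P[OF x] pos K_nonneg[of a] abs_le_square_iff[of "\<phi> x" P]
        by (auto simp: power_mult_distrib mult.left_commute intro!: mult_left_mono)
      finally have 1: "\<bar>v x * ?A\<bar> \<le> \<epsilon>\<^sup>2 * (V * (K a * P\<^sup>2))" .
      have "\<bar>w x * ?B\<bar> \<le> W * (\<Gamma> a * \<bar>\<epsilon> * \<phi> x\<bar>)" unfolding abs_mult[of "w x"]
        using W[of x] g_lipschitz[OF ax] pos by (intro mult_mono) auto
      also have "\<dots> \<le> \<bar>\<epsilon>\<bar> * (W * (\<Gamma> a * P))"
        using P[OF x] pos \<Gamma>_nonneg[of a] by (auto simp: abs_mult mult.left_commute intro!: mult_left_mono)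
      finally have "\<bar>\<epsilon>\<bar> * \<bar>w x * ?B\<bar> \<le> \<bar>\<epsilon>\<bar> * (\<bar>\<epsilon>\<bar> * (W * (\<Gamma> a * P)))" by (rule mult_left_mono) simp
      then have 2: "\<bar>\<epsilon> * (w x * ?B)\<bar> \<le> \<epsilon>\<^sup>2 * (W * (\<Gamma> a * P))"
        by (simp add: abs_mult[of \<epsilon>] power2_eq_square mult.assoc[symmetric] abs_mult[symmetric])
      have 3: "\<epsilon>\<^sup>2 * (w x)\<^sup>2 / 2 \<le> \<epsilon>\<^sup>2 * (W\<^sup>2 / 2)"
        using W[of x] pos abs_le_square_iff[of "w x" W] by (auto intro!: mult_left_mono)
      have "(?u x)\<^sup>2 / 2 - ?u x * g x (?d x)
        = ((v x)\<^sup>2 / 2 - v x * g x (c x)) + \<epsilon> * ?I x + (\<epsilon>\<^sup>2 * (w x)\<^sup>2 / 2 - v x * ?A - \<epsilon> * (w x * ?B))"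
        by (simp add: power2_eq_square algebra_simps add_divide_distrib)
      then show "(?u x)\<^sup>2 / 2 - ?u x * g x (?d x)
        \<le> ((v x)\<^sup>2 / 2 - v x * g x (c x)) + \<epsilon> * ?I x + \<epsilon>\<^sup>2 * Q"
        using 1 2 3 unfolding Q_def by (simp only: distrib_left)
    qed
    also have "\<dots> = Actv a b c v + \<epsilon> * integral {a..b} ?I + \<epsilon>\<^sup>2 * (Q * (b - a))"
    proof -
      have i3: "(\<lambda>s. \<epsilon> * ?I s) integrable_on {a..b}" by (intro integrable_on_mult_right Iint)
      have "integral {a..b} (\<lambda>s. ((v s)\<^sup>2 / 2 - v s * g s (c s)) + \<epsilon> * ?I s + \<epsilon>\<^sup>2 * Q)
         = integral {a..b} (\<lambda>s. ((v s)\<^sup>2 / 2 - v s * g s (c s)) + \<epsilon> * ?I s) + integral {a..b} (\<lambda>s. \<epsilon>\<^sup>2 * Q)"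
        by (rule integral_add[OF integrable_add[OF i1 i3] integrable_const_ivl])
      also have "integral {a..b} (\<lambda>s. ((v s)\<^sup>2 / 2 - v s * g s (c s)) + \<epsilon> * ?I s) = Actv a b c v + integral {a..b} (\<lambda>s. \<epsilon> * ?I s)"
        unfolding Actv_def by (rule integral_add[OF i1 i3])
      also have "integral {a..b} (\<lambda>s. \<epsilon> * ?I s) = \<epsilon> * integral {a..b} ?I" by (rule integral_mult_right)
      also have "integral {a..b} (\<lambda>s. \<epsilon>\<^sup>2 * Q) = \<epsilon>\<^sup>2 * (Q * (b - a))" using \<open>a \<le> b\<close> by simp
      finally show ?thesis .
    qed
    finally show ?thesis using min[OF \<epsilon>] Act_eq_Actv[OF c] Act_eq_Actv[OF vel] by linarith
  qed
  define J where "J = integral {a..b} ?I"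
  (* R is at least the absolute value of J, so that the test value - J / R of \<epsilon> is admissible. *)
  define R where "R = Q * (b - a) + 1 + \<bar>J\<bar>"
  have "0 \<le> Q * (b - a)" using \<open>Q \<ge> 0\<close> \<open>a \<le> b\<close> by simp
  then have R: "R > 0" "\<bar>J\<bar> \<le> R" "Q * (b - a) < R" unfolding R_def by linarith+
  have "0 \<le> (- J / R) * J + (- J / R)\<^sup>2 * (Q * (b - a))"
    using key[of "- J / R"] R unfolding J_def[symmetric] by simp
  also have "\<dots> = J\<^sup>2 / R\<^sup>2 * (Q * (b - a) - R)" using R by (simp add: field_simps power2_eq_square)
  finally have "\<not> 0 < J\<^sup>2 / R\<^sup>2" using R(3) mult_pos_neg[of "J\<^sup>2 / R\<^sup>2" "Q * (b - a) - R"] by linarith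
  then have "J\<^sup>2 / R\<^sup>2 \<le> 0" by simp
  then have "J = 0" using R(1) by (simp add: divide_le_0_iff)
  then show ?thesis unfolding J_def .
qed

text \<open>The argument of du Bois-Reymond. Integrating the first variation by parts moves the force to a primitive
  \<open>H\<close> and leaves \<open>integral (v - g + H) * w = 0\<close> for the derivatives \<open>w\<close> of all test functions. So
  \<open>v - g + H\<close> is almost everywhere a constant, which makes \<open>v\<close> continuous, and then \<open>v - g\<close> differentiable.\<close>

lemma minimizer_regular:
  assumes "a < b" "b \<le> 0" and lip: "L-lipschitz_on {a..b} c"
    and min: "\<And>e M. M-lipschitz_on {a..b} e \<Longrightarrow> e a = c a \<Longrightarrow> e b = c b \<Longrightarrow> Act a b c \<le> Act a b e"
  shows "\<exists>v. continuous_on {a..b} v \<and> (\<forall>s\<in>{a..b}. (c has_real_derivative v s) (at s within {a..b})) \<and>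
    (\<forall>s\<in>{a..b}. ((\<lambda>s. v s - g s (c s)) has_real_derivative - (v s * gx s (c s))) (at s within {a..b}))"
proof -
  have ab: "a \<le> b" using \<open>a < b\<close> by simp
  obtain v where v: "velocity a b c v" "\<And>x. \<bar>v x\<bar> \<le> L" using velocity_exists[OF lip ab] by auto
  have L: "L \<ge> 0" using lipschitz_on_nonneg[OF lip] .
  have cc: "continuous_on {a..b} c" using velocity_continuous[OF v(1)] .
  note gc = continuous_on_g[OF cc \<open>b \<le> 0\<close>]
  define \<gamma> where "\<gamma> x = indicator {a..b} x *\<^sub>R g x (c x)" for x :: real
  define \<gamma>' where "\<gamma>' x = indicator {a..b} x *\<^sub>R gx x (c x)" for x :: real
  have \<gamma>m[measurable]: "\<gamma> \<in> borel_measurable borel" "\<gamma>' \<in> borel_measurable borel"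
    unfolding \<gamma>_def[abs_def] \<gamma>'_def[abs_def] by (intro borel_measurable_continuous_on_indicator gc; simp)+
  have \<gamma>b: "\<bar>\<gamma> x\<bar> \<le> \<Gamma> a" "\<bar>\<gamma>' x\<bar> \<le> \<Gamma> a" for x
    using g_bound[of a x "c x"] gx_bound[of a x "c x"] \<Gamma>_nonneg[of a] \<open>b \<le> 0\<close>
    unfolding \<gamma>_def \<gamma>'_def by (auto split: split_indicator)
  define q where "q x = v x * \<gamma>' x" for x
  have qm: "q \<in> borel_measurable borel" unfolding q_def[abs_def] using velocity_measurable[OF v(1)] by measurable
  have qb: "\<bar>q x\<bar> \<le> L * \<Gamma> a" for x
    unfolding q_def abs_mult using v(2)[of x] \<gamma>b(2)[of x] L by (intro mult_mono) auto
  define H where "H s = integral {a..s} q" for s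
  have Hv: "velocity a b H q" unfolding H_def[abs_def] by (rule velocity_primitive[OF qm qb ab])
  have Hc: "continuous_on {a..b} H" using velocity_continuous[OF Hv] .
  define H' where "H' x = indicator {a..b} x *\<^sub>R H x" for x :: real
  have H'm: "H' \<in> borel_measurable borel"
    unfolding H'_def[abs_def] by (intro borel_measurable_continuous_on_indicator Hc) simp
  obtain B where B: "\<forall>x\<in>{a..b}. \<bar>H x\<bar> \<le> B" using continuous_on_Icc_bounded[OF Hc] by blast
  have H'b: "\<bar>H' x\<bar> \<le> max B 0" for x unfolding H'_def using B by (auto split: split_indicator simp: le_max_iff_disj)
  (* The test function \<phi> has the derivative v - \<gamma> + H' - k, and k is chosen such that \<phi> vanishes at b. *)
  define k where "k = (c b - c a - integral {a..b} \<gamma> + integral {a..b} H') / (b - a)"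
  define \<phi> where "\<phi> = (\<lambda>s. ((c s + (- 1) * integral {a..s} \<gamma>) + 1 * integral {a..s} H') + 1 * (- c a - k * (s - a)))"
  define w where "w = (\<lambda>s. ((v s + (- 1) * \<gamma> s) + 1 * H' s) + 1 * (- k))"
  have lin: "velocity a b (\<lambda>s. - c a - k * (s - a)) (\<lambda>s. - k)"
    by (rule velocityI[of _ "\<bar>k\<bar>" "{}"]) (auto intro!: derivative_eq_intros simp: algebra_simps)
  have \<phi>v: "velocity a b \<phi> w" unfolding \<phi>_def w_def
    by (intro velocity_affine v(1) velocity_primitive[OF \<gamma>m(1) \<gamma>b(1) ab] velocity_primitive[OF H'm H'b ab] lin)
  have \<phi>0: "\<phi> a = 0" unfolding \<phi>_def by simp
  have \<phi>1: "\<phi> b = 0" unfolding \<phi>_def k_def using \<open>a < b\<close> by simp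
  have fv: "integral {a..b} (\<lambda>s. (v s - g s (c s)) * w s - v s * gx s (c s) * \<phi> s) = 0"
  proof (rule first_variation[OF ab \<open>b \<le> 0\<close> v(1) \<phi>v])
    fix \<epsilon> :: real
    have va: "velocity a b (\<lambda>s. c s + \<epsilon> * \<phi> s) (\<lambda>s. v s + \<epsilon> * w s)" by (rule velocity_affine[OF v(1) \<phi>v])
    obtain M where "\<And>x. \<bar>v x + \<epsilon> * w x\<bar> \<le> M" using velocity_bounded[OF va] by auto
    then have "M-lipschitz_on {a..b} (\<lambda>s. c s + \<epsilon> * \<phi> s)" by (rule velocity_lipschitz[OF va])
    then show "Act a b c \<le> Act a b (\<lambda>s. c s + \<epsilon> * \<phi> s)" by (rule min) (simp_all add: \<phi>0 \<phi>1)
  qed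
  have bp: "integral {a..b} (\<lambda>s. q s * \<phi> s + H s * w s) = 0"
    using velocity_by_parts[OF Hv \<phi>v ab] by (simp add: \<phi>0 \<phi>1)
  obtain W where W: "\<And>x. \<bar>w x\<bar> \<le> W" using velocity_bounded[OF \<phi>v] by auto
  have wm[measurable]: "w \<in> borel_measurable borel" by (rule velocity_measurable[OF \<phi>v])
  have wint: "integral {a..b} w = 0" using velocity_integral[OF \<phi>v, of a b] ab \<phi>0 \<phi>1 by simp
  have w2m: "(\<lambda>s. (w s)\<^sup>2) \<in> borel_measurable borel" by measurable
  have w2b: "\<bar>(w x)\<^sup>2\<bar> \<le> W\<^sup>2" for x using W[of x] abs_le_square_iff[of "w x" W] by auto
  have ww: "(\<lambda>s. (w s)\<^sup>2) integrable_on {a..b}"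
    by (rule bounded_borel_integrable_on[OF w2m w2b])
  obtain P where P: "\<forall>x\<in>{a..b}. \<bar>\<phi> x\<bar> \<le> P" using continuous_on_Icc_bounded[OF velocity_continuous[OF \<phi>v]] by blast
  have bpi: "(\<lambda>s. q s * \<phi> s + H s * w s) integrable_on {a..b}"
  proof (rule bounded_measurable_integrable_on)
    note [measurable] = borel_measurable_lebesgue_on_Icc[OF qm, of a b] borel_measurable_lebesgue_on_Icc[OF wm, of a b]
      continuous_on_measurable_Icc[OF Hc] continuous_on_measurable_Icc[OF velocity_continuous[OF \<phi>v]]
    show "(\<lambda>s. q s * \<phi> s + H s * w s) \<in> borel_measurable (lebesgue_on {a..b})" by measurable
    fix x assume x: "x \<in> {a..b}"
    have "\<bar>q x * \<phi> x\<bar> \<le> (L * \<Gamma> a) * P" unfolding abs_mult using qb[of x] P x by (intro mult_mono) (auto intro: order_trans[OF abs_ge_zero])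
    moreover have "\<bar>H x * w x\<bar> \<le> B * W" unfolding abs_mult using W[of x] B x by (intro mult_mono) (auto intro: order_trans[OF abs_ge_zero])
    ultimately show "\<bar>q x * \<phi> x + H x * w x\<bar> \<le> (L * \<Gamma> a) * P + B * W" by linarith
  qed
  have "integral {a..b} (\<lambda>s. (w s)\<^sup>2) = 0"
  proof -
    have "integral {a..b} (\<lambda>s. (v s - g s (c s)) * w s - v s * gx s (c s) * \<phi> s)
      = integral {a..b} (\<lambda>s. ((w s)\<^sup>2 + k * w s) - (q s * \<phi> s + H s * w s))"
      by (rule integral_cong) (simp add: w_def q_def \<gamma>_def \<gamma>'_def H'_def power2_eq_square algebra_simps)
    also have "\<dots> = integral {a..b} (\<lambda>s. (w s)\<^sup>2 + k * w s) - integral {a..b} (\<lambda>s. q s * \<phi> s + H s * w s)"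
      by (rule integral_diff[OF integrable_add[OF ww integrable_on_mult_right[OF velocity_integrable[OF \<phi>v]]] bpi])
    also have "integral {a..b} (\<lambda>s. (w s)\<^sup>2 + k * w s) = integral {a..b} (\<lambda>s. (w s)\<^sup>2) + integral {a..b} (\<lambda>s. k * w s)"
      by (rule integral_add[OF ww integrable_on_mult_right[OF velocity_integrable[OF \<phi>v]]])
    also have "integral {a..b} (\<lambda>s. k * w s) = k * integral {a..b} w" by (rule integral_mult_right)
    finally show ?thesis using fv bp wint by simp
  qed
  then have neg: "negligible {x\<in>{a..b}. (w x)\<^sup>2 \<noteq> 0}"
    by (intro negligible_nonzero_if_integral_0[OF w2m w2b]) auto
  have \<phi>z: "\<phi> s = 0" if s: "s \<in> {a..b}" for s
  proof -
    have "integral {a..s} (\<lambda>_. 0) = integral {a..s} w"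
      by (rule integral_spike[OF neg]) (use s in auto)
    then show ?thesis using velocity_integral[OF \<phi>v, of a s] s \<phi>0 by simp
  qed
  define u where "u s = g s (c s) - H s + k" for s
  have uc: "continuous_on {a..b} u" unfolding u_def[abs_def] by (intro continuous_intros gc Hc)
  have ceq: "c s = c a + integral {a..s} u" if s: "s \<in> {a..b}" for s
  proof -
    have i1: "(\<lambda>s. g s (c s)) integrable_on {a..s}" "H integrable_on {a..s}"
      using s gc Hc by (auto intro!: integrable_continuous_interval intro: continuous_on_subset)
    have "integral {a..s} u = integral {a..s} (\<lambda>s. g s (c s)) - integral {a..s} H + k * (s - a)"
      unfolding u_def[abs_def] using s i1 by (simp add: integral_add integral_diff integrable_diff integrable_const_ivl)
    moreover have "integral {a..s} \<gamma> = integral {a..s} (\<lambda>s. g s (c s))" "integral {a..s} H' = integral {a..s} H"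
      by (rule integral_cong, use s in \<open>auto simp: \<gamma>_def H'_def\<close>)+
    ultimately show ?thesis using \<phi>z[OF s] unfolding \<phi>_def by simp
  qed
  have cder: "(c has_real_derivative u s) (at s within {a..b})" if s: "s \<in> {a..b}" for s
  proof -
    have "((\<lambda>s. c a + integral {a..s} u) has_real_derivative 0 + u s) (at s within {a..b})"
      by (intro DERIV_add DERIV_const integral_has_real_derivative[OF uc s])
    then have "((\<lambda>s. c a + integral {a..s} u) has_real_derivative u s) (at s within {a..b})" by simp
    then show ?thesis
      by (rule has_field_derivative_transform_within[OF _ zero_less_one s]) (rule ceq[symmetric])
  qed
  obtain N where N: "negligible N" "\<And>x. x\<in>{a<..<b} - N \<Longrightarrow> (c has_real_derivative v x) (at x)"
    using velocity_derivative[OF v(1)] by auto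
  have vu: "v x = u x" if "x \<in> {a..b} - (N \<union> {a, b})" for x
  proof -
    have "x \<in> {a<..<b} - N" using that by auto
    moreover have "(c has_real_derivative u x) (at x)"
      using cder[of x] that by (subst at_within_Icc_at[symmetric, of a x b]) auto
    ultimately show ?thesis using N(2) DERIV_unique by blast
  qed
  have Heq: "H s = integral {a..s} (\<lambda>y. u y * gx y (c y))" if "s \<in> {a..b}" for s
    unfolding H_def
  proof (rule integral_spike[symmetric, of "N \<union> {a, b}"])
    fix x assume "x \<in> {a..s} - (N \<union> {a, b})"
    then show "q x = u x * gx x (c x)" using vu[of x] that unfolding q_def \<gamma>'_def by auto
  qed (use N in auto)
  have pder: "((\<lambda>s. u s - g s (c s)) has_real_derivative - (u s * gx s (c s))) (at s within {a..b})" if s: "s \<in> {a..b}" for s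
  proof -
    have "((\<lambda>s. k - integral {a..s} (\<lambda>y. u y * gx y (c y))) has_real_derivative 0 - (u s * gx s (c s))) (at s within {a..b})"
      by (intro DERIV_diff DERIV_const integral_has_real_derivative[OF _ s] continuous_intros uc gc)
    then have "((\<lambda>s. k - integral {a..s} (\<lambda>y. u y * gx y (c y))) has_real_derivative - (u s * gx s (c s))) (at s within {a..b})" by simp
    then show ?thesis
    proof (rule has_field_derivative_transform_within[OF _ zero_less_one s])
      fix x assume "x \<in> {a..b}"
      from Heq[OF this] show "k - integral {a..x} (\<lambda>y. u y * gx y (c y)) = u x - g x (c x)"
        unfolding u_def[of x] by simp
    qed
  qed
  show ?thesis using uc cder pder by blast
qed

end

section \<open>The Euler-Lagrange equation\<close>

text \<open>Gronwall in both directions of time: \<open>w\<close> times a suitable exponential is monotone on either side of \<open>t\<close>.\<close>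

lemma gronwall_zero:
  fixes w w' :: "real \<Rightarrow> real"
  assumes der: "\<And>s. s \<in> {a..b} \<Longrightarrow> (w has_real_derivative w' s) (at s within {a..b})"
    and bound: "\<And>s. s \<in> {a..b} \<Longrightarrow> \<bar>w' s\<bar> \<le> M * w s" and nonneg: "\<And>s. s \<in> {a..b} \<Longrightarrow> 0 \<le> w s"
    and t: "t \<in> {a..b}" "w t = 0" and s: "s \<in> {a..b}"
  shows "w s = 0"
proof -
  have cont: "continuous_on {a..b} w" using der DERIV_continuous_on by blast
  have at: "(w has_real_derivative w' x) (at x)" if "a < x" "x < b" for x
    using der[of x] that by (subst at_within_Icc_at[symmetric, of a x b]) auto
  consider "s = t" | "t < s" | "s < t" by linarith
  then have "w s \<le> 0"
  proof cases
    case 2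
    have "w s * exp (- M * s) \<le> w t * exp (- M * t)"
    proof (rule DERIV_nonpos_imp_decreasing_open[OF less_imp_le[OF 2]])
      fix x assume x: "t < x" "x < s"
      have "((\<lambda>x. w x * exp (- M * x)) has_real_derivative (w' x - M * w x) * exp (- M * x)) (at x)"
        using x s t by (auto intro!: derivative_eq_intros at simp: algebra_simps)
      moreover have "(w' x - M * w x) * exp (- M * x) \<le> 0"
        using bound[of x] x s t by (intro mult_nonpos_nonneg) auto
      ultimately show "\<exists>y. ((\<lambda>x. w x * exp (- M * x)) has_real_derivative y) (at x) \<and> y \<le> 0" by blast
    qed (use s t in \<open>auto intro!: continuous_intros continuous_on_subset[OF cont]\<close>)
    then show ?thesis using t(2) by (simp add: mult_le_0_iff)
  next
    case 3
    have "w s * exp (M * s) \<le> w t * exp (M * t)"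
    proof (rule DERIV_nonneg_imp_increasing_open[OF less_imp_le[OF 3]])
      fix x assume x: "s < x" "x < t"
      have "((\<lambda>x. w x * exp (M * x)) has_real_derivative (w' x + M * w x) * exp (M * x)) (at x)"
        using x s t by (auto intro!: derivative_eq_intros at simp: algebra_simps)
      moreover have "0 \<le> (w' x + M * w x) * exp (M * x)"
        using bound[of x] x s t by (intro mult_nonneg_nonneg) auto
      ultimately show "\<exists>y. ((\<lambda>x. w x * exp (M * x)) has_real_derivative y) (at x) \<and> 0 \<le> y" by blast
    qed (use s t in \<open>auto intro!: continuous_intros continuous_on_subset[OF cont]\<close>)
    then show ?thesis using t(2) by (simp add: mult_le_0_iff)
  qed (use t in simp)
  then show ?thesis using nonneg[OF s] by simp
qed

context forced_lagrangian begin

text \<open>The equation is stated for the momentum \<open>v - g\<close>. The velocity alone need not be differentiable, because the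
  force is only continuous in time.\<close>

definition EL :: "real \<Rightarrow> real \<Rightarrow> (real \<Rightarrow> real) \<Rightarrow> (real \<Rightarrow> real) \<Rightarrow> bool" where
  "EL a b c v \<longleftrightarrow> continuous_on {a..b} v \<and> (\<forall>s\<in>{a..b}. (c has_real_derivative v s) (at s within {a..b})) \<and>
    (\<forall>s\<in>{a..b}. ((\<lambda>s. v s - g s (c s)) has_real_derivative - (v s * gx s (c s))) (at s within {a..b}))"

text \<open>The squared distance in position and momentum satisfies a Gronwall inequality; momenta are compared
  rather than velocities since only they have derivatives.\<close>

lemma EL_unique:
  assumes "b \<le> 0" and 1: "EL a b c1 v1" and 2: "EL a b c2 v2"
    and t: "t \<in> {a..b}" "c1 t = c2 t" "v1 t = v2 t" and s: "s \<in> {a..b}"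
  shows "c1 s = c2 s"
proof -
  obtain V where V: "\<forall>x\<in>{a..b}. \<bar>v2 x\<bar> \<le> V" using 2 continuous_on_Icc_bounded unfolding EL_def by blast
  define z where "z s = c1 s - c2 s" for s
  (* The difference of the momenta. *)
  define y where "y s = (v1 s - g s (c1 s)) - (v2 s - g s (c2 s))" for s
  define z' where "z' s = v1 s - v2 s" for s
  define y' where "y' s = - (v1 s * gx s (c1 s)) - - (v2 s * gx s (c2 s))" for s
  have zd: "(z has_real_derivative z' s) (at s within {a..b})" if "s \<in> {a..b}" for s
    unfolding z_def[abs_def] z'_def by (rule DERIV_diff) (use 1 2 that in \<open>simp_all add: EL_def\<close>)
  have yd: "(y has_real_derivative y' s) (at s within {a..b})" if "s \<in> {a..b}" for s
    unfolding y_def[abs_def] y'_def by (rule DERIV_diff) (use 1 2 that in \<open>simp_all add: EL_def\<close>)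
  have bz: "\<bar>z' s\<bar> \<le> \<bar>y s\<bar> + \<Gamma> a * \<bar>z s\<bar>" if s: "s \<in> {a..b}" for s
  proof -
    have "z' s = y s + (g s (c2 s + z s) - g s (c2 s))" unfolding z'_def y_def z_def by simp
    then show ?thesis using g_lipschitz[of a s "c2 s" "z s"] s \<open>b \<le> 0\<close> by auto
  qed
  have by': "\<bar>y' s\<bar> \<le> \<Gamma> a * (\<bar>y s\<bar> + \<Gamma> a * \<bar>z s\<bar>) + V * (K a * \<bar>z s\<bar>)" if s: "s \<in> {a..b}" for s
  proof -
    have "y' s = - (z' s * gx s (c1 s)) - v2 s * (gx s (c1 s) - gx s (c2 s))"
      unfolding y'_def z'_def by (simp add: algebra_simps)
    then have "\<bar>y' s\<bar> \<le> \<bar>z' s * gx s (c1 s)\<bar> + \<bar>v2 s * (gx s (c1 s) - gx s (c2 s))\<bar>" by linarith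
    moreover have "\<bar>z' s * gx s (c1 s)\<bar> \<le> (\<bar>y s\<bar> + \<Gamma> a * \<bar>z s\<bar>) * \<Gamma> a"
      unfolding abs_mult using bz[OF s] gx_bound[of a s "c1 s"] s \<open>b \<le> 0\<close> \<Gamma>_nonneg[of a] by (intro mult_mono) auto
    moreover have "\<bar>v2 s * (gx s (c1 s) - gx s (c2 s))\<bar> \<le> V * (K a * \<bar>z s\<bar>)"
      unfolding abs_mult z_def using V s gx_lipschitz[of a s "c1 s" "c2 s"] \<open>b \<le> 0\<close> by (intro mult_mono) force+
    ultimately show ?thesis by (simp add: mult.commute)
  qed
  have Vp: "V \<ge> 0" using V t(1) by force
  define M where "M = 1 + 4 * \<Gamma> a + (\<Gamma> a)\<^sup>2 + V * K a"
  define w where "w s = (z s)\<^sup>2 + (y s)\<^sup>2" for s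
  define w' where "w' s = 2 * z s * z' s + 2 * y s * y' s" for s
  have "w s = 0"
  proof (rule gronwall_zero[where w = w and w' = w' and t = t and M = M, OF _ _ _ t(1) _ s])
    fix s assume s: "s \<in> {a..b}"
    show "(w has_real_derivative w' s) (at s within {a..b})"
      unfolding w_def[abs_def] w'_def by (auto intro!: derivative_eq_intros zd[OF s] yd[OF s])
    show "0 \<le> w s" unfolding w_def by simp
    have zy: "2 * \<bar>z s\<bar> * \<bar>y s\<bar> \<le> w s" unfolding w_def
      using sum_squares_bound[of "\<bar>z s\<bar>" "\<bar>y s\<bar>"] by simp
    have wz: "\<bar>z s\<bar> * \<bar>z s\<bar> \<le> w s" "\<bar>y s\<bar> * \<bar>y s\<bar> \<le> w s" unfolding w_def by (auto simp: power2_eq_square)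
    have G: "0 \<le> \<Gamma> a" "0 \<le> (\<Gamma> a)\<^sup>2 + V * K a" using \<Gamma>_nonneg K_nonneg Vp by auto
    have "\<bar>w' s\<bar> \<le> 2 * \<bar>z s\<bar> * \<bar>z' s\<bar> + 2 * \<bar>y s\<bar> * \<bar>y' s\<bar>"
      unfolding w'_def using abs_triangle_ineq[of "2 * z s * z' s" "2 * y s * y' s"] by (simp add: abs_mult)
    also have "\<dots> \<le> 2 * \<bar>z s\<bar> * (\<bar>y s\<bar> + \<Gamma> a * \<bar>z s\<bar>) + 2 * \<bar>y s\<bar> * (\<Gamma> a * (\<bar>y s\<bar> + \<Gamma> a * \<bar>z s\<bar>) + V * (K a * \<bar>z s\<bar>))"
      using bz[OF s] by'[OF s] by (intro add_mono mult_left_mono) auto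
    also have "\<dots> = 2 * \<bar>z s\<bar> * \<bar>y s\<bar> + 2 * \<Gamma> a * (\<bar>z s\<bar> * \<bar>z s\<bar>) + 2 * \<Gamma> a * (\<bar>y s\<bar> * \<bar>y s\<bar>)
        + ((\<Gamma> a)\<^sup>2 + V * K a) * (2 * \<bar>z s\<bar> * \<bar>y s\<bar>)"
      by (simp add: power2_eq_square algebra_simps)
    also have "\<dots> \<le> w s + 2 * \<Gamma> a * w s + 2 * \<Gamma> a * w s + ((\<Gamma> a)\<^sup>2 + V * K a) * w s"
      using zy wz G by (intro add_mono mult_left_mono) auto
    also have "\<dots> = M * w s" unfolding M_def by (simp add: algebra_simps)
    finally show "\<bar>w' s\<bar> \<le> M * w s" .
  qed (use t in \<open>simp add: w_def z_def y_def\<close>)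
  then show ?thesis unfolding w_def z_def by (simp add: add_nonneg_eq_0_iff)
qed

end

section \<open>Minimal curves and calm windows\<close>

lemma lipschitz_splice:
  fixes e f :: "real \<Rightarrow> real"
  assumes "L-lipschitz_on {a..m} e" "M-lipschitz_on {m..b} f" "e m = f m"
  shows "\<exists>N. N-lipschitz_on {a..b} (\<lambda>s. if s \<le> m then e s else f s)"
  using lipschitz_on_concat_max[OF assms] by blast

lemma velocity_linear:
  "S \<le> T \<Longrightarrow> velocity S T (\<lambda>s. p + (s - S) * m) (\<lambda>_. m)"
  by (rule velocityI[of _ "\<bar>m\<bar>" "{}"]) (auto intro!: derivative_eq_intros simp: algebra_simps)

lemma within_derivative_unique:
  fixes f :: "real \<Rightarrow> real"
  assumes "(f has_real_derivative D) (at t within S)" "(f has_real_derivative E) (at t within S)" "at t within S \<noteq> bot"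
  shows "D = E"
  using tendsto_unique[OF assms(3)] assms(1,2) unfolding has_field_derivative_iff by blast

context forced_lagrangian begin

definition loc_lipschitz :: "(real \<Rightarrow> real) \<Rightarrow> bool" where
  "loc_lipschitz c \<longleftrightarrow> (\<forall>a\<le>0. \<exists>L. L-lipschitz_on {a..0} c)"

text \<open>Curves are lifts of curves in the circle, hence a competitor may differ from \<open>c\<close> by integers at both ends.\<close>

definition minimal :: "(real \<Rightarrow> real) \<Rightarrow> bool" where
  "minimal c \<longleftrightarrow> loc_lipschitz c \<and> (\<forall>a<0. \<forall>e L. L-lipschitz_on {a..0} e \<longrightarrow> e a - c a \<in> \<int> \<longrightarrow> e 0 - c 0 \<in> \<int> \<longrightarrow>
     Act a 0 c \<le> Act a 0 e)"

lemma loc_lipschitzD: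
  assumes "loc_lipschitz c" "b \<le> 0" shows "\<exists>L. L-lipschitz_on {a..b} c"
proof (cases "a \<le> 0")
  case True
  then obtain L where "L-lipschitz_on {a..0} c" using assms unfolding loc_lipschitz_def by blast
  then show ?thesis using lipschitz_on_subset[of L "{a..0}" c "{a..b}"] assms by auto
next
  case False
  then have "{a..b} = {}" using assms by auto
  then show ?thesis by (auto intro: exI[of _ 0])
qed

lemma Act_splice:
  assumes "L-lipschitz_on {a..m} e" "M-lipschitz_on {m..b} f" "e m = f m" "a \<le> m" "m \<le> b" "b \<le> 0"
  shows "Act a b (\<lambda>s. if s \<le> m then e s else f s) = Act a m e + Act m b f"
proof -
  let ?e = "\<lambda>s. if s \<le> m then e s else f s"
  obtain N where N: "N-lipschitz_on {a..b} ?e" using lipschitz_splice[OF assms(1-3)] by blast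
  have "Act a b ?e = Act a m ?e + Act m b ?e" by (rule Act_combine[OF N assms(4-6)])
  moreover have "Act a m ?e = Act a m e" by (rule Act_cong) auto
  moreover have "Act m b ?e = Act m b f" by (rule Act_cong) auto
  ultimately show ?thesis by simp
qed

text \<open>A competitor on \<open>{a..b}\<close> extends to one on \<open>{a..0}\<close> by an integer translate of \<open>c\<close>, whose action is the same.\<close>

lemma minimal_restrict:
  assumes c: "minimal c" and ab: "a < b" "b \<le> 0" and e: "L-lipschitz_on {a..b} e"
    and "e a - c a \<in> \<int>" "e b - c b \<in> \<int>"
  shows "Act a b c \<le> Act a b e"
proof -
  obtain k where k: "e b - c b = of_int k" using assms(6) by (auto elim: Ints_cases)
  have ll: "loc_lipschitz c" using c unfolding minimal_def by blast
  let ?d = "\<lambda>s. c s + of_int k"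
  obtain M0 where M0: "M0-lipschitz_on {a..0} c" using loc_lipschitzD[OF ll] by blast
  obtain M where M: "M-lipschitz_on {b..0} c" using loc_lipschitzD[OF ll] by blast
  have Md: "M-lipschitz_on {b..0} ?d" using M unfolding lipschitz_on_def by simp
  have eb: "e b = ?d b" using k by simp
  let ?e = "\<lambda>s. if s \<le> b then e s else ?d s"
  obtain N where N: "N-lipschitz_on {a..0} ?e" using lipschitz_splice[OF e Md eb] by blast
  have "?e 0 - c 0 \<in> \<int>" using k ab assms(6) by (cases "b = 0") auto
  moreover have "?e a - c a \<in> \<int>" using assms by auto
  ultimately have "Act a 0 c \<le> Act a 0 ?e" using c N ab unfolding minimal_def by (meson less_le_trans)
  also have "Act a 0 ?e = Act a b e + Act b 0 ?d" using ab by (intro Act_splice[OF e Md eb]) auto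
  also have "Act b 0 ?d = Act b 0 c" by (rule Act_shift) simp
  finally show ?thesis using Act_combine[OF M0, of b] ab by auto
qed

lemma minimal_EL:
  assumes c: "minimal c" and ab: "a < b" "b \<le> 0"
  shows "\<exists>v. EL a b c v"
proof -
  obtain L where L: "L-lipschitz_on {a..b} c" using c loc_lipschitzD ab unfolding minimal_def by blast
  show ?thesis unfolding EL_def
    by (rule minimizer_regular[OF ab L]) (rule minimal_restrict[OF c ab], auto)
qed

lemma loc_lipschitz_shift: "loc_lipschitz c \<Longrightarrow> loc_lipschitz (\<lambda>s. c s + k)"
  unfolding loc_lipschitz_def lipschitz_on_def by simp

lemma minimal_shift:
  assumes "minimal c" shows "minimal (\<lambda>s. c s + of_int k)"
proof -
  have "e a - c a \<in> \<int>" if "e a - (c a + of_int k) \<in> \<int>" for a and e :: "real \<Rightarrow> real"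
    using Ints_add[OF that Ints_of_int[of k]] by simp
  then show ?thesis using assms Act_shift[of 0 _ c k] loc_lipschitz_shift unfolding minimal_def
    by (metis order_refl)
qed

text \<open>The force at a fixed time \<open>\<tau>\<close> is a gradient, so along a curve it contributes boundary terms only.\<close>

lemma gauge_integral:
  assumes c: "velocity S T c v" and "S \<le> T" and \<tau>: "\<tau> \<le> 0"
  shows "integral {S..T} (\<lambda>s. v s * g \<tau> (c s)) = G \<tau> (c T) - G \<tau> (c S)"
proof -
  obtain L where L: "\<And>x. \<bar>v x\<bar> \<le> L" using velocity_bounded[OF c] by auto
  obtain N where N: "negligible N" "\<And>x. x \<in> {S<..<T} - N \<Longrightarrow> (c has_real_derivative v x) (at x)"
    using velocity_derivative[OF c] by auto
  have lip: "(\<Gamma> \<tau>)-lipschitz_on UNIV (G \<tau>)"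
  proof (rule lipschitz_on_leI)
    fix x y :: real assume "x \<le> y"
    show "dist (G \<tau> x) (G \<tau> y) \<le> \<Gamma> \<tau> * dist x y"
    proof (cases "x = y")
      case False
      then obtain z where "G \<tau> y - G \<tau> x = (y - x) * g \<tau> z"
        using MVT2[of x y "G \<tau>" "g \<tau>"] G_deriv[OF \<tau>] \<open>x \<le> y\<close> by auto
      then have "\<bar>G \<tau> x - G \<tau> y\<bar> = \<bar>x - y\<bar> * \<bar>g \<tau> z\<bar>" by (metis abs_minus_commute abs_mult)
      then show ?thesis using g_bound[of \<tau> \<tau> z] \<tau> by (simp add: dist_real_def mult.commute mult_left_mono)
    qed simp
  qed (rule \<Gamma>_nonneg)
  have "(\<Gamma> \<tau> * L)-lipschitz_on {S..T} (\<lambda>s. G \<tau> (c s))"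
    using lipschitz_on_compose2[OF velocity_lipschitz[OF c L] lipschitz_on_subset[OF lip]] by (simp add: mult.commute)
  moreover have "((\<lambda>s. G \<tau> (c s)) has_real_derivative v x * g \<tau> (c x)) (at x)" if "x \<in> {S<..<T} - N" for x
    using DERIV_chain2[OF G_deriv[OF \<tau>] N(2)[OF that]] by (simp add: mult.commute)
  ultimately show ?thesis using \<open>S \<le> T\<close> N(1) by (intro lipschitz_FTC)
qed

lemma gauge_integrable:
  assumes c: "velocity S T c v" and \<tau>: "\<tau> \<le> 0"
  shows "(\<lambda>s. v s * g \<tau> (c s)) integrable_on {S..T}"
proof -
  obtain L where L: "\<And>x. \<bar>v x\<bar> \<le> L" using velocity_bounded[OF c] by auto
  have "L \<ge> 0" using L[of 0] by linarith
  have gT: "continuous_on UNIV (g \<tau>)" using g_deriv[OF \<tau>] DERIV_continuous_on by (metis has_field_derivative_at_within)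
  note [measurable] = borel_measurable_lebesgue_on_Icc[OF velocity_measurable[OF c], of S T]
    continuous_on_measurable_Icc[OF continuous_on_compose2[OF gT velocity_continuous[OF c]], simplified]
  show ?thesis
  proof (rule bounded_measurable_integrable_on)
  show "(\<lambda>s. v s * g \<tau> (c s)) \<in> borel_measurable (lebesgue_on {S..T})" by measurable
  fix x
  show "\<bar>v x * g \<tau> (c x)\<bar> \<le> L * \<Gamma> \<tau>" unfolding abs_mult
    using L[of x] g_bound[of \<tau> \<tau> "c x"] \<tau> \<open>L \<ge> 0\<close> by (intro mult_mono) auto
qed
qed

text \<open>Subtracting the force at time \<open>T\<close> leaves one that is small wherever the noise is calm.\<close>

lemma Act_gauge:
  assumes c: "velocity S T c v" and "S \<le> T" "T \<le> 0"
  shows "(\<lambda>s. (v s)\<^sup>2 / 2 - v s * (g s (c s) - g T (c s))) integrable_on {S..T}"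
    and "Act S T c = integral {S..T} (\<lambda>s. (v s)\<^sup>2 / 2 - v s * (g s (c s) - g T (c s))) - (G T (c T) - G T (c S))"
proof -
  obtain L where L: "\<And>x. \<bar>v x\<bar> \<le> L" using velocity_bounded[OF c] by auto
  have "L \<ge> 0" using L[of 0] by linarith
  have i1: "(\<lambda>s. (v s)\<^sup>2 / 2 - v s * g s (c s)) integrable_on {S..T}"
    by (rule Lag_integrable[OF velocity_continuous[OF c] velocity_measurable[OF c] L \<open>T \<le> 0\<close>])
  have i2: "(\<lambda>s. v s * g T (c s)) integrable_on {S..T}" by (rule gauge_integrable[OF c \<open>T \<le> 0\<close>])
  have eq: "(\<lambda>s. (v s)\<^sup>2 / 2 - v s * (g s (c s) - g T (c s))) = (\<lambda>s. ((v s)\<^sup>2 / 2 - v s * g s (c s)) + v s * g T (c s))"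
    by (auto simp: algebra_simps)
  show "(\<lambda>s. (v s)\<^sup>2 / 2 - v s * (g s (c s) - g T (c s))) integrable_on {S..T}"
    unfolding eq by (rule integrable_add[OF i1 i2])
  show "Act S T c = integral {S..T} (\<lambda>s. (v s)\<^sup>2 / 2 - v s * (g s (c s) - g T (c s))) - (G T (c T) - G T (c S))"
    unfolding eq integral_add[OF i1 i2] gauge_integral[OF assms] Act_eq_Actv[OF c] Actv_def by simp
qed

text \<open>Completing the square: \<open>v\<^sup>2 / 2 - v * p\<close> is at least \<open>- p\<^sup>2 / 2\<close>, here with \<open>p\<close> of size at most \<open>\<epsilon>\<close>.\<close>

lemma calm_lower:
  assumes lip: "L-lipschitz_on {S..T} c" and "S \<le> T" "T \<le> 0" "0 \<le> \<epsilon>"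
    and calm: "\<And>u x. u \<in> {S..T} \<Longrightarrow> \<bar>g u x - g T x\<bar> \<le> \<epsilon>"
  shows "- (\<epsilon>\<^sup>2 / 2) * (T - S) - (G T (c T) - G T (c S)) \<le> Act S T c"
proof -
  obtain v where v: "velocity S T c v" using velocity_exists[OF lip \<open>S \<le> T\<close>] by blast
  have "integral {S..T} (\<lambda>_. - (\<epsilon>\<^sup>2 / 2)) \<le> integral {S..T} (\<lambda>s. (v s)\<^sup>2 / 2 - v s * (g s (c s) - g T (c s)))"
  proof (rule integral_le[OF integrable_const_ivl Act_gauge(1)[OF v \<open>S \<le> T\<close> \<open>T \<le> 0\<close>]])
    fix x assume "x \<in> {S..T}"
    then have "(g x (c x) - g T (c x))\<^sup>2 \<le> \<epsilon>\<^sup>2" using calm[of x "c x"] \<open>0 \<le> \<epsilon>\<close> by (simp add: abs_le_square_iff[symmetric])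
    moreover have "0 \<le> (v x - (g x (c x) - g T (c x)))\<^sup>2" by simp
    ultimately show "- (\<epsilon>\<^sup>2 / 2) \<le> (v x)\<^sup>2 / 2 - v x * (g x (c x) - g T (c x))"
      unfolding power2_diff[of "v x"] by (simp add: algebra_simps)
  qed
  then show ?thesis using Act_gauge(2)[OF v \<open>S \<le> T\<close> \<open>T \<le> 0\<close>] \<open>S \<le> T\<close> by (simp add: algebra_simps)
qed

lemma calm_linear:
  fixes p m :: real
  assumes "S \<le> T" "T \<le> 0" "\<bar>m\<bar> \<le> \<epsilon>"
    and calm: "\<And>u x. u \<in> {S..T} \<Longrightarrow> \<bar>g u x - g T x\<bar> \<le> \<epsilon>"
  defines "l \<equiv> \<lambda>s. p + (s - S) * m"
  shows "Act S T l \<le> (3 * \<epsilon>\<^sup>2 / 2) * (T - S) - (G T (l T) - G T (l S))"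
proof -
  have v: "velocity S T l (\<lambda>_. m)" unfolding l_def by (rule velocity_linear[OF \<open>S \<le> T\<close>])
  have "integral {S..T} (\<lambda>s. m\<^sup>2 / 2 - m * (g s (l s) - g T (l s))) \<le> integral {S..T} (\<lambda>_. 3 * \<epsilon>\<^sup>2 / 2)"
  proof (rule integral_le[OF Act_gauge(1)[OF v \<open>S \<le> T\<close> \<open>T \<le> 0\<close>] integrable_const_ivl])
    fix x assume "x \<in> {S..T}"
    then have "\<bar>m * (g x (l x) - g T (l x))\<bar> \<le> \<epsilon> * \<epsilon>" unfolding abs_mult using calm[of x "l x"] assms(3) by (intro mult_mono) auto
    moreover have "m\<^sup>2 \<le> \<epsilon>\<^sup>2" using assms(3) by (simp add: abs_le_square_iff[symmetric])
    ultimately show "m\<^sup>2 / 2 - m * (g x (l x) - g T (l x)) \<le> 3 * \<epsilon>\<^sup>2 / 2" by (simp add: power2_eq_square)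
  qed
  then show ?thesis using Act_gauge(2)[OF v \<open>S \<le> T\<close> \<open>T \<le> 0\<close>] \<open>S \<le> T\<close> by (simp add: algebra_simps)
qed

lemma EL_derivative_subset:
  assumes "EL a b c v" "t \<in> S" "S \<subseteq> {a..b}"
  shows "(c has_real_derivative v t) (at t within S)"
  using assms DERIV_subset[of c "v t" t "{a..b}" S] unfolding EL_def by auto

end

section \<open>Minimal curves do not cross\<close>

text \<open>The windows are calm relative to the force at their right end point, uniformly in space.\<close>

locale calm_forced_lagrangian = forced_lagrangian +
  assumes calm: "0 < \<epsilon> \<Longrightarrow> \<exists>T\<le>\<tau>. \<forall>u\<in>{T - 1 / \<epsilon>..T}. \<forall>x. \<bar>g u x - g T x\<bar> \<le> \<epsilon>"
begin

text \<open>A window of length \<open>1 / \<epsilon>\<close> gives time to cross the circle with speed at most \<open>\<epsilon>\<close>.\<close>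

lemma reconnect:
  assumes "\<epsilon> > 0" and S: "S = T - 1 / \<epsilon>" and "T \<le> 0"
    and calm: "\<And>u x. u \<in> {S..T} \<Longrightarrow> \<bar>g u x - g T x\<bar> \<le> \<epsilon>"
  shows "\<exists>l L. L-lipschitz_on {S..T} l \<and> l S - p \<in> \<int> \<and> l T = q \<and> Act S T l \<le> 3 * \<epsilon> / 2 - (G T q - G T p)"
proof -
  (* After a shift by k the points p and q have distance at most 1. *)
  define k where "k = \<lfloor>q - p\<rfloor>"
  define m where "m = (q - p - of_int k) * \<epsilon>"
  define l where "l = (\<lambda>s. (p + of_int k) + (s - S) * m)"
  have ST: "S \<le> T" using S \<open>\<epsilon> > 0\<close> by simp
  have "0 \<le> q - p - of_int k" "q - p - of_int k \<le> 1" unfolding k_def by linarith+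
  then have "\<bar>m\<bar> \<le> \<epsilon>" unfolding m_def using \<open>\<epsilon> > 0\<close> by (simp add: abs_mult mult_left_le_one_le)
  then have *: "Act S T l \<le> (3 * \<epsilon>\<^sup>2 / 2) * (T - S) - (G T (l T) - G T (l S))"
    unfolding l_def by (intro calm_linear[OF ST \<open>T \<le> 0\<close> _ calm])
  have lT: "l T = q" unfolding l_def m_def S using \<open>\<epsilon> > 0\<close> by simp
  have lS: "l S = p + of_int k" unfolding l_def by simp
  have "(3 * \<epsilon>\<^sup>2 / 2) * (T - S) = 3 * \<epsilon> / 2" unfolding S using \<open>\<epsilon> > 0\<close> by (simp add: power2_eq_square)
  then have "Act S T l \<le> 3 * \<epsilon> / 2 - (G T q - G T p)" using * G_int[OF \<open>T \<le> 0\<close>, of p k] unfolding lT lS by linarith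
  moreover have "\<bar>m\<bar>-lipschitz_on {S..T} l" unfolding l_def by (rule velocity_lipschitz[OF velocity_linear[OF ST]]) simp
  moreover have "l S - p \<in> \<int>" using lS by simp
  ultimately show ?thesis using lT by blast
qed

text \<open>The curve that follows \<open>c2\<close> up to the meeting time and \<open>c1\<close> afterwards is minimizing on \<open>{t - 1..0}\<close>:
  an improvement by \<open>\<delta>\<close> would survive the exchange of \<open>c1\<close> and \<open>c2\<close> in a calm window in the past. Hence it has a
  velocity at \<open>t\<close>, which is that of both curves, and uniqueness for the Euler-Lagrange equation applies.\<close>

theorem minimal_noncrossing:
  assumes c1: "minimal c1" and c2: "minimal c2" and "t < 0" and meet: "c1 t = c2 t" and "s \<le> 0"
  shows "c1 s = c2 s"
proof -
  have ll: "loc_lipschitz c1" "loc_lipschitz c2" using c1 c2 unfolding minimal_def by blast+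
  define e0 where "e0 s = (if s \<le> t then c2 s else c1 s)" for s
  have lip2: "\<exists>L. L-lipschitz_on {a..b} c2" and lip1: "\<exists>L. L-lipschitz_on {a..b} c1" if "b \<le> 0" for a b
    using loc_lipschitzD ll that by blast+
  obtain L1 where L1: "L1-lipschitz_on {t..0} c1" using lip1 by blast
  obtain L2 where L2: "L2-lipschitz_on {t - 1..t} c2" using lip2 \<open>t < 0\<close> by (meson less_imp_le)
  obtain L0 where L0: "L0-lipschitz_on {t - 1..0} e0"
    using lipschitz_splice[OF L2 L1 meet[symmetric]] unfolding e0_def by blast
  have Act_e0: "Act (t - 1) 0 e0 = Act (t - 1) t c2 + Act t 0 c1"
    unfolding e0_def using \<open>t < 0\<close> by (intro Act_splice[OF L2 L1 meet[symmetric]]) auto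
  have min0: "Act (t - 1) 0 e0 \<le> Act (t - 1) 0 e"
    if e: "M-lipschitz_on {t - 1..0} e" "e (t - 1) = e0 (t - 1)" "e 0 = e0 0" for e M
  proof (rule ccontr)
    assume "\<not> Act (t - 1) 0 e0 \<le> Act (t - 1) 0 e"
    define \<delta> where "\<delta> = Act (t - 1) 0 e0 - Act (t - 1) 0 e"
    have "\<delta> > 0" using \<open>\<not> _\<close> unfolding \<delta>_def by simp
    (* The exchange in the window costs 4 * \<epsilon>, which is less than \<delta>. *)
    define \<epsilon> where "\<epsilon> = \<delta> / 8"
    have "\<epsilon> > 0" using \<open>\<delta> > 0\<close> unfolding \<epsilon>_def by simp
    obtain T where T: "T \<le> t - 1" "\<And>u x. u \<in> {T - 1 / \<epsilon>..T} \<Longrightarrow> \<bar>g u x - g T x\<bar> \<le> \<epsilon>"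
      using calm[OF \<open>\<epsilon> > 0\<close>, of "t - 1"] by blast
    define S where "S = T - 1 / \<epsilon>"
    have ST: "S < T" "T \<le> 0" "T < t" using \<open>\<epsilon> > 0\<close> T(1) \<open>t < 0\<close> unfolding S_def by auto
    have cal: "\<bar>g u x - g T x\<bar> \<le> \<epsilon>" if "u \<in> {S..T}" for u x using T(2) that unfolding S_def by blast
    obtain l1 M1 where l1: "M1-lipschitz_on {S..T} l1" "l1 S - c1 S \<in> \<int>" "l1 T = c2 T"
      "Act S T l1 \<le> 3 * \<epsilon> / 2 - (G T (c2 T) - G T (c1 S))"
      using reconnect[OF \<open>\<epsilon> > 0\<close> S_def ST(2) cal] by blast
    obtain l2 M2 where l2: "M2-lipschitz_on {S..T} l2" "l2 S - c2 S \<in> \<int>" "l2 T = c1 T"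
      "Act S T l2 \<le> 3 * \<epsilon> / 2 - (G T (c1 T) - G T (c2 S))"
      using reconnect[OF \<open>\<epsilon> > 0\<close> S_def ST(2) cal] by blast
    \<comment> \<open>\<open>c1\<close> is compared with the curve that changes to \<open>c2\<close> in the window and then follows \<open>c2\<close> and \<open>e\<close>.\<close>
    obtain N2 where N2: "N2-lipschitz_on {T..t - 1} c2" using lip2[of "t - 1"] \<open>t < 0\<close> by auto
    have j: "c2 (t - 1) = e (t - 1)" using e(2) unfolding e0_def by simp
    define d where "d s = (if s \<le> t - 1 then c2 s else e s)" for s
    obtain Nd where Nd: "Nd-lipschitz_on {T..0} d" using lipschitz_splice[OF N2 e(1) j] unfolding d_def by blast
    have Ad: "Act T 0 d = Act T (t - 1) c2 + Act (t - 1) 0 e"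
      unfolding d_def using T(1) \<open>t < 0\<close> by (intro Act_splice[OF N2 e(1) j]) auto
    have j2: "l1 T = d T" using l1(3) T(1) unfolding d_def by simp
    define f where "f s = (if s \<le> T then l1 s else d s)" for s
    obtain Nf where Nf: "Nf-lipschitz_on {S..0} f" using lipschitz_splice[OF l1(1) Nd j2] unfolding f_def by blast
    have Af: "Act S 0 f = Act S T l1 + Act T 0 d"
      unfolding f_def using ST by (intro Act_splice[OF l1(1) Nd j2]) auto
    have "f 0 = c1 0" using e(3) ST T(1) \<open>t < 0\<close> unfolding f_def d_def e0_def by auto
    then have 1: "Act S 0 c1 \<le> Act S 0 f"
      using l1(2) ST by (intro minimal_restrict[OF c1 _ _ Nf]) (auto simp: f_def)
    \<comment> \<open>\<open>c2\<close> is compared up to the meeting time with the curve that changes to \<open>c1\<close> in the window.\<close>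
    obtain N1 where N1: "N1-lipschitz_on {T..t} c1" using lip1[of t] \<open>t < 0\<close> by auto
    define h where "h s = (if s \<le> T then l2 s else c1 s)" for s
    obtain Nh where Nh: "Nh-lipschitz_on {S..t} h" using lipschitz_splice[OF l2(1) N1 l2(3)] unfolding h_def by blast
    have Ah: "Act S t h = Act S T l2 + Act T t c1"
      unfolding h_def using ST \<open>t < 0\<close> by (intro Act_splice[OF l2(1) N1 l2(3)]) auto
    have 2: "Act S t c2 \<le> Act S t h"
      using l2(2) ST \<open>t < 0\<close> meet by (intro minimal_restrict[OF c2 _ _ Nh]) (auto simp: h_def)
    \<comment> \<open>In the sum of the two comparisons the boundary terms of the window cancel.\<close>
    have comb: "Act a b c = Act a m c + Act m b c" if "c = c1 \<or> c = c2" "a \<le> m" "m \<le> b" "b \<le> 0" for a m b c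
    proof -
      have "\<exists>L. L-lipschitz_on {a..b} c" using that(1) lip1[OF that(4), of a] lip2[OF that(4), of a] by blast
      then obtain L where "L-lipschitz_on {a..b} c" by blast
      then show ?thesis by (rule Act_combine[OF _ that(2-4)])
    qed
    have lo: "- (\<epsilon> / 2) - (G T (c T) - G T (c S)) \<le> Act S T c" if "c = c1 \<or> c = c2" for c
    proof -
      have "\<exists>L. L-lipschitz_on {S..T} c" using that lip1[of T S] lip2[of T S] ST by auto
      then obtain L where L: "L-lipschitz_on {S..T} c" by blast
      have "- (\<epsilon>\<^sup>2 / 2) * (T - S) = - (\<epsilon> / 2)" unfolding S_def using \<open>\<epsilon> > 0\<close> by (simp add: power2_eq_square)
      then show ?thesis using calm_lower[OF L _ ST(2) _ cal] ST(1) \<open>\<epsilon> > 0\<close> by simp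
    qed
    have 3: "Act S 0 c1 = Act S T c1 + Act T t c1 + Act t 0 c1"
      using comb[of c1 S T 0] comb[of c1 T t 0] ST \<open>t < 0\<close> by simp
    have 4: "Act S t c2 = Act S T c2 + Act T (t - 1) c2 + Act (t - 1) t c2"
      using comb[of c2 S T t] comb[of c2 T "t - 1" t] ST T(1) \<open>t < 0\<close> by simp
    have "\<delta> \<le> 4 * \<epsilon>"
      using 1 2 3 4 Af Ad Ah Act_e0 l1(4) l2(4) lo[of c1] lo[of c2] unfolding \<delta>_def by simp
    then show False using \<open>\<delta> > 0\<close> unfolding \<epsilon>_def by simp
  qed
  have t10: "t - 1 < (0::real)" using \<open>t < 0\<close> by simp
  have "\<exists>v. EL (t - 1) 0 e0 v" unfolding EL_def
    by (rule minimizer_regular[OF t10 order_refl L0]) (rule min0)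
  then obtain v0 where v0: "EL (t - 1) 0 e0 v0" by blast
  define a where "a = min s (t - 1)"
  have a: "a < 0" "a \<le> t - 1" "a \<le> s" using \<open>t < 0\<close> unfolding a_def by auto
  obtain v1 where v1: "EL a 0 c1 v1" using minimal_EL[OF c1 a(1)] by auto
  obtain v2 where v2: "EL a 0 c2 v2" using minimal_EL[OF c2 a(1)] by auto
  have "v0 t = v1 t"
  proof (rule within_derivative_unique[of e0 _ t "{t..0}"])
    show "(e0 has_real_derivative v0 t) (at t within {t..0})"
      using \<open>t < 0\<close> by (intro EL_derivative_subset[OF v0]) auto
    have "(c1 has_real_derivative v1 t) (at t within {t..0})"
      using \<open>t < 0\<close> a by (intro EL_derivative_subset[OF v1]) auto
    then show "(e0 has_real_derivative v1 t) (at t within {t..0})"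
      by (rule has_field_derivative_transform_within[OF _ zero_less_one]) (use \<open>t < 0\<close> meet in \<open>auto simp: e0_def\<close>)
    show "at t within {t..0} \<noteq> bot" using \<open>t < 0\<close> by (simp add: at_within_Icc_at_right)
  qed
  moreover have "v0 t = v2 t"
  proof (rule within_derivative_unique[of e0 _ t "{t - 1..t}"])
    show "(e0 has_real_derivative v0 t) (at t within {t - 1..t})"
      using \<open>t < 0\<close> by (intro EL_derivative_subset[OF v0]) auto
    have "(c2 has_real_derivative v2 t) (at t within {t - 1..t})"
      using \<open>t < 0\<close> a by (intro EL_derivative_subset[OF v2]) auto
    then show "(e0 has_real_derivative v2 t) (at t within {t - 1..t})"
      by (rule has_field_derivative_transform_within[OF _ zero_less_one]) (auto simp: e0_def)
    show "at t within {t - 1..t} \<noteq> bot" by (simp add: at_within_Icc_at_left)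
  qed
  ultimately have "v1 t = v2 t" by simp
  then show ?thesis
    using EL_unique[OF order_refl v1 v2, of t s] a \<open>t < 0\<close> \<open>s \<le> 0\<close> meet by auto
qed

end

section \<open>Minimal polygons\<close>

text \<open>Nodes are numbered backwards in time, node \<open>i\<close> being at \<open>- i * h\<close>; cell \<open>i\<close> is \<open>{- (i + 1) * h<..- i * h}\<close>.\<close>

definition cell :: "real \<Rightarrow> real \<Rightarrow> nat" where "cell h s = nat \<lfloor>- s / h\<rfloor>"

definition slope :: "real \<Rightarrow> (nat \<Rightarrow> real) \<Rightarrow> nat \<Rightarrow> real" where
  "slope h y i = (y i - y (Suc i)) / h"

definition polygon :: "real \<Rightarrow> (nat \<Rightarrow> real) \<Rightarrow> real \<Rightarrow> real" where
  "polygon h y s = y (cell h s) + slope h y (cell h s) * (s + real (cell h s) * h)"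

lemma cell_eq:
  assumes "h > 0" "- (real (Suc i) * h) < s" "s \<le> - (real i * h)"
  shows "cell h s = i"
proof -
  have "real i \<le> - s / h" "- s / h < real i + 1" using assms by (auto simp: field_simps)
  then have "\<lfloor>- s / h\<rfloor> = int i" by (intro floor_unique) auto
  then show ?thesis unfolding cell_def by simp
qed

lemma cell_bounds:
  assumes "h > 0" "s \<le> 0"
  shows "- (real (Suc (cell h s)) * h) < s" "s \<le> - (real (cell h s) * h)"
proof -
  have "0 \<le> - s / h" using assms by (simp add: divide_nonpos_pos)
  then have "real (cell h s) = of_int \<lfloor>- s / h\<rfloor>" unfolding cell_def by simp
  then have "real (cell h s) \<le> - s / h" "- s / h < real (cell h s) + 1" by linarith+
  then show "- (real (Suc (cell h s)) * h) < s" "s \<le> - (real (cell h s) * h)"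
    using \<open>h > 0\<close> by (auto simp: field_simps)
qed

lemma polygon_on_cell:
  assumes "h > 0" "- (real (Suc i) * h) \<le> s" "s \<le> - (real i * h)"
  shows "polygon h y s = y i + slope h y i * (s + real i * h)"
proof (cases "s = - (real (Suc i) * h)")
  case True
  have "cell h s = Suc i" using assms True by (intro cell_eq) (auto simp: algebra_simps)
  then have "polygon h y s = y (Suc i)" unfolding polygon_def using True by simp
  also have "\<dots> = y i + slope h y i * (s + real i * h)"
    unfolding True slope_def using \<open>h > 0\<close> by (simp add: field_simps)
  finally show ?thesis .
next
  case False
  then have "cell h s = i" using assms by (intro cell_eq) auto
  then show ?thesis unfolding polygon_def by simp
qed

lemma polygon_node: "h > 0 \<Longrightarrow> polygon h y (- (real i * h)) = y i"
  using polygon_on_cell[of h i "- (real i * h)" y] by (simp add: algebra_simps)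

lemma polygon_local:
  assumes "h > 0" "\<And>i. i0 \<le> i \<Longrightarrow> i \<le> i1 \<Longrightarrow> y i = z i" and s: "- (real i1 * h) < s" "s \<le> - (real i0 * h)" "s \<le> 0"
  shows "polygon h y s = polygon h z s" "slope h y (cell h s) = slope h z (cell h s)"
proof -
  let ?i = "cell h s"
  note b = cell_bounds[OF \<open>h > 0\<close> s(3)]
  have "real ?i * h < real i1 * h" using b s by linarith
  then have "?i < i1" using \<open>h > 0\<close> by simp
  have "real i0 * h < real (Suc ?i) * h" using b s by linarith
  then have "i0 \<le> ?i" using \<open>h > 0\<close> by simp
  have "y ?i = z ?i" "y (Suc ?i) = z (Suc ?i)" using \<open>?i < i1\<close> \<open>i0 \<le> ?i\<close> assms(2) by auto
  then show "polygon h y s = polygon h z s" "slope h y (cell h s) = slope h z (cell h s)"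
    unfolding polygon_def slope_def by simp_all
qed

lemma slope_add: "slope h (\<lambda>i. y i + \<epsilon> * z i) i = slope h y i + \<epsilon> * slope h z i"
  unfolding slope_def by (simp add: algebra_simps add_divide_distrib diff_divide_distrib)

lemma polygon_add: "polygon h (\<lambda>i. y i + \<epsilon> * z i) s = polygon h y s + \<epsilon> * polygon h z s"
  unfolding polygon_def slope_add by (simp add: algebra_simps)

lemma polygon_shift: "polygon h (\<lambda>i. y i + k) s = polygon h y s + k"
  unfolding polygon_def slope_def by simp

lemma polygon_lipschitz_nodes:
  assumes "h > 0" "V \<ge> 0" and V: "\<And>i. \<bar>slope h y i\<bar> \<le> V"
  shows "V-lipschitz_on {- (real N * h)..0} (polygon h y)"
proof (induction N)
  case 0
  then show ?case using \<open>V \<ge> 0\<close> by (simp add: lipschitz_on_def)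
next
  case (Suc N)
  have 1: "V-lipschitz_on {- (real (Suc N) * h)..- (real N * h)} (polygon h y)"
  proof (rule lipschitz_onI[OF _ \<open>V \<ge> 0\<close>])
    fix s t assume "s \<in> {- (real (Suc N) * h)..- (real N * h)}" "t \<in> {- (real (Suc N) * h)..- (real N * h)}"
    then have "polygon h y s - polygon h y t = slope h y N * (s - t)"
      using polygon_on_cell[OF \<open>h > 0\<close>, of N s y] polygon_on_cell[OF \<open>h > 0\<close>, of N t y] by (simp add: algebra_simps)
    then show "dist (polygon h y s) (polygon h y t) \<le> V * dist s t"
      using V[of N] by (simp add: dist_real_def abs_mult mult_right_mono)
  qed
  have "V-lipschitz_on {- (real (Suc N) * h)..0} (\<lambda>s. if s \<le> - (real N * h) then polygon h y s else polygon h y s)"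
    by (rule lipschitz_on_concat[OF 1 Suc.IH refl])
  then show ?case by simp
qed

lemma polygon_lipschitz:
  assumes "h > 0" and V: "\<And>i. \<bar>slope h y i\<bar> \<le> V"
  shows "V-lipschitz_on {a..0} (polygon h y)"
proof -
  have "V \<ge> 0" using V[of 0] by linarith
  obtain N where "- a / h \<le> real N" using real_arch_simple by blast
  then have "- (real N * h) \<le> a" using \<open>h > 0\<close> by (simp add: field_simps)
  then show ?thesis
    using lipschitz_on_subset[OF polygon_lipschitz_nodes[OF \<open>h > 0\<close> \<open>V \<ge> 0\<close> V, of N]] by auto
qed

lemma slope_cell_measurable: "(\<lambda>s. slope h y (cell h s)) \<in> borel_measurable borel"
proof -
  have "cell h \<in> borel \<rightarrow>\<^sub>M count_space UNIV" unfolding cell_def[abs_def] by measurable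
  then show ?thesis by (rule measurable_compose) simp
qed

lemma polygon_velocity:
  assumes "h > 0" and V: "\<And>i. \<bar>slope h y i\<bar> \<le> V" and "b \<le> 0"
  shows "velocity a b (polygon h y) (\<lambda>s. slope h y (cell h s))"
proof (cases "a \<le> 0")
  case True
  let ?v = "\<lambda>s. slope h y (cell h s)"
  let ?N = "range (\<lambda>i. - (real i * h))"
  have N: "negligible ?N" by (rule negligible_if_countable) auto
  have der: "(polygon h y has_real_derivative ?v x) (at x)" if x: "x < 0" "x \<notin> ?N" for x
  proof -
    let ?i = "cell h x"
    have b: "- (real (Suc ?i) * h) < x" "x < - (real ?i * h)"
      using cell_bounds[OF \<open>h > 0\<close>, of x] x by (auto simp: less_le)
    have "((\<lambda>s. y ?i + slope h y ?i * (s + real ?i * h)) has_real_derivative ?v x) (at x)"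
      by (auto intro!: derivative_eq_intros)
    then show ?thesis
      by (rule has_field_derivative_transform_within_open[where S = "{- (real (Suc ?i) * h)<..<- (real ?i * h)}"])
        (use b in \<open>auto simp: polygon_on_cell[OF \<open>h > 0\<close>, of ?i]\<close>)
  qed
  have "velocity a 0 (polygon h y) ?v"
  proof (rule velocityI[OF slope_cell_measurable V N])
    fix x assume "x \<in> {a<..<0} - ?N"
    then show "(polygon h y has_real_derivative ?v x) (at x)" using der by auto
  next
    fix s t assume st: "a \<le> s" "s \<le> t" "t \<le> 0"
    have "V-lipschitz_on {s..t} (polygon h y)"
      by (rule lipschitz_on_subset[OF polygon_lipschitz[OF assms(1,2), where a = s]]) (use st in auto)
    then show "integral {s..t} ?v = polygon h y t - polygon h y s"
      by (rule lipschitz_FTC[OF _ st(2) N]) (use der st in auto)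
  qed
  then show ?thesis by (rule velocity_subinterval) (use assms in auto)
next
  case False
  then show ?thesis using assms(3) by (intro velocityI[OF slope_cell_measurable V, of "{}"]) auto
qed

text \<open>Difference quotients over intervals that contain \<open>x\<close> are weighted averages of two quotients at \<open>x\<close>.\<close>

lemma straddle_derivative:
  fixes e :: "real \<Rightarrow> real"
  assumes "(e has_real_derivative D) (at x)" "\<eta> > 0"
  shows "\<exists>d>0. \<forall>p q. p \<le> x \<and> x \<le> q \<and> p < q \<and> q - p < d \<longrightarrow> \<bar>(e q - e p) / (q - p) - D\<bar> \<le> \<eta>"
proof -
  obtain d where d: "d > 0" "\<And>y. \<bar>y - x\<bar> < d \<Longrightarrow> \<bar>e y - e x - (y - x) * D\<bar> \<le> \<eta> * \<bar>y - x\<bar>"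
    using assms unfolding has_field_derivative_def has_derivative_at_alt by (auto simp: mult.commute)
  have "\<bar>(e q - e p) / (q - p) - D\<bar> \<le> \<eta>" if *: "p \<le> x" "x \<le> q" "p < q" "q - p < d" for p q
  proof -
    have "\<bar>e q - e x - (q - x) * D\<bar> \<le> \<eta> * (q - x)" "\<bar>e p - e x - (p - x) * D\<bar> \<le> \<eta> * (x - p)"
      using d(2)[of q] d(2)[of p] * by auto
    then have "\<bar>(e q - e p) - (q - p) * D\<bar> \<le> \<eta> * (q - p)" by (simp add: algebra_simps abs_le_iff)
    moreover have "(e q - e p) / (q - p) - D = ((e q - e p) - (q - p) * D) / (q - p)" using * by (simp add: field_simps)
    ultimately show ?thesis using * by (simp add: abs_divide pos_divide_le_eq)
  qed
  then show ?thesis using d(1) by blast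
qed

context forced_lagrangian begin

text \<open>Coercivity: half of the kinetic energy absorbs the term that is linear in the velocity.\<close>

lemma Act_lower:
  assumes v: "velocity a b c v" and "a \<le> b" "b \<le> 0"
  shows "(\<lambda>s. (v s)\<^sup>2) integrable_on {a..b}" "integral {a..b} (\<lambda>s. (v s)\<^sup>2) / 4 - (\<Gamma> a)\<^sup>2 * (b - a) \<le> Act a b c"
proof -
  obtain L where L: "\<And>x. \<bar>v x\<bar> \<le> L" using velocity_bounded[OF v] by auto
  note [measurable] = velocity_measurable[OF v]
  have "\<bar>(v x)\<^sup>2\<bar> \<le> L\<^sup>2" for x using L[of x] abs_le_square_iff[of "v x" L] by auto
  then show i: "(\<lambda>s. (v s)\<^sup>2) integrable_on {a..b}" by (intro bounded_borel_integrable_on) auto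
  have i': "(\<lambda>s. (v s)\<^sup>2 / 4) integrable_on {a..b}" using integrable_on_mult_right[OF i, of "1/4"] by simp
  have "integral {a..b} (\<lambda>s. (v s)\<^sup>2 / 4 - (\<Gamma> a)\<^sup>2) \<le> Actv a b c v" unfolding Actv_def
  proof (rule integral_le)
    show "(\<lambda>s. (v s)\<^sup>2 / 4 - (\<Gamma> a)\<^sup>2) integrable_on {a..b}" by (intro integrable_diff i' integrable_const_ivl)
    show "(\<lambda>s. (v s)\<^sup>2 / 2 - v s * g s (c s)) integrable_on {a..b}"
      by (rule Lag_integrable[OF velocity_continuous[OF v] velocity_measurable[OF v] L \<open>b \<le> 0\<close>])
    fix x assume x: "x \<in> {a..b}"
    have "(g x (c x))\<^sup>2 \<le> (\<Gamma> a)\<^sup>2" using g_bound[of a x "c x"] x \<open>b \<le> 0\<close> \<Gamma>_nonneg[of a] abs_le_square_iff[of "g x (c x)" "\<Gamma> a"] by auto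
    moreover have "0 \<le> (v x / 2 - g x (c x))\<^sup>2" by simp
    ultimately show "(v x)\<^sup>2 / 4 - (\<Gamma> a)\<^sup>2 \<le> (v x)\<^sup>2 / 2 - v x * g x (c x)"
      by (simp add: power2_eq_square algebra_simps)
  qed
  then show "integral {a..b} (\<lambda>s. (v s)\<^sup>2) / 4 - (\<Gamma> a)\<^sup>2 * (b - a) \<le> Act a b c"
    using \<open>a \<le> b\<close> i' by (simp add: Act_eq_Actv[OF v] integral_diff integrable_const_ivl mult.commute)
qed

text \<open>\<open>2 * \<bar>v\<bar> \<le> 1 + v\<^sup>2\<close>.\<close>

lemma velocity_abs_integral:
  assumes v: "velocity a b c v" and "a \<le> b" "b \<le> 0"
  shows "(\<lambda>s. \<bar>v s\<bar>) integrable_on {a'..b'}" "integral {a..b} (\<lambda>s. \<bar>v s\<bar>) \<le> ((b - a) + integral {a..b} (\<lambda>s. (v s)\<^sup>2)) / 2"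
proof -
  obtain L where L: "\<And>x. \<bar>v x\<bar> \<le> L" using velocity_bounded[OF v] by auto
  note [measurable] = velocity_measurable[OF v]
  show i: "(\<lambda>s. \<bar>v s\<bar>) integrable_on {a'..b'}" for a' b' using L by (intro bounded_borel_integrable_on[of _ _ _ L]) auto
  note i2 = Act_lower(1)[OF assms]
  have i3: "(\<lambda>s. (1 + (v s)\<^sup>2)) integrable_on {a..b}" by (intro integrable_add integrable_const_ivl i2)
  have "integral {a..b} (\<lambda>s. 2 * \<bar>v s\<bar>) \<le> integral {a..b} (\<lambda>s. 1 + (v s)\<^sup>2)"
  proof (rule integral_le[OF integrable_on_mult_right[OF i] i3])
    fix x show "2 * \<bar>v x\<bar> \<le> 1 + (v x)\<^sup>2" using sum_squares_bound[of 1 "\<bar>v x\<bar>"] by simp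
  qed
  then show "integral {a..b} (\<lambda>s. \<bar>v s\<bar>) \<le> ((b - a) + integral {a..b} (\<lambda>s. (v s)\<^sup>2)) / 2"
    using \<open>a \<le> b\<close> by (simp add: integral_add[OF integrable_const_ivl i2])
qed

text \<open>The action of a polygon depends on finitely many nodes. By coercivity these stay bounded along a
  minimizing sequence, and the action is continuous in the nodes.\<close>

lemma minimal_polygon_exists:
  assumes "h > 0"
  shows "\<exists>y V. y 0 = x \<and> (\<forall>i. \<bar>slope h y i\<bar> \<le> V) \<and>
    (\<forall>z. z 0 = x \<longrightarrow> Act (- (real N * h)) 0 (polygon h y) \<le> Act (- (real N * h)) 0 (polygon h z))"
proof -
  define a where "a = - (real N * h)"
  have a0: "a \<le> 0" unfolding a_def using \<open>h > 0\<close> by simp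
  define A where "A z = Act a 0 (polygon h z)" for z
  (* Nodes before - N * h do not influence the action; keeping them constant bounds the slopes. *)
  define trunc where "trunc z i = z (min i N)" for z :: "nat \<Rightarrow> real" and i
  have bdd: "\<exists>V. \<forall>i. \<bar>slope h (trunc z) i\<bar> \<le> V" for z
  proof -
    have "\<bar>slope h (trunc z) i\<bar> \<le> (\<Sum>j\<le>N. \<bar>slope h (trunc z) j\<bar>)" for i
    proof (cases "i \<le> N")
      case True
      then show ?thesis by (intro member_le_sum) auto
    next
      case False
      then show ?thesis unfolding slope_def trunc_def by (auto intro: sum_nonneg)
    qed
    then show ?thesis by blast
  qed
  have At: "A (trunc z) = A z" for z unfolding A_def
  proof (rule Act_cong)
    fix s assume "s \<in> {a<..<0}"
    then show "polygon h (trunc z) s = polygon h z s"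
      unfolding a_def by (intro polygon_local[OF \<open>h > 0\<close>, where ?i0.0 = 0 and ?i1.0 = N]) (auto simp: trunc_def)
  qed
  have vel: "velocity a 0 (polygon h (trunc z)) (\<lambda>s. slope h (trunc z) (cell h s))" for z
    using bdd[of z] polygon_velocity[OF \<open>h > 0\<close>] by blast
  have lower: "- ((\<Gamma> a)\<^sup>2 * (0 - a)) \<le> A z" for z
  proof -
    have "0 \<le> integral {a..0} (\<lambda>s. (slope h (trunc z) (cell h s))\<^sup>2)" by (intro integral_nonneg Act_lower(1)[OF vel a0 order_refl]) auto
    then show ?thesis using Act_lower(2)[OF vel a0 order_refl, of z] At[of z] unfolding A_def by linarith
  qed
  define Z where "Z = {z :: nat \<Rightarrow> real. z 0 = x}"
  have Zne: "(\<lambda>_. x) \<in> Z" unfolding Z_def by simp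
  define I where "I = Inf (A ` Z)"
  have bb: "bdd_below (A ` Z)" using lower by (auto simp: bdd_below_def)
  have Ile: "I \<le> A z" if "z \<in> Z" for z unfolding I_def using that bb by (intro cInf_lower) auto
  have "\<exists>z\<in>Z. A z < I + 1 / real (Suc j)" for j
  proof -
    have "\<exists>b\<in>A ` Z. b < I + 1 / real (Suc j)" unfolding I_def using Zne by (intro cInf_lessD) auto
    then show ?thesis by blast
  qed
  then obtain \<zeta> where \<zeta>: "\<And>j. \<zeta> j \<in> Z" "\<And>j. A (\<zeta> j) < I + 1 / real (Suc j)" by metis
  define Y where "Y = (\<Gamma> a)\<^sup>2 * (0 - a)"
  define R where "R = \<bar>x\<bar> + ((0 - a) + 4 * ((I + 1) + Y)) / 2"
  have bound: "norm (trunc (\<zeta> j) i) \<le> R" for i j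
  proof -
    let ?z = "trunc (\<zeta> j)" and ?i = "min i N"
    let ?v = "\<lambda>s. slope h ?z (cell h s)"
    let ?s = "- (real ?i * h)"
    have s: "a \<le> ?s" "?s \<le> 0" unfolding a_def using \<open>h > 0\<close> by (auto intro: mult_right_mono)
    have "1 / real (Suc j) \<le> 1" by simp
    then have "A ?z \<le> I + 1" using \<zeta>(2)[of j] At[of "\<zeta> j"] by linarith
    then have e: "integral {a..0} (\<lambda>s. (?v s)\<^sup>2) \<le> 4 * ((I + 1) + Y)"
      using Act_lower(2)[OF vel a0 order_refl, of "\<zeta> j"] unfolding A_def Y_def[symmetric] by (simp add: field_simps)
    have "\<bar>integral {?s..0} ?v\<bar> \<le> integral {?s..0} (\<lambda>s. \<bar>?v s\<bar>)"
      using integral_norm_bound_integral[OF velocity_integrable[OF vel] velocity_abs_integral(1)[OF vel a0 order_refl]] by simp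
    also have "\<dots> \<le> integral {a..0} (\<lambda>s. \<bar>?v s\<bar>)"
      using s by (intro integral_subset_le velocity_abs_integral(1)[OF vel a0 order_refl]) auto
    also have "\<dots> \<le> ((0 - a) + integral {a..0} (\<lambda>s. (?v s)\<^sup>2)) / 2"
      by (rule velocity_abs_integral(2)[OF vel a0 order_refl])
    finally have "\<bar>polygon h ?z 0 - polygon h ?z ?s\<bar> \<le> ((0 - a) + 4 * ((I + 1) + Y)) / 2"
      using e velocity_integral[OF vel, of ?s 0 "\<zeta> j"] s by simp
    moreover have "polygon h ?z ?s = ?z i" using polygon_node[OF \<open>h > 0\<close>, of ?z ?i] by (simp add: trunc_def)
    moreover have "polygon h ?z 0 = x" using polygon_node[OF \<open>h > 0\<close>, of ?z 0] \<zeta>(1)[of j] by (simp add: trunc_def Z_def)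
    ultimately show ?thesis unfolding R_def real_norm_def by linarith
  qed
  obtain k where k: "strict_mono k" "\<And>i. \<exists>l. (\<lambda>j. trunc (\<zeta> (k j)) i) \<longlonglongrightarrow> l"
    using function_convergent_subsequence[of UNIV "\<lambda>j. trunc (\<zeta> j)" R] bound by auto
  then obtain y where y: "\<And>i. (\<lambda>j. trunc (\<zeta> (k j)) i) \<longlonglongrightarrow> y i" by metis
  have sl: "(\<lambda>j. slope h (trunc (\<zeta> (k j))) i) \<longlonglongrightarrow> slope h y i" for i
    unfolding slope_def using \<open>h > 0\<close> by (intro tendsto_intros y) auto
  have sb: "\<bar>slope h (trunc (\<zeta> j)) i\<bar> \<le> 2 * R / h" for i j
  proof -
    have "\<bar>trunc (\<zeta> j) i - trunc (\<zeta> j) (Suc i)\<bar> \<le> 2 * R" using bound[of j i] bound[of j "Suc i"] unfolding real_norm_def by linarith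
    then show ?thesis unfolding slope_def abs_divide using \<open>h > 0\<close> by (simp add: divide_right_mono)
  qed
  have yb: "\<bar>slope h y i\<bar> \<le> 2 * R / h" for i
    using tendsto_upperbound[OF tendsto_rabs[OF sl[of i]], of "2 * R / h"] sb by auto
  have y0: "y 0 = x"
    using LIMSEQ_unique[OF y[of 0]] \<zeta>(1) by (auto simp: Z_def trunc_def)
  have "(\<lambda>j. A (\<zeta> (k j))) \<longlonglongrightarrow> A y"
  proof -
    have "(\<lambda>j. Actv a 0 (polygon h (trunc (\<zeta> (k j)))) (\<lambda>s. slope h (trunc (\<zeta> (k j))) (cell h s)))
       \<longlonglongrightarrow> Actv a 0 (polygon h y) (\<lambda>s. slope h y (cell h s))"
    proof (rule Actv_tendsto[where N = "{}" and L = "2 * R / h"])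
      show "continuous_on {a..0} (polygon h (trunc (\<zeta> (k j))))" for j by (rule velocity_continuous[OF vel])
      show "(\<lambda>j. polygon h (trunc (\<zeta> (k j))) s) \<longlonglongrightarrow> polygon h y s" for s
        unfolding polygon_def by (intro tendsto_intros y sl)
    qed (use sb sl slope_cell_measurable in auto)
    moreover have "Actv a 0 (polygon h y) (\<lambda>s. slope h y (cell h s)) = A y"
      unfolding A_def by (rule Act_eq_Actv[symmetric, OF polygon_velocity[OF \<open>h > 0\<close> yb order_refl]])
    moreover have "Actv a 0 (polygon h (trunc (\<zeta> (k j)))) (\<lambda>s. slope h (trunc (\<zeta> (k j))) (cell h s)) = A (\<zeta> (k j))" for j
      using Act_eq_Actv[OF vel] At unfolding A_def by simp
    ultimately show ?thesis by simp
  qed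
  moreover have "(\<lambda>j. A (\<zeta> (k j))) \<longlonglongrightarrow> I"
  proof (rule tendsto_sandwich)
    show "\<forall>\<^sub>F j in sequentially. I \<le> A (\<zeta> (k j))" using Ile \<zeta>(1) by simp
    show "\<forall>\<^sub>F j in sequentially. A (\<zeta> (k j)) \<le> I + 1 / real (Suc (k j))" using \<zeta>(2) less_imp_le by (intro always_eventually) blast
    have "(\<lambda>j. I + 1 / real (Suc j)) \<longlonglongrightarrow> I + 0" by (intro tendsto_intros LIMSEQ_Suc[OF lim_1_over_n])
    then show "(\<lambda>j. I + 1 / real (Suc (k j))) \<longlonglongrightarrow> I"
      using LIMSEQ_subseq_LIMSEQ[OF _ k(1), of "\<lambda>j. I + 1 / real (Suc j)" I] by (simp add: o_def)
  qed simp
  ultimately have "A y = I" by (rule LIMSEQ_unique)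
  then have "\<forall>z. z 0 = x \<longrightarrow> A y \<le> A z" using Ile unfolding Z_def by auto
  then show ?thesis using y0 yb unfolding A_def a_def by blast
qed

end

section \<open>Uniform bounds for minimal polygons\<close>

lemma polygon_abs_bound:
  assumes "h > 0" "s \<le> 0" and B: "\<And>i. \<bar>y i\<bar> \<le> B"
  shows "\<bar>polygon h y s\<bar> \<le> B"
proof -
  let ?i = "cell h s"
  define \<theta> where "\<theta> = (- s - real ?i * h) / h"
  note b = cell_bounds[OF assms(1,2)]
  have \<theta>: "0 \<le> \<theta>" "\<theta> \<le> 1" using b \<open>h > 0\<close> unfolding \<theta>_def by (auto simp: field_simps)
  have "polygon h y s = (1 - \<theta>) * y ?i + \<theta> * y (Suc ?i)"
    unfolding polygon_def slope_def \<theta>_def using \<open>h > 0\<close> by (simp add: field_simps)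
  also have "\<bar>\<dots>\<bar> \<le> (1 - \<theta>) * B + \<theta> * B"
    using \<theta> B[of ?i] B[of "Suc ?i"] by (intro order_trans[OF abs_triangle_ineq] add_mono) (auto simp: abs_mult intro!: mult_left_mono)
  finally show ?thesis by (simp add: algebra_simps)
qed

lemma mean_bound:
  fixes f :: "real \<Rightarrow> real"
  assumes "h > 0" "f integrable_on {p..p + h}" and "\<And>x. x \<in> {p..p + h} \<Longrightarrow> \<bar>f x - K\<bar> \<le> e"
  shows "\<bar>integral {p..p + h} f / h - K\<bar> \<le> e"
proof -
  have "integral {p..p + h} f \<le> integral {p..p + h} (\<lambda>_. K + e)"
    by (rule integral_le) (use assms in \<open>auto intro!: integrable_const_ivl simp: abs_le_iff\<close>, force simp: algebra_simps)
  moreover have "integral {p..p + h} (\<lambda>_. K - e) \<le> integral {p..p + h} f"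
    by (rule integral_le) (use assms in \<open>auto intro!: integrable_const_ivl simp: abs_le_iff\<close>, force simp: algebra_simps)
  ultimately have "integral {p..p + h} f \<le> (K + e) * h" "(K - e) * h \<le> integral {p..p + h} f"
    using \<open>h > 0\<close> by (simp_all add: mult.commute)
  then have "integral {p..p + h} f / h \<le> K + e" "K - e \<le> integral {p..p + h} f / h"
    using \<open>h > 0\<close> by (simp_all add: pos_divide_le_eq pos_le_divide_eq)
  then show ?thesis by (simp add: abs_le_iff)
qed

context forced_lagrangian begin

definition minimal_polygon :: "real \<Rightarrow> nat \<Rightarrow> (nat \<Rightarrow> real) \<Rightarrow> bool" where
  "minimal_polygon h N y \<longleftrightarrow> (\<exists>V. \<forall>i. \<bar>slope h y i\<bar> \<le> V) \<and>
    (\<forall>z. z 0 = y 0 \<longrightarrow> Act (- (real N * h)) 0 (polygon h y) \<le> Act (- (real N * h)) 0 (polygon h z))"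

context
  fixes h :: real and N :: nat and y :: "nat \<Rightarrow> real"
  assumes h: "h > 0" and miny: "minimal_polygon h N y"
begin

lemma minpoly_velocity: "b \<le> 0 \<Longrightarrow> velocity a b (polygon h y) (\<lambda>s. slope h y (cell h s))"
  using miny polygon_velocity[OF h] unfolding minimal_polygon_def by blast

text \<open>Nodes between \<open>i0\<close> and \<open>i1\<close> may be moved freely, and the earlier part of the polygon may be shifted by an
  integer without changing its action.\<close>

lemma minpoly_compare:
  assumes "i0 < i1" "i1 \<le> N" "z i0 = y i0" "z i1 = y i1 + of_int k"
  shows "Act (- (real i1 * h)) (- (real i0 * h)) (polygon h y) \<le> Act (- (real i1 * h)) (- (real i0 * h)) (polygon h z)"
proof -
  obtain V where V: "\<And>i. \<bar>slope h y i\<bar> \<le> V" using miny unfolding minimal_polygon_def by auto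
  have V0: "V \<ge> 0" using V[of 0] by linarith
  (* At times before node i1, that is for larger indices, the competitor is y shifted by k. *)
  define z' where "z' i = (if i \<le> i0 then y i else if i \<le> i1 then z i else y i + of_int k)" for i
  define V' where "V' = V + (\<Sum>j\<le>N. \<bar>slope h z' j\<bar>)"
  have V': "\<bar>slope h z' i\<bar> \<le> V'" for i
  proof (cases "i \<le> N")
    case True
    then have "\<bar>slope h z' i\<bar> \<le> (\<Sum>j\<le>N. \<bar>slope h z' j\<bar>)" by (intro member_le_sum) auto
    then show ?thesis unfolding V'_def using V0 by linarith
  next
    case False
    then have "slope h z' i = slope h y i" unfolding slope_def z'_def using assms(1,2) by auto
    moreover have "0 \<le> (\<Sum>j\<le>N. \<bar>slope h z' j\<bar>)" by (rule sum_nonneg) simp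
    moreover have "\<bar>slope h z' i\<bar> \<le> V" using V[of i] \<open>slope h z' i = slope h y i\<close> by simp
    ultimately show ?thesis unfolding V'_def by linarith
  qed
  let ?N = "- (real N * h)" and ?a = "- (real i1 * h)" and ?b = "- (real i0 * h)"
  have ord: "?N \<le> ?a" "?a \<le> ?b" "?b \<le> 0" using assms h by (auto intro: mult_right_mono)
  have split: "Act ?N 0 (polygon h u) = Act ?N ?a (polygon h u) + Act ?a ?b (polygon h u) + Act ?b 0 (polygon h u)"
    if "\<And>i. \<bar>slope h u i\<bar> \<le> W" for u W
    using Act_combine[OF polygon_lipschitz[OF h that, where a = "?N"], of ?a]
      Act_combine[OF polygon_lipschitz[OF h that, where a = "?a"], of ?b] ord by auto
  have "z' 0 = y 0" unfolding z'_def by simp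
  then have "Act ?N 0 (polygon h y) \<le> Act ?N 0 (polygon h z')" using miny unfolding minimal_polygon_def by blast
  moreover have "Act ?b 0 (polygon h z') = Act ?b 0 (polygon h y)"
    by (rule Act_cong, rule polygon_local[OF h, of 0 i0]) (auto simp: z'_def)
  moreover have "Act ?a ?b (polygon h z') = Act ?a ?b (polygon h z)"
    by (rule Act_cong, rule polygon_local[OF h, of i0 i1]) (use ord assms in \<open>auto simp: z'_def\<close>)
  moreover have "Act ?N ?a (polygon h z') = Act ?N ?a (polygon h y)"
  proof (rule Act_shift_cong)
    fix s assume s: "s \<in> {?N<..<?a}"
    have "polygon h z' s = polygon h (\<lambda>i. y i + of_int k) s"
      by (rule polygon_local[OF h, of i1 N]) (use ord s assms in \<open>auto simp: z'_def\<close>)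
    then show "polygon h z' s = polygon h y s + of_int k" by (simp add: polygon_shift)
  qed (use ord in linarith)
  ultimately show ?thesis using split[OF V] split[OF V'] by linarith
qed

abbreviation (input) "gmean i \<equiv> integral {- (real (Suc i) * h)..- (real i * h)} (\<lambda>s. g s (polygon h y s)) / h"

lemma g_polygon_integrable: "b \<le> 0 \<Longrightarrow> (\<lambda>s. g s (polygon h y s)) integrable_on {a..b}"
  by (intro integrable_continuous_interval continuous_on_g velocity_continuous[OF minpoly_velocity])

text \<open>The first variation in the direction of the trapezoid that is \<open>1\<close> between the cells \<open>j\<close> and \<open>i\<close> and decreases to
  \<open>0\<close> on these cells. It compares the discrete momenta, slope minus mean force, of the two cells.\<close>

lemma minpoly_euler_lagrange:
  assumes ij: "i < j" "Suc j \<le> N" and A: "A \<le> - (real (Suc j) * h)"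
  defines "a \<equiv> - (real (Suc j) * h)" and "b \<equiv> - (real i * h)"
  shows "\<bar>slope h y j - slope h y i\<bar> \<le> \<bar>gmean j - gmean i\<bar> + \<Gamma> A * integral {a..b} (\<lambda>s. \<bar>slope h y (cell h s)\<bar>)"
proof -
  (* The slopes of \<eta> vanish except on the cells i and j. *)
  define \<eta> where "\<eta> l = (if i < l \<and> l \<le> j then 1 else 0 :: real)" for l
  let ?c = "polygon h y" and ?v = "\<lambda>s. slope h y (cell h s)" and ?\<phi> = "polygon h \<eta>" and ?w = "\<lambda>s. slope h \<eta> (cell h s)"
  define p where "p = - (real j * h)"
  define q where "q = - (real (Suc i) * h)"
  have ord: "a \<le> p" "p \<le> q" "q \<le> b" "b \<le> 0" "a \<le> b"
    using ij h unfolding a_def b_def p_def q_def by (auto intro!: mult_right_mono)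
  have \<eta>s: "slope h \<eta> i = - 1 / h" "slope h \<eta> j = 1 / h" "\<And>l. i < l \<Longrightarrow> l < j \<Longrightarrow> slope h \<eta> l = 0"
    using ij unfolding slope_def \<eta>_def by auto
  have \<eta>b: "\<bar>slope h \<eta> l\<bar> \<le> 1 / h" for l unfolding slope_def \<eta>_def using h by auto
  have cv: "velocity a b ?c ?v" by (rule minpoly_velocity[OF ord(4)])
  have \<phi>v: "velocity a b ?\<phi> ?w" by (rule polygon_velocity[OF h \<eta>b ord(4)])
  have fv: "integral {a..b} (\<lambda>s. (?v s - g s (?c s)) * ?w s - ?v s * gx s (?c s) * ?\<phi> s) = 0"
  proof (rule first_variation[OF ord(5,4) cv \<phi>v])
    fix \<epsilon> :: real
    have "Act a b ?c \<le> Act a b (polygon h (\<lambda>i. y i + \<epsilon> * \<eta> i))"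
      unfolding a_def b_def by (rule minpoly_compare[where k = 0]) (use ij in \<open>auto simp: \<eta>_def\<close>)
    then show "Act a b ?c \<le> Act a b (\<lambda>s. ?c s + \<epsilon> * ?\<phi> s)" by (simp add: polygon_add[abs_def])
  qed
  let ?F = "\<lambda>s. (?v s - g s (?c s)) * ?w s"
  obtain V where V: "\<And>i. \<bar>slope h y i\<bar> \<le> V" using miny unfolding minimal_polygon_def by auto
  have V0: "V \<ge> 0" using V[of 0] by linarith
  have cc: "continuous_on {a..b} ?c" and \<phi>c: "continuous_on {a..b} ?\<phi>" using cv \<phi>v velocity_continuous by blast+
  note [measurable] = borel_measurable_lebesgue_on_Icc[OF velocity_measurable[OF cv], of a b]
      borel_measurable_lebesgue_on_Icc[OF velocity_measurable[OF \<phi>v], of a b]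
      continuous_on_measurable_Icc[OF continuous_on_g(1)[OF cc ord(4)]]
      continuous_on_measurable_Icc[OF continuous_on_g(2)[OF cc ord(4)]]
      continuous_on_measurable_Icc[OF \<phi>c]
  have Fi: "?F integrable_on {a..b}"
  proof (rule bounded_measurable_integrable_on)
    show "?F \<in> borel_measurable (lebesgue_on {a..b})" by measurable
    fix x assume x: "x \<in> {a..b}"
    then have "\<bar>?v x - g x (?c x)\<bar> \<le> V + \<Gamma> a" using V[of "cell h x"] g_bound[of a x "?c x"] ord by auto
    then show "\<bar>?F x\<bar> \<le> (V + \<Gamma> a) * (1 / h)" unfolding abs_mult using \<eta>b V0 \<Gamma>_nonneg[of a] by (intro mult_mono) auto
  qed
  have vi: "(\<lambda>s. \<bar>?v s\<bar>) integrable_on {a..b}" by (rule velocity_abs_integral(1)[OF cv ord(5,4)])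
  have gb: "\<bar>?v x * gx x (?c x) * ?\<phi> x\<bar> \<le> \<Gamma> A * \<bar>?v x\<bar>" if x: "x \<in> {a..b}" for x
  proof -
    have "\<bar>?\<phi> x\<bar> \<le> 1" using polygon_abs_bound[OF h, of x \<eta> 1] x ord unfolding \<eta>_def by auto
    then have "\<bar>?v x * gx x (?c x) * ?\<phi> x\<bar> \<le> \<bar>?v x\<bar> * \<Gamma> A * 1" unfolding abs_mult
      using gx_bound[of A x "?c x"] x ord A[folded a_def] \<Gamma>_nonneg[of A] by (intro mult_mono) auto
    then show ?thesis by (simp add: mult.commute)
  qed
  have Gi: "(\<lambda>s. ?v s * gx s (?c s) * ?\<phi> s) integrable_on {a..b}"
  proof (rule bounded_measurable_integrable_on)
    show "(\<lambda>s. ?v s * gx s (?c s) * ?\<phi> s) \<in> borel_measurable (lebesgue_on {a..b})" by measurable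
    show "\<bar>?v x * gx x (?c x) * ?\<phi> x\<bar> \<le> \<Gamma> A * V" if "x \<in> {a..b}" for x
      using gb[OF that] V[of "cell h x"] \<Gamma>_nonneg[of A] by (meson mult_left_mono order_trans)
  qed
  have "\<bar>integral {a..b} (\<lambda>s. ?v s * gx s (?c s) * ?\<phi> s)\<bar> \<le> integral {a..b} (\<lambda>s. \<Gamma> A * \<bar>?v s\<bar>)"
    using integral_norm_bound_integral[OF Gi integrable_on_mult_right[OF vi]] gb by simp
  then have bd: "\<bar>integral {a..b} (\<lambda>s. ?v s * gx s (?c s) * ?\<phi> s)\<bar> \<le> \<Gamma> A * integral {a..b} (\<lambda>s. \<bar>?v s\<bar>)" by simp
  have "integral {a..b} ?F = integral {a..b} (\<lambda>s. ?v s * gx s (?c s) * ?\<phi> s)"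
    using fv integral_diff[OF Fi Gi] by simp
  moreover have "integral {a..b} ?F = (slope h y j - gmean j) - (slope h y i - gmean i)"
  proof -
    have c1: "integral {- (real (Suc l) * h)..- (real l * h)} ?F = slope h \<eta> l * h * (slope h y l - gmean l)" for l
    proof -
      let ?p = "- (real (Suc l) * h)" and ?q = "- (real l * h)"
      have pq: "?p \<le> ?q" "?q - ?p = h" "?q \<le> 0" using h by (auto simp: algebra_simps)
      have "integral {?p..?q} ?F = integral {?p..?q} (\<lambda>s. slope h \<eta> l * (slope h y l - g s (?c s)))"
      proof (rule integral_spike[of "{?p}"])
        fix x assume "x \<in> {?p..?q} - {?p}"
        then have "cell h x = l" by (intro cell_eq[OF h]) auto
        then show "slope h \<eta> l * (slope h y l - g x (?c x)) = ?F x" by simp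
      qed simp
      also have "\<dots> = slope h \<eta> l * integral {?p..?q} (\<lambda>s. slope h y l - g s (?c s))" by simp
      also have "integral {?p..?q} (\<lambda>s. slope h y l - g s (?c s)) = slope h y l * h - integral {?p..?q} (\<lambda>s. g s (?c s))"
        using pq by (subst integral_diff[OF integrable_const_ivl g_polygon_integrable]) (auto simp: mult.commute)
      also have "slope h \<eta> l * (slope h y l * h - integral {?p..?q} (\<lambda>s. g s (?c s))) = slope h \<eta> l * h * (slope h y l - gmean l)"
        using h by (simp add: field_simps)
      finally show ?thesis .
    qed
    have mid: "integral {p..q} ?F = integral {p..q} (\<lambda>_. 0)"
    proof (rule integral_spike[of "{p}"])
      fix x assume x: "x \<in> {p..q} - {p}"
      note cb = cell_bounds[OF h, of x]
      have "x \<le> 0" using x ord by auto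
      have "real (cell h x) * h < real j * h" using cb(2)[OF \<open>x \<le> 0\<close>] x unfolding p_def by auto
      then have "cell h x < j" using h by simp
      have "real (Suc i) * h < real (Suc (cell h x)) * h" using cb(1)[OF \<open>x \<le> 0\<close>] x unfolding q_def by auto
      then have "i < cell h x" using h by (simp add: mult_less_cancel_right)
      then show "0 = ?F x" using \<eta>s(3) \<open>cell h x < j\<close> by simp
    qed simp
    have "integral {a..b} ?F = integral {a..p} ?F + integral {p..q} ?F + integral {q..b} ?F"
    proof -
      have "integral {a..b} ?F = integral {a..p} ?F + integral {p..b} ?F"
        using ord by (intro Henstock_Kurzweil_Integration.integral_combine[symmetric] Fi) auto
      moreover have "integral {p..b} ?F = integral {p..q} ?F + integral {q..b} ?F"
        using ord by (intro Henstock_Kurzweil_Integration.integral_combine[symmetric] integrable_subinterval_real[OF Fi]) auto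
      ultimately show ?thesis by simp
    qed
    then show ?thesis using c1[of j] c1[of i] mid \<eta>s(1,2) h unfolding a_def b_def p_def q_def by simp
  qed
  ultimately show ?thesis using bd by linarith
qed

end

text \<open>In space \<open>g\<close> is periodic, so that a compact set of arguments suffices.\<close>

lemma g_uniform:
  assumes "e > 0"
  shows "\<exists>d>0. \<forall>s\<in>{a..0}. \<forall>s'\<in>{a..0}. \<forall>x x'. \<bar>s - s'\<bar> < d \<longrightarrow> \<bar>x - x'\<bar> < d \<longrightarrow> \<bar>g s x - g s' x'\<bar> < e"
proof -
  have "uniformly_continuous_on ({a..0} \<times> {-1..2}) (\<lambda>p. g (fst p) (snd p))"
    by (rule compact_uniformly_continuous[OF continuous_on_subset[OF g_cont]]) (auto intro: compact_Times)
  then obtain d where d: "d > 0" "\<And>p p'. p \<in> {a..0} \<times> {-1..2} \<Longrightarrow> p' \<in> {a..0} \<times> {-1..2} \<Longrightarrow> dist p' p < d \<Longrightarrow>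
      dist (g (fst p') (snd p')) (g (fst p) (snd p)) < e"
    using assms unfolding uniformly_continuous_on_def by metis
  define d' where "d' = min (d / 2) 1"
  have "\<bar>g s x - g s' x'\<bar> < e" if *: "s \<in> {a..0}" "s' \<in> {a..0}" "\<bar>s - s'\<bar> < d'" "\<bar>x - x'\<bar> < d'" for s s' x x'
  proof -
    define k where "k = - \<lfloor>x\<rfloor>"
    have x: "0 \<le> x + of_int k" "x + of_int k \<le> 1" unfolding k_def by linarith+
    have x': "- 1 \<le> x' + of_int k" "x' + of_int k \<le> 2" using x *(4) unfolding d'_def by linarith+
    have "dist (s, x + of_int k) (s', x' + of_int k) \<le> \<bar>s - s'\<bar> + \<bar>x - x'\<bar>"
      unfolding dist_Pair_Pair dist_real_def using sqrt_sum_squares_le_sum_abs[of "\<bar>s - s'\<bar>" "\<bar>x - x'\<bar>"] by simp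
    also have "\<dots> < d" using * unfolding d'_def by simp
    finally have "dist (g s (x + of_int k)) (g s' (x' + of_int k)) < e"
      using d(2)[of "(s', x' + of_int k)" "(s, x + of_int k)"] *(1,2) x x' by auto
    then show ?thesis using g_int[of s x k] g_int[of s' x' k] * by (simp add: dist_real_def)
  qed
  then show ?thesis using d(1) by (intro exI[of _ d']) (auto simp: d'_def)
qed

text \<open>The first three of these quantities bound, for a minimal polygon of mesh \<open>1 / n\<close> with \<open>m < n\<close> on the unit
  interval \<open>{- (m + 1)..- m}\<close>, the integral of the squared slope, the integral of its absolute value, and the
  slope itself; \<open>speed_bound m\<close> bounds the slope on \<open>{- m..0}\<close>. They do not depend on \<open>n\<close>.\<close>

definition energy_bound :: "nat \<Rightarrow> real" where
  "energy_bound m = 4 * (1 / 2 + \<Gamma> (- real (Suc m)) + (\<Gamma> (- real (Suc m)))\<^sup>2)"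

definition mass_bound :: "nat \<Rightarrow> real" where "mass_bound m = (1 + energy_bound m) / 2"

definition unit_speed_bound :: "nat \<Rightarrow> real" where
  "unit_speed_bound m = 2 * \<Gamma> (- real (Suc m)) + \<Gamma> (- real (Suc m)) * mass_bound m + mass_bound m"

definition speed_bound :: "nat \<Rightarrow> real" where "speed_bound m = (\<Sum>k<m. unit_speed_bound k)"

lemma bounds_nonneg: "0 \<le> energy_bound m" "0 \<le> mass_bound m" "0 \<le> unit_speed_bound m" "0 \<le> speed_bound m"
  unfolding speed_bound_def unit_speed_bound_def mass_bound_def energy_bound_def
  using \<Gamma>_nonneg by (auto intro!: sum_nonneg add_nonneg_nonneg mult_nonneg_nonneg)

context
  fixes n :: nat and y :: "nat \<Rightarrow> real" and h :: real
  assumes n: "n > 0" and hn: "h = 1 / real n" and miny: "minimal_polygon h (n * n) y"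
begin

lemma h_pos: "h > 0" using n hn by simp

lemma node_int: "real (m * n) * h = real m" using n hn by simp

text \<open>Compare with the straight line between the end points on the unit interval, after a shift by an integer that
  makes its slope at most \<open>1\<close>.\<close>

lemma minpoly_mass:
  assumes "Suc m \<le> n"
  shows "integral {- real (Suc m)..- real m} (\<lambda>s. \<bar>slope h y (cell h s)\<bar>) \<le> mass_bound m"
proof -
  let ?a = "- real (Suc m)" and ?b = "- real m" and ?v = "\<lambda>s. slope h y (cell h s)"
  let ?i0 = "m * n" and ?i1 = "Suc m * n"
  define k where "k = - \<lfloor>y ?i1 - y ?i0\<rfloor>"
  define D where "D = y ?i1 + of_int k - y ?i0"
  have D: "0 \<le> D" "D \<le> 1" unfolding D_def k_def by linarith+
  define z where "z i = y ?i0 + (real i - real ?i0) * h * D" for i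
  have sz: "slope h z i = - D" for i unfolding slope_def z_def using h_pos by (simp add: field_simps)
  have "z ?i1 = y ?i1 + of_int k"
  proof -
    have "(real ?i1 - real ?i0) * h = 1" using node_int[of "Suc m"] node_int[of m] by (simp only: left_diff_distrib)
    then show ?thesis unfolding z_def D_def by simp
  qed
  moreover have "?i1 \<le> n * n" using assms by (intro mult_le_mono1)
  ultimately have "Act (- (real ?i1 * h)) (- (real ?i0 * h)) (polygon h y) \<le> Act (- (real ?i1 * h)) (- (real ?i0 * h)) (polygon h z)"
    using n by (intro minpoly_compare[OF h_pos miny, where k = k]) (auto simp: z_def)
  then have "Act ?a ?b (polygon h y) \<le> Act ?a ?b (polygon h z)" unfolding node_int .
  also have "Act ?a ?b (polygon h z) = Actv ?a ?b (polygon h z) (\<lambda>s. - D)"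
    using Act_eq_Actv[OF polygon_velocity[OF h_pos, of z "D" ?b ?a]] D by (simp add: sz)
  also have "\<dots> \<le> integral {?a..?b} (\<lambda>_. 1 / 2 + \<Gamma> ?a)" unfolding Actv_def
  proof (rule integral_le)
    have "continuous_on {?a..?b} (polygon h z)"
      by (rule velocity_continuous[OF polygon_velocity[OF h_pos, of z D]]) (use D in \<open>auto simp: sz\<close>)
    then show "(\<lambda>s. (- D)\<^sup>2 / 2 - - D * g s (polygon h z s)) integrable_on {?a..?b}"
      using D by (intro Lag_integrable[where L = 1]) auto
    fix x assume x: "x \<in> {?a..?b}"
    have "D\<^sup>2 \<le> 1" using D by (simp add: power_le_one)
    moreover have "\<bar>D * g x (polygon h z x)\<bar> \<le> 1 * \<Gamma> ?a"
      unfolding abs_mult using D g_bound[of ?a x "polygon h z x"] x by (intro mult_mono) auto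
    then have "D * g x (polygon h z x) \<le> \<Gamma> ?a" by linarith
    ultimately show "(- D)\<^sup>2 / 2 - - D * g x (polygon h z x) \<le> 1 / 2 + \<Gamma> ?a" by simp
  qed (rule integrable_const_ivl)
  finally have A: "Act ?a ?b (polygon h y) \<le> 1 / 2 + \<Gamma> ?a" by simp
  have v: "velocity ?a ?b (polygon h y) ?v" by (rule minpoly_velocity[OF h_pos miny]) simp
  have "integral {?a..?b} (\<lambda>s. (?v s)\<^sup>2) \<le> energy_bound m"
    using Act_lower(2)[OF v] A unfolding energy_bound_def by simp
  then show ?thesis using velocity_abs_integral(2)[OF v] unfolding mass_bound_def by simp
qed

lemma unit_cell:
  assumes "- real (Suc m) < s" "s \<le> - real m"
  shows "m * n \<le> cell h s" "cell h s < Suc m * n"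
proof -
  have "s \<le> 0" using assms by linarith
  note b = cell_bounds[OF h_pos this]
  have "real (m * n) * h < real (Suc (cell h s)) * h" using b assms unfolding node_int by linarith
  then have "m * n < Suc (cell h s)" using h_pos by (simp only: mult_less_cancel_right_pos of_nat_less_iff)
  then show "m * n \<le> cell h s" by simp
  have "real (cell h s) * h < real (Suc m * n) * h" using b assms unfolding node_int by linarith
  then show "cell h s < Suc m * n" using h_pos by (simp only: mult_less_cancel_right_pos of_nat_less_iff)
qed

lemma gmean_bound:
  assumes "Suc i \<le> Suc m * n"
  shows "\<bar>integral {- (real (Suc i) * h)..- (real i * h)} (\<lambda>s. g s (polygon h y s)) / h\<bar> \<le> \<Gamma> (- real (Suc m))"
proof -
  have "real (Suc i) * h \<le> real (Suc m * n) * h" using assms h_pos by (intro mult_right_mono) (auto simp del: of_nat_Suc of_nat_mult)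
  then have le: "- real (Suc m) \<le> - (real (Suc i) * h)" unfolding node_int by simp
  have eq: "- (real i * h) = - (real (Suc i) * h) + h" by (simp add: algebra_simps)
  have "\<bar>integral {- (real (Suc i) * h)..- (real (Suc i) * h) + h} (\<lambda>s. g s (polygon h y s)) / h - 0\<bar> \<le> \<Gamma> (- real (Suc m))"
  proof (rule mean_bound[OF h_pos])
    have "- (real (Suc i) * h) + h \<le> 0" using h_pos by (simp add: algebra_simps)
    then show "(\<lambda>s. g s (polygon h y s)) integrable_on {- (real (Suc i) * h)..- (real (Suc i) * h) + h}"
      by (rule g_polygon_integrable[OF h_pos miny])
    fix x assume "x \<in> {- (real (Suc i) * h)..- (real (Suc i) * h) + h}"
    then show "\<bar>g x (polygon h y x) - 0\<bar> \<le> \<Gamma> (- real (Suc m))"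
      using le \<open>- (real (Suc i) * h) + h \<le> 0\<close> g_bound[of "- real (Suc m)" x "polygon h y x"] by auto
  qed
  then show ?thesis unfolding eq by simp
qed

text \<open>By the discrete Euler-Lagrange equation the slope varies by a bounded amount over the unit interval, and its mean
  absolute value is bounded.\<close>

lemma minpoly_speed_unit:
  assumes "Suc m \<le> n" "m * n \<le> i" "i < Suc m * n"
  shows "\<bar>slope h y i\<bar> \<le> unit_speed_bound m"
proof -
  let ?a = "- real (Suc m)" and ?b = "- real m" and ?v = "\<lambda>s. slope h y (cell h s)"
  let ?B = "2 * \<Gamma> ?a + \<Gamma> ?a * mass_bound m"
  have v: "velocity ?a ?b (polygon h y) ?v" by (rule minpoly_velocity[OF h_pos miny]) simp
  have vi: "(\<lambda>s. \<bar>?v s\<bar>) integrable_on {a'..b'}" for a' b' by (rule velocity_abs_integral(1)[OF v]) auto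
  have diff: "\<bar>slope h y j - slope h y i\<bar> \<le> ?B" if ij: "m * n \<le> i" "i < j" "j < Suc m * n" for i j
  proof -
    let ?p = "- (real (Suc j) * h)" and ?q = "- (real i * h)"
    have "real (Suc j) * h \<le> real (Suc m * n) * h" using ij h_pos by (intro mult_right_mono) (auto simp del: of_nat_Suc of_nat_mult)
    then have p: "?a \<le> ?p" unfolding node_int by simp
    have "real (m * n) * h \<le> real i * h" using ij h_pos by (intro mult_right_mono) (auto simp del: of_nat_mult)
    then have q: "?q \<le> ?b" unfolding node_int by simp
    have "Suc j \<le> Suc m * n" using ij by simp
    also have "\<dots> \<le> n * n" using assms(1) by (rule mult_le_mono1)
    finally have jN: "Suc j \<le> n * n" .
    have "integral {?p..?q} (\<lambda>s. \<bar>?v s\<bar>) \<le> integral {?a..?b} (\<lambda>s. \<bar>?v s\<bar>)"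
      by (rule integral_subset_le) (use p q vi in auto)
    then have "\<Gamma> ?a * integral {?p..?q} (\<lambda>s. \<bar>?v s\<bar>) \<le> \<Gamma> ?a * mass_bound m"
      using minpoly_mass[OF assms(1)] \<Gamma>_nonneg[of ?a] by (intro mult_left_mono) auto
    then show ?thesis
      using minpoly_euler_lagrange[OF h_pos miny ij(2) jN p] gmean_bound[of i m] gmean_bound[of j m] ij
      by linarith
  qed
  (* Averaging this over s bounds the slope by ?B and the mean absolute slope. *)
  have all: "\<bar>slope h y i\<bar> \<le> ?B + \<bar>?v s\<bar>" if "s \<in> {?a..?b}" "s \<noteq> ?a" for s
  proof -
    have c: "m * n \<le> cell h s" "cell h s < Suc m * n" using unit_cell[of m s] that by auto
    consider "cell h s = i" | "i < cell h s" | "cell h s < i" by linarith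
    then have "\<bar>slope h y (cell h s) - slope h y i\<bar> \<le> ?B"
    proof cases
      case 1
      then show ?thesis using \<Gamma>_nonneg bounds_nonneg by simp
    qed (use diff[of i "cell h s"] diff[of "cell h s" i] c assms in auto)
    then show ?thesis by linarith
  qed
  have "\<bar>slope h y i\<bar> = integral {?a..?b} (\<lambda>s. \<bar>slope h y i\<bar>)" by simp
  also have "\<dots> = integral {?a..?b} (\<lambda>s. if s = ?a then 0 else \<bar>slope h y i\<bar>)"
    by (rule integral_spike[of "{?a}"]) auto
  also have "\<dots> \<le> integral {?a..?b} (\<lambda>s. ?B + \<bar>?v s\<bar>)"
  proof (rule integral_le)
    show "(\<lambda>s. if s = ?a then 0 else \<bar>slope h y i\<bar>) integrable_on {?a..?b}"
      by (rule integrable_spike[of "\<lambda>s. \<bar>slope h y i\<bar>" _ "{?a}"]) (auto intro: integrable_const_ivl)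
    show "(\<lambda>s. ?B + \<bar>?v s\<bar>) integrable_on {?a..?b}" by (intro integrable_add vi integrable_const_ivl)
    fix s assume "s \<in> {?a..?b}"
    then show "(if s = ?a then 0 else \<bar>slope h y i\<bar>) \<le> ?B + \<bar>?v s\<bar>"
      using all[of s] \<Gamma>_nonneg bounds_nonneg by auto
  qed
  also have "\<dots> = ?B + integral {?a..?b} (\<lambda>s. \<bar>?v s\<bar>)"
    by (subst integral_add[OF integrable_const_ivl vi]) simp
  also have "\<dots> \<le> unit_speed_bound m" using minpoly_mass[OF assms(1)] unfolding unit_speed_bound_def by simp
  finally show ?thesis .
qed

lemma minpoly_speed:
  assumes "m \<le> n" "i < m * n"
  shows "\<bar>slope h y i\<bar> \<le> speed_bound m"
proof -
  define k where "k = i div n"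
  have k: "k < m" "k * n \<le> i" "i < Suc k * n"
    using assms n unfolding k_def by (auto simp: less_mult_imp_div_less dividend_less_div_times)
  have "\<bar>slope h y i\<bar> \<le> unit_speed_bound k" using k assms by (intro minpoly_speed_unit) auto
  also have "\<dots> \<le> speed_bound m" unfolding speed_bound_def using k bounds_nonneg by (intro member_le_sum) auto
  finally show ?thesis .
qed

lemma minpoly_speed_at:
  assumes "Suc m \<le> n" "s \<in> {- real m..0}"
  shows "\<bar>slope h y (cell h s)\<bar> \<le> speed_bound (Suc m)"
proof (rule minpoly_speed[OF assms(1)])
  have "s \<le> 0" using assms by simp
  have "real (cell h s) * h \<le> real (m * n) * h"
    using cell_bounds(2)[OF h_pos \<open>s \<le> 0\<close>] assms unfolding node_int by auto
  then have "cell h s \<le> m * n" using h_pos by (simp only: mult_le_cancel_right_pos of_nat_le_iff)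
  then show "cell h s < Suc m * n" using n by simp
qed

lemma minpoly_lipschitz:
  assumes "Suc m \<le> n" "s \<in> {- real m..0}" "t \<in> {- real m..0}"
  shows "\<bar>polygon h y s - polygon h y t\<bar> \<le> speed_bound (Suc m) * \<bar>s - t\<bar>"
proof -
  have *: "\<bar>polygon h y t - polygon h y s\<bar> \<le> speed_bound (Suc m) * (t - s)"
    if "s \<in> {- real m..0}" "t \<in> {- real m..0}" "s \<le> t" for s t
  proof (rule velocity_increment_bound[OF minpoly_velocity[OF h_pos miny order_refl, of "- real m"]])
    fix x assume "x \<in> {s..t}"
    then show "\<bar>slope h y (cell h x)\<bar> \<le> speed_bound (Suc m)" using that by (intro minpoly_speed_at[OF assms(1)]) auto
  qed (use that in auto)
  show ?thesis
  proof (cases "s \<le> t")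
    case True
    have "\<bar>polygon h y s - polygon h y t\<bar> = \<bar>polygon h y t - polygon h y s\<bar>" "\<bar>s - t\<bar> = t - s" using True by auto
    then show ?thesis using *[OF assms(2,3) True] by simp
  next
    case False
    then have "\<bar>s - t\<bar> = s - t" by simp
    then show ?thesis using *[OF assms(3,2)] False by simp
  qed
qed

text \<open>The discrete Euler-Lagrange equation over a short interval: the mean forces of nearby cells differ little by the
  uniform continuity of \<open>g\<close>, and the remaining integral is short. The term \<open>2 * h\<close> accounts for the cells that
  contain \<open>s\<close> and \<open>t\<close>.\<close>

lemma minpoly_equicontinuous:
  assumes m: "Suc (Suc m) \<le> n" and s: "s \<in> {- real m..0}" "t \<in> {- real m..0}"
    and g: "\<And>u u' x x'. u \<in> {- real (Suc m)..0} \<Longrightarrow> u' \<in> {- real (Suc m)..0} \<Longrightarrow> \<bar>u - u'\<bar> < d \<Longrightarrow> \<bar>x - x'\<bar> < d \<Longrightarrow>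
      \<bar>g u x - g u' x'\<bar> < e"
    and d: "(1 + speed_bound (Suc (Suc m))) * (\<bar>s - t\<bar> + 2 * h) < d" and "e > 0"
  shows "\<bar>slope h y (cell h s) - slope h y (cell h t)\<bar>
    \<le> e + \<Gamma> (- real (Suc m)) * (speed_bound (Suc (Suc m)) * (\<bar>s - t\<bar> + 2 * h))"
proof -
  let ?R = "speed_bound (Suc (Suc m))" and ?v = "\<lambda>s. slope h y (cell h s)" and ?a = "- real (Suc m)"
  have R: "?R \<ge> 0" by (rule bounds_nonneg)
  have main: "\<bar>slope h y (cell h s) - slope h y (cell h t)\<bar> \<le> e + \<Gamma> ?a * (?R * (\<bar>s - t\<bar> + 2 * h))"
    if le: "cell h s \<le> cell h t" "s \<in> {- real m..0}" "t \<in> {- real m..0}" "(1 + ?R) * (\<bar>s - t\<bar> + 2 * h) < d" for s t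
  proof -
  let ?i = "cell h s" and ?j = "cell h t" and ?D = "\<bar>s - t\<bar> + 2 * h"
  have D: "0 \<le> ?D" using h_pos by simp
  show ?thesis
  proof (cases "?i = ?j")
    case True
    then show ?thesis using \<open>e > 0\<close> \<Gamma>_nonneg R D by simp
  next
    case False
    then have ij: "?i < ?j" using le(1) by simp
    have s0: "s \<le> 0" "t \<le> 0" "- real m \<le> t" using le by auto
    note cs = cell_bounds[OF h_pos s0(1)] and ct = cell_bounds[OF h_pos s0(2)]
    let ?p = "- (real (Suc ?j) * h)" and ?q = "- (real ?i * h)"
    have h1: "h \<le> 1" using n hn by simp
    have p: "?a \<le> ?p" using ct s0 h1 by (simp add: algebra_simps)
    have q: "?q \<le> 0" using h_pos by simp
    have len: "?q - ?p \<le> ?D" using cs ct by (auto simp: algebra_simps)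
    have pq: "?p \<le> ?q" using ij h_pos by (auto intro: mult_right_mono)
    have "real (Suc ?j) * h \<le> real (Suc m * n) * h" using p unfolding node_int by simp
    then have "Suc ?j \<le> Suc m * n" using h_pos by (simp only: mult_le_cancel_right_pos of_nat_le_iff)
    also have "\<dots> \<le> n * n" using m by (intro mult_le_mono1) simp
    finally have jN: "Suc ?j \<le> n * n" .
    have vel: "velocity ?p ?q (polygon h y) ?v" by (rule minpoly_velocity[OF h_pos miny q])
    have vb: "\<bar>?v u\<bar> \<le> ?R" if "u \<in> {?p..?q}" for u
      using that p q by (intro minpoly_speed_at[OF m]) auto
    have "integral {?p..?q} (\<lambda>u. \<bar>?v u\<bar>) \<le> integral {?p..?q} (\<lambda>_. ?R)"
      by (rule integral_le[OF velocity_abs_integral(1)[OF vel pq q] integrable_const_ivl]) (rule vb)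
    also have "\<dots> = ?R * (?q - ?p)" using pq by (simp add: mult.commute)
    also have "\<dots> \<le> ?R * ?D" using len R by (rule mult_left_mono)
    finally have I: "\<Gamma> ?a * integral {?p..?q} (\<lambda>u. \<bar>?v u\<bar>) \<le> \<Gamma> ?a * (?R * ?D)"
      using \<Gamma>_nonneg by (rule mult_left_mono)
    have close: "\<bar>g u (polygon h y u) - g u' (polygon h y u')\<bar> \<le> e" if u: "u \<in> {?p..?q}" "u' \<in> {?p..?q}" for u u'
    proof -
      have uu: "\<bar>u - u'\<bar> \<le> ?D" using u len by auto
      have um: "u \<in> {?a..0}" "u' \<in> {?a..0}" using u p q by auto
      have "\<bar>polygon h y u - polygon h y u'\<bar> \<le> ?R * \<bar>u - u'\<bar>" by (rule minpoly_lipschitz[OF m um])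
      also have "\<dots> \<le> ?R * ?D" using uu R by (rule mult_left_mono)
      also have "\<dots> \<le> (1 + ?R) * ?D" using D by (simp add: algebra_simps)
      also have "\<dots> < d" by (rule le)
      finally have 1: "\<bar>polygon h y u - polygon h y u'\<bar> < d" .
      have "?D \<le> (1 + ?R) * ?D" using mult_nonneg_nonneg[OF R D] by (simp add: distrib_right)
      then have "\<bar>u - u'\<bar> < d" using uu le by linarith
      then show ?thesis using g[OF um _ 1] by simp
    qed
    let ?gm = "\<lambda>l. integral {- (real (Suc l) * h)..- (real l * h)} (\<lambda>s. g s (polygon h y s)) / h"
    (* Along the polygon over {?p..?q} any two values of g are within e of each other, hence so are any two cell means. *)
    have mean: "\<bar>?gm l - K\<bar> \<le> e" if l: "?i \<le> l" "l \<le> ?j" and K: "\<And>u. u \<in> {?p..?q} \<Longrightarrow> \<bar>g u (polygon h y u) - K\<bar> \<le> e" for l K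
    proof -
      have eq: "- (real l * h) = - (real (Suc l) * h) + h" by (simp add: algebra_simps)
      have sub: "?p \<le> - (real (Suc l) * h)" "- (real l * h) \<le> ?q" using l h_pos by (auto intro!: mult_right_mono)
      have "\<bar>integral {- (real (Suc l) * h)..- (real (Suc l) * h) + h} (\<lambda>s. g s (polygon h y s)) / h - K\<bar> \<le> e"
      proof (rule mean_bound[OF h_pos])
        show "(\<lambda>s. g s (polygon h y s)) integrable_on {- (real (Suc l) * h)..- (real (Suc l) * h) + h}"
          by (rule g_polygon_integrable[OF h_pos miny]) (use eq h_pos in \<open>auto simp: algebra_simps\<close>)
        show "\<bar>g u (polygon h y u) - K\<bar> \<le> e" if "u \<in> {- (real (Suc l) * h)..- (real (Suc l) * h) + h}" for u
          using that sub eq by (intro K) auto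
      qed
      then show ?thesis unfolding eq .
    qed
    have m1: "\<bar>?gm ?i - g u (polygon h y u)\<bar> \<le> e" if "u \<in> {?p..?q}" for u
      using ij close that by (intro mean) auto
    have "\<bar>?gm ?j - ?gm ?i\<bar> \<le> e"
      using ij m1 by (intro mean) (auto simp: abs_minus_commute)
    then show ?thesis
      using minpoly_euler_lagrange[OF h_pos miny ij jN p] I abs_minus_commute[of "?v s" "?v t"] by linarith
  qed
  qed
  show ?thesis
  proof (cases "cell h s \<le> cell h t")
    case True
    then show ?thesis using main[OF True s d] by simp
  next
    case False
    have "\<bar>?v s - ?v t\<bar> = \<bar>?v t - ?v s\<bar>" by simp
    moreover have "\<bar>s - t\<bar> = \<bar>t - s\<bar>" by simp
    ultimately show ?thesis using main[of t s] False s d by simp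
  qed
qed

end
end

section \<open>Existence of minimal curves\<close>

text \<open>Arzela-Ascoli for functions that need not be continuous: their oscillation at small distances vanishes
  only in the limit \<open>n \<longlonglongrightarrow> \<infinity>\<close>. A diagonal sequence converges on the rationals, and
  asymptotic equicontinuity extends this to all points.\<close>

lemma limit_extraction:
  fixes vv :: "nat \<Rightarrow> real \<Rightarrow> real"
  assumes bnd: "\<And>m n s. Suc m \<le> n \<Longrightarrow> s \<in> {- real m..0} \<Longrightarrow> \<bar>vv n s\<bar> \<le> R m"
    and equi: "\<And>m e. e > 0 \<Longrightarrow> \<exists>\<rho>>0. \<exists>N. \<forall>n\<ge>N. \<forall>s\<in>{- real m..0}. \<forall>t\<in>{- real m..0}. \<bar>s - t\<bar> < \<rho> \<longrightarrow> \<bar>vv n s - vv n t\<bar> \<le> e"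
  shows "\<exists>k v. strict_mono (k :: nat \<Rightarrow> nat) \<and> (\<forall>s\<le>0. (\<lambda>j. vv (k j) s) \<longlonglongrightarrow> v s) \<and> continuous_on {..0} v"
proof -
  define M where "M s = nat \<lceil>- s\<rceil>" for s :: real
  have M: "s \<in> {- real (M s)..0}" if "s \<le> 0" for s
    using that real_nat_ceiling_ge[of "- s"] unfolding M_def atLeastAtMost_iff by linarith
  (* The diagonal extraction needs one bound for all functions and points; the bound R m depends on m. *)
  define f where "f n s = (if Suc (M s) \<le> n then vv n s / (\<bar>R (M s)\<bar> + 1) else 0)" for n s
  have fb: "norm (f n s) \<le> 1" if "s \<in> {..0} \<inter> \<rat>" for n s
    using bnd[of "M s" n s] M[of s] that unfolding f_def by (auto simp: abs_divide)
  have cnt: "countable ({..0::real} \<inter> \<rat>)" using countable_rat by (rule countable_subset[rotated]) auto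
  obtain k where k: "strict_mono k" "\<And>s. s \<in> {..0} \<inter> \<rat> \<Longrightarrow> \<exists>l. (\<lambda>n. f (k n) s) \<longlonglongrightarrow> l"
    using function_convergent_subsequence[OF cnt, of f 1] fb by blast
  have rat: "Cauchy (\<lambda>j. vv (k j) q)" if q: "q \<in> {..0} \<inter> \<rat>" for q
  proof -
    obtain l where "(\<lambda>n. f (k n) q) \<longlonglongrightarrow> l" using k(2)[OF q] by blast
    then have "(\<lambda>n. f (k n) q * (\<bar>R (M q)\<bar> + 1)) \<longlonglongrightarrow> l * (\<bar>R (M q)\<bar> + 1)" by (intro tendsto_intros)
    moreover have "eventually (\<lambda>n. f (k n) q * (\<bar>R (M q)\<bar> + 1) = vv (k n) q) sequentially"
    proof (rule eventually_sequentiallyI[of "Suc (M q)"])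
      fix n assume "Suc (M q) \<le> n"
      then have "Suc (M q) \<le> k n" using seq_suble[OF k(1), of n] by linarith
      then show "f (k n) q * (\<bar>R (M q)\<bar> + 1) = vv (k n) q" unfolding f_def by (simp add: add_nonneg_eq_0_iff)
    qed
    ultimately have "(\<lambda>n. vv (k n) q) \<longlonglongrightarrow> l * (\<bar>R (M q)\<bar> + 1)" by (rule Lim_transform_eventually)
    then show ?thesis by (rule LIMSEQ_imp_Cauchy)
  qed
  have cau: "Cauchy (\<lambda>j. vv (k j) s)" if s: "s \<le> 0" for s
  proof (rule metric_CauchyI)
    fix e :: real assume "e > 0"
    obtain \<rho> N where \<rho>: "\<rho> > 0"
      "\<forall>n\<ge>N. \<forall>u\<in>{- real (Suc (M s))..0}. \<forall>t\<in>{- real (Suc (M s))..0}. \<bar>u - t\<bar> < \<rho> \<longrightarrow> \<bar>vv n u - vv n t\<bar> \<le> e / 4"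
      using equi[of "e / 4" "Suc (M s)"] \<open>e > 0\<close> by auto
    obtain q where q: "q \<in> \<rat>" "s - min \<rho> 1 < q" "q < s" using Rats_dense_in_real[of "s - min \<rho> 1" s] \<rho>(1) by auto
    have qm: "q \<in> {- real (Suc (M s))..0}" "s \<in> {- real (Suc (M s))..0}" using q M[OF s] by auto
    obtain N' where N': "\<And>i j. i \<ge> N' \<Longrightarrow> j \<ge> N' \<Longrightarrow> dist (vv (k i) q) (vv (k j) q) < e / 4"
      using metric_CauchyD[OF rat, of q "e / 4"] q s \<open>e > 0\<close> by auto
    have "dist (vv (k i) s) (vv (k j) s) < e" if ij: "i \<ge> max N N'" "j \<ge> max N N'" for i j
    proof -
      have "k i \<ge> N" "k j \<ge> N" using seq_suble[OF k(1), of i] seq_suble[OF k(1), of j] ij by linarith+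
      then have "\<bar>vv (k i) s - vv (k i) q\<bar> \<le> e / 4" "\<bar>vv (k j) s - vv (k j) q\<bar> \<le> e / 4"
        using \<rho>(2) qm q by auto
      moreover have "\<bar>vv (k i) q - vv (k j) q\<bar> < e / 4" using N'[of i j] ij by (simp add: dist_real_def)
      ultimately show ?thesis using \<open>e > 0\<close> unfolding dist_real_def by linarith
    qed
    then show "\<exists>M. \<forall>m\<ge>M. \<forall>n\<ge>M. dist (vv (k m) s) (vv (k n) s) < e" by blast
  qed
  define v where "v s = lim (\<lambda>j. vv (k j) s)" for s
  have lim: "(\<lambda>j. vv (k j) s) \<longlonglongrightarrow> v s" if "s \<le> 0" for s
    unfolding v_def using cau[OF that] by (simp add: Cauchy_convergent_iff convergent_LIMSEQ_iff)
  have "continuous_on {..0} v"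
    unfolding continuous_on_iff
  proof (intro ballI allI impI)
    fix s e :: real assume s: "s \<in> {..0}" and "e > 0"
    obtain \<rho> N where \<rho>: "\<rho> > 0"
      "\<forall>n\<ge>N. \<forall>u\<in>{- real (Suc (M s))..0}. \<forall>t\<in>{- real (Suc (M s))..0}. \<bar>u - t\<bar> < \<rho> \<longrightarrow> \<bar>vv n u - vv n t\<bar> \<le> e / 2"
      using equi[of "e / 2" "Suc (M s)"] \<open>e > 0\<close> by auto
    have "dist (v t) (v s) < e" if t: "t \<in> {..0}" "dist t s < min \<rho> 1" for t
    proof -
      have tm: "t \<in> {- real (Suc (M s))..0}" "s \<in> {- real (Suc (M s))..0}"
        using M[of s] s t by (auto simp: dist_real_def)
      have "(\<lambda>j. \<bar>vv (k j) t - vv (k j) s\<bar>) \<longlonglongrightarrow> \<bar>v t - v s\<bar>" using lim s t by (intro tendsto_intros) auto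
      moreover have "\<bar>vv (k j) t - vv (k j) s\<bar> \<le> e / 2" if "j \<ge> N" for j
        using \<rho>(2) tm t seq_suble[OF k(1), of j] that by (auto simp: dist_real_def)
      ultimately have "\<bar>v t - v s\<bar> \<le> e / 2" by (intro LIMSEQ_le_const2) blast+
      then show ?thesis using \<open>e > 0\<close> by (simp add: dist_real_def)
    qed
    then show "\<exists>d>0. \<forall>t\<in>{..0}. dist t s < d \<longrightarrow> dist (v t) (v s) < e"
      using \<rho>(1) by (intro exI[of _ "min \<rho> 1"]) auto
  qed
  then show ?thesis using k(1) lim by blast
qed

text \<open>Approximation of a Lipschitz curve by the polygons through its values at the nodes. The slopes converge wherever
  the curve is differentiable. Nodes before \<open>- m\<close> take the value at \<open>- m\<close>.\<close>

lemma interpolation_limits: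
  fixes e :: "real \<Rightarrow> real"
  assumes lip: "L-lipschitz_on {- real m..0} e"
  defines "en \<equiv> \<lambda>n i. e (max (- (real i * (1 / real n))) (- real m))"
  shows "n > 0 \<Longrightarrow> \<bar>slope (1 / real n) (en n) i\<bar> \<le> L"
    and "s \<in> {- real m..0} \<Longrightarrow> (\<lambda>n. polygon (1 / real n) (en n) s) \<longlonglongrightarrow> e s"
    and "s \<in> {- real m<..0} \<Longrightarrow> (e has_real_derivative D) (at s) \<Longrightarrow>
      (\<lambda>n. slope (1 / real n) (en n) (cell (1 / real n) s)) \<longlonglongrightarrow> D"
proof -
  have L: "L \<ge> 0" using lipschitz_on_nonneg[OF lip] .
  show sl: "\<bar>slope (1 / real n) (en n) i\<bar> \<le> L" if "n > 0" for n i
  proof -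
    let ?h = "1 / real n"
    have "\<bar>en n i - en n (Suc i)\<bar> \<le> L * \<bar>max (- (real i * ?h)) (- real m) - max (- (real (Suc i) * ?h)) (- real m)\<bar>"
      using lipschitz_onD[OF lip, of "max (- (real i * ?h)) (- real m)" "max (- (real (Suc i) * ?h)) (- real m)"]
      unfolding en_def by (auto simp: dist_real_def)
    also have "\<dots> \<le> L * ?h"
    proof (rule mult_left_mono[OF _ L])
      have "real (Suc i) * ?h = real i * ?h + ?h" by (simp add: add_divide_distrib)
      moreover have "0 \<le> ?h" by simp
      moreover have "\<bar>max (- A) B - max (- (A + k)) B\<bar> \<le> k" if "0 \<le> k" for A B k :: real
        using that by (auto simp: max_def)
      ultimately show "\<bar>max (- (real i * ?h)) (- real m) - max (- (real (Suc i) * ?h)) (- real m)\<bar> \<le> ?h"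
        by (simp only:)
    qed
    finally show ?thesis unfolding slope_def abs_divide using that by (simp add: field_simps)
  qed
  have node: "- (real (Suc (cell (1 / real n) s)) * (1 / real n)) < s" "s \<le> - (real (cell (1 / real n) s) * (1 / real n))"
    if "n > 0" "s \<le> 0" for n s
    using cell_bounds[of "1 / real n" s] that by auto
  have hlim: "(\<lambda>n. 1 / real n) \<longlonglongrightarrow> 0" by (rule lim_1_over_n)
  show "(\<lambda>n. polygon (1 / real n) (en n) s) \<longlonglongrightarrow> e s" if s: "s \<in> {- real m..0}" for s
  proof -
    have b: "\<bar>polygon (1 / real n) (en n) s - e s\<bar> \<le> 2 * L * (1 / real n)" if n: "n > 0" for n
    proof -
      let ?h = "1 / real n" and ?i = "cell (1 / real n) s"
      let ?q = "- (real ?i * ?h)"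
      have nb: "- (real (Suc ?i) * ?h) < s" "s \<le> ?q" using node[OF n, of s] s by auto
      have eq: "real (Suc ?i) * ?h = real ?i * ?h + ?h" by (simp add: add_divide_distrib)
      have q: "?q \<in> {- real m..0}" using nb s by auto
      have e1: "en n ?i = e ?q" unfolding en_def using q by (simp add: max_def)
      have "\<bar>e ?q - e s\<bar> \<le> L * \<bar>?q - s\<bar>" using lipschitz_onD[OF lip q, of s] s by (auto simp: dist_real_def)
      also have "\<dots> \<le> L * ?h" using nb eq L by (intro mult_left_mono) auto
      finally have 1: "\<bar>e ?q - e s\<bar> \<le> L * ?h" .
      have "\<bar>slope ?h (en n) ?i * (s + real ?i * ?h)\<bar> \<le> L * ?h"
        unfolding abs_mult using sl[OF n] nb eq L by (intro mult_mono) auto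
      then show ?thesis using 1 e1 unfolding polygon_def by linarith
    qed
    have "(\<lambda>n. 2 * L * (1 / real n)) \<longlonglongrightarrow> 2 * L * 0" by (intro tendsto_intros hlim)
    then have l0: "(\<lambda>n. 2 * L * (1 / real n)) \<longlonglongrightarrow> 0" by simp
    have "(\<lambda>n. polygon (1 / real n) (en n) s - e s) \<longlonglongrightarrow> 0"
    proof (rule Lim_null_comparison[OF _ l0], rule eventually_sequentiallyI[of 1])
      fix n :: nat assume "1 \<le> n"
      then have "n > 0" by simp
      from b[OF this] show "norm (polygon (1 / real n) (en n) s - e s) \<le> 2 * L * (1 / real n)" by (simp only: real_norm_def)
    qed
    then show ?thesis by (simp add: LIM_zero_iff)
  qed
  show "(\<lambda>n. slope (1 / real n) (en n) (cell (1 / real n) s)) \<longlonglongrightarrow> D"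
    if s: "s \<in> {- real m<..0}" and D: "(e has_real_derivative D) (at s)" for s D
  proof (rule LIMSEQ_I)
    fix r :: real assume "r > 0"
    then obtain d where d: "d > 0" "\<And>p q. p \<le> s \<Longrightarrow> s \<le> q \<Longrightarrow> p < q \<Longrightarrow> q - p < d \<Longrightarrow> \<bar>(e q - e p) / (q - p) - D\<bar> \<le> r / 2"
      using straddle_derivative[OF D, of "r / 2"] by auto
    define d' where "d' = min d (s + real m)"
    have "d' > 0" using d s unfolding d'_def by auto
    then obtain N where N: "N > 0" "1 / real N < d'" using ex_inverse_of_nat_less[of d'] by (auto simp: inverse_eq_divide)
    have "norm (slope (1 / real n) (en n) (cell (1 / real n) s) - D) < r" if n: "n \<ge> N" for n
    proof -
      let ?h = "1 / real n" and ?i = "cell (1 / real n) s"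
      let ?q = "- (real ?i * ?h)" and ?p = "- (real (Suc ?i) * ?h)"
      have n0: "n > 0" using n N by simp
      have nb: "?p < s" "s \<le> ?q" using node[OF n0, of s] s by auto
      have h: "?q - ?p = ?h" "?h > 0" using n0 by (auto simp: field_simps)
      have "?h \<le> 1 / real N" using n N by (simp add: frac_le)
      then have hd: "?h < d'" using N by simp
      have pm: "- real m \<le> ?p" using hd nb h unfolding d'_def by linarith
      have mx: "max ?p (- real m) = ?p" "max ?q (- real m) = ?q" using pm h by (intro max_absorb1; linarith)+
      have "slope ?h (en n) ?i = (e ?q - e ?p) / (?q - ?p)"
        unfolding slope_def en_def mx h(1) ..
      moreover have "\<bar>(e ?q - e ?p) / (?q - ?p) - D\<bar> \<le> r / 2"
        using nb h hd unfolding d'_def by (intro d(2)) auto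
      ultimately show ?thesis using \<open>r > 0\<close> by simp
    qed
    then show "\<exists>N. \<forall>n\<ge>N. norm (slope (1 / real n) (en n) (cell (1 / real n) s) - D) < r" by blast
  qed
qed

context forced_lagrangian begin

text \<open>A limit of minimal polygons. A competitor \<open>e\<close> of the limit \<open>c\<close> is turned into one of the polygons by adding to
  them the interpolation of \<open>e - c\<close>, which vanishes at \<open>0\<close> and is an integer at \<open>- m\<close>; the inequality between the
  actions passes to the limit.\<close>

theorem minimal_exists:
  "\<exists>c v. c 0 = x \<and> minimal c \<and> continuous_on {..0} v \<and> (\<forall>s\<le>0. \<forall>a<s. (c has_real_derivative v s) (at s within {a..0}))"
proof -
  have "\<exists>y. y 0 = x \<and> minimal_polygon (1 / real n) (n * n) y" if "n > 0" for n
  proof -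
    have "1 / real n > 0" using that by simp
    from minimal_polygon_exists[OF this, of x "n * n"] obtain y V where y: "y 0 = x" "\<forall>i. \<bar>slope (1 / real n) y i\<bar> \<le> V"
      "\<forall>z. z 0 = x \<longrightarrow> Act (- (real (n * n) * (1 / real n))) 0 (polygon (1 / real n) y) \<le> Act (- (real (n * n) * (1 / real n))) 0 (polygon (1 / real n) z)"
      by blast
    then have "minimal_polygon (1 / real n) (n * n) y" unfolding minimal_polygon_def by (simp only: y(1)) blast
    then show ?thesis using y(1) by blast
  qed
  then obtain Y where Y: "\<And>n. n > 0 \<Longrightarrow> Y n 0 = x" "\<And>n. n > 0 \<Longrightarrow> minimal_polygon (1 / real n) (n * n) (Y n)" by metis
  define cc where "cc n = polygon (1 / real n) (Y n)" for n
  define vv where "vv n s = slope (1 / real n) (Y n) (cell (1 / real n) s)" for n s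
  have vel: "velocity a b (cc n) (vv n)" if "n > 0" "b \<le> 0" for n a b
    unfolding cc_def vv_def[abs_def] using that Y(2) by (intro minpoly_velocity) auto
  have vb: "\<bar>vv n s\<bar> \<le> speed_bound (Suc m)" if "Suc m \<le> n" "s \<in> {- real m..0}" for m n s
    unfolding vv_def using that Y(2) by (intro minpoly_speed_at[OF _ refl]) auto
  have equi: "\<exists>\<rho>>0. \<exists>N. \<forall>n\<ge>N. \<forall>s\<in>{- real m..0}. \<forall>t\<in>{- real m..0}. \<bar>s - t\<bar> < \<rho> \<longrightarrow> \<bar>vv n s - vv n t\<bar> \<le> e"
    if "e > 0" for m e
  proof -
    let ?R = "speed_bound (Suc (Suc m))" and ?G = "\<Gamma> (- real (Suc m))"
    have nn: "?R \<ge> 0" "?G \<ge> 0" using bounds_nonneg \<Gamma>_nonneg by auto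
    obtain d where d: "d > 0" "\<forall>s\<in>{- real (Suc m)..0}. \<forall>s'\<in>{- real (Suc m)..0}. \<forall>x x'. \<bar>s - s'\<bar> < d \<longrightarrow> \<bar>x - x'\<bar> < d \<longrightarrow> \<bar>g s x - g s' x'\<bar> < e / 2"
      using g_uniform[of "e / 2" "- real (Suc m)"] half_gt_zero[OF \<open>e > 0\<close>] by blast
    (* If \<bar>s - t\<bar> and 1 / n are below \<rho>, then \<bar>s - t\<bar> + 2 / n is below 3 * \<rho>. *)
    define \<rho> where "\<rho> = min (d / (1 + ?R)) (e / (2 * (1 + ?G * ?R))) / 4"
    have pos: "1 + ?R > 0" "1 + ?G * ?R > 0" using nn by (auto intro: add_pos_nonneg)
    have cancel1: "P * (3 * (q / P / 4)) = 3 * q / 4" and cancel2: "P * (3 * (q / (2 * P) / 4)) = 3 * q / 8" if "P > 0" for P q :: real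
      using that by simp_all
    have \<rho>1: "\<rho> \<le> d / (1 + ?R) / 4" unfolding \<rho>_def by (intro divide_right_mono min.cobounded1) simp
    have \<rho>2: "\<rho> \<le> e / (2 * (1 + ?G * ?R)) / 4" unfolding \<rho>_def by (intro divide_right_mono min.cobounded2) simp
    have "\<rho> > 0" unfolding \<rho>_def using d(1) that pos by auto
    obtain N where N: "N > 0" "1 / real N < \<rho>" using ex_inverse_of_nat_less[OF \<open>\<rho> > 0\<close>] by (auto simp: inverse_eq_divide)
    have "\<bar>vv n s - vv n t\<bar> \<le> e" if n: "n \<ge> max N (Suc (Suc m))" and st: "s \<in> {- real m..0}" "t \<in> {- real m..0}" "\<bar>s - t\<bar> < \<rho>" for n s t
    proof -
      let ?h = "1 / real n" and ?D = "\<bar>s - t\<bar> + 2 * (1 / real n)"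
      have n0: "n > 0" using n by simp
      have "?h \<le> 1 / real N" using n N by (simp add: frac_le)
      then have D: "?D < 3 * \<rho>" "0 \<le> ?D" using N st by auto
      have "(1 + ?R) * ?D \<le> (1 + ?R) * (3 * \<rho>)" using D pos by (intro mult_left_mono) auto
      also have "\<dots> \<le> (1 + ?R) * (3 * (d / (1 + ?R) / 4))" using pos \<rho>1 by (intro mult_left_mono) linarith+
      also have "\<dots> = 3 * d / 4" by (rule cancel1[OF pos(1)])
      also have "\<dots> < d" using d(1) by simp
      finally have 1: "(1 + ?R) * ?D < d" .
      have "\<bar>vv n s - vv n t\<bar> \<le> e / 2 + ?G * (?R * ?D)"
        unfolding vv_def using n n0 Y(2)[OF n0] st 1 d(2) \<open>e > 0\<close>
        by (intro minpoly_equicontinuous[OF _ refl]) auto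
      also have "?G * (?R * ?D) \<le> (1 + ?G * ?R) * ?D" using D(2) by (simp add: algebra_simps)
      also have "\<dots> \<le> (1 + ?G * ?R) * (3 * \<rho>)" using D pos by (intro mult_left_mono) auto
      also have "\<dots> \<le> (1 + ?G * ?R) * (3 * (e / (2 * (1 + ?G * ?R)) / 4))" using pos \<rho>2 by (intro mult_left_mono) linarith+
      also have "\<dots> = 3 * e / 8" by (rule cancel2[OF pos(2)])
      also have "\<dots> \<le> e / 2" using \<open>e > 0\<close> by simp
      finally show ?thesis by simp
    qed
    then show ?thesis using \<open>\<rho> > 0\<close> by blast
  qed
  obtain k v where k: "strict_mono k" and lim: "\<And>s. s \<le> 0 \<Longrightarrow> (\<lambda>j. vv (k j) s) \<longlonglongrightarrow> v s" and vc: "continuous_on {..0} v"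
    using limit_extraction[of vv "\<lambda>m. speed_bound (Suc m)", OF vb equi] by blast
  have kj: "j \<le> k j" for j using seq_suble[OF k] .
  have vbd: "\<bar>v s\<bar> \<le> speed_bound (Suc m)" if "s \<in> {- real m..0}" for s m
  proof -
    have "(\<lambda>j. \<bar>vv (k j) s\<bar>) \<longlonglongrightarrow> \<bar>v s\<bar>" using lim that by (intro tendsto_intros) auto
    moreover have "\<forall>j\<ge>Suc m. \<bar>vv (k j) s\<bar> \<le> speed_bound (Suc m)" using vb[OF _ that] kj order_trans by blast
    ultimately show ?thesis by (intro LIMSEQ_le_const2) blast+
  qed
  have vci: "continuous_on {a..b} v" if "b \<le> 0" for a b using that by (intro continuous_on_subset[OF vc]) auto
  have vi: "v integrable_on {a..b}" if "b \<le> 0" for a b using vci[OF that] by (rule integrable_continuous_interval)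
  define c where "c s = x - integral {s..0} v" for s
  have cder: "(c has_real_derivative v s) (at s within {a..0})" if "a \<le> s" "s \<le> 0" for a s
  proof -
    have "((\<lambda>s. (x - integral {a..0} v) + integral {a..s} v) has_real_derivative 0 + v s) (at s within {a..0})"
      using that by (intro DERIV_add DERIV_const integral_has_real_derivative vci) auto
    then have "((\<lambda>s. (x - integral {a..0} v) + integral {a..s} v) has_real_derivative v s) (at s within {a..0})" by simp
    then show ?thesis
    proof (rule has_field_derivative_transform_within[OF _ zero_less_one])
      fix u assume "u \<in> {a..0}"
      then have "integral {a..u} v + integral {u..0} v = integral {a..0} v"
        by (intro Henstock_Kurzweil_Integration.integral_combine vi) auto
      then show "x - integral {a..0} v + integral {a..u} v = c u" unfolding c_def by linarith
    qed (use that in auto)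
  qed
  have cvel: "\<exists>w. velocity a 0 c w \<and> (\<forall>s\<in>{a..0}. w s = v s) \<and> (\<forall>s. \<bar>w s\<bar> \<le> speed_bound (Suc m))" if a: "- real m \<le> a" "a \<le> 0" for a m
  proof -
    define w where "w s = indicator {a..0} s *\<^sub>R v s" for s :: real
    have wv: "w s = v s" if "s \<in> {a..0}" for s using that unfolding w_def by simp
    have wb: "\<bar>w s\<bar> \<le> speed_bound (Suc m)" for s
      using vbd[of s m] a bounds_nonneg(4) unfolding w_def by (auto split: split_indicator)
    have "velocity a 0 c w"
    proof (rule velocityI[OF _ wb, where N = "{}"])
      show "w \<in> borel_measurable borel" unfolding w_def[abs_def] by (rule borel_measurable_continuous_on_indicator[OF _ vci]) auto
      fix s assume s: "s \<in> {a<..<0} - {}"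
      then show "(c has_real_derivative w s) (at s)"
        using cder[of a s] wv[of s] by (simp add: at_within_Icc_at)
    next
      fix s t assume st: "a \<le> s" "s \<le> t" "t \<le> 0"
      have "integral {s..t} w = integral {s..t} v" using st wv by (intro integral_cong) auto
      moreover have "integral {s..t} v + integral {t..0} v = integral {s..0} v"
        using st by (intro Henstock_Kurzweil_Integration.integral_combine vi) auto
      ultimately show "integral {s..t} w = c t - c s" unfolding c_def by simp
    qed simp
    then show ?thesis using wv wb by blast
  qed
  have clim: "(\<lambda>j. cc (k j) s) \<longlonglongrightarrow> c s" if s: "s \<le> 0" for s
  proof -
    define m where "m = nat \<lceil>- s\<rceil>"
    have m: "- real m \<le> s" unfolding m_def using real_nat_ceiling_ge[of "- s"] by linarith
    have eq: "cc (k (j + Suc m)) s = x - integral {s..0} (vv (k (j + Suc m)))" for j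
    proof -
      have k0: "k (j + Suc m) > 0" using kj[of "j + Suc m"] by simp
      have "integral {s..0} (vv (k (j + Suc m))) = cc (k (j + Suc m)) 0 - cc (k (j + Suc m)) s"
        by (rule velocity_integral[OF vel[OF k0 order_refl]]) (use s in auto)
      moreover have "cc (k (j + Suc m)) 0 = x"
        unfolding cc_def using polygon_node[of "1 / real (k (j + Suc m))" "Y (k (j + Suc m))" 0] k0 Y(1)[OF k0] by simp
      ultimately show ?thesis by simp
    qed
    have "(\<lambda>j. integral {s..0} (vv (k (j + Suc m)))) \<longlonglongrightarrow> integral {s..0} v"
    proof (rule dominated_convergence)
      fix j
      have k0: "k (j + Suc m) > 0" "Suc m \<le> k (j + Suc m)" using kj[of "j + Suc m"] by auto
      show "vv (k (j + Suc m)) integrable_on {s..0}" by (rule velocity_integrable[OF vel[OF k0(1) order_refl]])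
      show "norm (vv (k (j + Suc m)) u) \<le> speed_bound (Suc m)" if "u \<in> {s..0}" for u
        using vb[OF k0(2), of u] that m by auto
    next
      fix u assume "u \<in> {s..0}"
      then show "(\<lambda>j. vv (k (j + Suc m)) u) \<longlonglongrightarrow> v u"
        using LIMSEQ_ignore_initial_segment[OF lim[of u], of "Suc m"] by simp
    qed (rule integrable_const_ivl)
    then have "(\<lambda>j. cc (k (j + Suc m)) s) \<longlonglongrightarrow> x - integral {s..0} v"
      unfolding eq by (intro tendsto_intros)
    then show ?thesis unfolding c_def by (rule LIMSEQ_offset)
  qed
  have c0: "c 0 = x" unfolding c_def by simp
  have cll: "loc_lipschitz c" unfolding loc_lipschitz_def
  proof (intro allI impI)
    fix a :: real assume a: "a \<le> 0"
    have "- real (nat \<lceil>- a\<rceil>) \<le> a" using real_nat_ceiling_ge[of "- a"] by linarith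
    from cvel[OF this a] obtain w where w: "velocity a 0 c w" "\<forall>s. \<bar>w s\<bar> \<le> speed_bound (Suc (nat \<lceil>- a\<rceil>))" by blast
    then show "\<exists>L. L-lipschitz_on {a..0} c" using velocity_lipschitz[OF w(1)] by blast
  qed
  have key: "Act (- real m) 0 c \<le> Act (- real m) 0 e"
    if m: "m > 0" and e: "L-lipschitz_on {- real m..0} e" "e 0 = c 0" "e (- real m) = c (- real m) + of_int i" for m e L i
  proof -
    let ?a = "- real m"
    have a0: "?a \<le> 0" by simp
    obtain w where w: "velocity ?a 0 c w" "\<And>s. s \<in> {?a..0} \<Longrightarrow> w s = v s" "\<And>s. \<bar>w s\<bar> \<le> speed_bound (Suc m)" using cvel[OF order_refl a0] by blast
    have clip: "(speed_bound (Suc m))-lipschitz_on {?a..0} c" by (rule velocity_lipschitz[OF w(1,3)])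
    obtain u where u: "velocity ?a 0 e u" using velocity_exists[OF e(1) a0] by blast
    obtain N where N: "negligible N" "\<And>x. x \<in> {?a<..<0} - N \<Longrightarrow> (e has_real_derivative u x) (at x)" using velocity_derivative[OF u] by auto
    define en where "en n i = e (max (- (real i * (1 / real n))) (- real m))" for n i
    define cn where "cn n i = c (max (- (real i * (1 / real n))) (- real m))" for n i
    (* The minimal polygon Y n plus the interpolation of e - c. *)
    define z where "z n i = (en n i + 1 * Y n i) + (- 1) * cn n i" for n i
    define zv where "zv n s = slope (1 / real n) (z n) (cell (1 / real n) s)" for n s
    have znv: "zv n s = slope (1 / real n) (en n) (cell (1 / real n) s) + vv n s - slope (1 / real n) (cn n) (cell (1 / real n) s)" for n s
      unfolding zv_def z_def slope_add vv_def by simp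
    have znp: "polygon (1 / real n) (z n) s = polygon (1 / real n) (en n) s + cc n s - polygon (1 / real n) (cn n) s" for n s
      unfolding z_def polygon_add cc_def by simp
    note ie = interpolation_limits[OF e(1), folded en_def[abs_def]] and ic = interpolation_limits[OF clip, folded cn_def[abs_def]]
    have ie': "\<bar>slope (1 / real n) (en n) i\<bar> \<le> L" "\<bar>slope (1 / real n) (cn n) i\<bar> \<le> speed_bound (Suc m)" if "n > 0" for n i
      using ie(1)[OF that] ic(1)[OF that] unfolding en_def cn_def by auto
    have zvel: "velocity ?a 0 (polygon (1 / real n) (z n)) (zv n)" if n: "n > 0" for n
    proof -
      obtain V where V: "\<And>i. \<bar>slope (1 / real n) (Y n) i\<bar> \<le> V" using Y(2)[OF n] unfolding minimal_polygon_def by auto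
      have "\<bar>slope (1 / real n) (z n) i\<bar> \<le> L + V + speed_bound (Suc m)" for i
        using ie'[OF n, of i] V[of i] unfolding z_def slope_add by simp
      then show ?thesis unfolding zv_def[abs_def] using n by (intro polygon_velocity) auto
    qed
    have cmp: "Act ?a 0 (cc n) \<le> Act ?a 0 (polygon (1 / real n) (z n))" if n: "n \<ge> m" for n
    proof -
      have n0: "n > 0" "1 / real n > 0" using n m by auto
      have nd: "real (m * n) * (1 / real n) = real m" using n0 by simp
      have "Act (- (real (m * n) * (1 / real n))) (- (real 0 * (1 / real n))) (polygon (1 / real n) (Y n))
        \<le> Act (- (real (m * n) * (1 / real n))) (- (real 0 * (1 / real n))) (polygon (1 / real n) (z n))"
      proof (rule minpoly_compare[OF n0(2) Y(2)[OF n0(1)]])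
        show "0 < m * n" "m * n \<le> n * n" using m n n0 by auto
        show "z n 0 = Y n 0" unfolding z_def en_def cn_def using e(2) by simp
        show "z n (m * n) = Y n (m * n) + of_int i"
          unfolding z_def en_def cn_def nd using e(3) by simp
      qed
      then show ?thesis unfolding nd cc_def by simp
    qed
    let ?J = "Suc m"
    have k0: "k (j + ?J) > 0" "Suc m \<le> k (j + ?J)" "m \<le> k (j + ?J)" for j using kj[of "j + ?J"] by auto
    have lim1: "(\<lambda>j. Actv ?a 0 (cc (k (j + ?J))) (vv (k (j + ?J)))) \<longlonglongrightarrow> Actv ?a 0 c v"
    proof (rule Actv_tendsto[where N = "{}" and L = "speed_bound (Suc m)"])
      show "continuous_on {?a..0} (cc (k (j + ?J)))" for j by (rule velocity_continuous[OF vel[OF k0(1) order_refl]])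
      show "vv (k (j + ?J)) \<in> borel_measurable borel" for j by (rule velocity_measurable[OF vel[OF k0(1) order_refl]])
      show "\<bar>vv (k (j + ?J)) x\<bar> \<le> speed_bound (Suc m)" if "x \<in> {?a..0}" for j x by (rule vb[OF k0(2) that])
      show "(\<lambda>j. cc (k (j + ?J)) s) \<longlonglongrightarrow> c s" if "s \<in> {?a..0}" for s
        using LIMSEQ_ignore_initial_segment[OF clim[of s], of "?J"] that by simp
      show "(\<lambda>j. vv (k (j + ?J)) s) \<longlonglongrightarrow> v s" if "s \<in> {?a..0} - {}" for s
        using LIMSEQ_ignore_initial_segment[OF lim[of s], of "?J"] that by simp
    qed auto
    define B where "B = L + speed_bound (Suc m) + speed_bound (Suc m)"
    have lim2: "(\<lambda>j. Actv ?a 0 (polygon (1 / real (k (j + ?J))) (z (k (j + ?J)))) (zv (k (j + ?J)))) \<longlonglongrightarrow> Actv ?a 0 e u"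
    proof (rule Actv_tendsto[where N = "N \<union> {?a, 0}" and L = B])
      show "continuous_on {?a..0} (polygon (1 / real (k (j + ?J))) (z (k (j + ?J))))" for j
        by (rule velocity_continuous[OF zvel[OF k0(1)]])
      show "zv (k (j + ?J)) \<in> borel_measurable borel" for j by (rule velocity_measurable[OF zvel[OF k0(1)]])
      show "\<bar>zv (k (j + ?J)) s\<bar> \<le> B" if "s \<in> {?a..0}" for j s
        unfolding znv B_def using ie'(1)[OF k0(1)[of j], of "cell (1 / real (k (j + ?J))) s"]
          ie'(2)[OF k0(1)[of j], of "cell (1 / real (k (j + ?J))) s"] vb[OF k0(2)[of j] that] by linarith
      show "negligible (N \<union> {?a, 0})" using N(1) by simp
      have sub: "strict_mono (\<lambda>j. k (j + ?J))" using k by (simp add: strict_mono_def)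
      show "(\<lambda>j. polygon (1 / real (k (j + ?J))) (z (k (j + ?J))) s) \<longlonglongrightarrow> e s" if s: "s \<in> {?a..0}" for s
      proof -
        have 1: "(\<lambda>n. polygon (1 / real n) (en n) s) \<longlonglongrightarrow> e s" "(\<lambda>n. polygon (1 / real n) (cn n) s) \<longlonglongrightarrow> c s"
          using ie(2)[OF s] ic(2)[OF s] unfolding en_def[abs_def] cn_def[abs_def] by auto
        have "(\<lambda>j. polygon (1 / real (k (j + ?J))) (en (k (j + ?J))) s + cc (k (j + ?J)) s - polygon (1 / real (k (j + ?J))) (cn (k (j + ?J))) s)
           \<longlonglongrightarrow> e s + c s - c s"
          using LIMSEQ_subseq_LIMSEQ[OF 1(1) sub] LIMSEQ_subseq_LIMSEQ[OF 1(2) sub]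
            LIMSEQ_ignore_initial_segment[OF clim[of s], of "?J"] s
          by (intro tendsto_intros) (auto simp: o_def)
        then show ?thesis unfolding znp by simp
      qed
      show "(\<lambda>j. zv (k (j + ?J)) s) \<longlonglongrightarrow> u s" if s: "s \<in> {?a..0} - (N \<union> {?a, 0})" for s
      proof -
        have s': "s \<in> {?a<..0}" "s \<in> {?a<..<0} - N" "s \<le> 0" "?a < s" "s < 0" using s by auto
        have cd: "(c has_real_derivative v s) (at s)" using cder[of ?a s] s' by (simp add: at_within_Icc_at)
        have 1: "(\<lambda>n. slope (1 / real n) (en n) (cell (1 / real n) s)) \<longlonglongrightarrow> u s"
          "(\<lambda>n. slope (1 / real n) (cn n) (cell (1 / real n) s)) \<longlonglongrightarrow> v s"
          using ie(3)[OF s'(1) N(2)[OF s'(2)]] ic(3)[OF s'(1) cd] unfolding en_def[abs_def] cn_def[abs_def] by auto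
        have "(\<lambda>j. slope (1 / real (k (j + ?J))) (en (k (j + ?J))) (cell (1 / real (k (j + ?J))) s) + vv (k (j + ?J)) s
            - slope (1 / real (k (j + ?J))) (cn (k (j + ?J))) (cell (1 / real (k (j + ?J))) s)) \<longlonglongrightarrow> u s + v s - v s"
          using LIMSEQ_subseq_LIMSEQ[OF 1(1) sub] LIMSEQ_subseq_LIMSEQ[OF 1(2) sub]
            LIMSEQ_ignore_initial_segment[OF lim[of s], of "?J"] s'
          by (intro tendsto_intros) (auto simp: o_def)
        then show ?thesis unfolding znv by simp
      qed
    qed simp
    have "Actv ?a 0 c v \<le> Actv ?a 0 e u"
    proof (rule LIMSEQ_le[OF lim1 lim2], intro exI allI impI)
      fix j
      show "Actv ?a 0 (cc (k (j + ?J))) (vv (k (j + ?J))) \<le> Actv ?a 0 (polygon (1 / real (k (j + ?J))) (z (k (j + ?J)))) (zv (k (j + ?J)))"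
        using cmp[OF k0(3)] Act_eq_Actv[OF vel[OF k0(1) order_refl]] Act_eq_Actv[OF zvel[OF k0(1)]] by simp
    qed
    moreover have "Actv ?a 0 c v = Actv ?a 0 c w" unfolding Actv_def by (rule integral_cong) (simp add: w(2))
    ultimately show ?thesis using Act_eq_Actv[OF w(1)] Act_eq_Actv[OF u] by simp
  qed
  have "minimal c" unfolding minimal_def
  proof (intro conjI cll allI impI)
    fix a :: real and e L
    assume a: "a < 0" and e: "L-lipschitz_on {a..0} e" and "e a - c a \<in> \<int>" "e 0 - c 0 \<in> \<int>"
    then obtain k1 k0 where k1: "e a - c a = of_int k1" and k0: "e 0 - c 0 = of_int k0" by (auto elim!: Ints_cases)
    define m where "m = nat \<lceil>- a\<rceil>"
    have "- real m \<le> a" unfolding m_def using real_nat_ceiling_ge[of "- a"] by linarith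
    moreover from this have "m > 0" using a by (cases m) auto
    ultimately have m: "m > 0" "- real m \<le> a" by blast+
    obtain L1 where "L1-lipschitz_on {- real m..a} c" using loc_lipschitzD[OF cll, of a] a by auto
    then have L1: "L1-lipschitz_on {- real m..a} (\<lambda>s. c s + of_int k1)" unfolding lipschitz_on_def by simp
    obtain L2 where L2: "L2-lipschitz_on {- real m..0} c" using loc_lipschitzD[OF cll] by blast
    have j: "c a + of_int k1 = e a" using k1 by simp
    define f where "f s = (if s \<le> a then c s + of_int k1 else e s)" for s
    obtain M where M: "M-lipschitz_on {- real m..0} f" using lipschitz_splice[OF L1 e j] unfolding f_def by blast
    have Af: "Act (- real m) 0 f = Act (- real m) a (\<lambda>s. c s + of_int k1) + Act a 0 e"
      unfolding f_def using a m by (intro Act_splice[OF L1 e j]) auto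
    have M': "M-lipschitz_on {- real m..0} (\<lambda>s. f s + of_int (- k0))" using M unfolding lipschitz_on_def dist_real_def by simp
    have "Act (- real m) 0 c \<le> Act (- real m) 0 (\<lambda>s. f s + of_int (- k0))"
      by (rule key[OF m(1) M', of "k1 - k0"]) (use a m k0 in \<open>auto simp: f_def\<close>)
    also have "\<dots> = Act (- real m) 0 f" by (rule Act_shift) simp
    finally have "Act (- real m) 0 c \<le> Act (- real m) a c + Act a 0 e" using Af Act_shift[of a "- real m" c k1] a by simp
    then show "Act a 0 c \<le> Act a 0 e" using Act_combine[OF L2 m(2)] a by simp
  qed
  then show ?thesis using c0 vc cder by (intro exI[of _ c] exI[of _ v]) auto
qed

end

section \<open>Lifts of curves in the circle\<close>

lemma to_circle_eq_iff: "to_circle x = to_circle y \<longleftrightarrow> x - y \<in> \<int>"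
  by transfer simp

lemma to_circle_surj: "\<exists>x. to_circle x = p"
proof transfer
  fix p :: real
  show "\<exists>x. x - p \<in> \<int>" by (rule exI[of _ p]) simp
qed

lemma dist_to_circle_le: "dist (to_circle x) (to_circle y) \<le> \<bar>x - y\<bar>"
proof transfer
  fix x y :: real
  show "\<bar>x - y - of_int (round (x - y))\<bar> \<le> \<bar>x - y\<bar>"
    using round_diff_minimal[of "x - y" 0] by simp
qed

lemma dist_to_circle_eq: "\<bar>x - y\<bar> \<le> 1 / 2 \<Longrightarrow> dist (to_circle x) (to_circle y) = \<bar>x - y\<bar>"
proof transfer
  fix x y :: real
  assume le: "\<bar>x - y\<bar> \<le> 1 / 2"
  let ?n = "round (x - y)"
  have "\<bar>x - y - of_int ?n\<bar> \<le> \<bar>x - y\<bar>"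
    using round_diff_minimal[of "x - y" 0] by simp
  moreover have "\<bar>x - y\<bar> \<le> \<bar>x - y - of_int ?n\<bar>"
  proof (cases "?n = 0")
    case False
    then have "1 \<le> \<bar>real_of_int ?n\<bar>" by linarith
    then show ?thesis using le by linarith
  qed simp
  ultimately show "\<bar>x - y - of_int ?n\<bar> = \<bar>x - y\<bar>" by simp
qed

text \<open>The circle as the unit circle of the complex plane, where a curve has a continuous logarithm.\<close>

lift_definition circle_emb :: "circle \<Rightarrow> complex" is "\<lambda>x. cis (2 * pi * x)"
proof -
  fix x y :: real assume "x - y \<in> \<int>"
  then have "cis (2 * pi * (x - y)) = 1" by (rule cis_multiple_2pi)
  then show "cis (2 * pi * x) = cis (2 * pi * y)"
    by (simp add: right_diff_distrib cis_divide[symmetric] field_simps)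
qed

lemma norm_cis_diff_le: "norm (cis a - cis b) \<le> \<bar>a - b\<bar>"
proof -
  have "cis a - cis b = cis b * (cis (a - b) - 1)" by (simp add: right_diff_distrib cis_mult)
  then have "norm (cis a - cis b) = norm (exp (\<i> * of_real (a - b)) - 1)" by (simp add: norm_mult cis_conv_exp)
  also have "\<dots> = 2 * \<bar>sin ((a - b) / 2)\<bar>" by (rule dist_exp_i_1)
  also have "\<dots> \<le> \<bar>a - b\<bar>" using abs_sin_x_le_abs_x[of "(a - b) / 2"] by simp
  finally show ?thesis .
qed

lemma circle_emb_dist: "norm (circle_emb p - circle_emb q) \<le> 2 * pi * dist p q"
proof transfer
  fix x y :: real
  let ?k = "of_int (round (x - y)) :: real"
  have "cis (2 * pi * ?k) = 1" by (rule cis_multiple_2pi) simp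
  then have "cis (2 * pi * (y + ?k)) = cis (2 * pi * y)"
    by (simp add: distrib_left cis_mult[symmetric])
  then have "norm (cis (2 * pi * x) - cis (2 * pi * y)) \<le> \<bar>2 * pi * x - 2 * pi * (y + ?k)\<bar>"
    using norm_cis_diff_le[of "2 * pi * x" "2 * pi * (y + ?k)"] by simp
  also have "\<dots> = \<bar>2 * pi * (x - y - ?k)\<bar>" by (simp add: algebra_simps)
  also have "\<dots> = 2 * pi * \<bar>x - y - ?k\<bar>" by (simp add: abs_mult)
  finally show "norm (cis (2 * pi * x) - cis (2 * pi * y)) \<le> 2 * pi * \<bar>x - y - ?k\<bar>" .
qed

lemma circle_emb_inj: "circle_emb p = circle_emb q \<Longrightarrow> p = q"
proof transfer
  fix x y :: real
  assume "cis (2 * pi * x) = cis (2 * pi * y)"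
  then have "exp (\<i> * of_real (2 * pi * x)) = exp (\<i> * of_real (2 * pi * y))" by (simp add: cis_conv_exp)
  then obtain n :: int where "\<i> * of_real (2 * pi * x) = \<i> * of_real (2 * pi * y) + (of_int (2 * n) * pi) * \<i>"
    unfolding exp_eq by blast
  then have "Im (\<i> * of_real (2 * pi * x)) = Im (\<i> * of_real (2 * pi * y) + (of_int (2 * n) * pi) * \<i>)" by simp
  then have "2 * pi * x = 2 * pi * y + 2 * of_int n * pi" by simp
  then have "2 * pi * (x - y) = 2 * pi * of_int n" by (simp add: algebra_simps)
  then have "x - y = of_int n" by simp
  then show "x - y \<in> \<int>" by simp
qed

text \<open>The imaginary part of a continuous logarithm, divided by \<open>2 * pi\<close>.\<close>

lemma lift_exists:
  assumes "continuous_on {a..b} \<eta>"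
  shows "\<exists>c. lift_on {a..b} \<eta> c"
proof -
  have emb: "continuous_on {a..b} (\<lambda>t. circle_emb (\<eta> t))"
    unfolding continuous_on_iff
  proof (intro ballI allI impI)
    fix t e :: real assume t: "t \<in> {a..b}" "e > 0"
    have "e / (2 * pi) > 0" using t by simp
    then obtain d where d: "d > 0" "\<forall>s\<in>{a..b}. dist s t < d \<longrightarrow> dist (\<eta> s) (\<eta> t) < e / (2 * pi)"
      using assms t(1) unfolding continuous_on_iff by blast
    have "dist (circle_emb (\<eta> s)) (circle_emb (\<eta> t)) < e" if "s \<in> {a..b}" "dist s t < d" for s
    proof -
      have "2 * pi * dist (\<eta> s) (\<eta> t) < 2 * pi * (e / (2 * pi))" using d that by (intro mult_strict_left_mono) auto
      also have "\<dots> = e" by simp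
      finally show ?thesis using circle_emb_dist[of "\<eta> s" "\<eta> t"] unfolding dist_norm[of "circle_emb (\<eta> s)"] by linarith
    qed
    then show "\<exists>d>0. \<forall>s\<in>{a..b}. dist s t < d \<longrightarrow> dist (circle_emb (\<eta> s)) (circle_emb (\<eta> t)) < e" using d(1) by blast
  qed
  have n1: "norm (circle_emb p) = 1" for p by transfer simp
  have contr: "contractible {a..b}" by (rule convex_imp_contractible) simp
  have nz: "circle_emb (\<eta> z) \<noteq> 0" for z using n1[of "\<eta> z"] by auto
  obtain g where g: "continuous_on {a..b} g" "\<And>t. t \<in> {a..b} \<Longrightarrow> circle_emb (\<eta> t) = exp (g t)"
    using continuous_logarithm_on_contractible[OF emb contr nz] by blast
  define c where "c t = Im (g t) / (2 * pi)" for t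
  have "to_circle (c t) = \<eta> t" if t: "t \<in> {a..b}" for t
  proof (rule circle_emb_inj)
    have "exp (Re (g t)) = 1" using n1[of "\<eta> t"] g(2)[OF t] by (simp add: norm_exp_eq_Re)
    then have "circle_emb (\<eta> t) = cis (Im (g t))" using g(2)[OF t] by (simp add: exp_eq_polar)
    also have "\<dots> = circle_emb (to_circle (c t))"
      unfolding c_def circle_emb.abs_eq to_circle.abs_eq by simp
    finally show "circle_emb (to_circle (c t)) = circle_emb (\<eta> t)" by simp
  qed
  moreover have "continuous_on {a..b} c" unfolding c_def[abs_def] by (intro continuous_intros g(1)) simp
  ultimately show ?thesis unfolding lift_on_def by blast
qed

text \<open>The difference of two lifts is continuous and integer-valued.\<close>

lemma lift_unique:
  assumes c: "lift_on I \<eta> c" and d: "lift_on I \<eta> d" and "connected I" "t0 \<in> I"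
  shows "\<exists>k::int. \<forall>t\<in>I. d t = c t + of_int k"
proof -
  have int: "d t - c t \<in> \<int>" if "t \<in> I" for t
    using c d that unfolding lift_on_def to_circle_eq_iff[symmetric] by auto
  have "(\<lambda>t. d t - c t) constant_on I"
  proof (rule continuous_discrete_range_constant[OF \<open>connected I\<close>])
    show "continuous_on I (\<lambda>t. d t - c t)" using c d unfolding lift_on_def by (intro continuous_intros) auto
    fix t assume t: "t \<in> I"
    have "1 \<le> norm ((d y - c y) - (d t - c t))" if y: "y \<in> I" "d y - c y \<noteq> d t - c t" for y
    proof -
      obtain i j :: int where ij: "d y - c y = of_int i" "d t - c t = of_int j" using int[OF y(1)] int[OF t] by (auto elim!: Ints_cases)
      then have "i \<noteq> j" using y(2) by auto
      then show ?thesis unfolding ij real_norm_def by linarith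
    qed
    then show "\<exists>e>0. \<forall>y. y \<in> I \<and> d y - c y \<noteq> d t - c t \<longrightarrow> e \<le> norm ((d y - c y) - (d t - c t))"
      by (intro exI[of _ 1]) auto
  qed
  then obtain r where r: "\<And>t. t \<in> I \<Longrightarrow> d t - c t = r" unfolding constant_on_def by blast
  then have "r \<in> \<int>" using int[OF \<open>t0 \<in> I\<close>] \<open>t0 \<in> I\<close> by metis
  then obtain k :: int where "r = of_int k" by (elim Ints_cases)
  then show ?thesis using r by (intro exI[of _ k]) (auto simp: algebra_simps)
qed

lemma lift_on_subset: "lift_on I \<xi> c \<Longrightarrow> J \<subseteq> I \<Longrightarrow> lift_on J \<xi> c"
  unfolding lift_on_def by (auto intro: continuous_on_subset)

text \<open>At distances below \<open>1 / 2\<close> the projection to the circle is an isometry; at larger distances a bound on the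
  lift suffices.\<close>

lemma lift_lipschitz:
  assumes \<eta>: "L-lipschitz_on {a..b} \<eta>" and c: "lift_on {a..b} \<eta> c"
  shows "\<exists>M. M-lipschitz_on {a..b} c"
proof -
  have cc: "continuous_on {a..b} c" using c unfolding lift_on_def by blast
  have L: "L \<ge> 0" using lipschitz_on_nonneg[OF \<eta>] .
  have "uniformly_continuous_on {a..b} c" by (rule compact_uniformly_continuous[OF cc]) simp
  then obtain d where d: "d > 0" "\<And>s t. s \<in> {a..b} \<Longrightarrow> t \<in> {a..b} \<Longrightarrow> dist t s < d \<Longrightarrow> dist (c t) (c s) < 1 / 2"
    unfolding uniformly_continuous_on_def by (auto dest!: spec[of _ "1 / 2"])
  obtain B where B: "\<And>s. s \<in> {a..b} \<Longrightarrow> \<bar>c s\<bar> \<le> B" using continuous_on_Icc_bounded[OF cc] by blast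
  define M where "M = L + 2 * \<bar>B\<bar> / d"
  have "M-lipschitz_on {a..b} c"
  proof (rule lipschitz_onI)
    show "0 \<le> M" unfolding M_def using L d(1) by simp
    fix s t assume st: "s \<in> {a..b}" "t \<in> {a..b}"
    show "dist (c s) (c t) \<le> M * dist s t"
    proof (cases "dist s t < d")
      case True
      then have "\<bar>c s - c t\<bar> \<le> 1 / 2" using d(2)[OF st(2,1)] by (simp add: dist_real_def)
      then have "dist (c s) (c t) = dist (to_circle (c s)) (to_circle (c t))" by (simp add: dist_to_circle_eq dist_real_def)
      also have "\<dots> = dist (\<eta> s) (\<eta> t)" using c st unfolding lift_on_def by simp
      also have "\<dots> \<le> L * dist s t" by (rule lipschitz_onD[OF \<eta> st])
      also have "\<dots> \<le> M * dist s t" unfolding M_def using d(1) by (intro mult_right_mono) auto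
      finally show ?thesis .
    next
      case False
      have "dist (c s) (c t) \<le> 2 * \<bar>B\<bar>" using B[OF st(1)] B[OF st(2)] by (simp add: dist_real_def)
      also have "\<dots> = 2 * \<bar>B\<bar> / d * d" using d(1) by simp
      also have "\<dots> \<le> 2 * \<bar>B\<bar> / d * dist s t" using False d(1) by (intro mult_left_mono) auto
      also have "\<dots> \<le> M * dist s t" unfolding M_def using L by (intro mult_right_mono) auto
      finally show ?thesis .
    qed
  qed
  then show ?thesis by blast
qed

lemma to_circle_lipschitz: "M-lipschitz_on S c \<Longrightarrow> M-lipschitz_on S (\<lambda>s. to_circle (c s))"
proof (rule lipschitz_onI)
  assume c: "M-lipschitz_on S c"
  show "0 \<le> M" using lipschitz_on_nonneg[OF c] .
  fix s t assume "s \<in> S" "t \<in> S"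
  then have "dist (c s) (c t) \<le> M * dist s t" by (rule lipschitz_onD[OF c])
  then show "dist (to_circle (c s)) (to_circle (c t)) \<le> M * dist s t"
    using dist_to_circle_le[of "c s" "c t"] by (simp add: dist_real_def)
qed

lemma piecewise_C1_lipschitz:
  fixes c :: "real \<Rightarrow> real"
  assumes fin: "\<And>a. finite (S \<inter> {a..0})"
    and C1: "\<And>a b. a < b \<Longrightarrow> b \<le> 0 \<Longrightarrow> S \<inter> {a<..<b} = {} \<Longrightarrow>
         (\<exists>c'. continuous_on {a..b} c' \<and> (\<forall>s\<in>{a..b}. (c has_real_derivative c' s) (at s within {a..b})))"
    and "b \<le> 0"
  shows "\<exists>L. L-lipschitz_on {a..b} c"
  using \<open>b \<le> 0\<close>
proof (induction "card (S \<inter> {a<..<b})" arbitrary: a b rule: less_induct)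
  case less
  have finS: "finite (S \<inter> {x<..<y})" if "y \<le> 0" for x y
    by (rule finite_subset[OF _ fin[of x]]) (use that in auto)
  show ?case
  proof (cases "a < b")
    case False
    then have "{a..b} = {} \<or> {a..b} = {a}" by auto
    then show ?thesis by (auto intro: exI[of _ 0])
  next
    case True
    show ?thesis
    proof (cases "S \<inter> {a<..<b} = {}")
      case True
      then obtain c' where c': "continuous_on {a..b} c'" "\<And>s. s\<in>{a..b} \<Longrightarrow> (c has_real_derivative c' s) (at s within {a..b})"
        using C1 \<open>a < b\<close> less(2) by blast
      obtain B where B: "\<And>s. s \<in> {a..b} \<Longrightarrow> \<bar>c' s\<bar> \<le> B" using continuous_on_Icc_bounded[OF c'(1)] by blast
      have "B-lipschitz_on {a..b} c"
      proof (rule lipschitz_onI)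
        show "0 \<le> B" using B[of a] \<open>a < b\<close> by auto
        fix s t assume st: "s \<in> {a..b}" "t \<in> {a..b}"
        have "norm (c s - c t) \<le> B * norm (s - t)"
          by (rule field_differentiable_bound[OF convex_real_interval(5) c'(2)]) (use B st in auto)
        then show "dist (c s) (c t) \<le> B * dist s t" by (simp add: dist_real_def)
      qed
      then show ?thesis by blast
    next
      case False
      then obtain p where p: "p \<in> S" "a < p" "p < b" by auto
      have "card (S \<inter> {a<..<p}) < card (S \<inter> {a<..<b})"
        by (rule psubset_card_mono[OF finS[OF less(2)]]) (use p in auto)
      moreover have "card (S \<inter> {p<..<b}) < card (S \<inter> {a<..<b})"
        by (rule psubset_card_mono[OF finS[OF less(2)]]) (use p in auto)
      ultimately obtain L1 L2 where "L1-lipschitz_on {a..p} c" "L2-lipschitz_on {p..b} c"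
        using less(1)[of a p] less(1)[of p b] p less(2) by auto
      then have "(max L1 L2)-lipschitz_on {a..b} (\<lambda>x. if x \<le> p then c x else c x)" by (rule lipschitz_on_concat_max) simp
      then show ?thesis by auto
    qed
  qed
qed

section \<open>The force of the noise\<close>

text \<open>A realization of the noise, with the paths \<open>b\<close> of the processes. Growth and calmness of the paths are the almost
  sure properties on which the argument rests.\<close>

locale noise_paths =
  fixes F f f' b :: "nat \<Rightarrow> real \<Rightarrow> real" and C :: real
  assumes F_deriv: "k \<ge> 1 \<Longrightarrow> (F k has_real_derivative f k x) (at x)"
    and f_deriv: "k \<ge> 1 \<Longrightarrow> (f k has_real_derivative f' k x) (at x)"
    and F_periodic: "k \<ge> 1 \<Longrightarrow> F k (x + 1) = F k x"
    and f_periodic: "k \<ge> 1 \<Longrightarrow> f k (x + 1) = f k x"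
    and f'_periodic: "k \<ge> 1 \<Longrightarrow> f' k (x + 1) = f' k x"
    and F_bound: "k \<ge> 1 \<Longrightarrow> \<bar>F k x\<bar> \<le> C / (real k)\<^sup>2"
    and f_bound: "k \<ge> 1 \<Longrightarrow> \<bar>f k x\<bar> \<le> C / (real k)\<^sup>2"
    and f'_bound: "k \<ge> 1 \<Longrightarrow> \<bar>f' k x\<bar> \<le> C / (real k)\<^sup>2"
    and f'_lipschitz: "k \<ge> 1 \<Longrightarrow> \<bar>f' k x - f' k y\<bar> \<le> C / (real k)\<^sup>2 * \<bar>x - y\<bar>"
    and b_continuous: "k \<ge> 1 \<Longrightarrow> continuous_on UNIV (b k)"
    and b_zero: "k \<ge> 1 \<Longrightarrow> b k 0 = 0"
    and b_growth: "\<exists>K. \<forall>k\<ge>1. \<forall>s\<in>{- real n..0}. \<bar>b k s\<bar> \<le> K * sqrt (real k)"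
    and b_calm: "0 < \<epsilon> \<Longrightarrow> 0 < \<delta> \<Longrightarrow> \<exists>T\<le>\<tau>. \<forall>u\<in>{T - 1 / \<epsilon>..T}. \<forall>k\<ge>1. \<bar>b k u - b k T\<bar> \<le> \<delta> * sqrt (real k)"
begin

text \<open>The decay \<open>1 / k\<^sup>2\<close> of the coefficients against the growth \<open>sqrt k\<close> of the paths, with \<open>k = n + 1\<close>.\<close>

definition \<kappa> :: "nat \<Rightarrow> real" where "\<kappa> n = sqrt (real (Suc n)) / (real (Suc n))\<^sup>2"

definition g :: "real \<Rightarrow> real \<Rightarrow> real" where "g s x = (\<Sum>n. f (Suc n) x * b (Suc n) s)"
definition gx :: "real \<Rightarrow> real \<Rightarrow> real" where "gx s x = (\<Sum>n. f' (Suc n) x * b (Suc n) s)"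
definition G :: "real \<Rightarrow> real \<Rightarrow> real" where "G s x = (\<Sum>n. F (Suc n) x * b (Suc n) s)"

lemma \<kappa>_summable: "summable \<kappa>"
proof -
  have "summable (\<lambda>n. of_nat n powr (- 3 / 2) :: real)" by (simp add: summable_real_powr_iff)
  then have "summable (\<lambda>n. real (Suc n) powr (- 3 / 2))" by (subst summable_Suc_iff)
  moreover have "real (Suc n) powr (- 3 / 2) = \<kappa> n" for n
  proof -
    have "\<kappa> n = real (Suc n) powr (1 / 2) / real (Suc n) powr 2"
      unfolding \<kappa>_def by (simp add: powr_half_sqrt)
    also have "\<dots> = real (Suc n) powr (1 / 2 - 2)" by (rule powr_diff[symmetric])
    finally show ?thesis by simp
  qed
  ultimately show ?thesis by simp
qed

lemma \<kappa>_pos: "0 < \<kappa> n" unfolding \<kappa>_def by simp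

definition S\<kappa> :: real where "S\<kappa> = suminf \<kappa>"

lemma S\<kappa>_pos: "0 < S\<kappa>" unfolding S\<kappa>_def by (rule suminf_pos[OF \<kappa>_summable \<kappa>_pos])

lemma C_nonneg: "0 \<le> C" using F_bound[of 1 0] by simp

lemma series_bound:
  assumes "\<And>n. \<bar>p n\<bar> \<le> A * \<kappa> n"
  shows "summable (\<lambda>n. \<bar>p n\<bar>)" "summable p" "\<bar>suminf p\<bar> \<le> A * S\<kappa>"
proof -
  have s: "summable (\<lambda>n. A * \<kappa> n)" using \<kappa>_summable by (rule summable_mult)
  show a: "summable (\<lambda>n. \<bar>p n\<bar>)" by (rule summable_comparison_test'[OF s, of 0]) (use assms in auto)
  then show "summable p" by (rule summable_rabs_cancel)
  have "\<bar>suminf p\<bar> \<le> (\<Sum>n. \<bar>p n\<bar>)" by (rule summable_rabs[OF a])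
  also have "\<dots> \<le> (\<Sum>n. A * \<kappa> n)" by (rule suminf_le[OF assms a s])
  also have "\<dots> = A * S\<kappa>" unfolding S\<kappa>_def by (rule suminf_mult[OF \<kappa>_summable])
  finally show "\<bar>suminf p\<bar> \<le> A * S\<kappa>" .
qed

lemma term_bound:
  assumes "\<bar>q\<bar> \<le> C / (real (Suc n))\<^sup>2 * A" "\<bar>r\<bar> \<le> B * sqrt (real (Suc n))"
  shows "\<bar>q * r\<bar> \<le> (C * A * B) * \<kappa> n"
proof -
  have "\<bar>q * r\<bar> \<le> (C / (real (Suc n))\<^sup>2 * A) * (B * sqrt (real (Suc n)))"
    unfolding abs_mult by (rule mult_mono[OF assms]) (use assms(1) abs_ge_zero order_trans in blast, simp)
  also have "\<dots> = (C * A * B) * \<kappa> n" unfolding \<kappa>_def by simp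
  finally show ?thesis .
qed

definition growth :: "nat \<Rightarrow> real" where
  "growth n = (SOME K. \<forall>k\<ge>1. \<forall>s\<in>{- real n..0}. \<bar>b k s\<bar> \<le> K * sqrt (real k))"

lemma growth: "s \<in> {- real n..0} \<Longrightarrow> \<bar>b (Suc k) s\<bar> \<le> growth n * sqrt (real (Suc k))"
proof -
  assume s: "s \<in> {- real n..0}"
  have "\<forall>k\<ge>1. \<forall>s\<in>{- real n..0}. \<bar>b k s\<bar> \<le> growth n * sqrt (real k)"
    unfolding growth_def by (rule someI_ex[OF b_growth])
  then show ?thesis using s by (metis le_add1 plus_1_eq_Suc)
qed

lemma ex_window: "s \<le> 0 \<Longrightarrow> \<exists>n. s \<in> {- real n..0}"
proof -
  assume "s \<le> 0"
  obtain n where "- s \<le> real n" using real_arch_simple by blast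
  then show ?thesis using \<open>s \<le> 0\<close> by (intro exI[of _ n]) auto
qed

lemma coefficient_bound:
  assumes "\<And>k x. k \<ge> 1 \<Longrightarrow> \<bar>\<phi> k x\<bar> \<le> C / (real k)\<^sup>2" "s \<in> {- real n..0}"
  shows "\<bar>\<phi> (Suc k) x * b (Suc k) s\<bar> \<le> (C * 1 * growth n) * \<kappa> k"
  by (rule term_bound) (use assms(1)[of "Suc k" x] growth[OF assms(2)] in auto)

lemma force_term_bound: "s \<in> {- real n..0} \<Longrightarrow> \<bar>f (Suc k) x * b (Suc k) s\<bar> \<le> (C * 1 * growth n) * \<kappa> k"
  and force_derivative_term_bound: "s \<in> {- real n..0} \<Longrightarrow> \<bar>f' (Suc k) x * b (Suc k) s\<bar> \<le> (C * 1 * growth n) * \<kappa> k"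
  and potential_term_bound: "s \<in> {- real n..0} \<Longrightarrow> \<bar>F (Suc k) x * b (Suc k) s\<bar> \<le> (C * 1 * growth n) * \<kappa> k"
  by (rule coefficient_bound, rule f_bound f'_bound F_bound, assumption+)+

text \<open>Uniform convergence on each strip \<open>{- n..0} \<times> UNIV\<close>.\<close>

lemma potential_series_continuous:
  fixes \<phi> :: "nat \<Rightarrow> real \<Rightarrow> real"
  assumes bnd: "\<And>k x. k \<ge> 1 \<Longrightarrow> \<bar>\<phi> k x\<bar> \<le> C / (real k)\<^sup>2" and cont: "\<And>k. k \<ge> 1 \<Longrightarrow> continuous_on UNIV (\<phi> k)"
  shows "continuous_on ({..0} \<times> UNIV) (\<lambda>p. \<Sum>n. \<phi> (Suc n) (snd p) * b (Suc n) (fst p))"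
proof -
  let ?h = "\<lambda>p :: real \<times> real. \<Sum>n. \<phi> (Suc n) (snd p) * b (Suc n) (fst p)"
  have loc: "continuous_on ({- real n..0} \<times> UNIV) ?h" for n
  proof (rule uniform_limit_theorem)
    show "uniform_limit ({- real n..0} \<times> UNIV) (\<lambda>N p. \<Sum>i<N. \<phi> (Suc i) (snd p) * b (Suc i) (fst p)) ?h sequentially"
      by (rule Weierstrass_m_test[where M = "\<lambda>k. (C * 1 * growth n) * \<kappa> k"])
        (use coefficient_bound[of \<phi>, OF bnd] \<kappa>_summable in \<open>auto intro: summable_mult\<close>)
    show "\<forall>\<^sub>F N in sequentially. continuous_on ({- real n..0} \<times> UNIV) (\<lambda>p. \<Sum>i<N. \<phi> (Suc i) (snd p) * b (Suc i) (fst p))"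
      by (intro always_eventually allI continuous_intros continuous_on_compose2[OF cont] continuous_on_compose2[OF b_continuous]) auto
  qed simp
  show ?thesis unfolding continuous_on_eq_continuous_within
  proof
    fix p :: "real \<times> real" assume p: "p \<in> {..0} \<times> UNIV"
    then have "fst p \<le> 0" by (cases p) auto
    then obtain n where n: "fst p \<in> {- real n..0}" using ex_window by blast
    have "continuous (at p within ({- real (Suc n)..0} \<times> UNIV)) ?h"
      using loc[of "Suc n"] n p unfolding continuous_on_eq_continuous_within by (cases p) auto
    moreover have "at p within ({- real (Suc n)..0} \<times> UNIV) = at p within ({..0} \<times> UNIV)"
      by (rule at_within_nhd[of _ "{- real (Suc n)<..} \<times> UNIV"]) (use n in \<open>cases p; auto intro: open_Times\<close>)+
    ultimately show "continuous (at p within {..0} \<times> UNIV) ?h" by simp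
  qed
qed

text \<open>Termwise differentiation, the series of the derivatives being uniformly convergent.\<close>

lemma series_derivative:
  fixes \<phi> \<psi> :: "nat \<Rightarrow> real \<Rightarrow> real"
  assumes der: "\<And>k x. k \<ge> 1 \<Longrightarrow> (\<phi> k has_real_derivative \<psi> k x) (at x)"
    and bnd: "\<And>k x. k \<ge> 1 \<Longrightarrow> \<bar>\<phi> k x\<bar> \<le> C / (real k)\<^sup>2" "\<And>k x. k \<ge> 1 \<Longrightarrow> \<bar>\<psi> k x\<bar> \<le> C / (real k)\<^sup>2"
    and s: "s \<in> {- real n..0}"
  shows "((\<lambda>x. \<Sum>n. \<phi> (Suc n) x * b (Suc n) s) has_real_derivative (\<Sum>n. \<psi> (Suc n) x * b (Suc n) s)) (at x)"
proof (rule has_field_derivative_series'(2)[of UNIV])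
  show "((\<lambda>x. \<phi> (Suc n) x * b (Suc n) s) has_real_derivative \<psi> (Suc n) x * b (Suc n) s) (at x within UNIV)" for n x
    using der[of "Suc n" x] by (auto intro!: DERIV_cmult_right)
  show "uniformly_convergent_on UNIV (\<lambda>N x. \<Sum>i<N. \<psi> (Suc i) x * b (Suc i) s)"
    by (rule Weierstrass_m_test'[where M = "\<lambda>k. (C * 1 * growth n) * \<kappa> k"])
      (use coefficient_bound[of \<psi>, OF bnd(2) s] \<kappa>_summable in \<open>auto intro: summable_mult\<close>)
  show "summable (\<lambda>n. \<phi> (Suc n) 0 * b (Suc n) s)"
    using series_bound(2)[OF coefficient_bound[of \<phi>, OF bnd(1) s]] by simp
qed auto

end

text \<open>Calm paths give a calm force since the tolerances are summable against the coefficients.\<close>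

sublocale noise_paths \<subseteq> calm_forced_lagrangian g gx G
proof
  show "continuous_on ({..0} \<times> UNIV) (\<lambda>p. g (fst p) (snd p))" unfolding g_def
    by (rule potential_series_continuous[OF f_bound]) (use f_deriv DERIV_continuous_on in \<open>blast intro: has_field_derivative_at_within\<close>)+
  have f'c: "continuous_on UNIV (f' k)" if "k \<ge> 1" for k
  proof -
    have "(C / (real k)\<^sup>2)-lipschitz_on UNIV (f' k)"
      using f'_lipschitz[OF that] C_nonneg by (intro lipschitz_onI) (auto simp: dist_real_def)
    then show ?thesis by (rule lipschitz_on_continuous_on)
  qed
  show "continuous_on ({..0} \<times> UNIV) (\<lambda>p. gx (fst p) (snd p))" unfolding gx_def
    by (rule potential_series_continuous[OF f'_bound f'c])
  show "(g s has_real_derivative gx s x) (at x)" if "s \<le> 0" for s x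
    using ex_window[OF that] series_derivative[OF f_deriv f_bound f'_bound] unfolding g_def[abs_def] gx_def by blast
  show "(G s has_real_derivative g s x) (at x)" if "s \<le> 0" for s x
    using ex_window[OF that] series_derivative[OF F_deriv F_bound f_bound] unfolding g_def G_def[abs_def] by blast
  show "g s (x + 1) = g s x" "gx s (x + 1) = gx s x" "G s (x + 1) = G s x" for s x
    unfolding g_def gx_def G_def by (simp_all add: f_periodic f'_periodic F_periodic)
  show "\<exists>\<Gamma>. \<forall>s\<in>{a..0}. \<forall>x. \<bar>g s x\<bar> \<le> \<Gamma> \<and> \<bar>gx s x\<bar> \<le> \<Gamma>" for a
  proof -
    obtain n where n: "a \<in> {- real n..0} \<or> a > 0" using ex_window[of a] by fastforce
    have "\<bar>g s x\<bar> \<le> (C * 1 * growth n) * S\<kappa> \<and> \<bar>gx s x\<bar> \<le> (C * 1 * growth n) * S\<kappa>" if "s \<in> {a..0}" for s x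
    proof -
      have "s \<in> {- real n..0}" using n that by auto
      then show ?thesis unfolding g_def gx_def using series_bound(3)[OF force_term_bound] series_bound(3)[OF force_derivative_term_bound] by simp
    qed
    then show ?thesis by blast
  qed
  show "\<exists>K. \<forall>s\<in>{a..0}. \<forall>x y. \<bar>gx s x - gx s y\<bar> \<le> K * \<bar>x - y\<bar>" for a
  proof -
    obtain n where n: "a \<in> {- real n..0} \<or> a > 0" using ex_window[of a] by fastforce
    have "\<bar>gx s x - gx s y\<bar> \<le> (C * growth n * S\<kappa>) * \<bar>x - y\<bar>" if "s \<in> {a..0}" for s x y
    proof -
      have s: "s \<in> {- real n..0}" using n that by auto
      have "gx s x - gx s y = (\<Sum>n. (f' (Suc n) x - f' (Suc n) y) * b (Suc n) s)"
        unfolding gx_def using series_bound(2)[OF force_derivative_term_bound[OF s]] by (simp add: suminf_diff left_diff_distrib)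
      also have "\<bar>\<dots>\<bar> \<le> (C * \<bar>x - y\<bar> * growth n) * S\<kappa>"
      proof (rule series_bound(3), rule term_bound[OF _ growth[OF s]])
        fix k show "\<bar>f' (Suc k) x - f' (Suc k) y\<bar> \<le> C / (real (Suc k))\<^sup>2 * \<bar>x - y\<bar>" by (rule f'_lipschitz) simp
      qed
      finally show ?thesis by (simp add: mult_ac)
    qed
    then show ?thesis by blast
  qed
  show "\<exists>T\<le>\<tau>. \<forall>u\<in>{T - 1 / \<epsilon>..T}. \<forall>x. \<bar>g u x - g T x\<bar> \<le> \<epsilon>" if eps: "0 < \<epsilon>" for \<epsilon> \<tau>
  proof -
    define \<delta> where "\<delta> = \<epsilon> / ((C + 1) * S\<kappa>)"
    have \<delta>: "0 < \<delta>" unfolding \<delta>_def using eps C_nonneg S\<kappa>_pos by simp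
    obtain T where T: "T \<le> min \<tau> 0" "\<forall>u\<in>{T - 1 / \<epsilon>..T}. \<forall>k\<ge>1. \<bar>b k u - b k T\<bar> \<le> \<delta> * sqrt (real k)"
      using b_calm[OF eps \<delta>, of "min \<tau> 0"] by blast
    have "\<bar>g u x - g T x\<bar> \<le> \<epsilon>" if u: "u \<in> {T - 1 / \<epsilon>..T}" for u x
    proof -
      have u0: "u \<le> 0" "T \<le> 0" using u T by auto
      obtain n where n: "u \<in> {- real n..0}" using ex_window[OF u0(1)] by blast
      obtain n' where n': "T \<in> {- real n'..0}" using ex_window[OF u0(2)] by blast
      have "g u x - g T x = (\<Sum>n. f (Suc n) x * (b (Suc n) u - b (Suc n) T))"
        unfolding g_def using series_bound(2)[OF force_term_bound[OF n]] series_bound(2)[OF force_term_bound[OF n']] by (simp add: suminf_diff right_diff_distrib)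
      also have "\<bar>\<dots>\<bar> \<le> (C * 1 * \<delta>) * S\<kappa>"
      proof (rule series_bound(3), rule term_bound)
        fix k
        show "\<bar>f (Suc k) x\<bar> \<le> C / (real (Suc k))\<^sup>2 * 1" using f_bound[of "Suc k" x] by simp
        show "\<bar>b (Suc k) u - b (Suc k) T\<bar> \<le> \<delta> * sqrt (real (Suc k))"
          by (rule T(2)[rule_format, OF u]) simp
      qed
      also have "\<dots> = \<epsilon> * (C / (C + 1))"
      proof -
        have "C + 1 \<noteq> 0" "S\<kappa> \<noteq> 0" using S\<kappa>_pos C_nonneg by auto
        then show ?thesis unfolding \<delta>_def by simp
      qed
      also have "\<dots> \<le> \<epsilon> * 1" using eps C_nonneg \<open>0 < \<epsilon>\<close> by (intro mult_left_mono) auto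
      finally show ?thesis by simp
    qed
    then show ?thesis using T(1) by (intro exI[of _ T]) auto
  qed
qed

section \<open>One-sided minimizers as minimal curves\<close>

lemma continuous_on_atMost:
  fixes c :: "real \<Rightarrow> real"
  assumes "\<And>a. continuous_on {a..0} c"
  shows "continuous_on {..0} c"
  unfolding continuous_on_eq_continuous_within
proof
  fix x :: real assume x: "x \<in> {..0}"
  have "continuous (at x within {x - 1..0}) c"
    using assms[of "x - 1"] x unfolding continuous_on_eq_continuous_within by auto
  moreover have "at x within {x - 1..0} = at x within {..0}"
    by (rule at_within_nhd[of _ "{x - 1<..}"]) (use x in auto)
  ultimately show "continuous (at x within {..0}) c" by simp
qed

lemma bchoice3:
  assumes "\<forall>x\<in>A. \<exists>a b c. P x a b c"
  shows "\<exists>f g h. \<forall>x\<in>A. P x (f x) (g x) (h x)"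
  using assms by metis

context noise_paths begin

text \<open>The action sums over \<open>k \<ge> 1\<close> unconditionally, whereas series are convenient for termwise estimates.\<close>

lemma infsum_eq_suminf:
  assumes "\<And>n. \<bar>p (Suc n)\<bar> \<le> A * \<kappa> n"
  shows "infsum p {1..} = (\<Sum>n. p (Suc n))"
proof -
  have "bij_betw Suc UNIV {1..}"
    unfolding bij_betw_def by (auto simp: inj_on_def image_def dest: Suc_le_D)
  then have "infsum p {1..} = infsum (\<lambda>n. p (Suc n)) UNIV" by (rule infsum_reindex_bij_betw[symmetric])
  also have "((\<lambda>n. p (Suc n)) has_sum (\<Sum>n. p (Suc n))) UNIV"
    by (rule norm_summable_imp_has_sum)
      (use series_bound(1,2)[of "\<lambda>n. p (Suc n)", OF assms] in \<open>auto intro: summable_sums\<close>)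
  then have "infsum (\<lambda>n. p (Suc n)) UNIV = (\<Sum>n. p (Suc n))" by (rule infsumI)
  finally show ?thesis .
qed

lemma force_series:
  assumes u: "u \<in> {- real n..0}" and s: "s \<in> {- real n..0}"
  shows "(\<Sum>\<^sub>\<infinity>k\<in>{1..}. f k x * D * (b k u - b k s)) = D * (g u x - g s x)"
proof -
  have "\<bar>(f (Suc k) x * D) * (b (Suc k) u - b (Suc k) s)\<bar> \<le> (C * \<bar>D\<bar> * (2 * growth n)) * \<kappa> k" for k
  proof (rule term_bound)
    show "\<bar>f (Suc k) x * D\<bar> \<le> C / (real (Suc k))\<^sup>2 * \<bar>D\<bar>"
      unfolding abs_mult by (rule mult_right_mono[OF f_bound]) auto
    show "\<bar>b (Suc k) u - b (Suc k) s\<bar> \<le> 2 * growth n * sqrt (real (Suc k))"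
      using growth[OF u, of k] growth[OF s, of k] by linarith
  qed
  then have "(\<Sum>\<^sub>\<infinity>k\<in>{1..}. f k x * D * (b k u - b k s)) = (\<Sum>k. f (Suc k) x * D * (b (Suc k) u - b (Suc k) s))"
    by (rule infsum_eq_suminf)
  also have "\<dots> = (\<Sum>k. D * (f (Suc k) x * b (Suc k) u) - D * (f (Suc k) x * b (Suc k) s))"
    by (simp add: algebra_simps)
  also have "\<dots> = D * g u x - D * g s x"
    unfolding g_def using series_bound(2)[OF force_term_bound[OF u, of _ x]] series_bound(2)[OF force_term_bound[OF s, of _ x]]
    by (subst suminf_diff[symmetric]) (auto simp: suminf_mult intro: summable_mult)
  finally show ?thesis by (simp add: right_diff_distrib)
qed

lemma boundary_series:
  assumes s: "s \<in> {- real n..0}"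
  shows "(\<Sum>\<^sub>\<infinity>k\<in>{1..}. F k x * (b k 0 - b k s)) = - G s x"
proof -
  have eq: "F (Suc k) x * (b (Suc k) 0 - b (Suc k) s) = - (F (Suc k) x * b (Suc k) s)" for k
    using b_zero[of "Suc k"] by simp
  have "(\<Sum>\<^sub>\<infinity>k\<in>{1..}. F k x * (b k 0 - b k s)) = (\<Sum>k. F (Suc k) x * (b (Suc k) 0 - b (Suc k) s))"
    by (rule infsum_eq_suminf[where A = "C * 1 * growth n"]) (use potential_term_bound[OF s] in \<open>simp add: eq\<close>)
  also have "\<dots> = - G s x" unfolding eq G_def by (rule suminf_minus[OF series_bound(2)[OF potential_term_bound[OF s]]])
  finally show ?thesis .
qed

text \<open>The paths vanish at time \<open>0\<close> and their values at the initial time \<open>s\<close>, which enter the action as subtracted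
  constants, contribute a gradient. This gradient cancels against a part of the boundary term.\<close>

lemma action_eq:
  assumes "s \<le> 0" and c: "L-lipschitz_on {s..0} c" and lift: "lift_on {s..0} \<xi> c"
  shows "action F f b s 0 \<xi> = Act s 0 c - G s (c s)"
proof -
  define d where "d = (SOME d. lift_on {s..0} \<xi> d)"
  have ld: "lift_on {s..0} \<xi> d" unfolding d_def using lift by (rule someI[of "lift_on {s..0} \<xi>"])
  obtain k :: int where k: "\<forall>t\<in>{s..0}. d t = c t + of_int k"
    using lift_unique[OF lift ld, of s] \<open>s \<le> 0\<close> by auto
  have "L-lipschitz_on {s..0} d" using c k unfolding lipschitz_on_def dist_real_def by auto
  then obtain v where v: "velocity s 0 d v" using velocity_exists \<open>s \<le> 0\<close> by blast
  obtain V where V: "\<And>x. \<bar>v x\<bar> \<le> V" using velocity_bounded[OF v] by auto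
  have "V \<ge> 0" using V[of 0] by linarith
  obtain N where N: "negligible N" "\<And>x. x\<in>{s<..<0} - N \<Longrightarrow> (d has_real_derivative v x) (at x)"
    using velocity_derivative[OF v] by auto
  obtain n where n: "s \<in> {- real n..0}" using ex_window[OF \<open>s \<le> 0\<close>] by blast
  let ?I = "\<lambda>u. 1/2 * (deriv d u)\<^sup>2 - (\<Sum>\<^sub>\<infinity>k\<in>{1..}. f k (d u) * deriv d u * (b k u - b k s))"
  let ?J = "\<lambda>u. ((v u)\<^sup>2 / 2 - v u * g u (d u)) + v u * g s (d u)"
  have i1: "(\<lambda>u. (v u)\<^sup>2 / 2 - v u * g u (d u)) integrable_on {s..0}"
    by (rule Lag_integrable[OF velocity_continuous[OF v] velocity_measurable[OF v] V order_refl])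
  have i2: "(\<lambda>u. v u * g s (d u)) integrable_on {s..0}" by (rule gauge_integrable[OF v \<open>s \<le> 0\<close>])
  have JN: "?I u = ?J u" if "u \<in> {s..0} - (N \<union> {s, 0})" for u
  proof -
    have "deriv d u = v u" using N(2)[of u] that by (auto intro: DERIV_imp_deriv)
    moreover have "u \<in> {- real n..0}" using that n by auto
    ultimately show ?thesis using force_series[OF _ n, of u "d u" "v u"] by (simp add: right_diff_distrib)
  qed
  have neg: "negligible (N \<union> {s, 0})" using N(1) by simp
  have absJ: "?J absolutely_integrable_on {s..0}"
  proof (rule absolutely_integrable_integrable_bound)
    show "?J integrable_on {s..0}" by (rule integrable_add[OF i1 i2])
    show "(\<lambda>_. V\<^sup>2 / 2 + V * \<Gamma> s + V * \<Gamma> s) integrable_on {s..0}" by (rule integrable_const_ivl)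
    fix u assume u: "u \<in> {s..0}"
    have "\<bar>(v u)\<^sup>2 / 2\<bar> \<le> V\<^sup>2 / 2" using V[of u] \<open>V \<ge> 0\<close> by (simp add: abs_le_square_iff[symmetric])
    moreover have "\<bar>v u * g u (d u)\<bar> \<le> V * \<Gamma> s" "\<bar>v u * g s (d u)\<bar> \<le> V * \<Gamma> s"
      unfolding abs_mult using V[of u] g_bound[of s u "d u"] g_bound[of s s "d u"] u \<open>V \<ge> 0\<close> by (auto intro!: mult_mono)
    ultimately show "norm (?J u) \<le> V\<^sup>2 / 2 + V * \<Gamma> s + V * \<Gamma> s" unfolding real_norm_def by linarith
  qed
  have absI: "?I absolutely_integrable_on {s..0}" by (rule absolutely_integrable_spike[OF absJ neg JN])
  have "(LINT u:{s..0}|lebesgue. ?I u) = integral {s..0} ?I" by (rule set_lebesgue_integral_eq_integral(2)[OF absI])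
  also have "\<dots> = integral {s..0} ?J" by (rule integral_spike[OF neg]) (rule JN[symmetric])
  also have "\<dots> = Act s 0 d + (G s (d 0) - G s (d s))"
    unfolding integral_add[OF i1 i2] gauge_integral[OF v \<open>s \<le> 0\<close> \<open>s \<le> 0\<close>] Act_eq_Actv[OF v] Actv_def by simp
  finally have "action F f b s 0 \<xi> = Act s 0 d - G s (d s)"
    unfolding action_def line_action_def d_def[symmetric] boundary_series[OF n] by simp
  moreover have "Act s 0 d = Act s 0 c" by (rule Act_shift_cong[where k = k]) (use k in auto)
  moreover have "G s (d s) = G s (c s)" using k \<open>s \<le> 0\<close> G_int[OF \<open>s \<le> 0\<close>, of "c s" k] by simp
  ultimately show ?thesis by simp
qed

text \<open>A Lipschitz competitor of the lift on \<open>{a..0}\<close> continues before \<open>a\<close> by an integer translate of the lift, and thus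
  projects to a competitor of the minimizer.\<close>

lemma minimizer_lift_minimal:
  assumes "one_sided_minimizer F f b \<xi>"
  shows "\<exists>c. lift_on {..0} \<xi> c \<and> minimal c"
proof -
  obtain c S where c: "lift_on {..0} \<xi> c" "\<And>a. finite (S \<inter> {a..0})"
    "\<And>a b. a < b \<Longrightarrow> b \<le> 0 \<Longrightarrow> S \<inter> {a<..<b} = {} \<Longrightarrow>
         (\<exists>c'. continuous_on {a..b} c' \<and> (\<forall>s\<in>{a..b}. (c has_real_derivative c' s) (at s within {a..b})))"
    using conjunct1[OF assms[unfolded one_sided_minimizer_def], unfolded piecewise_C1_curve_def]
    by (elim exE conjE) (rule that, assumption, rule spec, assumption, drule spec, drule spec, erule mp, blast)
  have ll: "loc_lipschitz c" unfolding loc_lipschitz_def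
    using piecewise_C1_lipschitz[of S c 0, OF c(2,3)] by blast
  have "Act a 0 c \<le> Act a 0 e"
    if a: "a < 0" and e: "L-lipschitz_on {a..0} e" and int: "e a - c a \<in> \<int>" "e 0 - c 0 \<in> \<int>" for a e L
  proof -
    obtain i where i: "e a - c a = of_int i" using int(1) by (auto elim: Ints_cases)
    define h where "h s = (if s \<le> a then c s + of_int i else e s)" for s
    define \<eta> where "\<eta> s = to_circle (h s)" for s
    have he: "h s = e s" if "s \<in> {a..0}" for s using that i unfolding h_def by auto
    have \<eta>\<xi>: "\<eta> s = \<xi> s" if "s \<le> a" for s
    proof -
      have "to_circle (c s + of_int i) = to_circle (c s)" by (simp add: to_circle_eq_iff)
      then show ?thesis using c(1) that a unfolding \<eta>_def h_def lift_on_def by auto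
    qed
    have "\<eta> 0 = \<xi> 0"
    proof -
      have "to_circle (e 0) = to_circle (c 0)" using int(2) by (simp add: to_circle_eq_iff)
      then show ?thesis using c(1) a unfolding \<eta>_def h_def lift_on_def by auto
    qed
    moreover have "lipschitz_curve \<eta>" unfolding lipschitz_curve_def
    proof (intro allI impI)
      fix a' :: real assume "a' \<le> 0"
      have "\<exists>M. M-lipschitz_on {min a' a..0} h"
      proof -
        obtain M1 where "M1-lipschitz_on {min a' a..a} c" using loc_lipschitzD[OF ll, of a] a by auto
        then have "M1-lipschitz_on {min a' a..a} (\<lambda>s. c s + of_int i)" unfolding lipschitz_on_def dist_real_def by simp
        then show ?thesis unfolding h_def using lipschitz_splice[OF _ e] i by auto
      qed
      then obtain M where "M-lipschitz_on {min a' a..0} h" by blast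
      then have "M-lipschitz_on {a'..0} h" by (rule lipschitz_on_subset) auto
      then show "\<exists>L. L-lipschitz_on {a'..0} \<eta>" unfolding \<eta>_def[abs_def] using to_circle_lipschitz by blast
    qed
    ultimately have le: "action F f b a 0 \<xi> \<le> action F f b a 0 \<eta>"
      using assms a \<eta>\<xi> unfolding one_sided_minimizer_def by blast
    obtain M where M: "M-lipschitz_on {a..0} c" using loc_lipschitzD[OF ll] by blast
    have l1: "lift_on {a..0} \<xi> c" by (rule lift_on_subset[OF c(1)]) auto
    have l2: "lift_on {a..0} \<eta> e" unfolding lift_on_def
      using lipschitz_on_continuous_on[OF e] by (auto simp: \<eta>_def he)
    have "G a (e a) = G a (c a)" using i a G_int[of a "c a" i] by (simp add: algebra_simps)
    then show ?thesis using le action_eq[OF _ M l1] action_eq[OF _ e l2] a by simp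
  qed
  then have "minimal c" unfolding minimal_def using ll by blast
  then show ?thesis using c(1) by blast
qed

text \<open>Lifts of competitors in the circle are Lipschitz and agree with \<open>c\<close> up to integers at the end points.\<close>

lemma minimal_one_sided_minimizer:
  assumes c: "minimal c" and vc: "continuous_on {..0} v"
    and cv: "\<And>s a. s \<le> 0 \<Longrightarrow> a < s \<Longrightarrow> (c has_real_derivative v s) (at s within {a..0})"
    and \<xi>: "\<And>s. s \<le> 0 \<Longrightarrow> \<xi> s = to_circle (c s)"
  shows "one_sided_minimizer F f b \<xi>"
proof -
  have ll: "loc_lipschitz c" using c unfolding minimal_def by blast
  have cc: "continuous_on {..0} c"
  proof (rule continuous_on_atMost)
    fix a show "continuous_on {a..0} c" using loc_lipschitzD[OF ll order_refl, of a] lipschitz_on_continuous_on by blast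
  qed
  have lift: "lift_on {..0} \<xi> c" unfolding lift_on_def using cc \<xi> by auto
  have "piecewise_C1_curve \<xi>" unfolding piecewise_C1_curve_def
  proof (rule exI[of _ c], rule exI[of _ "{}"], intro conjI lift allI impI)
    fix a b :: real assume ab: "a < b \<and> b \<le> 0 \<and> {} \<inter> {a<..<b} = {}"
    show "\<exists>c'. continuous_on {a..b} c' \<and> (\<forall>s\<in>{a..b}. (c has_real_derivative c' s) (at s within {a..b}))"
    proof (intro exI[of _ v] conjI ballI)
      show "continuous_on {a..b} v" by (rule continuous_on_subset[OF vc]) (use ab in auto)
      fix s assume s: "s \<in> {a..b}"
      show "(c has_real_derivative v s) (at s within {a..b})"
        by (rule DERIV_subset[OF cv[of s "a - 1"]]) (use s ab in auto)
    qed
  qed simp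
  moreover have "action F f b s 0 \<xi> \<le> action F f b s 0 \<eta>"
    if \<eta>: "lipschitz_curve \<eta>" "\<eta> 0 = \<xi> 0" "\<tau> < 0" "\<forall>t\<le>\<tau>. \<eta> t = \<xi> t" "s \<le> \<tau>" for \<eta> \<tau> s
  proof -
    have s: "s < 0" using \<eta> by linarith
    obtain L where L: "L-lipschitz_on {s..0} \<eta>" using \<eta>(1)[unfolded lipschitz_curve_def, rule_format, of s] s by auto
    obtain e where e: "lift_on {s..0} \<eta> e" using lift_exists[OF lipschitz_on_continuous_on[OF L]] by blast
    obtain M where M: "M-lipschitz_on {s..0} e" using lift_lipschitz[OF L e] by blast
    have "to_circle (e s) = to_circle (c s)" "to_circle (e 0) = to_circle (c 0)"
      using e \<eta> s \<xi>[of s] \<xi>[of 0] unfolding lift_on_def by auto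
    then have int: "e s - c s \<in> \<int>" "e 0 - c 0 \<in> \<int>" unfolding to_circle_eq_iff by auto
    then obtain i where i: "e s - c s = of_int i" by (auto elim: Ints_cases)
    have "Act s 0 c \<le> Act s 0 e" using c s M int unfolding minimal_def by blast
    moreover have "G s (e s) = G s (c s)" using i s G_int[of s "c s" i] by (simp add: algebra_simps)
    moreover obtain M' where M': "M'-lipschitz_on {s..0} c" using loc_lipschitzD[OF ll] by blast
    moreover have "lift_on {s..0} \<xi> c" by (rule lift_on_subset[OF lift]) auto
    ultimately show ?thesis using action_eq[OF _ M' _, of \<xi>] action_eq[OF _ M e] s by simp
  qed
  ultimately show ?thesis unfolding one_sided_minimizer_def by blast
qed

text \<open>Otherwise the curves would meet at a negative time.\<close>

lemma minimal_order:
  assumes c: "minimal c" and d: "minimal d" and "c 0 < d 0" and "s \<le> 0"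
  shows "c s < d s"
proof (rule ccontr)
  assume "\<not> c s < d s"
  then have "0 \<le> c s - d s" by simp
  have cont: "continuous_on {s..0} x" if "minimal x" for x
    using that loc_lipschitzD[of x 0 s] lipschitz_on_continuous_on unfolding minimal_def by blast
  have "\<exists>t. s \<le> t \<and> t \<le> 0 \<and> c t - d t = 0"
    by (rule IVT2'[of "\<lambda>t. c t - d t"])
      (use \<open>0 \<le> c s - d s\<close> \<open>c 0 < d 0\<close> \<open>s \<le> 0\<close> in \<open>auto intro: continuous_on_diff cont c d\<close>)
  then obtain t where t: "t \<le> 0" "c t = d t" by auto
  then have "t < 0" using \<open>c 0 < d 0\<close> by (cases "t = 0") auto
  then have "c 0 = d 0" using minimal_noncrossing[OF c d _ t(2)] by simp
  then show False using \<open>c 0 < d 0\<close> by simp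
qed

text \<open>Each exceptional point is assigned a rational number between two minimal curves at time \<open>- 1\<close>; the order of
  minimal curves makes this assignment injective.\<close>

theorem countable_nonunique:
  "countable {x. \<not> (\<exists>!\<xi>. \<xi> \<in> {..0} \<rightarrow>\<^sub>E UNIV \<and> one_sided_minimizer F f b \<xi> \<and> \<xi> 0 = x)}" (is "countable ?Bad")
proof -
  have two_exist: "\<exists>r c d. r \<in> {0..<1} \<and> to_circle r = x \<and> minimal c \<and> minimal d \<and> c 0 = r \<and> d 0 = r \<and> c (- 1) < d (- 1)"
    if x: "x \<in> ?Bad" for x
  proof -
    obtain r0 where r0: "to_circle r0 = x" using to_circle_surj by blast
    (* Lifts are normalized to end in {0..<1}. *)
    define r where "r = frac r0"
    have "r - r0 \<in> \<int>" unfolding r_def frac_def by simp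
    then have rx: "to_circle r = x" using r0 to_circle_eq_iff by metis
    have r: "r \<in> {0..<1}" unfolding r_def by (simp add: frac_lt_1)
    obtain c v where cv: "c 0 = r" "minimal c" "continuous_on {..0} v"
      "\<forall>s\<le>0. \<forall>a<s. (c has_real_derivative v s) (at s within {a..0})"
      using minimal_exists[of r] by blast
    define \<xi> where "\<xi> = restrict (\<lambda>s. to_circle (c s)) {..0}"
    have \<xi>: "\<xi> \<in> {..0} \<rightarrow>\<^sub>E UNIV" "\<xi> 0 = x" unfolding \<xi>_def using cv(1) rx by auto
    have "one_sided_minimizer F f b \<xi>"
      by (rule minimal_one_sided_minimizer[OF cv(2,3)]) (use cv(4) in \<open>auto simp: \<xi>_def\<close>)
    then obtain \<eta> where \<eta>: "\<eta> \<in> {..0} \<rightarrow>\<^sub>E UNIV" "one_sided_minimizer F f b \<eta>" "\<eta> 0 = x" "\<eta> \<noteq> \<xi>"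
      using x \<xi> by blast
    obtain d0 where d0: "lift_on {..0} \<eta> d0" "minimal d0" using minimizer_lift_minimal[OF \<eta>(2)] by blast
    have "to_circle (d0 0) = to_circle r" using d0(1) \<eta>(3) rx unfolding lift_on_def by auto
    then obtain i where i: "d0 0 - r = of_int i" unfolding to_circle_eq_iff by (auto elim: Ints_cases)
    define d where "d s = d0 s + of_int (- i)" for s
    have d: "minimal d" unfolding d_def[abs_def] by (rule minimal_shift[OF d0(2)])
    have d00: "d 0 = r" using i unfolding d_def by simp
    have dl: "to_circle (d s) = \<eta> s" if "s \<le> 0" for s
    proof -
      have "to_circle (d s) = to_circle (d0 s)" unfolding d_def by (simp add: to_circle_eq_iff)
      then show ?thesis using d0(1) that unfolding lift_on_def by auto
    qed
    have "c (- 1) \<noteq> d (- 1)"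
    proof
      assume eq: "c (- 1) = d (- 1)"
      have "c s = d s" if "s \<le> 0" for s by (rule minimal_noncrossing[OF cv(2) d _ eq that]) simp
      then have "\<eta> s = \<xi> s" for s
        using dl[of s] \<eta>(1) unfolding \<xi>_def by (cases "s \<le> 0") (auto simp: PiE_def extensional_def)
      then show False using \<eta>(4) by blast
    qed
    then consider "c (- 1) < d (- 1)" | "d (- 1) < c (- 1)" by linarith
    then show ?thesis
    proof cases
      case 1 show ?thesis by (rule exI[of _ r], rule exI[of _ c], rule exI[of _ d]) (use 1 r rx cv(1,2) d d00 in simp)
    next
      case 2 show ?thesis by (rule exI[of _ r], rule exI[of _ d], rule exI[of _ c]) (use 2 r rx cv(1,2) d d00 in simp)
    qed
  qed
  define two where "two x r c d \<longleftrightarrow> r \<in> {0..<1} \<and> to_circle r = x \<and> minimal c \<and> minimal d \<and> c 0 = r \<and> d 0 = r \<and> c (- 1) < d (- 1)"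
    for x r c d
  have "\<forall>x\<in>?Bad. \<exists>r c d. two x r c d"
  proof
    fix x assume "x \<in> ?Bad"
    then show "\<exists>r c d. two x r c d" unfolding two_def by (rule two_exist)
  qed
  from bchoice3[OF this] obtain r c d where "\<forall>x\<in>?Bad. two x (r x) (c x) (d x)" by (elim exE)
  then have rcd: "\<And>x. x \<in> ?Bad \<Longrightarrow> r x \<in> {0..<1} \<and> to_circle (r x) = x \<and> minimal (c x) \<and> minimal (d x) \<and>
    c x 0 = r x \<and> d x 0 = r x \<and> c x (- 1) < d x (- 1)"
    unfolding two_def by (rule bspec)
  have "\<exists>q\<in>\<rat>. c x (- 1) < q \<and> q < d x (- 1)" if "x \<in> ?Bad" for x
    using rcd[OF that] Rats_dense_in_real by blast
  then have "\<forall>x\<in>?Bad. \<exists>q. q \<in> \<rat> \<and> c x (- 1) < q \<and> q < d x (- 1)" unfolding Bex_def by (intro ballI)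
  from bchoice[OF this] obtain q where qb: "\<forall>x\<in>?Bad. q x \<in> \<rat> \<and> c x (- 1) < q x \<and> q x < d x (- 1)" by (elim exE)
  note q = bspec[OF qb]
  have less: "q x < q y" if "x \<in> ?Bad" "y \<in> ?Bad" "r x < r y" for x y
  proof -
    have 1: "minimal (d x)" "d x 0 = r x" "q x < d x (- 1)" using rcd[OF that(1)] q[OF that(1)] by simp_all
    have 2: "minimal (c y)" "c y 0 = r y" "c y (- 1) < q y" using rcd[OF that(2)] q[OF that(2)] by simp_all
    have "d x (- 1) < c y (- 1)" by (rule minimal_order[OF 1(1) 2(1)]) (simp_all add: 1(2) 2(2) that(3))
    then show ?thesis using 1(3) 2(3) by linarith
  qed
  have inj: "inj_on q ?Bad"
  proof (rule inj_onI)
    fix x y assume xy: "x \<in> ?Bad" "y \<in> ?Bad" "q x = q y"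
    have "r x = r y" using less[OF xy(1,2)] less[OF xy(2,1)] xy(3) by linarith
    have "x = to_circle (r x)" using rcd[OF xy(1)] by simp
    also have "\<dots> = to_circle (r y)" using \<open>r x = r y\<close> by (rule arg_cong)
    also have "\<dots> = y" using rcd[OF xy(2)] by simp
    finally show "x = y" .
  qed
  have "countable (q ` ?Bad)" by (rule countable_subset[OF image_subsetI countable_rat]) (rule conjunct1[OF q])
  then show ?thesis by (rule countable_image_inj_on[OF _ inj])
qed

end

section \<open>Oscillation of Wiener processes\<close>

lemma wiener_measurable: "wiener_process M W \<Longrightarrow> W t \<in> borel_measurable M"
  unfolding wiener_process_def by blast

lemma wiener_increment_distributed:
  "wiener_process M W \<Longrightarrow> s < t \<Longrightarrow>
    distributed M lborel (\<lambda>\<omega>. W t \<omega> - W s \<omega>) (normal_density 0 (sqrt (t - s)))"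
  unfolding wiener_process_def by blast

context prob_space begin

text \<open>Markov's inequality for the fourth moment. The second moment would not suffice: the chaining argument loses a
  factor \<open>2^l\<close> at level \<open>l\<close>.\<close>

lemma wiener_increment_tail:
  assumes W: "wiener_process M W" and "s < t" "0 < a"
  shows "prob {\<omega>\<in>space M. a < \<bar>W t \<omega> - W s \<omega>\<bar>} \<le> 3 * (t - s)\<^sup>2 / a ^ 4"
proof -
  note [measurable] = wiener_measurable[OF W]
  let ?D = "\<lambda>\<omega>. W t \<omega> - W s \<omega>" and ?n = "normal_density 0 (sqrt (t - s))"
  note D = wiener_increment_distributed[OF W \<open>s < t\<close>]
  have pos: "0 < sqrt (t - s)" using \<open>s < t\<close> by simp
  have mom: "has_bochner_integral lborel (\<lambda>x. ?n x * x ^ 4) (3 * (t - s)\<^sup>2)"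
    using normal_moment_even[OF pos, of 0 2] \<open>s < t\<close>
    by (simp add: fact_numeral power_divide field_simps)
  have int: "integrable M (\<lambda>\<omega>. ?D \<omega> ^ 4)"
    using distributed_integrable[OF D, of "\<lambda>x. x ^ 4"] integrable.intros[OF mom] by simp
  have E: "expectation (\<lambda>\<omega>. ?D \<omega> ^ 4) = 3 * (t - s)\<^sup>2"
    using distributed_integral[OF D, of "\<lambda>x. x ^ 4"] has_bochner_integral_integral_eq[OF mom] by simp
  have "prob {\<omega>\<in>space M. a < \<bar>?D \<omega>\<bar>} \<le> prob {\<omega>\<in>space M. a ^ 4 \<le> ?D \<omega> ^ 4}"
  proof (rule finite_measure_mono)
    show "{\<omega>\<in>space M. a < \<bar>?D \<omega>\<bar>} \<subseteq> {\<omega>\<in>space M. a ^ 4 \<le> ?D \<omega> ^ 4}"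
    proof safe
      fix \<omega> assume "a < \<bar>?D \<omega>\<bar>"
      then have "a ^ 4 \<le> \<bar>?D \<omega>\<bar> ^ 4" using \<open>0 < a\<close> by (intro power_mono) auto
      then show "a ^ 4 \<le> ?D \<omega> ^ 4" by (simp add: power_even_abs)
    qed
  qed simp
  also have "\<dots> \<le> expectation (\<lambda>\<omega>. ?D \<omega> ^ 4) / a ^ 4"
    by (rule integral_Markov_inequality_measure[OF int, of "space M" "a ^ 4", simplified]) (use \<open>0 < a\<close> in auto)
  finally show ?thesis unfolding E .
qed

text \<open>On \<open>{- \<beta>..\<beta>}\<close> the normal density is at least its value at \<open>\<beta>\<close>.\<close>

lemma wiener_increment_small:
  assumes W: "wiener_process M W" and "s < t" "0 < \<beta>"
  shows "2 * \<beta> * normal_density 0 (sqrt (t - s)) \<beta> \<le> prob {\<omega>\<in>space M. \<bar>W t \<omega> - W s \<omega>\<bar> \<le> \<beta>}"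
proof -
  note [measurable] = wiener_measurable[OF W]
  let ?D = "\<lambda>\<omega>. W t \<omega> - W s \<omega>" and ?n = "normal_density 0 (sqrt (t - s))"
  note D = wiener_increment_distributed[OF W \<open>s < t\<close>]
  have mono: "?n \<beta> \<le> ?n x" if "\<bar>x\<bar> \<le> \<beta>" for x
  proof -
    have "x\<^sup>2 \<le> \<beta>\<^sup>2" using that \<open>0 < \<beta>\<close> by (simp add: abs_le_square_iff[symmetric])
    then show ?thesis unfolding normal_density_def using \<open>s < t\<close>
      by (intro mult_left_mono) (auto simp: divide_right_mono)
  qed
  have "ennreal (2 * \<beta> * ?n \<beta>) = (\<integral>\<^sup>+x. ennreal (?n \<beta>) * indicator {-\<beta>..\<beta>} x \<partial>lborel)"
    using \<open>0 < \<beta>\<close> by (subst nn_integral_cmult_indicator) (simp_all add: ennreal_mult''[symmetric] mult.commute)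
  also have "\<dots> \<le> (\<integral>\<^sup>+x. ennreal (?n x) * indicator {-\<beta>..\<beta>} x \<partial>lborel)"
    by (rule nn_integral_mono) (auto simp: indicator_def intro!: ennreal_leI mono)
  also have "\<dots> = emeasure M (?D -` {-\<beta>..\<beta>} \<inter> space M)"
    by (rule distributed_emeasure[OF D, symmetric]) simp
  also have "?D -` {-\<beta>..\<beta>} \<inter> space M = {\<omega>\<in>space M. \<bar>?D \<omega>\<bar> \<le> \<beta>}" by auto
  finally show ?thesis by (simp add: emeasure_eq_measure)
qed

end

text \<open>Oscillation from the left end point of a block, seen at the dyadic points of level \<open>l\<close>. For fixed \<open>l\<close> it depends on
  finitely many increments, and all levels together determine the oscillation of a continuous path.\<close>

definition dyadic_osc_le :: "nat \<Rightarrow> real \<Rightarrow> real \<Rightarrow> real \<Rightarrow> (real \<Rightarrow> real) \<Rightarrow> bool" where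
  "dyadic_osc_le l s h \<alpha> w \<longleftrightarrow> (\<forall>m\<le>2^l. \<bar>w (s + h * real m / 2^l) - w s\<bar> \<le> \<alpha>)"

lemma dyadic_osc_le_decreasing:
  assumes "l \<le> l'" "dyadic_osc_le l' s h \<alpha> w"
  shows "dyadic_osc_le l s h \<alpha> w"
  unfolding dyadic_osc_le_def
proof (intro allI impI)
  fix m :: nat assume m: "m \<le> 2^l"
  define d where "d = l' - l"
  have l': "l' = l + d" using assms(1) unfolding d_def by simp
  have "m * 2^d \<le> 2^l'" using m unfolding l' power_add by simp
  then have "\<bar>w (s + h * real (m * 2^d) / 2^l') - w s\<bar> \<le> \<alpha>" using assms(2) unfolding dyadic_osc_le_def by blast
  moreover have "h * real (m * 2^d) / 2^l' = h * real m / 2^l" unfolding l' power_add by simp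
  ultimately show "\<bar>w (s + h * real m / 2^l) - w s\<bar> \<le> \<alpha>" by simp
qed

text \<open>A dyadic point is reached from a point of the previous level by at most one increment, and the allowed increments
  form a geometric series with sum \<open>a\<close>.\<close>

lemma dyadic_chaining:
  assumes r: "0 \<le> r" "r < 1" and "0 \<le> a"
    and inc: "\<And>l m. m < 2^l \<Longrightarrow> \<bar>w (s + h * real (Suc m) / 2^l) - w (s + h * real m / 2^l)\<bar> \<le> a * (1 - r) * r^l"
  shows "dyadic_osc_le l s h a w"
proof -
  have "\<forall>m\<le>2^l. \<bar>w (s + h * real m / 2^l) - w s\<bar> \<le> a * (1 - r ^ Suc l)"
  proof (induction l)
    case 0
    show ?case
    proof (intro allI impI)
      fix m :: nat assume "m \<le> 2^0"
      then have "m = 0 \<or> m = 1" by auto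
      then show "\<bar>w (s + h * real m / 2^0) - w s\<bar> \<le> a * (1 - r ^ Suc 0)"
        using inc[of 0 0] r \<open>0 \<le> a\<close> by auto
    qed
  next
    case (Suc l)
    have geo: "a * (1 - r ^ Suc l) + a * (1 - r) * r ^ Suc l = a * (1 - r ^ Suc (Suc l))" by (simp add: algebra_simps)
    show ?case
    proof (intro allI impI)
      fix m :: nat assume m: "m \<le> 2 ^ Suc l"
      show "\<bar>w (s + h * real m / 2 ^ Suc l) - w s\<bar> \<le> a * (1 - r ^ Suc (Suc l))"
      proof (cases "even m")
        case True
        then obtain q where q: "m = 2 * q" by (elim evenE)
        then have "\<bar>w (s + h * real q / 2 ^ l) - w s\<bar> \<le> a * (1 - r ^ Suc l)" using Suc m by simp
        moreover have "0 \<le> a * (1 - r) * r ^ Suc l" using r \<open>0 \<le> a\<close> by simp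
        moreover have "h * real m / 2 ^ Suc l = h * real q / 2 ^ l" using q by simp
        ultimately show ?thesis using geo by simp
      next
        case False
        then obtain q where q: "m = Suc (2 * q)" by (elim oddE) simp
        have "\<bar>w (s + h * real q / 2 ^ l) - w s\<bar> \<le> a * (1 - r ^ Suc l)" using Suc m q by simp
        moreover have eq: "h * real (2 * q) / 2 ^ Suc l = h * real q / 2 ^ l" by simp
        moreover have "\<bar>w (s + h * real (Suc (2 * q)) / 2 ^ Suc l) - w (s + h * real (2 * q) / 2 ^ Suc l)\<bar> \<le> a * (1 - r) * r ^ Suc l"
          by (rule inc) (use m q in simp)
        ultimately show ?thesis unfolding q eq using geo by linarith
      qed
    qed
  qed
  moreover have "a * (1 - r ^ Suc l) \<le> a" using r \<open>0 \<le> a\<close> by (simp add: algebra_simps)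
  ultimately show ?thesis unfolding dyadic_osc_le_def by force
qed

lemma dyadic_osc_le_continuous:
  assumes cont: "continuous_on UNIV w" and "0 < h"
    and osc: "\<And>l. dyadic_osc_le l s h \<alpha> w" and u: "u \<in> {s..s + h}"
  shows "\<bar>w u - w s\<bar> \<le> \<alpha>"
proof -
  define m where "m l = nat \<lfloor>(u - s) / h * 2 ^ l\<rfloor>" for l :: nat
  have fl: "real (m l) \<le> (u - s) / h * 2 ^ l" "(u - s) / h * 2 ^ l < real (m l) + 1" for l
    unfolding m_def using u \<open>0 < h\<close> by (auto simp: of_nat_nat)
  have le: "m l \<le> 2 ^ l" for l
  proof -
    have "(u - s) / h * 2 ^ l \<le> 1 * 2 ^ l" using u \<open>0 < h\<close> by (intro mult_right_mono) auto
    with fl(1)[of l] have "real (m l) \<le> 1 * 2 ^ l" by (rule order_trans)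
    then show ?thesis by simp
  qed
  have "(\<lambda>l. real (m l) / 2 ^ l) \<longlonglongrightarrow> (u - s) / h"
  proof (rule tendsto_sandwich[of "\<lambda>l. (u - s) / h - (1 / 2) ^ l" _ _ "\<lambda>l. (u - s) / h"])
    have "(u - s) / h - (1 / 2) ^ l \<le> real (m l) / 2 ^ l" for l
    proof -
      have "(u - s) / h < (real (m l) + 1) / 2 ^ l" using fl(2)[of l] by (simp add: less_divide_eq)
      also have "\<dots> = real (m l) / 2 ^ l + (1 / 2) ^ l" by (simp add: add_divide_distrib power_divide)
      finally show ?thesis by simp
    qed
    then show "\<forall>\<^sub>F l in sequentially. (u - s) / h - (1 / 2) ^ l \<le> real (m l) / 2 ^ l" by simp
    have "real (m l) / 2 ^ l \<le> (u - s) / h" for l using fl(1)[of l] by (simp add: divide_le_eq)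
    then show "\<forall>\<^sub>F l in sequentially. real (m l) / 2 ^ l \<le> (u - s) / h" by simp
    have "(\<lambda>l. (u - s) / h - (1 / 2) ^ l) \<longlonglongrightarrow> (u - s) / h - 0"
      by (intro tendsto_intros LIMSEQ_realpow_zero) auto
    then show "(\<lambda>l. (u - s) / h - (1 / 2) ^ l) \<longlonglongrightarrow> (u - s) / h" by simp
  qed simp
  then have "(\<lambda>l. s + h * (real (m l) / 2 ^ l)) \<longlonglongrightarrow> s + h * ((u - s) / h)" by (rule tendsto_add[OF tendsto_const tendsto_mult[OF tendsto_const]])
  then have lim: "(\<lambda>l. s + h * real (m l) / 2 ^ l) \<longlonglongrightarrow> u" using \<open>0 < h\<close> by simp
  have "(\<lambda>l. w (s + h * real (m l) / 2 ^ l)) \<longlonglongrightarrow> w u"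
    using continuous_on_tendsto_compose[OF cont lim] by simp
  then have "(\<lambda>l. \<bar>w (s + h * real (m l) / 2 ^ l) - w s\<bar>) \<longlonglongrightarrow> \<bar>w u - w s\<bar>" by (intro tendsto_intros)
  then show ?thesis
    by (rule LIMSEQ_le_const2) (use osc le in \<open>auto simp: dyadic_osc_le_def\<close>)
qed

context prob_space begin

text \<open>A union bound over all dyadic increments of the block. What matters is the order \<open>h\<^sup>2\<close>, the constant is generous.\<close>

lemma wiener_oscillation_tail:
  assumes W: "wiener_process M W" and "0 < h" "0 < a"
  shows "prob {\<omega>\<in>space M. \<not> (\<forall>l. dyadic_osc_le l s h a (\<lambda>t. W t \<omega>))} \<le> 200000 * h\<^sup>2 / a ^ 4"
proof -
  note [measurable] = wiener_measurable[OF W]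
  (* The sum over the levels converges if 2 * r^4 > 1. For r = 9 / 10 it is at most 5, and 3 / (1 - r)^4 = 30000. *)
  define r :: real where "r = 9 / 10"
  let ?p = "\<lambda>l m. s + h * real m / 2 ^ l"
  define E where "E l m = {\<omega>\<in>space M. a * (1 - r) * r ^ l < \<bar>W (?p l (Suc m)) \<omega> - W (?p l m) \<omega>\<bar>}" for l m :: nat
  define c where "c = 30000 * h\<^sup>2 / a ^ 4"
  have c: "0 \<le> c" unfolding c_def by simp
  have Em: "E l m \<in> events" for l m unfolding E_def by measurable
  have PE: "prob (E l m) \<le> c * (1 / (4 * r ^ 4)) ^ l" for l m
  proof -
    have step: "?p l (Suc m) - ?p l m = h / 2 ^ l" by (simp add: diff_divide_distrib[symmetric] algebra_simps)
    have "0 < h / 2 ^ l" using \<open>0 < h\<close> by simp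
    then have lt: "?p l m < ?p l (Suc m)" using step by linarith
    have pos: "0 < a * (1 - r) * r ^ l" using \<open>0 < a\<close> unfolding r_def by simp
    have "prob (E l m) \<le> 3 * (?p l (Suc m) - ?p l m)\<^sup>2 / (a * (1 - r) * r ^ l) ^ 4"
      unfolding E_def by (rule wiener_increment_tail[OF W lt pos])
    also have "\<dots> = 3 * (h / 2 ^ l)\<^sup>2 / (a * (1 - r) * r ^ l) ^ 4" unfolding step ..
    also have "\<dots> = 3 * h\<^sup>2 / (a ^ 4 * (1 - r) ^ 4) * (1 / ((2 ^ l)\<^sup>2 * (r ^ l) ^ 4))"
      by (simp add: power_mult_distrib power_divide)
    also have "(2 ^ l)\<^sup>2 * (r ^ l) ^ 4 = (4 * r ^ 4) ^ l"
      by (simp add: power_mult_distrib power_mult[symmetric] mult.commute[of l]) (simp add: power_mult)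
    also have "3 * h\<^sup>2 / (a ^ 4 * (1 - r) ^ 4) = c" unfolding c_def r_def by (simp add: power_divide)
    finally show ?thesis by (simp add: power_divide)
  qed
  have PU: "prob (\<Union>m<2^l. E l m) \<le> c * (1 / (2 * r ^ 4)) ^ l" for l
  proof -
    have "prob (\<Union>m<2^l. E l m) \<le> (\<Sum>m<2^l. prob (E l m))" by (rule measure_UNION_le) (auto intro: Em)
    also have "\<dots> \<le> (\<Sum>m<(2::nat)^l. c * (1 / (4 * r ^ 4)) ^ l)" by (rule sum_mono) (rule PE)
    also have "\<dots> = c * (2 ^ l * (1 / (4 * r ^ 4)) ^ l)" by simp
    also have "2 ^ l * (1 / (4 * r ^ 4)) ^ l = (1 / (2 * r ^ 4)) ^ l"
      unfolding power_mult_distrib[symmetric] by (rule arg_cong[where f = "\<lambda>x. x ^ l"]) simp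
    finally show ?thesis .
  qed
  have q: "\<bar>1 / (2 * r ^ 4)\<bar> < 1" "1 / (1 - 1 / (2 * r ^ 4)) \<le> 5" unfolding r_def by (simp_all add: power_divide)
  have sg: "(\<lambda>l. c * (1 / (2 * r ^ 4)) ^ l) sums (c * (1 / (1 - 1 / (2 * r ^ 4))))"
    by (rule sums_mult[OF geometric_sums]) (use q(1) in simp)
  have sp: "summable (\<lambda>l. prob (\<Union>m<2^l. E l m))"
    by (rule summable_comparison_test'[OF sums_summable[OF sg], of 0]) (use PU in simp)
  have sub: "{\<omega>\<in>space M. \<not> (\<forall>l. dyadic_osc_le l s h a (\<lambda>t. W t \<omega>))} \<subseteq> (\<Union>l. \<Union>m<2^l. E l m)"
  proof
    fix \<omega> assume \<omega>: "\<omega> \<in> {\<omega>\<in>space M. \<not> (\<forall>l. dyadic_osc_le l s h a (\<lambda>t. W t \<omega>))}"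
    show "\<omega> \<in> (\<Union>l. \<Union>m<2^l. E l m)"
    proof (rule ccontr)
      assume no: "\<omega> \<notin> (\<Union>l. \<Union>m<2^l. E l m)"
      have "dyadic_osc_le l s h a (\<lambda>t. W t \<omega>)" for l
      proof (rule dyadic_chaining[where r = r])
        fix l m :: nat assume "m < 2 ^ l"
        then have "\<omega> \<notin> E l m" using no by blast
        then show "\<bar>W (?p l (Suc m)) \<omega> - W (?p l m) \<omega>\<bar> \<le> a * (1 - r) * r ^ l" using \<omega> unfolding E_def by auto
      qed (use \<open>0 < a\<close> in \<open>auto simp: r_def\<close>)
      then show False using \<omega> by blast
    qed
  qed
  have "prob {\<omega>\<in>space M. \<not> (\<forall>l. dyadic_osc_le l s h a (\<lambda>t. W t \<omega>))} \<le> prob (\<Union>l. \<Union>m<2^l. E l m)"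
    by (rule finite_measure_mono[OF sub]) (intro sets.countable_UN sets.finite_UN image_subsetI Em; simp add: Em)
  also have "\<dots> \<le> (\<Sum>l. prob (\<Union>m<2^l. E l m))"
    by (rule finite_measure_subadditive_countably[OF _ sp]) (auto intro!: sets.finite_UN Em)
  also have "\<dots> \<le> c * (1 / (1 - 1 / (2 * r ^ 4)))"
    unfolding sums_unique[OF sg] by (rule suminf_le[OF PU sp sums_summable[OF sg]])
  also have "\<dots> \<le> c * 5" by (rule mult_left_mono[OF q(2) c])
  also have "\<dots> \<le> 200000 * h\<^sup>2 / a ^ 4" unfolding c_def by (simp add: divide_right_mono)
  finally show ?thesis .
qed

end

section \<open>Calm blocks\<close>

text \<open>The infinite product converges to a non-zero limit and its partial products decrease.\<close>

lemma prod_bounded_below: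
  fixes q :: "nat \<Rightarrow> real"
  assumes q: "\<And>k. 0 < q k" "\<And>k. q k \<le> 1" and sum: "summable (\<lambda>k. 1 - q k)"
  shows "\<exists>p>0. \<forall>n. p \<le> (\<Prod>k<n. q k)"
proof -
  have "summable (\<lambda>k. norm (q k - 1))" using sum q(2) by (simp add: abs_minus_commute)
  then have "convergent_prod q"
    by (intro abs_convergent_prod_imp_convergent_prod) (simp add: abs_convergent_prod_conv_summable)
  moreover have "q k \<noteq> 0" for k using q(1)[of k] by simp
  ultimately obtain L where L: "(\<lambda>n. \<Prod>k\<le>n. q k) \<longlonglongrightarrow> L" "L \<noteq> 0"
    using convergent_prod_iff_nz_lim[of q] by blast
  have dec: "decseq (\<lambda>n. \<Prod>k\<le>n. q k)"
    unfolding decseq_Suc_iff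
  proof
    fix n
    have "(\<Prod>k\<le>Suc n. q k) = (\<Prod>k\<le>n. q k) * q (Suc n)" by simp
    also have "\<dots> \<le> (\<Prod>k\<le>n. q k) * 1"
      by (intro mult_left_mono q(2) prod_nonneg) (auto intro: less_imp_le q(1))
    finally show "(\<Prod>k\<le>Suc n. q k) \<le> (\<Prod>k\<le>n. q k)" by simp
  qed
  have le: "L \<le> (\<Prod>k\<le>n. q k)" for n by (rule decseq_ge[OF dec L(1)])
  have "0 \<le> L" by (rule LIMSEQ_le_const[OF L(1)]) (auto intro: prod_nonneg less_imp_le q)
  then have "0 < L" using L(2) by simp
  moreover have "L \<le> (\<Prod>k<n. q k)" for n
  proof (cases n)
    case 0
    have "L \<le> q 0" using le[of 0] by simp
    then show ?thesis using 0 q(2)[of 0] by simp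
  next
    case (Suc m)
    then show ?thesis using le[of m] by (simp add: lessThan_Suc_atMost)
  qed
  ultimately show ?thesis by blast
qed

lemma decreasing_power_comparison:
  fixes A B :: real assumes "0 < A"
  shows "\<exists>N::nat. 1 \<le> N \<and> B / (real N)\<^sup>2 < A / sqrt (real N)"
proof -
  have "((\<lambda>n. B / (real n)\<^sup>2 * sqrt (real n)) \<longlongrightarrow> 0) sequentially" by real_asymp
  then have "\<forall>\<^sub>F n in sequentially. B / (real n)\<^sup>2 * sqrt (real n) < A" by (rule order_tendstoD(2)) (rule assms)
  then have "\<forall>\<^sub>F n in sequentially. B / (real n)\<^sup>2 * sqrt (real n) < A \<and> 1 \<le> n"
    by (rule eventually_conj) (rule eventually_ge_at_top)
  then obtain n where n: "B / (real n)\<^sup>2 * sqrt (real n) < A" "1 \<le> n"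
    using eventually_happens'[OF sequentially_bot] by blast
  then have "B / (real n)\<^sup>2 < A / sqrt (real n)" by (subst less_divide_eq) auto
  then show ?thesis using n(2) by blast
qed

text \<open>The end increment has its own, smaller bound \<open>\<beta>\<close>: end increments add up over the blocks of a window.\<close>

definition calm_block :: "real \<Rightarrow> real \<Rightarrow> real \<Rightarrow> real \<Rightarrow> (real \<Rightarrow> real) \<Rightarrow> bool" where
  "calm_block s h \<alpha> \<beta> w \<longleftrightarrow> (\<forall>l. dyadic_osc_le l s h \<alpha> w) \<and> \<bar>w (s + h) - w s\<bar> \<le> \<beta>"

text \<open>The event as a set of paths, in the form in which the independence of the processes is given.\<close>

lemma calm_block_sets:
  "{w\<in>space (PiM UNIV (\<lambda>_::real. borel)). calm_block s h \<alpha> \<beta> w} \<in> sets (PiM UNIV (\<lambda>_::real. borel :: real measure))"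
proof -
  have [measurable]: "(\<lambda>w::real\<Rightarrow>real. w t) \<in> borel_measurable (PiM UNIV (\<lambda>_. borel))" for t
    by (rule measurable_component_singleton) simp
  show ?thesis unfolding calm_block_def dyadic_osc_le_def by measurable
qed

context prob_space begin

lemma calm_block_measurable:
  assumes W: "wiener_process M W"
  shows "{\<omega>\<in>space M. calm_block s h \<alpha> \<beta> (\<lambda>t. W t \<omega>)} \<in> events"
proof -
  note [measurable] = wiener_measurable[OF W]
  show ?thesis unfolding calm_block_def dyadic_osc_le_def by measurable
qed

text \<open>The end increment and the oscillation are dependent, so the probability that the latter fails is subtracted.\<close>

lemma prob_calm_block_ge:
  assumes W: "wiener_process M W" and "0 < h" "0 < \<alpha>"
  shows "prob {\<omega>\<in>space M. \<bar>W (s + h) \<omega> - W s \<omega>\<bar> \<le> \<beta>} - 200000 * h\<^sup>2 / \<alpha> ^ 4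
    \<le> prob {\<omega>\<in>space M. calm_block s h \<alpha> \<beta> (\<lambda>t. W t \<omega>)}"
proof -
  note [measurable] = wiener_measurable[OF W]
  let ?E = "{\<omega>\<in>space M. \<bar>W (s + h) \<omega> - W s \<omega>\<bar> \<le> \<beta>}"
    and ?F = "{\<omega>\<in>space M. \<not> (\<forall>l. dyadic_osc_le l s h \<alpha> (\<lambda>t. W t \<omega>))}"
    and ?C = "{\<omega>\<in>space M. calm_block s h \<alpha> \<beta> (\<lambda>t. W t \<omega>)}"
  have F: "?F \<in> events" unfolding dyadic_osc_le_def by measurable
  have C: "?C \<in> events" by (rule calm_block_measurable[OF W])
  have "prob ?E \<le> prob (?C \<union> ?F)"
    by (rule finite_measure_mono[OF _ sets.Un[OF C F]]) (auto simp: calm_block_def)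
  also have "\<dots> \<le> prob ?C + prob ?F" by (rule measure_Un_le[OF C F])
  finally show ?thesis using wiener_oscillation_tail[OF W \<open>0 < h\<close> \<open>0 < \<alpha>\<close>, of s] by linarith
qed

text \<open>For large tolerances both conditions fail with small probability.\<close>

lemma prob_calm_block_ge_1_minus:
  assumes W: "wiener_process M W" and "0 < h" "0 < \<alpha>" "0 < \<beta>"
  shows "1 - 3 * h\<^sup>2 / \<beta> ^ 4 - 200000 * h\<^sup>2 / \<alpha> ^ 4 \<le> prob {\<omega>\<in>space M. calm_block s h \<alpha> \<beta> (\<lambda>t. W t \<omega>)}"
proof -
  note [measurable] = wiener_measurable[OF W]
  have "prob {\<omega>\<in>space M. \<bar>W (s + h) \<omega> - W s \<omega>\<bar> \<le> \<beta>} = 1 - prob {\<omega>\<in>space M. \<beta> < \<bar>W (s + h) \<omega> - W s \<omega>\<bar>}"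
    using prob_neg[of "\<lambda>\<omega>. \<beta> < \<bar>W (s + h) \<omega> - W s \<omega>\<bar>"] by (simp add: not_less)
  moreover have "prob {\<omega>\<in>space M. \<beta> < \<bar>W (s + h) \<omega> - W s \<omega>\<bar>} \<le> 3 * h\<^sup>2 / \<beta> ^ 4"
    using wiener_increment_tail[OF W, of s "s + h" \<beta>] assms by simp
  ultimately show ?thesis using prob_calm_block_ge[OF W \<open>0 < h\<close> \<open>0 < \<alpha>\<close>, of s \<beta>] by linarith
qed

text \<open>At a fixed dyadic level the events depend on disjoint groups of independent increments; as the level grows they
  decrease to the calm blocks, and the probabilities converge.\<close>

lemma wiener_blocks_independent:
  assumes W: "wiener_process M W" and "0 < h" and J: "finite J" "J \<noteq> {}" "J \<subseteq> {..<n}"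
  shows "prob (\<Inter>p\<in>J. {\<omega>\<in>space M. calm_block (S + real p * h) h \<alpha> \<beta> (\<lambda>t. W t \<omega>)})
    = (\<Prod>p\<in>J. prob {\<omega>\<in>space M. calm_block (S + real p * h) h \<alpha> \<beta> (\<lambda>t. W t \<omega>)})"
proof -
  define E where "E l p = {\<omega>\<in>space M. dyadic_osc_le l (S + real p * h) h \<alpha> (\<lambda>t. W t \<omega>)
      \<and> \<bar>W (S + real p * h + h) \<omega> - W (S + real p * h) \<omega>\<bar> \<le> \<beta>}" for l p :: nat
  note [measurable] = wiener_measurable[OF W]
  have Em: "E l p \<in> events" for l p unfolding E_def dyadic_osc_le_def by measurable
  have dec: "decseq (\<lambda>l. E l p)" for p
    unfolding decseq_def E_def using dyadic_osc_le_decreasing by blast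
  have lim1: "(\<lambda>l. prob (E l p)) \<longlonglongrightarrow> prob (\<Inter>l. E l p)" for p
    by (rule finite_Lim_measure_decseq[OF _ dec]) (auto intro: Em)
  have "(\<lambda>l. prob (\<Inter>p\<in>J. E l p)) \<longlonglongrightarrow> prob (\<Inter>l. \<Inter>p\<in>J. E l p)"
  proof (rule finite_Lim_measure_decseq)
    show "range (\<lambda>l. \<Inter>p\<in>J. E l p) \<subseteq> events" using J Em by auto
    show "decseq (\<lambda>l. \<Inter>p\<in>J. E l p)" using dec unfolding decseq_def by blast
  qed
  moreover have fin: "prob (\<Inter>p\<in>J. E l p) = (\<Prod>p\<in>J. prob (E l p))" for l
  proof -
    (* Block p consists of the grid steps K p. *)
    define t where "t i = S + h * real i / 2 ^ l" for i :: nat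
    define X where "X i \<omega> = W (t (Suc i)) \<omega> - W (t i) \<omega>" for i \<omega>
    define K where "K p = {p * 2 ^ l..<Suc p * 2 ^ l}" for p :: nat
    let ?P = "\<lambda>p x. (\<forall>m\<le>2^l. \<bar>\<Sum>i=p*2^l..<p*2^l+m. x i\<bar> \<le> \<alpha>) \<and> \<bar>\<Sum>i=p*2^l..<p*2^l+2^l. x i\<bar> \<le> \<beta>"
    have "strict_mono_on {..n * 2 ^ l} t"
      unfolding strict_mono_on_def t_def using \<open>0 < h\<close> by (auto intro!: divide_strict_right_mono)
    then have X: "indep_vars (\<lambda>_. borel) X {..<n * 2 ^ l}"
      using W unfolding wiener_process_def X_def[abs_def] by blast
    have KJ: "K p \<subseteq> {..<n * 2 ^ l}" if "p \<in> J" for p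
    proof -
      have "Suc p * 2 ^ l \<le> n * 2 ^ l" using that J(3) by (intro mult_right_mono) auto
      then show ?thesis unfolding K_def by auto
    qed
    have disj: "disjoint_family_on K J" unfolding disjoint_family_on_def
    proof (intro ballI impI)
      fix p p' :: nat assume "p \<noteq> p'"
      show "K p \<inter> K p' = {}"
      proof (rule ccontr)
        assume "K p \<inter> K p' \<noteq> {}"
        then obtain i where "i \<in> K p" "i \<in> K p'" by blast
        then have "i div 2 ^ l = p" "i div 2 ^ l = p'" unfolding K_def
          by (auto intro!: div_nat_eqI simp: mult.commute)
        then show False using \<open>p \<noteq> p'\<close> by simp
      qed
    qed
    have "indep_vars (\<lambda>p. PiM (K p) (\<lambda>_. borel)) (\<lambda>p \<omega>. restrict (\<lambda>i. X i \<omega>) (K p)) J"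
      by (rule indep_vars_restrict[OF X KJ disj])
    then have ind: "indep_events (\<lambda>p. {\<omega>\<in>space M. ?P p (restrict (\<lambda>i. X i \<omega>) (K p))}) J"
    proof (rule indep_eventsI_indep_vars)
      fix p :: nat
      have sumM: "(\<lambda>x. \<Sum>i=p*2^l..<p*2^l+m. x i) \<in> borel_measurable (PiM (K p) (\<lambda>_. borel :: real measure))" if "m \<le> 2 ^ l" for m
        by (intro borel_measurable_sum measurable_component_singleton) (use that in \<open>auto simp: K_def\<close>)
      let ?N = "PiM (K p) (\<lambda>_. borel :: real measure)"
      have le: "{x\<in>space ?N. \<bar>\<Sum>i=p*2^l..<p*2^l+m. x i\<bar> \<le> c} \<in> sets ?N" if "m \<le> 2 ^ l" for m c
        by (rule borel_measurable_le[OF borel_measurable_abs[OF sumM[OF that]] borel_measurable_const])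
      have "{x\<in>space ?N. m \<le> 2 ^ l \<longrightarrow> \<bar>\<Sum>i=p*2^l..<p*2^l+m. x i\<bar> \<le> \<alpha>} \<in> sets ?N" for m
        by (cases "m \<le> 2 ^ l") (simp_all add: le)
      then show "{x\<in>space ?N. ?P p x} \<in> sets ?N"
        by (intro sets.sets_Collect_conj sets.sets_Collect_countable_All le order_refl)
    qed
    have tele: "(\<Sum>i=p*2^l..<p*2^l+m. restrict (\<lambda>i. X i \<omega>) (K p) i)
        = W (S + real p * h + h * real m / 2 ^ l) \<omega> - W (S + real p * h) \<omega>" if "m \<le> 2 ^ l" for p m \<omega>
    proof -
      have "(\<Sum>i=p*2^l..<p*2^l+m. restrict (\<lambda>i. X i \<omega>) (K p) i) = (\<Sum>i=p*2^l..<p*2^l+m. W (t (Suc i)) \<omega> - W (t i) \<omega>)"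
        by (rule sum.cong) (use that in \<open>auto simp: K_def X_def\<close>)
      also have "\<dots> = W (t (p*2^l+m)) \<omega> - W (t (p*2^l)) \<omega>"
        by (rule sum_Suc_diff'[of _ _ "\<lambda>i. W (t i) \<omega>"]) simp
      also have "t (p*2^l) = S + real p * h" unfolding t_def by simp
      also have "t (p*2^l+m) = S + real p * h + h * real m / 2 ^ l" unfolding t_def by (simp add: field_simps)
      finally show ?thesis .
    qed
    have "{\<omega>\<in>space M. ?P p (restrict (\<lambda>i. X i \<omega>) (K p))} = E l p" for p
      unfolding E_def dyadic_osc_le_def using tele[OF order_refl] by (auto simp: tele simp del: restrict_apply)
    then have "indep_events (E l) J" using ind by simp
    then show ?thesis using J unfolding indep_events_def by blast
  qed
  moreover have "(\<lambda>l. \<Prod>p\<in>J. prob (E l p)) \<longlonglongrightarrow> (\<Prod>p\<in>J. prob (\<Inter>l. E l p))"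
    by (intro tendsto_prod lim1)
  ultimately have "prob (\<Inter>l. \<Inter>p\<in>J. E l p) = (\<Prod>p\<in>J. prob (\<Inter>l. E l p))"
    using LIMSEQ_unique by simp
  moreover have EI: "(\<Inter>l. E l p) = {\<omega>\<in>space M. calm_block (S + real p * h) h \<alpha> \<beta> (\<lambda>t. W t \<omega>)}" for p
    unfolding E_def calm_block_def by auto
  moreover have "(\<Inter>l. \<Inter>p\<in>J. E l p) = (\<Inter>p\<in>J. \<Inter>l. E l p)" by blast
  ultimately show ?thesis by simp
qed

end

section \<open>Calm windows\<close>

text \<open>A point of the window is reached by the end increments of the blocks to the right of it and an oscillation within
  its own block.\<close>

lemma calm_window:
  assumes cont: "continuous_on UNIV w" and "0 < h" "0 \<le> \<beta>" "1 \<le> N"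
    and calm: "\<And>j. a \<le> j \<Longrightarrow> j < a + N \<Longrightarrow> calm_block (- (real (Suc j) * h)) h \<alpha> \<beta> w"
    and u: "u \<in> {- (real (a + N) * h)..- (real a * h)}"
  shows "\<bar>w u - w (- (real a * h))\<bar> \<le> \<alpha> + real N * \<beta>"
proof -
  have ends: "\<bar>w (- (real (a + n) * h)) - w (- (real a * h))\<bar> \<le> real n * \<beta>" if "n \<le> N" for n
    using that
  proof (induction n)
    case (Suc n)
    have "\<bar>w (- (real (Suc (a + n)) * h) + h) - w (- (real (Suc (a + n)) * h))\<bar> \<le> \<beta>"
      using calm[of "a + n"] Suc unfolding calm_block_def by simp
    moreover have eq: "- (real (Suc (a + n)) * h) + h = - (real (a + n) * h)" by (simp add: algebra_simps)
    moreover have "\<bar>w (- (real (a + n) * h)) - w (- (real a * h))\<bar> \<le> real n * \<beta>" using Suc by simp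
    ultimately have "\<bar>w (- (real (Suc (a + n)) * h)) - w (- (real a * h))\<bar> \<le> real n * \<beta> + \<beta>" unfolding eq by linarith
    then show ?case by (simp add: algebra_simps)
  qed simp
  (* The minimum matters at the left end of the window, which belongs to its last block. *)
  define j where "j = min (nat \<lfloor>- u / h\<rfloor>) (a + N - 1)"
  have ux: "real a \<le> - u / h" "- u / h \<le> real (a + N)" using u \<open>0 < h\<close> by (auto simp: field_simps)
  then have "int a \<le> \<lfloor>- u / h\<rfloor>" by (simp add: le_floor_iff)
  then have j: "a \<le> j" "j < a + N" unfolding j_def using \<open>1 \<le> N\<close> by auto
  have ju: "real j \<le> - u / h" "- u / h \<le> real (Suc j)"
  proof -
    have fl: "real (nat \<lfloor>- u / h\<rfloor>) \<le> - u / h" "- u / h < real (nat \<lfloor>- u / h\<rfloor>) + 1"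
    proof -
      have "real (nat \<lfloor>- u / h\<rfloor>) = of_int \<lfloor>- u / h\<rfloor>" using \<open>int a \<le> \<lfloor>- u / h\<rfloor>\<close> by simp
      then show "real (nat \<lfloor>- u / h\<rfloor>) \<le> - u / h" "- u / h < real (nat \<lfloor>- u / h\<rfloor>) + 1" using floor_correct[of "- u / h"] by linarith+
    qed
    have "real j \<le> real (nat \<lfloor>- u / h\<rfloor>)" unfolding j_def by simp
    then show "real j \<le> - u / h" using fl(1) by linarith
    show "- u / h \<le> real (Suc j)"
    proof (cases "nat \<lfloor>- u / h\<rfloor> \<le> a + N - 1")
      case True then show ?thesis unfolding j_def using fl(2) by simp
    next
      case False
      then have "Suc j = a + N" unfolding j_def using \<open>1 \<le> N\<close> by simp
      then show ?thesis using ux(2) by simp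
    qed
  qed
  have "u \<in> {- (real (Suc j) * h)..- (real (Suc j) * h) + h}"
    using ju \<open>0 < h\<close> by (simp add: field_simps)
  moreover have "dyadic_osc_le l (- (real (Suc j) * h)) h \<alpha> w" for l
    using calm[OF j] unfolding calm_block_def by blast
  ultimately have 1: "\<bar>w u - w (- (real (Suc j) * h))\<bar> \<le> \<alpha>"
    using dyadic_osc_le_continuous[OF cont \<open>0 < h\<close>] by blast
  define n where "n = Suc j - a"
  have n: "n \<le> N" "a + n = Suc j" unfolding n_def using j by auto
  have "\<bar>w (- (real (Suc j) * h)) - w (- (real a * h))\<bar> \<le> real n * \<beta>" using ends[OF n(1)] unfolding n(2) .
  moreover have "real n * \<beta> \<le> real N * \<beta>" using n(1) \<open>0 \<le> \<beta>\<close> by (intro mult_right_mono) auto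
  ultimately show ?thesis using 1 by linarith
qed

context prob_space begin

text \<open>The limit superior has probability at least \<open>p\<close>, hence probability \<open>1\<close> by the zero-one law of Borel.\<close>

lemma infinitely_often_if_prob_ge:
  fixes A :: "nat \<Rightarrow> 'a set"
  assumes ind: "indep_events A UNIV" and "0 < p" and p: "\<And>i. p \<le> prob (A i)"
  shows "AE \<omega> in M. \<forall>n. \<exists>m\<ge>n. \<omega> \<in> A m"
proof -
  have A: "A i \<in> events" for i using ind unfolding indep_events_def by blast
  have U: "(\<Union>m\<in>{n..}. A m) \<in> events" for n using A by auto
  have "(\<lambda>n. prob (\<Union>m\<in>{n..}. A m)) \<longlonglongrightarrow> prob (\<Inter>n. \<Union>m\<in>{n..}. A m)"
  proof (rule finite_Lim_measure_decseq)
    show "decseq (\<lambda>n. \<Union>m\<in>{n..}. A m)" unfolding decseq_def using order_trans by fastforce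
  qed (use U in auto)
  moreover have "p \<le> prob (\<Union>m\<in>{n..}. A m)" for n
    by (rule order_trans[OF p[of n]], rule finite_measure_mono[OF _ U]) auto
  ultimately have "p \<le> prob (\<Inter>n. \<Union>m\<in>{n..}. A m)" by (intro LIMSEQ_le_const) auto
  then have "prob (\<Inter>n. \<Union>m\<in>{n..}. A m) = 1" using borel_0_1_law[OF ind] \<open>0 < p\<close> by auto
  from AE_prob_1[OF this] show ?thesis by eventually_elim auto
qed

text \<open>For each process the blocks are independent, and the processes are independent of each other.\<close>

lemma blocks_independent:
  fixes B :: "nat \<Rightarrow> real \<Rightarrow> 'a \<Rightarrow> real"
  assumes W: "\<And>k. k \<ge> 1 \<Longrightarrow> wiener_process M (B k)"
    and I: "indep_vars (\<lambda>_. PiM UNIV (\<lambda>_::real. borel)) (\<lambda>k \<omega> t. B k t \<omega>) {1..}" and "0 < h"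
  shows "indep_events (\<lambda>(k, j). {\<omega>\<in>space M. calm_block (- (real (Suc j) * h)) h (\<alpha> k) (\<beta> k) (\<lambda>t. B k t \<omega>)}) ({1..} \<times> UNIV)"
proof -
  define Q where "Q k j = {\<omega>\<in>space M. calm_block (- (real (Suc j) * h)) h (\<alpha> k) (\<beta> k) (\<lambda>t. B k t \<omega>)}" for k j :: nat
  have Q: "Q k j \<in> events" if "k \<ge> 1" for k j unfolding Q_def by (rule calm_block_measurable[OF W[OF that]])
  have row: "prob (\<Inter>j\<in>J. Q k j) = (\<Prod>j\<in>J. prob (Q k j))" if k: "k \<ge> 1" and J: "finite J" "J \<noteq> {}" for k J
  proof -
    obtain n where n: "J \<subseteq> {..<n}" using finite_nat_iff_bounded J(1) by blast
    have inj: "inj_on (\<lambda>j. n - 1 - j) J"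
  proof (rule inj_onI)
    fix x y assume "x \<in> J" "y \<in> J" "n - 1 - x = n - 1 - y"
    moreover from this have "x < n" "y < n" using n by auto
    ultimately show "x = y" by linarith
  qed
    define C where "C p = {\<omega>\<in>space M. calm_block (- (real n * h) + real p * h) h (\<alpha> k) (\<beta> k) (\<lambda>t. B k t \<omega>)}" for p :: nat
    have Qj: "C (n - 1 - j) = Q k j" if "j \<in> J" for j
    proof -
      have "real (n - 1 - j) = real n - real (Suc j)" using n that by auto
      then have "- (real n * h) + real (n - 1 - j) * h = - (real (Suc j) * h)" by (simp add: algebra_simps)
      then show ?thesis unfolding C_def Q_def by (simp only:)
    qed
    have "(\<Inter>j\<in>J. Q k j) = (\<Inter>j\<in>J. C (n - 1 - j))" by (intro INF_cong refl Qj[symmetric])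
    then have "prob (\<Inter>j\<in>J. Q k j) = prob (\<Inter>p\<in>(\<lambda>j. n - 1 - j) ` J. C p)" unfolding image_image by simp
    also have "\<dots> = (\<Prod>p\<in>(\<lambda>j. n - 1 - j) ` J. prob (C p))"
      unfolding C_def by (rule wiener_blocks_independent[OF W[OF k] \<open>0 < h\<close>, where n = n]) (use n J in auto)
    also have "\<dots> = (\<Prod>j\<in>J. prob (Q k j))" unfolding prod.reindex[OF inj] comp_def by (rule prod.cong[OF refl]) (simp only: Qj)
    finally show ?thesis .
  qed
  have "indep_events (\<lambda>(k, j). Q k j) ({1..} \<times> UNIV)"
  proof (rule indep_eventsI)
    fix x :: "nat \<times> nat" assume "x \<in> {1..} \<times> UNIV"
    then show "(case x of (k, j) \<Rightarrow> Q k j) \<in> events" using Q by auto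
  next
    fix J :: "(nat \<times> nat) set" assume J: "J \<subseteq> {1..} \<times> UNIV" "finite J" "J \<noteq> {}"
    define K where "K = fst ` J"
    define R where "R k = {j. (k, j) \<in> J}" for k
    have K: "finite K" "K \<noteq> {}" "K \<subseteq> {1..}" unfolding K_def using J by auto
    have R: "finite (R k)" for k
      by (rule finite_subset[of _ "snd ` J"]) (use J(2) in \<open>force simp: R_def\<close>)+
    have Rn: "R k \<noteq> {}" if "k \<in> K" for k using that unfolding K_def R_def by force
    have JS: "J = Sigma K R" unfolding K_def R_def by force
    define X where "X k = {w\<in>space (PiM UNIV (\<lambda>_::real. borel :: real measure)). \<forall>j\<in>R k. calm_block (- (real (Suc j) * h)) h (\<alpha> k) (\<beta> k) w}" for k
    have X: "X k \<in> sets (PiM UNIV (\<lambda>_::real. borel))" for k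
      unfolding X_def by (intro sets.sets_Collect_finite_All calm_block_sets R)
    have pre: "(\<lambda>\<omega> t. B k t \<omega>) -` X k \<inter> space M = (\<Inter>j\<in>R k. Q k j)" if "k \<in> K" for k
      unfolding X_def Q_def using Rn[OF that] by (auto simp: space_PiM)
    have "(\<Inter>x\<in>J. case x of (k, j) \<Rightarrow> Q k j) = (\<Inter>k\<in>K. (\<lambda>\<omega> t. B k t \<omega>) -` X k \<inter> space M)"
      unfolding JS using pre by (auto simp: K(2))
    then have "prob (\<Inter>x\<in>J. case x of (k, j) \<Rightarrow> Q k j) = (\<Prod>k\<in>K. prob ((\<lambda>\<omega> t. B k t \<omega>) -` X k \<inter> space M))"
      using indep_varsD[OF I K(2,1,3), of X] X by simp
    also have "\<dots> = (\<Prod>k\<in>K. \<Prod>j\<in>R k. prob (Q k j))"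
      by (rule prod.cong) (use K(3) pre row R Rn in auto)
    also have "\<dots> = (\<Prod>x\<in>J. prob (case x of (k, j) \<Rightarrow> Q k j))"
      unfolding JS by (subst prod.Sigma) (use K R in \<open>auto simp: split_def\<close>)
    finally show "prob (\<Inter>x\<in>J. case x of (k, j) \<Rightarrow> Q k j) = (\<Prod>x\<in>J. prob (case x of (k, j) \<Rightarrow> Q k j))" .
  qed
  then show ?thesis unfolding Q_def .
qed

text \<open>Windows are built from disjoint sets of independent events.\<close>

lemma independent_windows:
  fixes Q :: "nat \<Rightarrow> nat \<Rightarrow> 'a set"
  assumes ind: "indep_events (\<lambda>(k, j). Q k j) ({1..} \<times> UNIV)" and "1 \<le> N"
  shows "indep_events (\<lambda>i. \<Inter>k\<in>{1..}. \<Inter>j\<in>{i * N..<i * N + N}. Q k j) UNIV"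
proof -
  define D where "D i = {1::nat..} \<times> {i * N..<i * N + N}" for i
  let ?E = "\<lambda>x. {case x of (k, j) \<Rightarrow> Q k j}"
  have sub: "(\<Union>i\<in>UNIV. D i) \<subseteq> {1..} \<times> UNIV" unfolding D_def by auto
  have disj: "disjoint_family_on D UNIV" unfolding disjoint_family_on_def
  proof (intro ballI impI)
    fix i i' :: nat assume "i \<noteq> i'"
    show "D i \<inter> D i' = {}"
    proof (rule ccontr)
      assume "D i \<inter> D i' \<noteq> {}"
      then obtain j where "j \<in> {i * N..<i * N + N}" "j \<in> {i' * N..<i' * N + N}" unfolding D_def by blast
      then have "j div N = i" "j div N = i'" by (auto intro!: div_nat_eqI simp: mult.commute)
      then show False using \<open>i \<noteq> i'\<close> by simp
    qed
  qed
  have "indep_sets (\<lambda>i. sigma_sets (space M) (\<Union>x\<in>D i. ?E x)) UNIV"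
  proof (rule indep_sets_collect_sigma[OF _ _ disj])
    show "indep_sets ?E (\<Union>i\<in>UNIV. D i)"
      by (rule indep_sets_mono_index[OF sub]) (use ind in \<open>simp add: indep_events_def_alt\<close>)
  qed (simp add: Int_stable_def)
  then have "indep_sets (\<lambda>i. {\<Inter>k\<in>{1..}. \<Inter>j\<in>{i * N..<i * N + N}. Q k j}) UNIV"
  proof (rule indep_sets_mono_sets)
    fix i :: nat
    have events: "(\<Union>x\<in>D i. ?E x) \<subseteq> Pow (space M)"
    proof
      fix X assume "X \<in> (\<Union>x\<in>D i. ?E x)"
      then obtain k j where "k \<ge> 1" "X = Q k j" unfolding D_def by auto
      then have "X \<in> events" using ind unfolding indep_events_def by auto
      then show "X \<in> Pow (space M)" using sets.sets_into_space by blast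
    qed
    have "(\<Inter>x\<in>D i. case x of (k, j) \<Rightarrow> Q k j) \<in> sigma_sets (space M) (\<Union>x\<in>D i. ?E x)"
    proof (rule sigma_algebra.countable_INT'[OF sigma_algebra_sigma_sets[OF events]])
      show "countable (D i)" unfolding D_def by simp
      show "D i \<noteq> {}" unfolding D_def using \<open>1 \<le> N\<close> by auto
    qed (auto intro: sigma_sets.Basic)
    moreover have "(\<Inter>x\<in>D i. case x of (k, j) \<Rightarrow> Q k j) = (\<Inter>k\<in>{1..}. \<Inter>j\<in>{i * N..<i * N + N}. Q k j)"
      unfolding D_def by auto
    ultimately show "{\<Inter>k\<in>{1..}. \<Inter>j\<in>{i * N..<i * N + N}. Q k j} \<subseteq> sigma_sets (space M) (\<Union>x\<in>D i. ?E x)" by simp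
  qed
  then show ?thesis by (simp add: indep_events_def_alt)
qed

lemma prob_window_ge:
  fixes Q :: "nat \<Rightarrow> nat \<Rightarrow> 'a set"
  assumes ind: "indep_events (\<lambda>(k, j). Q k j) ({1..} \<times> UNIV)" and "1 \<le> N"
    and q: "\<And>k j. q k \<le> prob (Q (Suc k) j)" "\<And>k. 0 < q k" and p: "0 < p" "\<And>n. p \<le> (\<Prod>k<n. q k)"
  shows "p ^ N \<le> prob (\<Inter>k\<in>{1..}. \<Inter>j\<in>{a..<a + N}. Q k j)"
proof -
  have Q: "Q k j \<in> events" if "k \<ge> 1" for k j using ind that unfolding indep_events_def by auto
  define A where "A n = (\<Inter>x\<in>{1..Suc n} \<times> {a..<a + N}. case x of (k, j) \<Rightarrow> Q k j)" for n
  have ne: "{1..Suc n} \<times> {a..<a + N} \<noteq> {}" for n using \<open>1 \<le> N\<close> by auto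
  have A: "A n \<in> events" for n
    unfolding A_def by (rule sets.finite_INT[OF _ ne]) (auto intro: Q)
  have "decseq A" unfolding decseq_def A_def by force
  then have "(\<lambda>n. prob (A n)) \<longlonglongrightarrow> prob (\<Inter>n. A n)" by (rule finite_Lim_measure_decseq[rotated]) (use A in auto)
  moreover have "p ^ N \<le> prob (A n)" for n
  proof -
    have "p ^ N \<le> (\<Prod>k<Suc n. q k) ^ N" by (rule power_mono[OF p(2)]) (use p(1) in simp)
    also have "\<dots> = (\<Prod>k<Suc n. q k ^ N)" by (rule prod_power_distrib)
    also have "\<dots> \<le> (\<Prod>k<Suc n. \<Prod>j\<in>{a..<a + N}. prob (Q (Suc k) j))"
    proof (rule prod_mono)
      fix k assume "k \<in> {..<Suc n}"
      have "q k ^ N = (\<Prod>j\<in>{a..<a + N}. q k)" by simp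
      also have "\<dots> \<le> (\<Prod>j\<in>{a..<a + N}. prob (Q (Suc k) j))" by (rule prod_mono) (use q less_imp_le in blast)
      finally show "0 \<le> q k ^ N \<and> q k ^ N \<le> (\<Prod>j\<in>{a..<a + N}. prob (Q (Suc k) j))" using q(2)[of k] by simp
    qed
    also have "\<dots> = (\<Prod>k=1..Suc n. \<Prod>j\<in>{a..<a + N}. prob (Q k j))"
      by (rule prod.reindex_bij_witness[of _ "\<lambda>k. k - 1" Suc]) auto
    also have "\<dots> = (\<Prod>x\<in>{1..Suc n} \<times> {a..<a + N}. prob (case x of (k, j) \<Rightarrow> Q k j))"
      by (subst prod.cartesian_product) (simp add: split_def)
    also have "\<dots> = prob (A n)"
      unfolding A_def
    proof (rule sym)
      have "{1..Suc n} \<times> {a..<a + N} \<subseteq> {1..} \<times> UNIV" by auto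
      then show "prob (\<Inter>x\<in>{1..Suc n} \<times> {a..<a + N}. case x of (k, j) \<Rightarrow> Q k j)
        = (\<Prod>x\<in>{1..Suc n} \<times> {a..<a + N}. prob (case x of (k, j) \<Rightarrow> Q k j))"
        using ind ne[of n] unfolding indep_events_def by blast
    qed
    finally show ?thesis .
  qed
  ultimately have "p ^ N \<le> prob (\<Inter>n. A n)" by (intro LIMSEQ_le_const) auto
  also have "(\<Inter>n. A n) = (\<Inter>k\<in>{1..}. \<Inter>j\<in>{a..<a + N}. Q k j)"
  proof (intro equalityI subsetI)
    fix \<omega> assume \<omega>: "\<omega> \<in> (\<Inter>n. A n)"
    show "\<omega> \<in> (\<Inter>k\<in>{1..}. \<Inter>j\<in>{a..<a + N}. Q k j)"
    proof (intro INT_I)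
      fix k j :: nat assume "k \<in> {1..}" "j \<in> {a..<a + N}"
      then have "(k, j) \<in> {1..Suc k} \<times> {a..<a + N}" by auto
      moreover have "\<omega> \<in> A k" using \<omega> by blast
      ultimately show "\<omega> \<in> Q k j" unfolding A_def by blast
    qed
  qed (auto simp: A_def)
  finally show ?thesis .
qed

text \<open>With blocks of length \<open>h = L / N\<close> the first probability is of order \<open>(1 / N) / sqrt h\<close>, that is of order
  \<open>1 / sqrt N\<close>, whereas the oscillation bound is of order \<open>h\<^sup>2\<close>, that is of order \<open>1 / N\<^sup>2\<close>.\<close>

lemma small_increment_beats_oscillation:
  assumes W: "\<And>k. k \<in> K \<Longrightarrow> wiener_process M (B k)" and "0 < L" "0 < \<delta>"
  shows "\<exists>N::nat. \<exists>p>0. 1 \<le> N \<and> (\<forall>k\<in>K. \<forall>s \<beta>. \<delta> / (2 * real N) \<le> \<beta> \<longrightarrow>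
    p + 200000 * (L / real N)\<^sup>2 / (\<delta> / 2) ^ 4 \<le> prob {\<omega>\<in>space M. \<bar>B k (s + L / real N) \<omega> - B k s \<omega>\<bar> \<le> \<beta>})"
proof -
  define A where "A = \<delta> * exp (- (\<delta>\<^sup>2 / (8 * L))) / sqrt (2 * pi * L)"
  define B' where "B' = 200000 * L\<^sup>2 / (\<delta> / 2) ^ 4"
  have "0 < A" unfolding A_def using assms by simp
  then obtain N :: nat where N: "1 \<le> N" "B' / (real N)\<^sup>2 < A / sqrt (real N)" using decreasing_power_comparison by blast
  have N0: "0 < real N" using N(1) by simp
  define h where "h = L / real N"
  have h: "0 < h" unfolding h_def using \<open>0 < L\<close> N0 by simp
  define \<beta>0 where "\<beta>0 = \<delta> / (2 * real N)"
  have \<beta>0: "0 < \<beta>0" unfolding \<beta>0_def using \<open>0 < \<delta>\<close> N0 by simp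
  have "A / sqrt (real N) + 0 \<le> prob {\<omega>\<in>space M. \<bar>B k (s + h) \<omega> - B k s \<omega>\<bar> \<le> \<beta>}" if k: "k \<in> K" and \<beta>: "\<beta>0 \<le> \<beta>" for k s \<beta>
  proof -
    note [measurable] = wiener_measurable[OF W[OF k]]
    have sh: "sqrt (2 * pi * (sqrt h)\<^sup>2) = sqrt (2 * pi * L) / sqrt (real N)"
      using h unfolding h_def by (simp add: real_sqrt_divide[symmetric])
    have "\<beta>0\<^sup>2 / (2 * h) = \<delta>\<^sup>2 / (8 * L) / real N"
      unfolding \<beta>0_def h_def using N0 \<open>0 < L\<close> by (simp add: power_divide power2_eq_square field_simps)
    also have "\<dots> \<le> \<delta>\<^sup>2 / (8 * L)" using N(1) \<open>0 < L\<close> by (simp add: divide_le_eq mult_le_cancel_left1)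
    finally have e: "exp (- (\<delta>\<^sup>2 / (8 * L))) \<le> exp (- (\<beta>0\<^sup>2 / (2 * h)))" by simp
    have "A / sqrt (real N) = 2 * \<beta>0 * (1 / (sqrt (2 * pi * L) / sqrt (real N)) * exp (- (\<delta>\<^sup>2 / (8 * L))))"
    proof -
      have "2 * \<beta>0 * sqrt (real N) = \<delta> / sqrt (real N)" unfolding \<beta>0_def using N0 by (simp add: real_div_sqrt field_simps)
      then have "2 * \<beta>0 * sqrt (real N) * (exp (- (\<delta>\<^sup>2 / (8 * L))) / sqrt (2 * pi * L)) = A / sqrt (real N)" unfolding A_def by simp
      then show ?thesis by simp
    qed
    also have "\<dots> \<le> 2 * \<beta>0 * (1 / (sqrt (2 * pi * L) / sqrt (real N)) * exp (- (\<beta>0\<^sup>2 / (2 * h))))"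
      using e \<beta>0 N0 \<open>0 < L\<close> by (intro mult_left_mono) auto
    also have "\<dots> = 2 * \<beta>0 * normal_density 0 (sqrt (s + h - s)) \<beta>0"
      unfolding normal_density_def using h by (simp add: sh[symmetric])
    also have "\<dots> \<le> prob {\<omega>\<in>space M. \<bar>B k (s + h) \<omega> - B k s \<omega>\<bar> \<le> \<beta>0}"
      by (rule wiener_increment_small[OF W[OF k] _ \<beta>0]) (use h in simp)
    also have "\<dots> \<le> prob {\<omega>\<in>space M. \<bar>B k (s + h) \<omega> - B k s \<omega>\<bar> \<le> \<beta>}"
      by (rule finite_measure_mono) (use \<beta> in auto)
    finally show ?thesis by simp
  qed
  moreover have "200000 * h\<^sup>2 / (\<delta> / 2) ^ 4 = B' / (real N)\<^sup>2" unfolding h_def B'_def by (simp add: power_divide)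
  ultimately show ?thesis using N unfolding h_def \<beta>0_def
    by (intro exI[of _ N] exI[of _ "A / sqrt (real N) - B' / (real N)\<^sup>2"]) auto
qed

text \<open>The tolerance of the \<open>k\<close>-th process is split evenly: one half for the oscillation within a block, the other half for
  the \<open>N\<close> end increments.\<close>

lemma wiener_paths_calm:
  fixes B :: "nat \<Rightarrow> real \<Rightarrow> 'a \<Rightarrow> real"
  assumes W: "\<And>k. k \<ge> 1 \<Longrightarrow> wiener_process M (B k)"
    and I: "indep_vars (\<lambda>_. PiM UNIV (\<lambda>_::real. borel)) (\<lambda>k \<omega> t. B k t \<omega>) {1..}"
    and "0 < L" "0 < \<delta>"
  shows "AE \<omega> in M. \<forall>\<tau>. \<exists>T\<le>\<tau>. \<forall>u\<in>{T - L..T}. \<forall>k\<ge>1. \<bar>B k u \<omega> - B k T \<omega>\<bar> \<le> \<delta> * sqrt (real k)"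
proof -
  obtain N :: nat and p0 where N: "1 \<le> N" "0 < p0"
    and small: "\<forall>k\<in>{1..}. \<forall>s \<beta>. \<delta> / (2 * real N) \<le> \<beta> \<longrightarrow>
      p0 + 200000 * (L / real N)\<^sup>2 / (\<delta> / 2) ^ 4 \<le> prob {\<omega>\<in>space M. \<bar>B k (s + L / real N) \<omega> - B k s \<omega>\<bar> \<le> \<beta>}"
    using small_increment_beats_oscillation[of "{1..}" B L \<delta>] W \<open>0 < L\<close> \<open>0 < \<delta>\<close> by auto
  have N0: "0 < real N" using N(1) by simp
  define h where "h = L / real N"
  have h: "0 < h" "real N * h = L" unfolding h_def using \<open>0 < L\<close> N0 by auto
  define \<alpha> where "\<alpha> k = \<delta> * sqrt (real k) / 2" for k
  define \<beta> where "\<beta> k = \<delta> * sqrt (real k) / (2 * real N)" for k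
  have \<alpha>: "0 < \<alpha> k" "\<delta> / 2 \<le> \<alpha> k" and \<beta>: "0 < \<beta> k" "\<delta> / (2 * real N) \<le> \<beta> k" if "k \<ge> 1" for k
  proof -
    have "1 \<le> sqrt (real k)" using that by simp
    then have "\<delta> * 1 \<le> \<delta> * sqrt (real k)" using \<open>0 < \<delta>\<close> by (intro mult_left_mono) auto
    then show "\<delta> / 2 \<le> \<alpha> k" "\<delta> / (2 * real N) \<le> \<beta> k" unfolding \<alpha>_def \<beta>_def using N0 by (auto intro: divide_right_mono)
    show "0 < \<alpha> k" "0 < \<beta> k" unfolding \<alpha>_def \<beta>_def using \<open>0 < \<delta>\<close> N0 that by auto
  qed
  define Q where "Q k j = {\<omega>\<in>space M. calm_block (- (real (Suc j) * h)) h (\<alpha> k) (\<beta> k) (\<lambda>t. B k t \<omega>)}" for k j :: nat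
  have ind: "indep_events (\<lambda>(k, j). Q k j) ({1..} \<times> UNIV)"
    unfolding Q_def by (rule blocks_independent[OF W I h(1)])
  (* The two lower bounds for calm blocks: the first one is positive for all k, the second one tends to 1 as k grows. *)
  define D where "D = 3 * h\<^sup>2 / (\<delta> / (2 * real N)) ^ 4 + 200000 * h\<^sup>2 / (\<delta> / 2) ^ 4"
  define q where "q k = max p0 (1 - D / (real (Suc k))\<^sup>2)" for k
  have qQ: "q k \<le> prob (Q (Suc k) j)" for k j
  proof -
    have k: "Suc k \<ge> 1" by simp
    let ?s = "- (real (Suc j) * h)"
    have "200000 * h\<^sup>2 / \<alpha> (Suc k) ^ 4 \<le> 200000 * h\<^sup>2 / (\<delta> / 2) ^ 4"
      using \<alpha>(2)[OF k] \<open>0 < \<delta>\<close> by (intro divide_left_mono power_mono mult_pos_pos zero_less_power) (auto intro: \<alpha>(1)[OF k])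
    moreover have "p0 + 200000 * h\<^sup>2 / (\<delta> / 2) ^ 4 \<le> prob {\<omega>\<in>space M. \<bar>B (Suc k) (?s + h) \<omega> - B (Suc k) ?s \<omega>\<bar> \<le> \<beta> (Suc k)}"
      unfolding h_def by (rule small[rule_format]) (use \<beta>(2)[OF k] in auto)
    ultimately have 1: "p0 \<le> prob (Q (Suc k) j)"
      using prob_calm_block_ge[OF W[OF k] h(1) \<alpha>(1)[OF k], of ?s "\<beta> (Suc k)"] unfolding Q_def by linarith
    have s4: "sqrt (real (Suc k)) ^ 4 = (real (Suc k))\<^sup>2"
      using power_mult[of "sqrt (real (Suc k))" 2 2] by simp
    have "3 * h\<^sup>2 / \<beta> (Suc k) ^ 4 + 200000 * h\<^sup>2 / \<alpha> (Suc k) ^ 4 = D / (real (Suc k))\<^sup>2"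
      unfolding D_def \<alpha>_def \<beta>_def power_divide power_mult_distrib s4
      by (simp add: add_divide_distrib)
    then have 2: "1 - D / (real (Suc k))\<^sup>2 \<le> prob (Q (Suc k) j)"
      using prob_calm_block_ge_1_minus[OF W[OF k] h(1) \<alpha>(1)[OF k] \<beta>(1)[OF k], of ?s] unfolding Q_def by linarith
    show ?thesis unfolding q_def using 1 2 by simp
  qed
  have q1: "q k \<le> 1" for k using order_trans[OF qQ[of k 0] prob_le_1] .
  have q0: "0 < q k" for k unfolding q_def using \<open>0 < p0\<close> by simp
  have "summable (\<lambda>k. 1 - q k)"
  proof (rule summable_comparison_test'[of "\<lambda>k. D * (1 / (real (Suc k))\<^sup>2)" 0])
    have "summable (\<lambda>n. 1 / (real n)\<^sup>2)" using inverse_power_summable[of 2, where 'a = real] by (simp add: inverse_eq_divide)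
    then have "summable (\<lambda>n. 1 / (real (Suc n))\<^sup>2)" by (subst summable_Suc_iff)
    then show "summable (\<lambda>k. D * (1 / (real (Suc k))\<^sup>2))" by (rule summable_mult)
    fix k show "norm (1 - q k) \<le> D * (1 / (real (Suc k))\<^sup>2)" using q1[of k] unfolding q_def by simp
  qed
  then obtain p where p: "0 < p" "\<forall>n. p \<le> (\<Prod>k<n. q k)" using prod_bounded_below[of q, OF q0 q1] by blast
  have "AE \<omega> in M. \<forall>n. \<exists>m\<ge>n. \<omega> \<in> (\<Inter>k\<in>{1..}. \<Inter>j\<in>{m * N..<m * N + N}. Q k j)"
  proof (rule infinitely_often_if_prob_ge[OF independent_windows[OF ind N(1)]])
    show "0 < p ^ N" using p(1) by simp
    show "p ^ N \<le> prob (\<Inter>k\<in>{1..}. \<Inter>j\<in>{i * N..<i * N + N}. Q k j)" for i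
      by (rule prob_window_ge[where q = q, OF ind N(1) qQ q0 p(1)]) (rule p(2)[rule_format])
  qed
  moreover have "AE \<omega> in M. \<forall>k\<in>{1..}. continuous_on UNIV (\<lambda>t. B k t \<omega>)"
    unfolding AE_ball_countable[OF countableI_type]
    using W unfolding wiener_process_def by auto
  ultimately show ?thesis
  proof eventually_elim
    case (elim \<omega>)
    show ?case
    proof
      fix \<tau> :: real
      obtain n :: nat where n: "- \<tau> / L \<le> real n" using real_arch_simple by blast
      obtain m where m: "n \<le> m" "\<omega> \<in> (\<Inter>k\<in>{1..}. \<Inter>j\<in>{m * N..<m * N + N}. Q k j)" using elim(1) by blast
      define T where "T = - (real (m * N) * h)"
      have TL: "T = - (real m * L)" unfolding T_def using h(2) by (simp add: mult.assoc)
      have "- \<tau> = - \<tau> / L * L" using \<open>0 < L\<close> by simp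
      also have "\<dots> \<le> real n * L" using n \<open>0 < L\<close> by (intro mult_right_mono) auto
      also have "\<dots> \<le> real m * L" using m(1) \<open>0 < L\<close> by (intro mult_right_mono) auto
      finally have "T \<le> \<tau>" unfolding TL by simp
      moreover have "\<bar>B k u \<omega> - B k T \<omega>\<bar> \<le> \<delta> * sqrt (real k)" if u: "u \<in> {T - L..T}" and k: "k \<ge> 1" for u k
      proof -
        have "\<bar>B k u \<omega> - B k (- (real (m * N) * h)) \<omega>\<bar> \<le> \<alpha> k + real N * \<beta> k"
        proof (rule calm_window[of "\<lambda>t. B k t \<omega>"])
          show "continuous_on UNIV (\<lambda>t. B k t \<omega>)" using elim(2) k by simp
          show "calm_block (- (real (Suc j) * h)) h (\<alpha> k) (\<beta> k) (\<lambda>t. B k t \<omega>)" if "m * N \<le> j" "j < m * N + N" for j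
            using m(2) k that unfolding Q_def by auto
          have "real (m * N + N) * h = real (m * N) * h + L" using h(2) by (simp add: distrib_right)
          then show "u \<in> {- (real (m * N + N) * h)..- (real (m * N) * h)}" using u unfolding T_def by simp
        qed (use h N \<beta>(1)[OF k] in auto)
        also have "\<alpha> k + real N * \<beta> k = \<delta> * sqrt (real k)" unfolding \<alpha>_def \<beta>_def using N0 by simp
        finally show ?thesis unfolding T_def .
      qed
      ultimately show "\<exists>T\<le>\<tau>. \<forall>u\<in>{T - L..T}. \<forall>k\<ge>1. \<bar>B k u \<omega> - B k T \<omega>\<bar> \<le> \<delta> * sqrt (real k)" by blast
    qed
  qed
qed

text \<open>The oscillation over \<open>{- L..0}\<close> exceeds \<open>sqrt k\<close> with a probability of order \<open>1 / k\<^sup>2\<close>, so by Borel-Cantelli this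
  happens for finitely many \<open>k\<close> only. The factor \<open>2\<close> comes from comparing with the value \<open>0\<close> at time \<open>0\<close> through
  the left end point.\<close>

lemma wiener_paths_growth:
  fixes B :: "nat \<Rightarrow> real \<Rightarrow> 'a \<Rightarrow> real"
  assumes W: "\<And>k. k \<ge> 1 \<Longrightarrow> wiener_process M (B k)" and "0 < L"
  shows "AE \<omega> in M. \<exists>K. \<forall>k\<ge>1. \<forall>s\<in>{- L..0}. \<bar>B k s \<omega>\<bar> \<le> K * sqrt (real k)"
proof -
  define A where "A k = {\<omega>\<in>space M. \<not> (\<forall>l. dyadic_osc_le l (- L) L (sqrt (real (Suc k))) (\<lambda>t. B (Suc k) t \<omega>))}" for k
  have A: "A k \<in> events" for k
  proof -
    have [measurable]: "B (Suc k) t \<in> borel_measurable M" for t by (rule wiener_measurable[OF W]) simp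
    show ?thesis unfolding A_def dyadic_osc_le_def by measurable
  qed
  have PA: "prob (A k) \<le> 200000 * L\<^sup>2 * (1 / (real (Suc k))\<^sup>2)" for k
  proof -
    have "sqrt (real (Suc k)) ^ 4 = (real (Suc k))\<^sup>2"
      using power_mult[of "sqrt (real (Suc k))" 2 2] by simp
    then show ?thesis using wiener_oscillation_tail[OF W \<open>0 < L\<close>, of "Suc k" "sqrt (real (Suc k))" "- L"] unfolding A_def by simp
  qed
  have "summable (\<lambda>k. prob (A k))"
  proof (rule summable_comparison_test'[of "\<lambda>k. 200000 * L\<^sup>2 * (1 / (real (Suc k))\<^sup>2)" 0])
    have "summable (\<lambda>n. 1 / (real n)\<^sup>2)" using inverse_power_summable[of 2, where 'a = real] by (simp add: inverse_eq_divide)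
    then have "summable (\<lambda>n. 1 / (real (Suc n))\<^sup>2)" by (subst summable_Suc_iff)
    then show "summable (\<lambda>k. 200000 * L\<^sup>2 * (1 / (real (Suc k))\<^sup>2))" by (rule summable_mult)
  qed (use PA in simp)
  then have "AE \<omega> in M. \<forall>\<^sub>F k in sequentially. \<omega> \<in> space M - A k"
    by (intro borel_cantelli_AE1 A) (simp_all add: emeasure_eq_measure)
  moreover have "AE \<omega> in M. \<forall>k\<in>{1..}. B k 0 \<omega> = 0 \<and> continuous_on UNIV (\<lambda>t. B k t \<omega>)"
    unfolding AE_ball_countable[OF countableI_type]
    using W unfolding wiener_process_def by auto
  ultimately show ?thesis
  proof eventually_elim
    case (elim \<omega>)
    obtain k0 where k0: "\<And>k. k \<ge> k0 \<Longrightarrow> \<omega> \<in> space M - A k" using elim(1) unfolding eventually_sequentially by blast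
    have "\<exists>K. \<forall>s\<in>{- L..0}. \<bar>B k s \<omega>\<bar> \<le> K" if "k \<ge> 1" for k
    proof -
      have "compact ((\<lambda>s. B k s \<omega>) ` {- L..0})"
        by (rule compact_continuous_image) (use elim(2) that in \<open>auto intro: continuous_on_subset\<close>)
      from compact_imp_bounded[OF this] show ?thesis unfolding bounded_iff by auto
    qed
    then obtain K where K: "\<And>k s. k \<ge> 1 \<Longrightarrow> s \<in> {- L..0} \<Longrightarrow> \<bar>B k s \<omega>\<bar> \<le> K k" by metis
    have "\<bar>B k s \<omega>\<bar> \<le> (2 + (\<Sum>i=1..k0. \<bar>K i\<bar>)) * sqrt (real k)" if k: "k \<ge> 1" and s: "s \<in> {- L..0}" for k s
    proof -
      have sq: "1 \<le> sqrt (real k)" using k by simp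
      have nn: "0 \<le> (\<Sum>i=1..k0. \<bar>K i\<bar>)" by (rule sum_nonneg) simp
      show ?thesis
      proof (cases "k \<le> k0")
        case True
        have "\<bar>B k s \<omega>\<bar> \<le> \<bar>K k\<bar>" using K[OF k s] by linarith
        also have "\<dots> \<le> (\<Sum>i=1..k0. \<bar>K i\<bar>)" by (rule member_le_sum) (use True k in auto)
        also have "\<dots> \<le> (2 + (\<Sum>i=1..k0. \<bar>K i\<bar>)) * 1" by simp
        also have "\<dots> \<le> (2 + (\<Sum>i=1..k0. \<bar>K i\<bar>)) * sqrt (real k)" using sq nn by (intro mult_left_mono) auto
        finally show ?thesis .
      next
        case False
        then have "\<omega> \<in> space M - A (k - 1)" using k0[of "k - 1"] by simp
        then have osc: "dyadic_osc_le l (- L) L (sqrt (real k)) (\<lambda>t. B k t \<omega>)" for l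
          unfolding A_def using k by simp
        have cont: "continuous_on UNIV (\<lambda>t. B k t \<omega>)" "B k 0 \<omega> = 0" using elim(2) k by auto
        have "\<bar>B k u \<omega> - B k (- L) \<omega>\<bar> \<le> sqrt (real k)" if "u \<in> {- L..0}" for u
          using dyadic_osc_le_continuous[OF cont(1) \<open>0 < L\<close> osc, of u] that by simp
        from this[OF s] this[of 0] have "\<bar>B k s \<omega>\<bar> \<le> 2 * sqrt (real k)" using cont(2) \<open>0 < L\<close> by simp
        also have "\<dots> \<le> (2 + (\<Sum>i=1..k0. \<bar>K i\<bar>)) * sqrt (real k)" using nn by (intro mult_right_mono) auto
        finally show ?thesis .
      qed
    qed
    then show ?case by blast
  qed
qed

end

section \<open>Regular periodic functions and the theorem\<close>

lemma periodic_frac: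
  fixes g :: "real \<Rightarrow> real"
  assumes "\<And>x. g (x + 1) = g x"
  shows "g (frac x) = g x"
  using periodic_int[of g x "- \<lfloor>x\<rfloor>", OF assms] unfolding frac_def by simp

text \<open>The derivative commutes with translations, also where it does not exist.\<close>

lemma deriv_periodic:
  fixes g :: "real \<Rightarrow> real"
  assumes "\<And>x. g (x + 1) = g x"
  shows "(deriv ^^ j) g (x + 1) = (deriv ^^ j) g x"
proof (induction j arbitrary: x)
  case (Suc j)
  have "deriv ((deriv ^^ j) g) (x + 1) = deriv (\<lambda>x. (deriv ^^ j) g (x + 1)) x"
    unfolding deriv_def by (simp add: DERIV_shift)
  then show ?case by (simp add: Suc)
qed (simp add: assms)

lemma C_class_differentiable:
  "C_class r g \<Longrightarrow> j < r \<Longrightarrow> ((deriv ^^ j) g has_real_derivative (deriv ^^ Suc j) g x) (at x)"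
  unfolding C_class_def
  by (simp add: DERIV_deriv_iff_real_differentiable differentiable_on_def)

lemma C_class_continuous: "C_class r g \<Longrightarrow> j \<le> r \<Longrightarrow> continuous_on UNIV ((deriv ^^ j) g)"
  unfolding C_class_def by (cases "j = r") (auto intro: differentiable_imp_continuous_on)

text \<open>The suprema in the norm are those of bounded functions, by continuity on a period.\<close>

lemma abs_deriv_le_C_norm:
  assumes per: "\<And>x. g (x + 1) = g x" and C: "C_class r g" and "j \<le> r"
  shows "\<bar>(deriv ^^ j) g x\<bar> \<le> C_norm r g"
proof -
  have bdd: "bdd_above (range (\<lambda>x. \<bar>(deriv ^^ i) g x\<bar>))" if "i \<le> r" for i
  proof -
    have "continuous_on {0..1} ((deriv ^^ i) g)" by (rule continuous_on_subset[OF C_class_continuous[OF C that]]) simp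
    then obtain b where b: "\<And>y. y \<in> {0..1} \<Longrightarrow> \<bar>(deriv ^^ i) g y\<bar> \<le> b"
      using continuous_on_Icc_bounded by blast
    have "\<bar>(deriv ^^ i) g y\<bar> \<le> b" for y
      using b[of "frac y"] periodic_frac[of "(deriv ^^ i) g" y, OF deriv_periodic[of g, OF per]] by (simp add: frac_lt_1 less_imp_le)
    then show ?thesis by (intro bdd_aboveI[of _ b]) auto
  qed
  have nn: "0 \<le> (SUP x. \<bar>(deriv ^^ i) g x\<bar>)" if "i \<le> r" for i
    by (rule order_trans[OF abs_ge_zero cSUP_upper[OF UNIV_I[of 0] bdd[OF that]]])
  have "\<bar>(deriv ^^ j) g x\<bar> \<le> (SUP x. \<bar>(deriv ^^ j) g x\<bar>)" by (rule cSUP_upper[OF UNIV_I bdd[OF \<open>j \<le> r\<close>]])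
  also have "\<dots> \<le> C_norm r g" unfolding C_norm_def by (rule member_le_sum) (use nn \<open>j \<le> r\<close> in auto)
  finally show ?thesis .
qed

text \<open>\<open>F x\<close> is the mean of the differences \<open>F x - F y\<close> over \<open>y\<close> in a period.\<close>

lemma abs_le_if_mean_zero:
  fixes F f :: "real \<Rightarrow> real"
  assumes per: "\<And>x. F (x + 1) = F x" and mean: "integral {0..1} F = 0"
    and F: "\<And>x. (F has_real_derivative f x) (at x)" and f: "\<And>x. \<bar>f x\<bar> \<le> c"
  shows "\<bar>F x\<bar> \<le> c"
proof -
  have lip: "\<bar>F y - F z\<bar> \<le> c * \<bar>y - z\<bar>" for y z
    using field_differentiable_bound[of UNIV F f c y z] F f by simp
  have "0 \<le> c" using f[of 0] by linarith
  have "continuous_on {0..1} F" using F by (meson DERIV_continuous continuous_at_imp_continuous_on)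
  then have "(F has_integral 0) {0..1}" using mean integrable_continuous_real has_integral_integral by metis
  then have "((\<lambda>y. F (frac x) - F y) has_integral (F (frac x) - 0)) {0..1}"
    using has_integral_const_real[of "F (frac x)" 0 1] by (intro has_integral_diff) auto
  then have "norm (F (frac x) - 0) \<le> c * measure lborel {0..1::real}"
  proof (rule has_integral_bound_real[OF \<open>0 \<le> c\<close> finite.emptyI])
    fix y :: real assume y: "y \<in> {0..1} - {}"
    have "0 \<le> y" "y \<le> 1" using y by auto
    then have "\<bar>frac x - y\<bar> \<le> 1" using frac_lt_1[of x] frac_ge_0[of x] by linarith
    then have "c * \<bar>frac x - y\<bar> \<le> c * 1" using \<open>0 \<le> c\<close> by (intro mult_left_mono) auto
    then show "norm (F (frac x) - F y) \<le> c" using lip[of "frac x" y] by simp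
  qed
  then show ?thesis using periodic_frac[of F x, OF per] by simp
qed

theorem theorem1p1:
  fixes M :: "'a measure"
    and B :: "nat \<Rightarrow> real \<Rightarrow> 'a \<Rightarrow> real"
    and F f :: "nat \<Rightarrow> real \<Rightarrow> real"
    and r :: nat and C :: real
  assumes "prob_space M"
    and "\<And>k. k \<ge> 1 \<Longrightarrow> wiener_process M (B k)"
    and "prob_space.indep_vars M (\<lambda>_. PiM UNIV (\<lambda>_::real. borel)) (\<lambda>k \<omega> t. B k t \<omega>) {1..}"
    and "\<And>k x. k \<ge> 1 \<Longrightarrow> F k (x + 1) = F k x"
    and "\<And>k. k \<ge> 1 \<Longrightarrow> integral {0..1} (F k) = 0"
    and "\<And>k x. k \<ge> 1 \<Longrightarrow> (F k has_real_derivative f k x) (at x)"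
    and "r \<ge> 3"
    and "\<And>k. k \<ge> 1 \<Longrightarrow> C_class r (f k)"
    and "\<And>k. k \<ge> 1 \<Longrightarrow> C_norm r (f k) \<le> C / (real k)\<^sup>2"
  shows "AE \<omega> in M. countable {x :: circle.
           \<not> (\<exists>!\<xi>. \<xi> \<in> {..0} \<rightarrow>\<^sub>E UNIV \<and>
                 one_sided_minimizer F f (\<lambda>k t. B k t \<omega>) \<xi> \<and> \<xi> 0 = x)}"
proof -
  interpret prob_space M by fact
  note W = assms(2) and F_per = assms(4) and mean = assms(5) and F_deriv = assms(6)
    and reg = assms(8) and norm = assms(9)
  have f_per: "f k (x + 1) = f k x" if k: "k \<ge> 1" for k x
  proof -
    have "((\<lambda>y. F k (y + 1)) has_real_derivative f k (x + 1)) (at x)"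
      using F_deriv[OF k, of "x + 1"] by (simp add: DERIV_shift)
    then show ?thesis using DERIV_unique F_deriv[OF k, of x] by (auto simp: F_per[OF k])
  qed
  have bound: "\<bar>(deriv ^^ j) (f k) x\<bar> \<le> C / (real k)\<^sup>2" if "k \<ge> 1" "j \<le> r" for k j x
    using abs_deriv_le_C_norm[OF f_per reg] norm order_trans that by blast
  have f_deriv: "(f k has_real_derivative deriv (f k) x) (at x)" if "k \<ge> 1" for k x
    using C_class_differentiable[OF reg[OF that], of 0] \<open>r \<ge> 3\<close> by simp
  have f'_deriv: "(deriv (f k) has_real_derivative deriv (deriv (f k)) x) (at x)" if "k \<ge> 1" for k x
    using C_class_differentiable[OF reg[OF that], of 1] \<open>r \<ge> 3\<close> by simp
  have f_bound: "\<bar>f k x\<bar> \<le> C / (real k)\<^sup>2" and f'_bound: "\<bar>deriv (f k) x\<bar> \<le> C / (real k)\<^sup>2"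
    and f''_bound: "\<bar>deriv (deriv (f k)) x\<bar> \<le> C / (real k)\<^sup>2" if "k \<ge> 1" for k x
    using bound[OF that, of 0 x] bound[OF that, of 1 x] bound[OF that, of 2 x] \<open>r \<ge> 3\<close>
    by (simp_all add: numeral_2_eq_2)
  have "AE \<omega> in M. \<forall>k\<in>{1..}. B k 0 \<omega> = 0 \<and> continuous_on UNIV (\<lambda>t. B k t \<omega>)"
    unfolding AE_ball_countable[OF countableI_type] using W unfolding wiener_process_def by auto
  moreover have "AE \<omega> in M. \<forall>n. \<exists>K. \<forall>k\<ge>1. \<forall>s\<in>{- real (Suc n)..0}. \<bar>B k s \<omega>\<bar> \<le> K * sqrt (real k)"
    unfolding AE_all_countable by (intro allI wiener_paths_growth W) simp_all
  moreover have "AE \<omega> in M. \<forall>m n. \<forall>\<tau>. \<exists>T\<le>\<tau>. \<forall>u\<in>{T - real (Suc m)..T}. \<forall>k\<ge>1.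
      \<bar>B k u \<omega> - B k T \<omega>\<bar> \<le> inverse (real (Suc n)) * sqrt (real k)"
    unfolding AE_all_countable by (intro allI wiener_paths_calm W assms(3)) simp_all
  ultimately show ?thesis
  proof eventually_elim
    case (elim \<omega>)
    interpret noise_paths F f "\<lambda>k. deriv (f k)" "\<lambda>k t. B k t \<omega>" C
    proof
      fix k :: nat and x y :: real
      assume k: "k \<ge> 1"
      show "(F k has_real_derivative f k x) (at x)" "(f k has_real_derivative deriv (f k) x) (at x)"
        "F k (x + 1) = F k x" "f k (x + 1) = f k x"
        by (fact F_deriv[OF k] f_deriv[OF k] F_per[OF k] f_per[OF k])+
      show "deriv (f k) (x + 1) = deriv (f k) x" using deriv_periodic[of "f k" 1 x] f_per[OF k] by simp
      show "\<bar>F k x\<bar> \<le> C / (real k)\<^sup>2"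
        by (rule abs_le_if_mean_zero[OF F_per[OF k] mean[OF k] F_deriv[OF k] f_bound[OF k]])
      show "\<bar>f k x\<bar> \<le> C / (real k)\<^sup>2" "\<bar>deriv (f k) x\<bar> \<le> C / (real k)\<^sup>2"
        by (fact f_bound[OF k] f'_bound[OF k])+
      show "\<bar>deriv (f k) x - deriv (f k) y\<bar> \<le> C / (real k)\<^sup>2 * \<bar>x - y\<bar>"
        using field_differentiable_bound[of UNIV "deriv (f k)" "deriv (deriv (f k))" "C / (real k)\<^sup>2" x y]
          f'_deriv[OF k] f''_bound[OF k] by simp
      show "continuous_on UNIV (\<lambda>t. B k t \<omega>)" "B k 0 \<omega> = 0" using elim(1) k by auto
    next
      fix n
      obtain K where "\<forall>k\<ge>1. \<forall>s\<in>{- real (Suc n)..0}. \<bar>B k s \<omega>\<bar> \<le> K * sqrt (real k)" using elim(2) by blast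
      then show "\<exists>K. \<forall>k\<ge>1. \<forall>s\<in>{- real n..0}. \<bar>B k s \<omega>\<bar> \<le> K * sqrt (real k)" by (intro exI[of _ K]) auto
    next
      fix \<epsilon> \<delta> \<tau> :: real assume pos: "0 < \<epsilon>" "0 < \<delta>"
      obtain m :: nat where m: "1 / \<epsilon> \<le> real m" using real_arch_simple by blast
      obtain n where n: "inverse (real (Suc n)) < \<delta>" using reals_Archimedean[OF pos(2)] by blast
      obtain T where T: "T \<le> \<tau>" "\<forall>u\<in>{T - real (Suc m)..T}. \<forall>k\<ge>1. \<bar>B k u \<omega> - B k T \<omega>\<bar> \<le> inverse (real (Suc n)) * sqrt (real k)"
        using elim(3) by blast
      show "\<exists>T\<le>\<tau>. \<forall>u\<in>{T - 1 / \<epsilon>..T}. \<forall>k\<ge>1. \<bar>B k u \<omega> - B k T \<omega>\<bar> \<le> \<delta> * sqrt (real k)"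
      proof (intro exI[of _ T] conjI T(1) ballI allI impI)
        fix u and k :: nat assume u: "u \<in> {T - 1 / \<epsilon>..T}" and k: "k \<ge> 1"
        have "u \<in> {T - real (Suc m)..T}" using u m by auto
        then have "\<bar>B k u \<omega> - B k T \<omega>\<bar> \<le> inverse (real (Suc n)) * sqrt (real k)" using T(2) k by blast
        also have "\<dots> \<le> \<delta> * sqrt (real k)" using n by (intro mult_right_mono) auto
        finally show "\<bar>B k u \<omega> - B k T \<omega>\<bar> \<le> \<delta> * sqrt (real k)" .
      qed
    qed
    show ?case by (rule countable_nonunique)
  qed
qed

end
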